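(* Let $1<p<\infty$, let $Z=(Z,d,\mu)$ be a $p$-PI space, let $\Omega\subset Z$ be a measurable set satisfying the measure-density condition, and let $\mathbb V$ be a Banach space. Then, given $u\in L^p(\Omega;\mathbb V)$, there exists $h\in W^{1,p}(Z;\mathbb V)$ with $u=h|_\Omega$ if and only if there exists some $s=s(u)>0$ such that the function $$x\mapsto u^\sharp_s(x):=\sup_{0<t<s}\frac1t\,\frac{1}{\mu(\Omega\cap B(x,t))^2}\int_{\Omega\cap B(x,t)}\int_{\Omega\cap B(x,t)}|u(y)-u(z)|\,d\mu(y)\,d\mu(z)$$ belongs to $L^p(\Omega)$.
   Context: Metric measure space: a triple $(Z,d,\mu)$ with $(Z,d)$ a separable metric space and $\mu$ a Borel regular outer measure with $0<\mu(B)<\infty$ for all open balls $B$. $\mu$ is doubling if there is $c_\mu>0$ with $\mu(2B)\le c_\mu\mu(B)$ for every open ball $B$ ($2B$ = same center, twice the radius). $L^p(Z;\mathbb V)$: a map $u:Z\to\mathbb V$ is measurable if preimages of open sets are $\mu$-measurable and $u(Z\setminus N)$ is separable for some $\mu$-null set $N$; $L^p(Z;\mathbb V)$ is the space of a.e.-equivalence classes of measurable $u$ with $|u|\in L^p(Z)$. Newton–Sobolev functions: a path is a continuous $\gamma:[a,b]\to Z$. For Borel $\rho:Z\to[0,\infty]$, $\int_\gamma\rho\,ds$ is the usual integral with respect to the length measure of $\gamma$ if $\gamma$ is rectifiable, and $\infty$ if $\gamma$ is not rectifiable. A family of paths $\Gamma$ is $p$-negligible if there is an $L^p$-integrable Borel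 $\rho:Z\to[0,\infty]$ with $\int_\gamma\rho\,ds=\infty$ for all $\gamma\in\Gamma$; a property holds for $p$-almost every path if it fails only on a $p$-negligible family. A Borel function $\rho:Z\to[0,\infty]$ is a $p$-weak upper gradient of $u:Z\to\mathbb V$ if $|u(\gamma(a))-u(\gamma(b))|\le\int_\gamma\rho\,ds$ for $p$-almost every path $\gamma:[a,b]\to Z$. $W^{1,p}(Z;\mathbb V)$ is the set of $u\in L^p(Z;\mathbb V)$ having a representative $\widetilde u$ that admits an $L^p$-integrable $p$-weak upper gradient, with norm $\|u\|_{L^p(Z;\mathbb V)}+\inf_\rho\|\rho\|_{L^p(Z)}$, the infimum being over $L^p$-integrable $p$-weak upper gradients of $\widetilde u$ (independent of the choice of such $\widetilde u$). $p$-PI space: a complete metric measure space with $\mu$ doubling and supporting a weak $(1,p)$-Poincaré inequality: there are $C>0$, $\lambda\ge1$ such that $\frac1{\mu(B)}\int_B|u-u_B|\,d\mu\le C\operatorname{diam}(B)\big(\frac1{\mu(\lambda B)}\int_{\lambda B}\rho^p\,d\mu\big)^{1/p}$ for every ball $B$, every integrable $u:\lambda B\to\mathbb R$ and every $L^p$-integrable $p$-weak upper gradient $\rho:\lambda B\to[0,\infty]$ of $u$, where $u_B$ is the average of $u$ over $B$. Measurable subsets $\Omega\subset Z$ are equipped with the restricted distance and measure. Measure-density condition: there is $c_\Omega>0$ with $\mu(B(x,r)\cap\Omega)\ge c_\Omega\,\mu(B(x,r))$ for every $x\in\Omega$, $r\in(0,1]$. Equality $u=h|_\Omega$ is understood almost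 everywhere in $\Omega$. *)

theory Defs
  imports "HOL-Analysis.Analysis"
begin

section \<open>Metric measure spaces\<close>

text \<open>
  The underlying metric space is a type; separability is the type class
  \<^class>\<open>second_countable_topology\<close>, which for metric spaces is the same thing.
\<close>

definition borel_regular_outer_measure :: "('a::topological_space set \<Rightarrow> ennreal) \<Rightarrow> bool" where
  "borel_regular_outer_measure \<mu> \<longleftrightarrow>
     outer_measure_space (Pow UNIV) \<mu> \<and>
     sets borel \<subseteq> lambda_system UNIV (Pow UNIV) \<mu> \<and>
     (\<forall>A. \<exists>B\<in>sets borel. A \<subseteq> B \<and> \<mu> B = \<mu> A)"

definition metric_measure_space ::
  "('a::{metric_space,second_countable_topology} set \<Rightarrow> ennreal) \<Rightarrow> bool" where
  "metric_measure_space \<mu> \<longleftrightarrow>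
     borel_regular_outer_measure \<mu> \<and> (\<forall>x r. 0 < r \<longrightarrow> 0 < \<mu> (ball x r) \<and> \<mu> (ball x r) < \<infinity>)"

text \<open>The measure obtained by restricting an outer measure to its Caratheodory measurable sets.\<close>

definition carath :: "('a set \<Rightarrow> ennreal) \<Rightarrow> 'a measure" where
  "carath \<mu> = measure_of UNIV (lambda_system UNIV (Pow UNIV) \<mu>) \<mu>"

lemma space_carath [simp]: "space (carath \<mu>) = UNIV"
  by (simp add: carath_def space_measure_of_conv)

lemma
  assumes "outer_measure_space (Pow UNIV) \<mu>"
  shows sets_carath: "sets (carath \<mu>) = lambda_system UNIV (Pow UNIV) \<mu>"
    and emeasure_carath: "A \<in> lambda_system UNIV (Pow UNIV) \<mu> \<Longrightarrow> emeasure (carath \<mu>) A = \<mu> A"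
proof -
  have ms: "measure_space UNIV (lambda_system UNIV (Pow UNIV) \<mu>) \<mu>"
    using sigma_algebra.caratheodory_lemma[OF sigma_algebra_Pow assms] .
  then show s: "sets (carath \<mu>) = lambda_system UNIV (Pow UNIV) \<mu>"
    unfolding carath_def measure_space_def
    by (simp add: sigma_algebra.sigma_sets_eq)
  show "emeasure (carath \<mu>) A = \<mu> A" if A: "A \<in> lambda_system UNIV (Pow UNIV) \<mu>"
    using ms s A unfolding measure_space_def
    by (intro emeasure_measure_of[OF carath_def]) auto
qed

definition doubling :: "('a::metric_space set \<Rightarrow> ennreal) \<Rightarrow> bool" where
  "doubling \<mu> \<longleftrightarrow> (\<exists>c::real. 0 < c \<and> (\<forall>x r. 0 < r \<longrightarrow> \<mu> (ball x (2 * r)) \<le> ennreal c * \<mu> (ball x r)))"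

definition measure_density :: "('a::metric_space set \<Rightarrow> ennreal) \<Rightarrow> 'a set \<Rightarrow> bool" where
  "measure_density \<mu> \<Omega> \<longleftrightarrow>
     (\<exists>c::real. 0 < c \<and>
       (\<forall>x\<in>\<Omega>. \<forall>r. 0 < r \<and> r \<le> 1 \<longrightarrow> \<mu> (ball x r \<inter> \<Omega>) \<ge> ennreal c * \<mu> (ball x r)))"

section \<open>Lebesgue spaces\<close>

text \<open>Below, a measure \<open>M\<close> also determines the set on which functions live, namely
  \<^term>\<open>space M\<close>; subsets are handled by \<^const>\<open>restrict_space\<close>.\<close>

definition ennreal_powr :: "ennreal \<Rightarrow> real \<Rightarrow> ennreal" where
  "ennreal_powr x p = (if x = \<infinity> then \<infinity> else ennreal (enn2real x powr p))"

definition Lp_nonneg :: "real \<Rightarrow> 'a measure \<Rightarrow> ('a \<Rightarrow> ennreal) \<Rightarrow> bool" where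
  "Lp_nonneg p M f \<longleftrightarrow> f \<in> borel_measurable M \<and> (\<integral>\<^sup>+x. ennreal_powr (f x) p \<partial>M) < \<infinity>"

definition ess_separable_measurable :: "'a measure \<Rightarrow> ('a \<Rightarrow> 'b::topological_space) \<Rightarrow> bool" where
  "ess_separable_measurable M u \<longleftrightarrow>
     u \<in> borel_measurable M \<and>
     (\<exists>N\<in>null_sets M. separable_space (subtopology euclidean (u ` (space M - N))))"

definition Lp :: "real \<Rightarrow> 'a measure \<Rightarrow> ('a \<Rightarrow> 'b::real_normed_vector) \<Rightarrow> bool" where
  "Lp p M u \<longleftrightarrow> ess_separable_measurable M u \<and> Lp_nonneg p M (\<lambda>x. ennreal (norm (u x)))"

section \<open>Line integrals\<close>

text \<open>A path is a triple \<open>(a, b, \<gamma>)\<close>; the values of \<open>\<gamma>\<close> outside \<open>{a..b}\<close> are irrelevant.\<close>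

type_synonym 'a curve = "real \<times> real \<times> (real \<Rightarrow> 'a)"

definition curves_in :: "'a::metric_space set \<Rightarrow> 'a curve set" where
  "curves_in S = {(a, b, \<gamma>). a \<le> b \<and> continuous_on {a..b} \<gamma> \<and> \<gamma> ` {a..b} \<subseteq> S}"

definition curve_length :: "(real \<Rightarrow> 'a::metric_space) \<Rightarrow> real \<Rightarrow> real \<Rightarrow> ennreal" where
  "curve_length \<gamma> a b =
     (SUP (n, t) \<in> {(n::nat, t::nat \<Rightarrow> real). t 0 = a \<and> t n = b \<and> (\<forall>i<n. t i \<le> t (Suc i))}.
        \<Sum>i<n. ennreal (dist (\<gamma> (t i)) (\<gamma> (t (Suc i)))))"

definition rectifiable :: "'a::metric_space curve \<Rightarrow> bool" where
  "rectifiable = (\<lambda>(a, b, \<gamma>). curve_length \<gamma> a b < \<infinity>)"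

text \<open>The length measure of a rectifiable path assigns to \<open>{c<..d}\<close> the length of the path
  between \<open>c\<close> and \<open>d\<close>. It is the Stieltjes measure of the length function, extended by constants
  outside \<open>{a..b}\<close>; that function is nondecreasing and continuous.\<close>

definition length_measure :: "'a::metric_space curve \<Rightarrow> real measure" where
  "length_measure = (\<lambda>(a, b, \<gamma>).
     interval_measure (\<lambda>t. enn2real (curve_length \<gamma> a (max a (min t b)))))"

definition line_integral :: "('a::metric_space \<Rightarrow> ennreal) \<Rightarrow> 'a curve \<Rightarrow> ennreal" where
  "line_integral \<rho> = (\<lambda>(a, b, \<gamma>).
     if rectifiable (a, b, \<gamma>)
     then (\<integral>\<^sup>+t\<in>{a..b}. \<rho> (\<gamma> t) \<partial>length_measure (a, b, \<gamma>)) else \<infinity>)"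

section \<open>Weak upper gradients and Newton--Sobolev functions\<close>

definition borel_on :: "'a::topological_space set \<Rightarrow> ('a \<Rightarrow> ennreal) \<Rightarrow> bool" where
  "borel_on S \<rho> \<longleftrightarrow> \<rho> \<in> borel_measurable (restrict_space borel S)"

definition p_negligible :: "real \<Rightarrow> 'a::metric_space measure \<Rightarrow> 'a curve set \<Rightarrow> bool" where
  "p_negligible p M \<Gamma> \<longleftrightarrow>
     (\<exists>\<rho>. borel_on (space M) \<rho> \<and> Lp_nonneg p M \<rho> \<and> (\<forall>c\<in>\<Gamma>. line_integral \<rho> c = \<infinity>))"

definition weak_upper_gradient ::
  "real \<Rightarrow> 'a::metric_space measure \<Rightarrow> ('a \<Rightarrow> ennreal) \<Rightarrow> ('a \<Rightarrow> 'b::real_normed_vector) \<Rightarrow> bool" where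
  "weak_upper_gradient p M \<rho> u \<longleftrightarrow>
     borel_on (space M) \<rho> \<and>
     p_negligible p M {(a, b, \<gamma>) \<in> curves_in (space M).
        \<not> ennreal (norm (u (\<gamma> a) - u (\<gamma> b))) \<le> line_integral \<rho> (a, b, \<gamma>)}"

definition newton_sobolev ::
  "real \<Rightarrow> 'a::metric_space measure \<Rightarrow> ('a \<Rightarrow> 'b::real_normed_vector) \<Rightarrow> bool" where
  "newton_sobolev p M u \<longleftrightarrow>
     Lp p M u \<and>
     (\<exists>v. Lp p M v \<and> (AE x in M. v x = u x) \<and>
          (\<exists>\<rho>. Lp_nonneg p M \<rho> \<and> weak_upper_gradient p M \<rho> v))"

section \<open>PI spaces\<close>

text \<open>In the inequality the integral of \<open>\<rho>\<^sup>p\<close> is finite, so \<^const>\<open>enn2real\<close> loses nothing.\<close>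

definition weak_poincare :: "real \<Rightarrow> ('a::metric_space set \<Rightarrow> ennreal) \<Rightarrow> bool" where
  "weak_poincare p \<mu> \<longleftrightarrow>
     (let M = carath \<mu> in
      \<exists>C L::real. 0 < C \<and> 1 \<le> L \<and>
       (\<forall>x r. 0 < r \<longrightarrow>
         (let B = ball x r; B' = ball x (L * r) in
          \<forall>(u :: 'a \<Rightarrow> real) \<rho>.
            integrable (restrict_space M B') u \<and>
            Lp_nonneg p (restrict_space M B') \<rho> \<and>
            weak_upper_gradient p (restrict_space M B') \<rho> u \<longrightarrow>
            (let uB = (LINT y:B|M. u y) / measure M B in
             (LINT y:B|M. \<bar>u y - uB\<bar>) / measure M B
             \<le> C * diameter B *
                 (enn2real (\<integral>\<^sup>+y\<in>B'. ennreal_powr (\<rho> y) p \<partial>M) / measure M B') powr (1 / p)))))"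

definition PI_space ::
  "real \<Rightarrow> ('a::{metric_space,second_countable_topology} set \<Rightarrow> ennreal) \<Rightarrow> bool" where
  "PI_space p \<mu> \<longleftrightarrow>
     metric_measure_space \<mu> \<and> complete (UNIV :: 'a set) \<and> doubling \<mu> \<and> weak_poincare p \<mu>"

section \<open>The sharp function\<close>

definition sharp ::
  "('a::metric_space set \<Rightarrow> ennreal) \<Rightarrow> 'a set \<Rightarrow> ('a \<Rightarrow> 'b::real_normed_vector) \<Rightarrow> real \<Rightarrow> 'a \<Rightarrow> ennreal"
  where
  "sharp \<mu> \<Omega> u s x =
     (SUP t\<in>{0<..<s}.
        ennreal (1 / t) * (1 / \<mu> (\<Omega> \<inter> ball x t) ^ 2) *
        (\<integral>\<^sup>+y\<in>\<Omega> \<inter> ball x t. (\<integral>\<^sup>+z\<in>\<Omega> \<inter> ball x t. ennreal (norm (u y - u z)) \<partial>carath \<mu>) \<partial>carath \<mu>))"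

end

theory Submission
 imports Defs
begin

text \<open>
 Both implications pass through pointwise gradients: \<open>h\<close> is in \<open>W\<^sup>1\<^sup>,\<^sup>p\<close> as soon as
 \<open>|h x - h y| \<le> d(x, y) (G x + G y)\<close> off a null set with \<open>G \<in> L\<^sup>p\<close>, and a function whose double
 averages over balls of radius \<open>t\<close> are at most \<open>t S(x)\<close> satisfies such an inequality with
 \<open>G = C S\<close>, because at level \<open>\<tau>\<close> it is \<open>C \<tau>\<close>-Lipschitz on \<open>{S \<le> \<tau>}\<close>. Vector-valued functions are
 reduced to the real functions \<open>x \<mapsto> |u x - w|\<close> with \<open>w\<close> in a countable dense set.

 If the sharp function is in \<open>L\<^sup>p\<close>, this gives a pointwise gradient on \<open>\<Omega>\<close>, and a Whitney-type
 extension (weighted averages of \<open>u\<close> over \<open>\<Omega> \<inter> B(x, 3 dist(x, \<Omega>))\<close>, cut off at distance 1) has a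
 pointwise gradient controlled by the maximal function; the closure of \<open>\<Omega>\<close> adds only a null set.

 Conversely, the maximal function of the oscillations has to be in \<open>L\<^sup>p\<close>, although the Poincare
 inequality has exponent \<open>p\<close> itself. On a ball with oscillation larger than \<open>\<tau> r\<close>, the function is
 replaced by the average of its Lipschitz truncations at levels \<open>2\<^sup>j \<tau>\<close> for \<open>k < j \<le> 2 k\<close>. The
 Poincare inequality for this average yields a good-lambda inequality in which the bad sets carry
 the factor \<open>k\<^sup>1\<^sup>-\<^sup>p\<close>, which is absorbed for large \<open>k\<close>; here \<open>p > 1\<close> is used.
\<close>

section \<open>Powers and Lebesgue classes of nonnegative functions\<close>

text \<open>With exponent p itself the Poincare inequality bounds the maximal oscillation only in
  weak L^p: the numbers \<open>level m\<close>, which are 2^(mp) times the measure of a bad set, are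
  bounded uniformly in m, and this alone does not make them summable. The weak bound is nevertheless
  what permits the absorption: it makes every finite sum of levels finite, so that half of it can be
  subtracted, and it controls the levels that a shift by up to 2k pushes out of the summation range.
  The gradient enters the recursion only on a shell between two bad sets whose levels have a fixed
  ratio; each point lies in boundedly many shells, so these terms add up to a multiple of the
  integral of the p-th power of the gradient.

  Exceptional families of curves are removed at once. Where a weak gradient is given, the function
  witnessing negligibility is added to it; where one is constructed, it is made infinite on a Borel
  null set. Most covering arguments go through one comparison of two measures,
  \<open>vitali_emeasure_le\<close>.\<close>

abbreviation enorm :: "'b::real_normed_vector \<Rightarrow> ennreal" where
 "enorm v \<equiv> ennreal (norm v)"

lemma ennreal_powr_ennreal: "0 \<le> x \<Longrightarrow> ennreal_powr (ennreal x) p = ennreal (x powr p)"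
 by (simp add: ennreal_powr_def)

lemma ennreal_powr_0 [simp]: "ennreal_powr 0 p = 0"
 by (simp add: ennreal_powr_def)

lemma ennreal_powr_top [simp]: "ennreal_powr \<infinity> p = \<infinity>"
 by (simp add: ennreal_powr_def)

lemma ennreal_powr_less_top_iff [simp]: "ennreal_powr x p < \<infinity> \<longleftrightarrow> x < \<infinity>"
 by (simp add: ennreal_powr_def less_top[symmetric])

lemma ennreal_powr_mono: "0 \<le> p \<Longrightarrow> x \<le> y \<Longrightarrow> ennreal_powr x p \<le> ennreal_powr y p"
 by (cases x; cases y) (auto simp: ennreal_powr_def powr_mono2 top_unique)

lemma ennreal_powr_mult:
 assumes "0 < p" "0 \<le> c"
 shows "ennreal_powr (ennreal c * x) p = ennreal (c powr p) * ennreal_powr x p"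
proof (cases x)
 case (real r)
 then show ?thesis using assms
  by (simp add: ennreal_mult[symmetric] ennreal_powr_ennreal powr_mult)
next
 case top
 show ?thesis
 proof (cases "c = 0")
  case True with top assms show ?thesis by simp
 next
  case False
  with assms have "ennreal c * top = top" "ennreal (c powr p) * top = top"
   by (simp_all add: ennreal_mult_top)
  with top show ?thesis by (simp add: ennreal_powr_def)
 qed
qed

lemma ennreal_powr_add_le:
 assumes "0 < p"
 shows "ennreal_powr (x + y) p \<le> ennreal (2 powr p) * (ennreal_powr x p + ennreal_powr y p)"
proof -
 have "x + y \<le> ennreal 2 * max x y"
  by (simp add: add_mono mult_2)
 then have "ennreal_powr (x + y) p \<le> ennreal (2 powr p) * ennreal_powr (max x y) p"
  using ennreal_powr_mono[of p "x + y" "ennreal 2 * max x y"] assms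
   ennreal_powr_mult[of p 2 "max x y"] by simp
 also have "ennreal_powr (max x y) p \<le> ennreal_powr x p + ennreal_powr y p"
  by (simp add: max_def)
 finally show ?thesis by (simp add: mult_left_mono)
qed

lemma ennreal_powr_measurable [measurable (raw)]:
 assumes [measurable]: "f \<in> borel_measurable M"
 shows "(\<lambda>x. ennreal_powr (f x) p) \<in> borel_measurable M"
 unfolding ennreal_powr_def by measurable

lemma ennreal_mult_powr_minus_one:
 assumes "1 < p" shows "x * ennreal_powr x (p - 1) = ennreal_powr x p"
proof (cases x)
 case (real r)
 then show ?thesis using assms
  by (cases "r = 0") (auto simp: ennreal_powr_ennreal ennreal_mult[symmetric] powr_diff)
next
 case top
 then show ?thesis by (simp add: ennreal_powr_def)
qed

lemma Lp_nonneg_mono_AE: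
 assumes "Lp_nonneg p M f" "g \<in> borel_measurable M" "AE x in M. g x \<le> f x" "0 \<le> p"
 shows "Lp_nonneg p M g"
proof -
 have "(\<integral>\<^sup>+x. ennreal_powr (g x) p \<partial>M) \<le> (\<integral>\<^sup>+x. ennreal_powr (f x) p \<partial>M)"
  using assms by (intro nn_integral_mono_AE) (auto elim!: eventually_mono intro: ennreal_powr_mono)
 then show ?thesis using assms by (auto simp: Lp_nonneg_def)
qed

lemma Lp_nonneg_add:
 assumes "Lp_nonneg p M f" "Lp_nonneg p M g" "0 < p"
 shows "Lp_nonneg p M (\<lambda>x. f x + g x)"
proof -
 have [measurable]: "f \<in> borel_measurable M" "g \<in> borel_measurable M"
  using assms by (auto simp: Lp_nonneg_def)
 have "(\<integral>\<^sup>+x. ennreal_powr (f x + g x) p \<partial>M)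
   \<le> (\<integral>\<^sup>+x. ennreal (2 powr p) * (ennreal_powr (f x) p + ennreal_powr (g x) p) \<partial>M)"
  by (intro nn_integral_mono ennreal_powr_add_le assms)
 also have "... = ennreal (2 powr p) *
   ((\<integral>\<^sup>+x. ennreal_powr (f x) p \<partial>M) + (\<integral>\<^sup>+x. ennreal_powr (g x) p \<partial>M))"
  by (simp add: nn_integral_cmult nn_integral_add)
 also have "... < \<infinity>"
  using assms by (auto simp: Lp_nonneg_def ennreal_mult_less_top)
 finally show ?thesis by (auto simp: Lp_nonneg_def)
qed

lemma Lp_nonneg_cmult:
 assumes "Lp_nonneg p M f" "0 < p" "0 \<le> c"
 shows "Lp_nonneg p M (\<lambda>x. ennreal c * f x)"
proof -
 have [measurable]: "f \<in> borel_measurable M"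
  using assms by (auto simp: Lp_nonneg_def)
 show ?thesis using assms
  by (auto simp: Lp_nonneg_def ennreal_powr_mult nn_integral_cmult ennreal_mult_less_top)
qed

lemma Lp_nonneg_AE_finite:
 assumes "Lp_nonneg p M f" shows "AE x in M. f x < \<infinity>"
proof -
 have [measurable]: "f \<in> borel_measurable M"
  using assms by (auto simp: Lp_nonneg_def)
 have "AE x in M. ennreal_powr (f x) p \<noteq> \<infinity>"
  using assms by (intro nn_integral_PInf_AE) (auto simp: Lp_nonneg_def)
 then show ?thesis
  by eventually_elim (use ennreal_powr_less_top_iff in \<open>fastforce simp: less_top\<close>)
qed

section \<open>Dyadic level sums\<close>

text \<open>A discrete layer-cake formula: the sum is comparable to the power X^q, so that integrals
  of powers become series of measures of dyadic superlevel sets. \<open>int_decode\<close> turns the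
  sum over all integers into a series.\<close>

definition dyadic_sum :: "real \<Rightarrow> ennreal \<Rightarrow> ennreal" where
 "dyadic_sum q X = (\<Sum>n. ennreal (2 powr (q * of_int (int_decode n))) *
  indicator {..<X} (ennreal (2 powr of_int (int_decode n))))"

lemma dyadic_sum_ge_term:
 assumes "ennreal (2 powr of_int m) < X"
 shows "ennreal (2 powr (q * of_int m)) \<le> dyadic_sum q X"
proof -
 let ?a = "\<lambda>n. ennreal (2 powr (q * of_int (int_decode n))) *
  indicator {..<X} (ennreal (2 powr of_int (int_decode n)))"
 have "ennreal (2 powr (q * of_int m)) = ?a (int_encode m)" using assms by simp
 also have "... \<le> (\<Sum>n. ?a n)"
  using sum_le_suminf[of ?a "{int_encode m}"] by simp
 finally show ?thesis by (simp add: dyadic_sum_def)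
qed

text \<open>A single term suffices: for finite X > 0 the largest exponent m with 2^m < X satisfies X
  <= 2^(m+1). For X = \<infinity> every exponent occurs and the terms are unbounded.\<close>

lemma powr_le_dyadic_sum:
 assumes "0 < p"
 shows "ennreal_powr X p \<le> ennreal (2 powr p) * dyadic_sum p X"
proof (cases X)
 case top
 have "dyadic_sum p X = \<infinity>"
 proof (rule ccontr)
  assume "dyadic_sum p X \<noteq> \<infinity>"
  then obtain c where c: "dyadic_sum p X = ennreal c" "0 \<le> c"
   by (cases "dyadic_sum p X") auto
  define m where "m = \<lceil>log 2 (c + 1) / p\<rceil>"
  have "log 2 (c + 1) \<le> p * of_int m"
   unfolding m_def using assms le_of_int_ceiling[of "log 2 (c + 1) / p"]
   by (metis mult.commute pos_divide_le_eq)
  then have "2 powr (log 2 (c + 1)) \<le> 2 powr (p * of_int m)" by simp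
  then have "c + 1 \<le> 2 powr (p * of_int m)" using c by simp
  moreover have "ennreal (2 powr (p * of_int m)) \<le> ennreal c"
   using dyadic_sum_ge_term[of m X p] top c by simp
  ultimately show False using c by (simp add: ennreal_le_iff)
 qed
 then show ?thesis using top by (simp add: ennreal_mult_top)
next
 case (real x)
 show ?thesis
 proof (cases "x = 0")
  case True with real show ?thesis by simp
 next
  case False
  with real have x: "0 < x" by simp
  \<comment> \<open>The comparison 2^m < x is strict, hence the ceiling minus one and not the
    floor.\<close>
  define m where "m = \<lceil>log 2 x\<rceil> - 1"
  have m: "of_int m < log 2 x" "log 2 x \<le> of_int m + 1"
   unfolding m_def by linarith+
  have "2 powr of_int m < 2 powr (log 2 x)" using m by simp
  then have 1: "2 powr of_int m < x" using x by simp
  have "2 powr (log 2 x) \<le> 2 powr (of_int m + 1)" using m by simp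
  then have "x \<le> 2 * 2 powr of_int m" using x by (simp add: powr_add)
  then have "x powr p \<le> (2 * 2 powr of_int m) powr p" using x assms by (intro powr_mono2) auto
  also have "... = 2 powr p * 2 powr (p * of_int m)"
   by (simp add: powr_mult powr_powr mult.commute)
  finally have "ennreal (x powr p) \<le> ennreal (2 powr p) * ennreal (2 powr (p * of_int m))"
   by (simp add: ennreal_mult[symmetric])
  also have "ennreal (2 powr (p * of_int m)) \<le> dyadic_sum p X"
   using 1 x real by (intro dyadic_sum_ge_term) (simp add: ennreal_less_iff)
  finally show ?thesis using real x by (simp add: ennreal_powr_ennreal mult_left_mono)
 qed
qed

text \<open>Below the largest admissible exponent the terms run through part of a geometric series
  of ratio 2^(-q).\<close>

lemma dyadic_sum_le_powr:
 assumes "0 < q"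
 shows "dyadic_sum q X \<le> ennreal (1 / (1 - 2 powr - q)) * ennreal_powr X q"
proof (cases X)
 case top
 have "2 powr - q < 1" using assms by (simp add: powr_less_one)
 then have "ennreal (1 / (1 - 2 powr - q)) * top = top"
  using assms by (simp add: ennreal_mult_top)
 then show ?thesis using top by (simp add: ennreal_powr_def)
next
 case (real x)
 define c where "c = 2 powr - q"
 have c: "0 < c" "c < 1" unfolding c_def using assms by (auto simp: powr_less_one)
 \<comment> \<open>The enumeration by \<open>int_decode\<close> does not respect the order of the
   integers, so the bound is proved for arbitrary finite sets of admissible exponents, counted
   downwards from their maximum.\<close>
 have key: "(\<Sum>m\<in>A. 2 powr (q * of_int m)) \<le> x powr q / (1 - c)"
  if A: "finite A" "\<And>m. m \<in> A \<Longrightarrow> 2 powr of_int m < x" for A :: "int set"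
 proof (cases "A = {}")
  case True then show ?thesis using c by simp
 next
  case False
  define N where "N = Max A"
  have N: "N \<in> A" "\<And>m. m \<in> A \<Longrightarrow> m \<le> N" using A False by (auto simp: N_def)
  have "(\<Sum>m\<in>A. 2 powr (q * of_int m)) = (\<Sum>m\<in>A. 2 powr (q * of_int N) * c ^ nat (N - m))"
  proof (rule sum.cong[OF refl])
   fix m assume "m \<in> A"
   then have "real (nat (N - m)) = of_int N - of_int m" using N by simp
   then have "c ^ nat (N - m) = 2 powr (- q * (of_int N - of_int m))"
    unfolding c_def by (simp add: powr_realpow[symmetric] powr_powr)
   then show "2 powr (q * of_int m) = 2 powr (q * of_int N) * c ^ nat (N - m)"
    by (simp add: powr_add[symmetric] algebra_simps)
  qed
  also have "... = 2 powr (q * of_int N) * (\<Sum>m\<in>A. c ^ nat (N - m))"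
   by (simp add: sum_distrib_left)
  also have "(\<Sum>m\<in>A. c ^ nat (N - m)) = (\<Sum>j\<in>(\<lambda>m. nat (N - m)) ` A. c ^ j)"
  proof -
   have "inj_on (\<lambda>m. nat (N - m)) A"
   proof (rule inj_onI)
    fix m m' assume a: "m \<in> A" "m' \<in> A" "nat (N - m) = nat (N - m')"
    then have "m \<le> N" "m' \<le> N" using N by auto
    with a(3) show "m = m'" by linarith
   qed
   then show ?thesis by (simp add: sum.reindex)
  qed
  also have "... \<le> (\<Sum>j. c ^ j)"
   using c A by (intro sum_le_suminf) (auto intro: summable_geometric)
  also have "(\<Sum>j. c ^ j) = 1 / (1 - c)" using c by (intro suminf_geometric) auto
  also have "2 powr (q * of_int N) = (2 powr of_int N) powr q"
   by (simp add: powr_powr mult.commute)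
  also have "... * (1 / (1 - c)) \<le> x powr q * (1 / (1 - c))"
   using A(2)[OF N(1)] c assms by (intro mult_right_mono powr_mono2) auto
  finally show ?thesis using c by simp
 qed
 have "(\<Sum>n<k. ennreal (2 powr (q * of_int (int_decode n))) *
  indicator {..<X} (ennreal (2 powr of_int (int_decode n)))) \<le> ennreal (x powr q / (1 - c))" for k
 proof -
  let ?A = "{n. n < k \<and> 2 powr of_int (int_decode n) < x}"
  have "(\<Sum>n<k. ennreal (2 powr (q * of_int (int_decode n))) *
   indicator {..<X} (ennreal (2 powr of_int (int_decode n))))
   = (\<Sum>n\<in>?A. ennreal (2 powr (q * of_int (int_decode n))))"
   using real by (intro sum.mono_neutral_cong_right) (auto simp: ennreal_less_iff indicator_def)
  also have "... = ennreal (\<Sum>n\<in>?A. 2 powr (q * of_int (int_decode n)))"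
   by (subst sum_ennreal) auto
  also have "(\<Sum>n\<in>?A. 2 powr (q * of_int (int_decode n))) = (\<Sum>m\<in>int_decode ` ?A. 2 powr (q * of_int m))"
   by (subst sum.reindex) (auto simp: inj_on_def inj_int_decode[THEN injD])
  also have "... \<le> x powr q / (1 - c)" by (intro key) auto
  finally show ?thesis using c by (simp add: ennreal_leI)
 qed
 then have "dyadic_sum q X \<le> ennreal (x powr q / (1 - c))"
  unfolding dyadic_sum_def by (intro suminf_le_const) (auto)
 then show ?thesis using real c
  by (simp add: ennreal_powr_ennreal ennreal_mult[symmetric] c_def)
qed

section \<open>The Vitali covering argument\<close>

text \<open>Greedy selection: a ball of largest radius is kept, every ball meeting it lies in its
  threefold enlargement, and the balls disjoint from it are treated by induction.\<close>

lemma vitali_finite: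
 fixes P :: "('a::metric_space \<times> real) set"
 assumes "finite P" "\<And>q. q \<in> P \<Longrightarrow> 0 < snd q"
 shows "\<exists>J\<subseteq>P. disjoint_family_on (\<lambda>q. ball (fst q) (snd q)) J \<and>
  (\<Union>q\<in>P. ball (fst q) (snd q)) \<subseteq> (\<Union>q\<in>J. ball (fst q) (3 * snd q))"
 using assms
proof (induction "card P" arbitrary: P rule: less_induct)
 case less
 show ?case
 proof (cases "P = {}")
  case True then show ?thesis by (auto simp: disjoint_family_on_def)
 next
  case False
  obtain p where p: "p \<in> P" "\<And>q. q \<in> P \<Longrightarrow> snd q \<le> snd p"
  proof -
   have "Max (snd ` P) \<in> snd ` P" using False less.prems by (intro Max_in) auto
   then obtain p where "p \<in> P" "snd p = Max (snd ` P)" by auto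
   then show ?thesis using that less.prems by (metis Max_ge finite_imageI imageI)
  qed
  let ?Q = "{q\<in>P. ball (fst q) (snd q) \<inter> ball (fst p) (snd p) = {}}"
  have "0 < snd p" using p less.prems by blast
  then have "p \<notin> ?Q" by auto
  then have "?Q \<subset> P" using p(1) by blast
  then have "card ?Q < card P" using less.prems by (intro psubset_card_mono) auto
  from less.hyps[OF this] less.prems obtain J where
   J: "J \<subseteq> ?Q" "disjoint_family_on (\<lambda>q. ball (fst q) (snd q)) J"
    "(\<Union>q\<in>?Q. ball (fst q) (snd q)) \<subseteq> (\<Union>q\<in>J. ball (fst q) (3 * snd q))" by auto
  show ?thesis
  proof (intro exI[of _ "insert p J"] conjI)
   show "insert p J \<subseteq> P" using J p by auto
   show "disjoint_family_on (\<lambda>q. ball (fst q) (snd q)) (insert p J)"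
    using J unfolding disjoint_family_on_def by blast
   show "(\<Union>q\<in>P. ball (fst q) (snd q)) \<subseteq> (\<Union>q\<in>insert p J. ball (fst q) (3 * snd q))"
   proof
    fix x assume "x \<in> (\<Union>q\<in>P. ball (fst q) (snd q))"
    then obtain q where q: "q \<in> P" "x \<in> ball (fst q) (snd q)" by auto
    show "x \<in> (\<Union>q\<in>insert p J. ball (fst q) (3 * snd q))"
    proof (cases "q \<in> ?Q")
     case True then show ?thesis using q J(3) by blast
    next
     case False
     then obtain z where "z \<in> ball (fst q) (snd q)" "z \<in> ball (fst p) (snd p)" using q by auto
     then have "dist (fst p) x < 3 * snd p"
      using q p(2)[OF q(1)] dist_triangle[of "fst p" x z] dist_triangle[of z x "fst q"]
      by (simp add: dist_commute)
     then show ?thesis by simp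
    qed
   qed
  qed
 qed
qed

text \<open>Lindelof reduces the union to a countable one, which is exhausted by finite subunions;
  for these the finite selection gives a bound that does not depend on the subunion. Working with
  finite subfamilies also copes with unbounded radii. In the applications both measures are
  densities with respect to one measure, so a local estimate on balls is integrated into a global
  one.\<close>

lemma vitali_emeasure_le:
 fixes P :: "('a::{metric_space,second_countable_topology} \<times> real) set"
 assumes sets: "sets borel \<subseteq> sets \<alpha>" "sets borel \<subseteq> sets \<nu>"
  and P: "\<And>a r. (a, r) \<in> P \<Longrightarrow> 0 < r \<and> emeasure \<alpha> (ball a (3 * r)) \<le> emeasure \<nu> (ball a r)"
 shows "emeasure \<alpha> (\<Union>q\<in>P. ball (fst q) (snd q)) \<le> emeasure \<nu> (\<Union>q\<in>P. ball (fst q) (snd q))"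
proof (cases "P = {}")
 case True then show ?thesis by simp
next
 case False
 have op: "open S \<Longrightarrow> S \<in> sets \<alpha>" "open S \<Longrightarrow> S \<in> sets \<nu>" for S using sets by auto
 define F where "F = (\<lambda>q. ball (fst q) (snd q)) ` P"
 obtain F' where F': "F' \<subseteq> F" "countable F'" "\<Union>F' = \<Union>F"
  by (rule Lindelof[of F]) (auto simp: F_def)
 obtain P' where P': "P' \<subseteq> P" "countable P'" "F' = (\<lambda>q. ball (fst q) (snd q)) ` P'"
  using F' unfolding F_def by (metis (no_types, lifting) countable_subset_image)
 have U: "(\<Union>q\<in>P'. ball (fst q) (snd q)) = (\<Union>q\<in>P. ball (fst q) (snd q))"
  using F' P' by (simp add: F_def)
 have ne: "P' \<noteq> {}"
 proof
  assume "P' = {}"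
  moreover obtain q where "q \<in> P" using False by auto
  moreover have "fst q \<in> ball (fst q) (snd q)" using \<open>q \<in> P\<close> P[of "fst q" "snd q"] by simp
  ultimately show False using U by auto
 qed
 define e where "e = from_nat_into P'"
 have re: "range e = P'" unfolding e_def by (rule range_from_nat_into[OF ne P'(2)])
 define G where "G n = (\<Union>i\<le>n. ball (fst (e i)) (snd (e i)))" for n :: nat
 have UG: "(\<Union>n. G n) = (\<Union>q\<in>P. ball (fst q) (snd q))"
  unfolding U[symmetric] re[symmetric] G_def by auto
 have "emeasure \<alpha> (G n) \<le> emeasure \<nu> (\<Union>q\<in>P. ball (fst q) (snd q))" for n
 proof -
  have pos: "0 < snd q" if "q \<in> e ` {..n}" for q
   using that re P' P[of "fst q" "snd q"] by auto
  obtain J where J: "J \<subseteq> e ` {..n}" "disjoint_family_on (\<lambda>q. ball (fst q) (snd q)) J"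
   "(\<Union>q\<in>e ` {..n}. ball (fst q) (snd q)) \<subseteq> (\<Union>q\<in>J. ball (fst q) (3 * snd q))"
   using vitali_finite[of "e ` {..n}"] pos by auto
  have finJ: "finite J" using J(1) by (rule finite_subset) auto
  have JP: "J \<subseteq> P" using J(1) re P'(1) by blast
  have "emeasure \<alpha> (G n) \<le> emeasure \<alpha> (\<Union>q\<in>J. ball (fst q) (3 * snd q))"
   using J(3) by (intro emeasure_mono) (auto simp: G_def intro!: op)
  also have "... \<le> (\<Sum>q\<in>J. emeasure \<alpha> (ball (fst q) (3 * snd q)))"
   using finJ by (intro emeasure_subadditive_finite) (auto intro!: op)
  also have "... \<le> (\<Sum>q\<in>J. emeasure \<nu> (ball (fst q) (snd q)))"
   using JP P by (intro sum_mono) auto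
  also have "... = emeasure \<nu> (\<Union>q\<in>J. ball (fst q) (snd q))"
   using finJ J(2) by (intro sum_emeasure) (auto intro!: op)
  also have "... \<le> emeasure \<nu> (\<Union>q\<in>P. ball (fst q) (snd q))"
   using JP by (intro emeasure_mono) (auto intro!: op)
  finally show ?thesis .
 qed
 moreover have "(SUP n. emeasure \<alpha> (G n)) = emeasure \<alpha> (\<Union>n. G n)"
  by (intro SUP_emeasure_incseq) (auto simp: G_def incseq_def intro!: op, force)
 ultimately show ?thesis unfolding UG by (metis SUP_least)
qed

section \<open>Doubling measures and the maximal function\<close>

lemma borel_space_times_subset:
 assumes "sets borel \<subseteq> sets M" "space M = UNIV"
 shows "(\<lambda>x. x) \<in> measurable M (borel :: 'a::topological_space measure)"
 using assms by (intro measurableI) auto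

lemma ball_subset_ball:
 fixes x y :: "'a::metric_space"
 assumes "dist x y + r \<le> t" shows "ball y r \<subseteq> ball x t"
proof
 fix z assume "z \<in> ball y r"
 then show "z \<in> ball x t" using assms dist_triangle[of x z y] by simp
qed

lemma ennreal_divide_mult_self: "b \<noteq> 0 \<Longrightarrow> b < \<infinity> \<Longrightarrow> (a::ennreal) / b * b = a"
 by (simp add: ennreal_divide_times mult_divide_eq_ennreal less_top)

lemma ennreal_mult_le_cancel_right:
 "a * c \<le> b * c \<Longrightarrow> 0 < c \<Longrightarrow> c < \<infinity> \<Longrightarrow> (a::ennreal) \<le> b"
 using ennreal_mult_le_mult_iff[of c a b] by (simp add: mult.commute less_top zero_less_iff_neq_zero)

lemma ennreal_mult_collect:
 "0 \<le> a \<Longrightarrow> 0 \<le> b \<Longrightarrow> ennreal a * (ennreal b * c) = ennreal (a * b) * c"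
 by (simp add: ennreal_mult mult.assoc)

lemma ennreal_add_collect:
 "0 \<le> a \<Longrightarrow> 0 \<le> b \<Longrightarrow> ennreal a * c + ennreal b * c = ennreal (a + b) * c"
 by (simp add: distrib_right)

text \<open>The Borel sets are only contained in \<open>sets M\<close>, because the intended measure
  lives on all Caratheodory measurable sets.\<close>

locale doubling_measure =
 fixes M :: "'a::{metric_space,second_countable_topology} measure" and D :: real
 assumes space_M [simp]: "space M = UNIV"
  and sets_M: "sets borel \<subseteq> sets M"
  and D_ge_1: "1 \<le> D"
  and ball_pos: "0 < r \<Longrightarrow> 0 < emeasure M (ball x r)"
  and ball_finite: "emeasure M (ball x r) < \<infinity>"
  and doubling: "0 < r \<Longrightarrow> emeasure M (ball x (2 * r)) \<le> ennreal D * emeasure M (ball x r)"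
begin

abbreviation vol :: "'a \<Rightarrow> real \<Rightarrow> ennreal" where
 "vol x r \<equiv> emeasure M (ball x r)"

lemma open_sets_M [intro, simp]: "open S \<Longrightarrow> S \<in> sets M"
 using sets_M by auto

lemma closed_sets_M [intro, simp]: "closed S \<Longrightarrow> S \<in> sets M"
 using sets_M by auto

lemma id_measurable_M [measurable]: "(\<lambda>x. x) \<in> borel_measurable M"
 by (rule borel_space_times_subset[OF sets_M space_M])

lemma borel_measurable_M: "f \<in> borel_measurable borel \<Longrightarrow> f \<in> borel_measurable M"
 using measurable_compose[OF id_measurable_M] by auto

sublocale sigma_finite_measure M
proof
 obtain x0 :: 'a where True by simp
 show "\<exists>A. countable A \<and> A \<subseteq> sets M \<and> \<Union>A = space M \<and> (\<forall>a\<in>A. emeasure M a \<noteq> \<infinity>)"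
 proof (intro exI conjI)
  show "countable (range (\<lambda>n::nat. ball x0 (real n)))" by simp
  show "range (\<lambda>n::nat. ball x0 (real n)) \<subseteq> sets M" by auto
  show "\<Union> (range (\<lambda>n::nat. ball x0 (real n))) = space M"
   by (auto simp: reals_Archimedean2)
  show "\<forall>a\<in>range (\<lambda>n::nat. ball x0 (real n)). emeasure M a \<noteq> \<infinity>"
   using ball_finite by (auto simp: less_top)
 qed
qed

lemma ball_pow: "0 < r \<Longrightarrow> vol x (2 ^ n * r) \<le> ennreal (D ^ n) * vol x r"
proof (induction n)
 case (Suc n)
 have "vol x (2 ^ Suc n * r) \<le> ennreal D * vol x (2 ^ n * r)"
  using doubling[of "2 ^ n * r" x] Suc by (simp add: mult.assoc)
 also have "... \<le> ennreal D * (ennreal (D ^ n) * vol x r)"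
  using Suc by (intro mult_left_mono) auto
 also have "... = ennreal (D ^ Suc n) * vol x r"
  using D_ge_1 by (simp add: ennreal_mult mult.assoc)
 finally show ?case .
qed simp

lemma ball_le:
 assumes "0 < r" "dist x y + t \<le> 2 ^ n * r"
 shows "vol y t \<le> ennreal (D ^ n) * vol x r"
proof -
 have "ball y t \<subseteq> ball x (2 ^ n * r)"
  using assms by (intro ball_subset_ball)
 then have "vol y t \<le> vol x (2 ^ n * r)"
  by (intro emeasure_mono) auto
 also have "... \<le> ennreal (D ^ n) * vol x r" by (rule ball_pow[OF assms(1)])
 finally show ?thesis .
qed

section \<open>The centred maximal function and its boundedness on L^p\<close>

lemma indicator_ball_measurable [measurable]:
 "(\<lambda>(x, y). indicator (ball x r) y :: ennreal) \<in> borel_measurable (borel \<Otimes>\<^sub>M M)"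
proof -
 have "(\<lambda>p. dist (fst p) (snd p)) \<in> borel_measurable (borel \<Otimes>\<^sub>M M)"
  by (intro borel_measurable_dist measurable_fst measurable_compose[OF measurable_snd id_measurable_M])
 then have "{p \<in> space (borel \<Otimes>\<^sub>M M). dist (fst p) (snd p) < r} \<in> sets (borel \<Otimes>\<^sub>M M)"
  by measurable
 then have "(indicator {p \<in> space (borel \<Otimes>\<^sub>M M). dist (fst p) (snd p) < r} :: _ \<Rightarrow> ennreal)
  \<in> borel_measurable (borel \<Otimes>\<^sub>M M)" by (rule borel_measurable_indicator)
 also have "?this \<longleftrightarrow> ?thesis"
  by (intro measurable_cong) (auto simp: indicator_def space_pair_measure)
 finally show ?thesis .
qed

lemma ball_integral_measurable:
 assumes [measurable]: "f \<in> borel_measurable M"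
 shows "(\<lambda>x. \<integral>\<^sup>+y\<in>ball x r. f y \<partial>M) \<in> borel_measurable borel"
proof -
 have "(\<lambda>p. f (snd p) * (case p of (x, y) \<Rightarrow> indicator (ball x r) y)) \<in> borel_measurable (borel \<Otimes>\<^sub>M M)"
  using measurable_compose[OF measurable_snd assms(1)] indicator_ball_measurable[of r]
  by (intro borel_measurable_times_ennreal) auto
 then show ?thesis
  by (intro borel_measurable_nn_integral) (simp add: split_beta')
qed

lemma ball_measure_measurable: "(\<lambda>x. vol x r) \<in> borel_measurable borel"
 using ball_integral_measurable[of "\<lambda>_. 1" r] by simp

text \<open>Rational radii make this a countable supremum of Borel functions. An arbitrary radius r
  is reached through a rational one between r and 2 r, at the price of the factor \<open>D\<close>
  in \<open>ball_integral_le_mxf\<close>.\<close>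

definition mxf :: "('a \<Rightarrow> ennreal) \<Rightarrow> 'a \<Rightarrow> ennreal" where
 "mxf f x = (SUP r\<in>{r\<in>\<rat>. 0 < r}. (\<integral>\<^sup>+y\<in>ball x r. f y \<partial>M) / vol x r)"

lemma mxf_measurable:
 assumes "f \<in> borel_measurable M"
 shows "mxf f \<in> borel_measurable borel"
proof -
 have [measurable]: "(\<lambda>x. \<integral>\<^sup>+y\<in>ball x r. f y \<partial>M) \<in> borel_measurable borel"
  "(\<lambda>x. vol x r) \<in> borel_measurable borel" for r
  using ball_integral_measurable[OF assms] ball_measure_measurable by auto
 have "countable {r\<in>\<rat>. (0::real) < r}" by (rule countable_subset[OF _ countable_rat]) auto
 then show ?thesis unfolding mxf_def[abs_def] by measurable
qed

lemma ball_integral_le_mxf: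
 assumes "0 < r"
 shows "(\<integral>\<^sup>+y\<in>ball x r. f y \<partial>M) \<le> ennreal D * mxf f x * vol x r"
proof -
 obtain q where q: "q \<in> \<rat>" "r < q" "q < 2 * r"
  using Rats_dense_in_real[of r "2 * r"] assms by auto
 have pos: "vol x q \<noteq> 0" "vol x q < \<infinity>"
  using ball_pos[of q x] ball_finite[of x q] q assms by auto
 have "(\<integral>\<^sup>+y\<in>ball x r. f y \<partial>M) \<le> (\<integral>\<^sup>+y\<in>ball x q. f y \<partial>M)"
  using q by (intro nn_integral_mono mult_left_mono) (auto simp: indicator_def)
 also have "... = (\<integral>\<^sup>+y\<in>ball x q. f y \<partial>M) / vol x q * vol x q"
  using ennreal_divide_mult_self[OF pos] by simp
 also have "... \<le> mxf f x * vol x q"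
  unfolding mxf_def using q assms by (intro mult_right_mono SUP_upper) auto
 also have "... \<le> mxf f x * (ennreal D * vol x r)"
  using ball_le[of r x x q 1] assms q by (intro mult_left_mono) auto
 finally show ?thesis by (simp add: ac_simps)
qed

text \<open>The level set is covered by balls on which the mean of f exceeds lam, and Vitali is
  applied to lam times \<open>M\<close> and D^2 f times \<open>M\<close>. The power D^2 comes from 3
  r <= 2^2 r.\<close>

lemma mxf_weak_type:
 assumes f [measurable]: "f \<in> borel_measurable M" and "0 < lam"
 shows "ennreal lam * emeasure M {x. ennreal lam < mxf f x} \<le> ennreal (D ^ 2) * (\<integral>\<^sup>+x. f x \<partial>M)"
proof -
 define P where "P = {(x, r). 0 < r \<and> ennreal lam * vol x r < (\<integral>\<^sup>+y\<in>ball x r. f y \<partial>M)}"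
 define \<alpha> where "\<alpha> = density M (\<lambda>_. ennreal lam)"
 define \<nu> where "\<nu> = density M (\<lambda>x. ennreal (D ^ 2) * f x)"
 have U: "{x. ennreal lam < mxf f x} \<subseteq> (\<Union>q\<in>P. ball (fst q) (snd q))"
 proof
  fix x assume "x \<in> {x. ennreal lam < mxf f x}"
  then obtain r where r: "0 < r" "ennreal lam < (\<integral>\<^sup>+y\<in>ball x r. f y \<partial>M) / vol x r"
   unfolding mxf_def by (auto simp: less_SUP_iff)
  have pos: "vol x r \<noteq> 0" "vol x r < \<infinity>"
   using ball_pos[of r x] ball_finite[of x r] r by auto
  have "ennreal lam * vol x r
    < (\<integral>\<^sup>+y\<in>ball x r. f y \<partial>M) / vol x r * vol x r"
   using r pos by (intro ennreal_mult_strict_right_mono) (auto simp: less_top zero_less_iff_neq_zero)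
  then have "(x, r) \<in> P" using r ennreal_divide_mult_self[OF pos] by (auto simp: P_def)
  then show "x \<in> (\<Union>q\<in>P. ball (fst q) (snd q))" using r by force
 qed
 have Um: "(\<Union>q\<in>P. ball (fst q) (snd q)) \<in> sets M" by (intro open_sets_M open_UN) auto
 have "ennreal lam * emeasure M {x. ennreal lam < mxf f x}
  \<le> ennreal lam * emeasure M (\<Union>q\<in>P. ball (fst q) (snd q))"
  using U Um by (intro mult_left_mono emeasure_mono) auto
 also have "... = emeasure \<alpha> (\<Union>q\<in>P. ball (fst q) (snd q))"
  unfolding \<alpha>_def using Um by (subst emeasure_density) (auto simp: nn_integral_cmult)
 also have "... \<le> emeasure \<nu> (\<Union>q\<in>P. ball (fst q) (snd q))"
 proof (rule vitali_emeasure_le)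
  fix a r assume P: "(a, r) \<in> P"
  have "emeasure \<alpha> (ball a (3 * r)) = ennreal lam * vol a (3 * r)"
   unfolding \<alpha>_def by (subst emeasure_density) (auto simp: nn_integral_cmult)
  also have "... \<le> ennreal lam * (ennreal (D ^ 2) * vol a r)"
   using P by (intro mult_left_mono ball_le) (auto simp: P_def)
  also have "... = ennreal (D ^ 2) * (ennreal lam * vol a r)" by (simp add: ac_simps)
  also have "... \<le> ennreal (D ^ 2) * (\<integral>\<^sup>+y\<in>ball a r. f y \<partial>M)"
   using P by (intro mult_left_mono) (auto simp: P_def)
  also have "... = emeasure \<nu> (ball a r)"
   unfolding \<nu>_def by (subst emeasure_density) (auto simp: nn_integral_cmult[symmetric] mult.assoc)
  finally show "0 < r \<and> emeasure \<alpha> (ball a (3 * r)) \<le> emeasure \<nu> (ball a r)"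
   using P by (auto simp: P_def)
 qed (use sets_M in \<open>auto simp: \<alpha>_def \<nu>_def\<close>)
 also have "... \<le> emeasure \<nu> (space \<nu>)" by (rule emeasure_space)
 also have "... = ennreal (D ^ 2) * (\<integral>\<^sup>+x. f x \<partial>M)"
  unfolding \<nu>_def by (subst emeasure_density) (auto simp: nn_integral_cmult)
 finally show ?thesis .
qed

text \<open>The part of f below height lam contributes at most lam to the maximal function, so the
  height 2 lam is reached only through the part above lam; the weak-type bound is applied to that
  part.\<close>

lemma mxf_level:
 assumes f [measurable]: "f \<in> borel_measurable M" and "0 < lam"
 shows "ennreal lam * emeasure M {x. ennreal (2 * lam) < mxf f x}
  \<le> ennreal (D ^ 2) * (\<integral>\<^sup>+x. f x * indicator {..<f x} (ennreal lam) \<partial>M)"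
proof -
 define g where "g x = f x * indicator {..<f x} (ennreal lam)" for x
 have g [measurable]: "g \<in> borel_measurable M"
 proof -
  have "g = (\<lambda>x. if ennreal lam < f x then f x else 0)" by (auto simp: g_def fun_eq_iff)
  then show ?thesis by simp
 qed
 have "mxf f x \<le> ennreal lam + mxf g x" for x
  unfolding mxf_def
 proof (rule SUP_least)
  fix r :: real assume r: "r \<in> {r \<in> \<rat>. 0 < r}"
  have pos: "vol x r \<noteq> 0" "vol x r < \<infinity>"
   using ball_pos[of r x] ball_finite[of x r] r by auto
  have "(\<integral>\<^sup>+y\<in>ball x r. f y \<partial>M) \<le> (\<integral>\<^sup>+y\<in>ball x r. ennreal lam + g y \<partial>M)"
   by (intro nn_integral_mono mult_right_mono) (auto simp: g_def indicator_def add_increasing)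
  also have "... = ennreal lam * vol x r + (\<integral>\<^sup>+y\<in>ball x r. g y \<partial>M)"
   by (simp add: distrib_right nn_integral_add nn_integral_cmult)
  finally have "(\<integral>\<^sup>+y\<in>ball x r. f y \<partial>M) / vol x r
   \<le> (ennreal lam * vol x r + (\<integral>\<^sup>+y\<in>ball x r. g y \<partial>M)) / vol x r"
   by (rule divide_right_mono_ennreal)
  also have "... = ennreal lam + (\<integral>\<^sup>+y\<in>ball x r. g y \<partial>M) / vol x r"
   using pos by (simp add: add_divide_distrib_ennreal mult_divide_eq_ennreal less_top)
  also have "... \<le> ennreal lam + (SUP r\<in>{r\<in>\<rat>. 0 < r}. (\<integral>\<^sup>+y\<in>ball x r. g y \<partial>M) / vol x r)"
   using r by (intro add_left_mono SUP_upper)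
  finally show "(\<integral>\<^sup>+y\<in>ball x r. f y \<partial>M) / vol x r \<le> ..." .
 qed
 then have "{x. ennreal (2 * lam) < mxf f x} \<subseteq> {x. ennreal lam < mxf g x}"
 proof safe
  fix x assume "ennreal (2 * lam) < mxf f x" and *: "\<And>x. mxf f x \<le> ennreal lam + mxf g x"
  then have "ennreal (2 * lam) < ennreal lam + mxf g x" by (rule less_le_trans)
  moreover have "ennreal (2 * lam) = ennreal lam + ennreal lam"
   using \<open>0 < lam\<close> by (simp flip: ennreal_plus)
  ultimately have "ennreal lam + ennreal lam < ennreal lam + mxf g x" by simp
  then show "ennreal lam < mxf g x" by (meson add_left_mono leD leI)
 qed
 moreover have "{x. ennreal lam < mxf g x} \<in> sets M"
 proof -
  have [measurable]: "mxf g \<in> borel_measurable M" by (rule borel_measurable_M[OF mxf_measurable[OF g]])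
  have "{x \<in> space M. ennreal lam < mxf g x} \<in> sets M" by measurable
  then show ?thesis by simp
 qed
 ultimately have "ennreal lam * emeasure M {x. ennreal (2 * lam) < mxf f x}
  \<le> ennreal lam * emeasure M {x. ennreal lam < mxf g x}"
  by (intro mult_left_mono emeasure_mono) auto
 also have "... \<le> ennreal (D ^ 2) * (\<integral>\<^sup>+x. g x \<partial>M)" by (rule mxf_weak_type) fact+
 finally show ?thesis by (simp add: g_def)
qed

text \<open>Marcinkiewicz interpolation in dyadic form: \<open>mxf_level\<close> is summed over
  heights 2^m with weight 2^(pm). Exchanging sum and integral leaves f times a dyadic sum of
  exponent p - 1 at 2 f, which is comparable to f^p because p - 1 > 0.\<close>

lemma Lp_nonneg_mxf:
 assumes p: "1 < p" and f: "Lp_nonneg p M f"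
 shows "Lp_nonneg p M (mxf f)"
proof -
 have fm [measurable]: "f \<in> borel_measurable M" using f by (simp add: Lp_nonneg_def)
 have mm [measurable]: "mxf f \<in> borel_measurable M" by (rule borel_measurable_M[OF mxf_measurable[OF fm]])
 define e :: "nat \<Rightarrow> real" where "e n = of_int (int_decode n)" for n
 define C where "C = 2 * D ^ 2"
 have C: "0 \<le> C" using D_ge_1 by (simp add: C_def)
 have lev: "ennreal (2 powr (p * e n)) * emeasure M {x. ennreal (2 powr e n) < mxf f x}
  \<le> ennreal C * (\<integral>\<^sup>+x. f x * (ennreal (2 powr ((p - 1) * e n)) * indicator {..<ennreal 2 * f x} (ennreal (2 powr e n))) \<partial>M)"
  (is "?l \<le> ?r") for n
 proof -
  \<comment> \<open>\<open>mxf_level\<close> doubles the height, so the height 2^e is reached from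
    half of it; this is the factor 2 in \<open>C\<close>.\<close>
  define lam where "lam = 2 powr e n / 2"
  have l: "0 < lam" "2 * lam = 2 powr e n" by (auto simp: lam_def)
  have "2 powr (p * e n) = 2 * 2 powr ((p - 1) * e n) * lam"
   by (simp add: lam_def powr_add[symmetric] algebra_simps)
  then have "?l = ennreal (2 * 2 powr ((p - 1) * e n)) * (ennreal lam * emeasure M {x. ennreal (2 * lam) < mxf f x})"
   using l by (simp add: ennreal_mult[symmetric] mult.assoc[symmetric])
  also have "... \<le> ennreal (2 * 2 powr ((p - 1) * e n)) * (ennreal (D ^ 2) * (\<integral>\<^sup>+x. f x * indicator {..<f x} (ennreal lam) \<partial>M))"
   by (intro mult_left_mono mxf_level) (use l in auto)
  also have "... = ennreal C * (ennreal (2 powr ((p - 1) * e n)) * (\<integral>\<^sup>+x. f x * indicator {..<f x} (ennreal lam) \<partial>M))"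
   using D_ge_1 by (simp add: C_def ennreal_mult ac_simps)
  also have "... = ennreal C * (\<integral>\<^sup>+x. ennreal (2 powr ((p - 1) * e n)) * (f x * indicator {..<f x} (ennreal lam)) \<partial>M)"
  proof -
   have "(\<lambda>x. f x * indicator {..<f x} (ennreal lam)) = (\<lambda>x. if ennreal lam < f x then f x else 0)"
    by (auto simp: fun_eq_iff)
   then have "(\<lambda>x. f x * indicator {..<f x} (ennreal lam)) \<in> borel_measurable M" by simp
   then show ?thesis by (simp add: nn_integral_cmult)
  qed
  also have "... \<le> ?r"
  proof (intro mult_left_mono nn_integral_mono)
   fix x
   have "ennreal (2 powr e n) < ennreal 2 * f x" if "ennreal lam < f x"
   proof -
    have "ennreal 2 * ennreal lam < ennreal 2 * f x"
     using that by (intro ennreal_mult_strict_left_mono) auto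
    also have "ennreal 2 * ennreal lam = ennreal (2 powr e n)"
     using l ennreal_mult[of 2 lam] by simp
    finally show ?thesis .
   qed
   then show "ennreal (2 powr ((p - 1) * e n)) * (f x * indicator {..<f x} (ennreal lam))
    \<le> f x * (ennreal (2 powr ((p - 1) * e n)) * indicator {..<ennreal 2 * f x} (ennreal (2 powr e n)))"
    by (auto simp: indicator_def ac_simps)
  qed auto
  finally show ?thesis .
 qed
 have ind_meas: "(\<lambda>x. indicator {..<g x} c :: ennreal) \<in> borel_measurable M"
  if [measurable]: "g \<in> borel_measurable M" for g and c :: ennreal
 proof -
  have "(\<lambda>x. indicator {..<g x} c :: ennreal) = (\<lambda>x. if c < g x then 1 else 0)"
   by (auto simp: fun_eq_iff)
  then show ?thesis by simp
 qed
 note [measurable] = ind_meas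
 have "(\<integral>\<^sup>+x. ennreal_powr (mxf f x) p \<partial>M) \<le> (\<integral>\<^sup>+x. ennreal (2 powr p) * dyadic_sum p (mxf f x) \<partial>M)"
  using p by (intro nn_integral_mono powr_le_dyadic_sum) auto
 also have "... = ennreal (2 powr p) * (\<Sum>n. \<integral>\<^sup>+x. ennreal (2 powr (p * e n)) * indicator {..<mxf f x} (ennreal (2 powr e n)) \<partial>M)"
  unfolding dyadic_sum_def e_def[symmetric] by (subst nn_integral_cmult) (auto simp: nn_integral_suminf)
 also have "... = ennreal (2 powr p) * (\<Sum>n. ennreal (2 powr (p * e n)) * emeasure M {x. ennreal (2 powr e n) < mxf f x})"
 proof -
  have "(\<integral>\<^sup>+x. ennreal (2 powr (p * e n)) * indicator {..<mxf f x} (ennreal (2 powr e n)) \<partial>M)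
   = ennreal (2 powr (p * e n)) * emeasure M {x. ennreal (2 powr e n) < mxf f x}" for n
  proof -
   have "{x \<in> space M. ennreal (2 powr e n) < mxf f x} \<in> sets M" by measurable
   then have "(\<integral>\<^sup>+x. ennreal (2 powr (p * e n)) * indicator {x. ennreal (2 powr e n) < mxf f x} x \<partial>M)
    = ennreal (2 powr (p * e n)) * emeasure M {x. ennreal (2 powr e n) < mxf f x}"
    by (intro nn_integral_cmult_indicator) simp
   moreover have "(\<integral>\<^sup>+x. ennreal (2 powr (p * e n)) * indicator {..<mxf f x} (ennreal (2 powr e n)) \<partial>M)
    = (\<integral>\<^sup>+x. ennreal (2 powr (p * e n)) * indicator {x. ennreal (2 powr e n) < mxf f x} x \<partial>M)"
    by (intro nn_integral_cong) (auto simp: indicator_def)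
   ultimately show ?thesis by simp
  qed
  then show ?thesis by simp
 qed
 also have "... \<le> ennreal (2 powr p) * (\<Sum>n. ennreal C * (\<integral>\<^sup>+x. f x * (ennreal (2 powr ((p - 1) * e n)) * indicator {..<ennreal 2 * f x} (ennreal (2 powr e n))) \<partial>M))"
  by (intro mult_left_mono suminf_le lev) auto
 also have "... = ennreal (2 powr p) * (ennreal C * (\<integral>\<^sup>+x. f x * dyadic_sum (p - 1) (ennreal 2 * f x) \<partial>M))"
  unfolding dyadic_sum_def e_def[symmetric] by (simp add: nn_integral_suminf[symmetric])
 also have "... \<le> ennreal (2 powr p) * (ennreal C * (\<integral>\<^sup>+x. ennreal (1 / (1 - 2 powr - (p - 1)) * 2 powr (p - 1)) * ennreal_powr (f x) p \<partial>M))"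
 proof (intro mult_left_mono nn_integral_mono)
  fix x
  have "2 powr - (p - 1) < (1::real)" using p by (simp add: powr_less_one)
  then have "f x * dyadic_sum (p - 1) (ennreal 2 * f x)
   \<le> f x * (ennreal (1 / (1 - 2 powr - (p - 1))) * (ennreal (2 powr (p - 1)) * ennreal_powr (f x) (p - 1)))"
   using dyadic_sum_le_powr[of "p - 1" "ennreal 2 * f x"] ennreal_powr_mult[of "p - 1" 2 "f x"] p
   by (intro mult_left_mono) auto
  also have "... = ennreal (1 / (1 - 2 powr - (p - 1)) * 2 powr (p - 1)) * (f x * ennreal_powr (f x) (p - 1))"
   using \<open>2 powr - (p - 1) < (1::real)\<close> by (subst ennreal_mult) (auto simp: ac_simps)
  also have "... = ennreal (1 / (1 - 2 powr - (p - 1)) * 2 powr (p - 1)) * ennreal_powr (f x) p"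
   by (simp only: ennreal_mult_powr_minus_one[OF p])
  finally show "f x * dyadic_sum (p - 1) (ennreal 2 * f x)
   \<le> ennreal (1 / (1 - 2 powr - (p - 1)) * 2 powr (p - 1)) * ennreal_powr (f x) p" .
 qed auto
 also have "... < \<infinity>"
  using f by (auto simp: nn_integral_cmult Lp_nonneg_def ennreal_mult_less_top)
 finally show ?thesis by (simp add: Lp_nonneg_def)
qed

end

section \<open>Oscillation and Lipschitz approximation\<close>

text \<open>Dividing by the squared measure of the ball would give the mean oscillation; the
  unnormalised form keeps quotients out of the \<open>ennreal\<close> estimates.\<close>

definition dosc :: "'a::metric_space measure \<Rightarrow> ('a \<Rightarrow> 'b::real_normed_vector) \<Rightarrow> 'a \<Rightarrow> real \<Rightarrow> ennreal" where
 "dosc m f x t = (\<integral>\<^sup>+y\<in>ball x t. (\<integral>\<^sup>+z\<in>ball x t. enorm (f y - f z) \<partial>m) \<partial>m)"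

text \<open>If H exceeded c at almost every point of B, its integral would be strictly larger than c
  times the measure. The property \<open>Q\<close> lets the chosen point avoid a given null
  set.\<close>

lemma exists_le_average:
 assumes [measurable]: "H \<in> borel_measurable m" "B \<in> sets m"
  and B: "0 < emeasure m B" "emeasure m B < \<infinity>"
  and le: "(\<integral>\<^sup>+y\<in>B. H y \<partial>m) \<le> c * emeasure m B"
  and Q: "AE y in m. Q y"
 shows "\<exists>y\<in>B. Q y \<and> H y \<le> c"
proof (rule ccontr)
 assume contra: "\<not> (\<exists>y\<in>B. Q y \<and> H y \<le> c)"
 have ne: "\<not> (AE y in m. y \<notin> B)"
 proof -
  have "{y \<in> space m. \<not> y \<notin> B} = B" using sets.sets_into_space[OF assms(2)] by auto
  from AE_iff_measurable[OF assms(2) this] show ?thesis using B by auto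
 qed
 have "\<exists>y\<in>B. Q y"
 proof (rule ccontr)
  assume "\<not> ?thesis"
  with Q have "AE y in m. y \<notin> B" by (auto elim: eventually_mono)
  with ne show False ..
 qed
 with contra have c: "c \<noteq> \<infinity>" by auto
 have "(\<integral>\<^sup>+y. c * indicator B y \<partial>m) < (\<integral>\<^sup>+y. H y * indicator B y \<partial>m)"
 proof (rule nn_integral_less)
  show "(\<integral>\<^sup>+y. c * indicator B y \<partial>m) \<noteq> \<infinity>"
   using B c by (simp add: nn_integral_cmult ennreal_mult_eq_top_iff less_top)
  show "AE y in m. c * indicator B y \<le> H y * indicator B y"
   using Q contra by (auto elim!: eventually_mono simp: indicator_def not_le)
  show "\<not> (AE y in m. H y * indicator B y \<le> c * indicator B y)"
  proof
   assume "AE y in m. H y * indicator B y \<le> c * indicator B y"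
   with Q have "AE y in m. y \<notin> B"
    by eventually_elim (use contra in \<open>auto simp: indicator_def split: if_splits\<close>)
   with ne show False ..
  qed
 qed auto
 then show False using le by (simp add: nn_integral_cmult)
qed

lemma geometric_Cauchy_limit:
 fixes a :: "nat \<Rightarrow> real"
 assumes "\<And>k. \<bar>a k - a (Suc k)\<bar> \<le> K / 2 ^ k"
 shows "\<exists>c. \<forall>k. \<bar>a k - c\<bar> \<le> 2 * K / 2 ^ k"
proof -
 have step: "\<bar>a k - a (k + n)\<bar> \<le> 2 * K / 2 ^ k - 2 * K / 2 ^ (k + n)" for k n
 proof (induction n)
  case (Suc n)
  have "\<bar>a k - a (k + Suc n)\<bar> \<le> \<bar>a k - a (k + n)\<bar> + \<bar>a (k + n) - a (Suc (k + n))\<bar>" by simp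
  also have "... \<le> 2 * K / 2 ^ k - 2 * K / 2 ^ (k + n) + K / 2 ^ (k + n)"
   using Suc assms[of "k + n"] by simp
  also have "... = 2 * K / 2 ^ k - 2 * K / 2 ^ (k + Suc n)"
   by (simp add: field_simps)
  finally show ?case .
 qed simp
 have "0 \<le> K" using order_trans[OF abs_ge_zero assms[of 0]] by simp
 then have le: "\<bar>a k - a (k + n)\<bar> \<le> 2 * K / 2 ^ k" for k n
 proof -
  have "0 \<le> 2 * K / 2 ^ (k + n)" using \<open>0 \<le> K\<close> by simp
  then show ?thesis using step[of k n] by linarith
 qed
 have lim: "(\<lambda>k. 2 * K / 2 ^ k) \<longlonglongrightarrow> 0"
  using LIMSEQ_divide_realpow_zero[of 2 "2 * K"] by simp
 have "Cauchy a"
 proof (rule metric_CauchyI)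
  fix e :: real assume "0 < e"
  then have "eventually (\<lambda>k. 2 * K / 2 ^ k < e / 2) sequentially"
   using lim by (intro order_tendstoD(2)[of _ 0]) auto
  then obtain k where k: "2 * K / 2 ^ k < e / 2" by (auto simp: eventually_sequentially)
  show "\<exists>M. \<forall>m\<ge>M. \<forall>n\<ge>M. dist (a m) (a n) < e"
  proof (intro exI[of _ k] allI impI)
   fix m n assume mn: "k \<le> m" "k \<le> n"
   have "\<bar>a k - a m\<bar> \<le> 2 * K / 2 ^ k" "\<bar>a k - a n\<bar> \<le> 2 * K / 2 ^ k"
    using le[of k "m - k"] le[of k "n - k"] mn by auto
   then show "dist (a m) (a n) < e" using k by (simp add: dist_real_def)
  qed
 qed
 then obtain c where c: "a \<longlonglongrightarrow> c" by (auto simp: Cauchy_convergent_iff convergent_def)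
 have "\<bar>a k - c\<bar> \<le> 2 * K / 2 ^ k" for k
 proof -
  have "(\<lambda>n. \<bar>a k - a (k + n)\<bar>) \<longlonglongrightarrow> \<bar>a k - c\<bar>"
   using LIMSEQ_ignore_initial_segment[OF c, of k] by (intro tendsto_intros) (simp add: add.commute)
  then show ?thesis by (rule LIMSEQ_le_const2) (use le in auto)
 qed
 then show ?thesis by blast
qed

text \<open>Doubling is only required for balls centred in \<open>Om\<close> with radius in the initial
 segment \<open>T\<close> of the positive reals, so that both the whole space and a set satisfying the
 measure-density condition are covered.\<close>

locale local_doubling =
 fixes m :: "'a::{metric_space,second_countable_topology} measure"
  and Om :: "'a set" and T :: "real set" and D :: real
 assumes space_m [simp]: "space m = UNIV"
  and sets_m: "sets borel \<subseteq> sets m"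
  and Om_sets [measurable]: "Om \<in> sets m"
  and T_pos: "r \<in> T \<Longrightarrow> 0 < r"
  and T_down: "r \<in> T \<Longrightarrow> 0 < r' \<Longrightarrow> r' \<le> r \<Longrightarrow> r' \<in> T"
  and T_ne: "T \<noteq> {}"
  and D_ge_1: "1 \<le> D"
  and ball_pos: "x \<in> Om \<Longrightarrow> 0 < r \<Longrightarrow> 0 < emeasure m (ball x r)"
  and ball_finite: "emeasure m (ball x r) < \<infinity>"
  and doubling: "x \<in> Om \<Longrightarrow> r \<in> T \<Longrightarrow> emeasure m (ball x (2 * r)) \<le> ennreal D * emeasure m (ball x r)"
begin

lemma open_sets_m [intro, simp]: "open S \<Longrightarrow> S \<in> sets m"
 using sets_m by auto

lemma id_measurable_m [measurable]: "(\<lambda>x. x) \<in> borel_measurable m"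
 by (rule borel_space_times_subset[OF sets_m space_m])

lemma ball_sets_m [measurable]: "ball x r \<in> sets m" by simp

sublocale sigma_finite_measure m
proof
 obtain x0 :: 'a where True by simp
 show "\<exists>A. countable A \<and> A \<subseteq> sets m \<and> \<Union>A = space m \<and> (\<forall>a\<in>A. emeasure m a \<noteq> \<infinity>)"
 proof (intro exI conjI)
  show "countable (range (\<lambda>n::nat. ball x0 (real n)))" by simp
  show "range (\<lambda>n::nat. ball x0 (real n)) \<subseteq> sets m" by auto
  show "\<Union> (range (\<lambda>n::nat. ball x0 (real n))) = space m"
   by (auto simp: reals_Archimedean2)
  show "\<forall>a\<in>range (\<lambda>n::nat. ball x0 (real n)). emeasure m a \<noteq> \<infinity>"
   using ball_finite by (auto simp: less_top)
 qed
qed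

lemma doubling2:
 assumes "x \<in> Om" "2 * r \<in> T"
 shows "emeasure m (ball x (4 * r)) \<le> ennreal (D ^ 2) * emeasure m (ball x r)"
proof -
 have r: "r \<in> T" using assms T_pos[of "2 * r"] by (intro T_down[of "2 * r" r]) auto
 have "emeasure m (ball x (4 * r)) \<le> ennreal D * emeasure m (ball x (2 * r))"
  using doubling[OF assms] by simp
 also have "... \<le> ennreal D * (ennreal D * emeasure m (ball x r))"
  using doubling[OF assms(1) r] by (intro mult_left_mono) auto
 finally show ?thesis using D_ge_1 by (simp add: ennreal_mult power2_eq_square mult.assoc)
qed

text \<open>The number c acts as the Lebesgue value of f at x. In each ball of radius t0 / 2^k a
  point is chosen whose f-value is close in the mean to f on the ball; these values form a geometric
  Cauchy sequence with limit c. They replace averages, which would require integrability. The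
  constant is 10 = 2 + 8: passing to the next dyadic radius above t costs 2, and the tail 4 D \<tau>
  s k of the sequence is at most 8 D \<tau> t.\<close>

lemma osc_limit:
 fixes f :: "'a \<Rightarrow> real"
 assumes [measurable]: "f \<in> borel_measurable m" and x: "x \<in> Om" and t0: "t0 \<in> T" and "0 \<le> \<tau>"
  and osc: "\<And>t. t \<in> T \<Longrightarrow> dosc m f x t \<le> ennreal (\<tau> * t) * (emeasure m (ball x t))\<^sup>2"
 shows "\<exists>c. \<forall>t. 0 < t \<and> t \<le> t0 \<longrightarrow>
  (\<integral>\<^sup>+y\<in>ball x t. ennreal \<bar>f y - c\<bar> \<partial>m) \<le> ennreal (10 * D * \<tau> * t) * emeasure m (ball x t)"
proof -
 define s where "s k = t0 / 2 ^ k" for k :: nat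
 have t0p: "0 < t0" using T_pos t0 by auto
 have sT: "s k \<in> T" "0 < s k" for k
 proof -
  show p: "0 < s k" using t0p by (simp add: s_def)
  have "t0 * 1 \<le> t0 * 2 ^ k" using t0p by (intro mult_left_mono) auto
  then show "s k \<in> T" using T_down[OF t0 p] by (simp add: s_def divide_le_eq)
 qed
 have "\<exists>y\<in>ball x (s k). True \<and>
  (\<integral>\<^sup>+z\<in>ball x (s k). ennreal \<bar>f y - f z\<bar> \<partial>m) \<le> ennreal (\<tau> * s k) * emeasure m (ball x (s k))" for k
 proof (rule exists_le_average)
  show "(\<lambda>y. \<integral>\<^sup>+z\<in>ball x (s k). ennreal \<bar>f y - f z\<bar> \<partial>m) \<in> borel_measurable m"
   by measurable
  show "(\<integral>\<^sup>+y\<in>ball x (s k). (\<integral>\<^sup>+z\<in>ball x (s k). ennreal \<bar>f y - f z\<bar> \<partial>m) \<partial>m)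
   \<le> ennreal (\<tau> * s k) * emeasure m (ball x (s k)) * emeasure m (ball x (s k))"
   using osc[OF sT(1)] by (simp add: dosc_def power2_eq_square mult.assoc)
 qed (use ball_pos[OF x sT(2)] ball_finite in auto)
 then obtain y where y: "\<And>k. y k \<in> ball x (s k)"
  "\<And>k. (\<integral>\<^sup>+z\<in>ball x (s k). ennreal \<bar>f (y k) - f z\<bar> \<partial>m) \<le> ennreal (\<tau> * s k) * emeasure m (ball x (s k))"
  by metis
 have step: "\<bar>f (y k) - f (y (Suc k))\<bar> \<le> (2 * D * \<tau> * t0) / 2 ^ k" for k
 proof -
  let ?B = "ball x (s (Suc k))"
  have dbl: "emeasure m (ball x (s k)) \<le> ennreal D * emeasure m ?B"
   using doubling[OF x sT(1), of "Suc k"] by (simp add: s_def)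
  have "ennreal \<bar>f (y k) - f (y (Suc k))\<bar> * emeasure m ?B
   = (\<integral>\<^sup>+z\<in>?B. ennreal \<bar>f (y k) - f (y (Suc k))\<bar> \<partial>m)"
   by (simp add: nn_integral_cmult)
  also have "... \<le> (\<integral>\<^sup>+z. ennreal \<bar>f (y k) - f z\<bar> * indicator (ball x (s k)) z
    + ennreal \<bar>f (y (Suc k)) - f z\<bar> * indicator ?B z \<partial>m)"
  proof (intro nn_integral_mono)
   fix z
   have sub: "?B \<subseteq> ball x (s k)" using sT(2)[of k] by (intro subset_ball) (simp add: s_def field_simps)
   have "ennreal \<bar>f (y k) - f (y (Suc k))\<bar> \<le> ennreal \<bar>f (y k) - f z\<bar> + ennreal \<bar>f (y (Suc k)) - f z\<bar>"
    by (simp flip: ennreal_plus add: ennreal_leI)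
   then show "ennreal \<bar>f (y k) - f (y (Suc k))\<bar> * indicator ?B z
    \<le> ennreal \<bar>f (y k) - f z\<bar> * indicator (ball x (s k)) z + ennreal \<bar>f (y (Suc k)) - f z\<bar> * indicator ?B z"
    using sub by (cases "z \<in> ?B") (auto simp: subset_eq)
  qed
  also have "... \<le> ennreal (\<tau> * s k) * emeasure m (ball x (s k)) + ennreal (\<tau> * s (Suc k)) * emeasure m ?B"
   using y(2)[of k] y(2)[of "Suc k"] by (simp add: nn_integral_add add_mono)
  also have "... \<le> ennreal (\<tau> * s k) * (ennreal D * emeasure m ?B) + ennreal (\<tau> * s (Suc k)) * emeasure m ?B"
   using dbl by (intro add_mono mult_left_mono) auto
  also have "... = ennreal (\<tau> * s k * D + \<tau> * s (Suc k)) * emeasure m ?B"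
   using \<open>0 \<le> \<tau>\<close> sT(2)[THEN less_imp_le] D_ge_1 by (simp add: ennreal_mult ennreal_plus distrib_right mult.assoc)
  finally have "ennreal \<bar>f (y k) - f (y (Suc k))\<bar> \<le> ennreal (\<tau> * s k * D + \<tau> * s (Suc k))"
   by (rule ennreal_mult_le_cancel_right) (use ball_pos[OF x sT(2)] ball_finite in auto)
  then have "\<bar>f (y k) - f (y (Suc k))\<bar> \<le> \<tau> * s k * D + \<tau> * s (Suc k)"
   using \<open>0 \<le> \<tau>\<close> sT(2)[THEN less_imp_le] D_ge_1 by (subst (asm) ennreal_le_iff) auto
  also have "\<tau> * s (Suc k) \<le> \<tau> * s k * D"
  proof -
   have "s (Suc k) \<le> s k" using sT(2)[of k] by (simp add: s_def field_simps)
   also have "s k * 1 \<le> s k * D" using sT(2)[of k] D_ge_1 by (intro mult_left_mono) auto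
   finally show ?thesis using \<open>0 \<le> \<tau>\<close> by (simp add: mult_left_mono mult.assoc)
  qed
  finally show ?thesis by (simp add: s_def)
 qed
 obtain c where c: "\<And>k. \<bar>f (y k) - c\<bar> \<le> 2 * (2 * D * \<tau> * t0) / 2 ^ k"
  using geometric_Cauchy_limit[of "\<lambda>k. f (y k)" "2 * D * \<tau> * t0"] step by blast
 show ?thesis
 proof (intro exI[of _ c] allI impI, elim conjE)
  fix t :: real assume t: "0 < t" "t \<le> t0"
  have "\<exists>k. s k < t"
  proof -
   have "(\<lambda>k. t0 / 2 ^ k) \<longlonglongrightarrow> 0" using LIMSEQ_divide_realpow_zero[of 2 t0] by simp
   then have "eventually (\<lambda>k. t0 / 2 ^ k < t) sequentially"
    using t by (intro order_tendstoD(2)[of _ 0]) auto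
   then show ?thesis by (auto simp: s_def eventually_sequentially)
  qed
  \<comment> \<open>The first dyadic radius below t; its predecessor s k then lies between t and 2
    t.\<close>
  define j where "j = (LEAST k. s k < t)"
  have j: "s j < t" unfolding j_def by (rule LeastI_ex) fact
  have "j \<noteq> 0"
  proof
   assume "j = 0" then show False using j t by (simp add: s_def)
  qed
  then obtain k where k: "j = Suc k" using not0_implies_Suc by auto
  have "\<not> s k < t" using not_less_Least[of k "\<lambda>k. s k < t"] k by (simp add: j_def)
  then have k': "t \<le> s k" "s k \<le> 2 * t" using j k by (auto simp: s_def field_simps)
  have tT: "t \<in> T" using T_down[OF t0] t by auto
  have dbl: "emeasure m (ball x (s k)) \<le> ennreal D * emeasure m (ball x t)"
   by (rule order_trans[OF emeasure_mono[OF subset_ball[OF k'(2)]] doubling[OF x tT]]) simp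
  have "(\<integral>\<^sup>+z\<in>ball x t. ennreal \<bar>f z - c\<bar> \<partial>m)
   \<le> (\<integral>\<^sup>+z. ennreal \<bar>f (y k) - f z\<bar> * indicator (ball x (s k)) z
    + ennreal \<bar>f (y k) - c\<bar> * indicator (ball x t) z \<partial>m)"
  proof (intro nn_integral_mono)
   fix z
   have sub: "ball x t \<subseteq> ball x (s k)" using k' by (intro subset_ball)
   have "ennreal \<bar>f z - c\<bar> \<le> ennreal \<bar>f (y k) - f z\<bar> + ennreal \<bar>f (y k) - c\<bar>"
    by (simp flip: ennreal_plus add: ennreal_leI)
   then show "ennreal \<bar>f z - c\<bar> * indicator (ball x t) z
    \<le> ennreal \<bar>f (y k) - f z\<bar> * indicator (ball x (s k)) z + ennreal \<bar>f (y k) - c\<bar> * indicator (ball x t) z"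
    using sub by (cases "z \<in> ball x t") (auto simp: subset_eq)
  qed
  also have "... \<le> ennreal (\<tau> * s k) * emeasure m (ball x (s k)) + ennreal \<bar>f (y k) - c\<bar> * emeasure m (ball x t)"
   using y(2)[of k] by (simp add: nn_integral_add nn_integral_cmult add_mono)
  also have "... \<le> ennreal (\<tau> * (2 * t)) * (ennreal D * emeasure m (ball x t)) + ennreal (8 * D * \<tau> * t) * emeasure m (ball x t)"
  proof (rule add_mono[OF mult_mono[OF ennreal_leI] mult_right_mono[OF ennreal_leI]])
   show "\<tau> * s k \<le> \<tau> * (2 * t)" using \<open>0 \<le> \<tau>\<close> k' by (intro mult_left_mono)
   have "\<bar>f (y k) - c\<bar> \<le> 4 * D * \<tau> * s k" using c[of k] by (simp add: s_def mult.assoc)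
   also have "... \<le> 4 * D * \<tau> * (2 * t)"
    using \<open>0 \<le> \<tau>\<close> D_ge_1 k' by (intro mult_left_mono) auto
   finally show "\<bar>f (y k) - c\<bar> \<le> 8 * D * \<tau> * t" by simp
  qed (use dbl in auto)
  also have "... = ennreal (10 * D * \<tau> * t) * emeasure m (ball x t)"
   using \<open>0 \<le> \<tau>\<close> D_ge_1 t
   by (subst ennreal_mult_collect, simp, simp, subst ennreal_add_collect) (auto simp: algebra_simps)
  finally show "(\<integral>\<^sup>+z\<in>ball x t. ennreal \<bar>f z - c\<bar> \<partial>m) \<le> ennreal (10 * D * \<tau> * t) * emeasure m (ball x t)" .
 qed
qed

text \<open>Both numbers are close to f in the mean on the small ball, which has positive measure.
  Values attached to two scales or to two centres are compared in this way.\<close>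

lemma ball_average_dist_le:
 fixes f :: "'a \<Rightarrow> real"
 assumes [measurable]: "f \<in> borel_measurable m" and x: "y \<in> Om" and r: "0 < r" and "0 \<le> A"
  and sub: "ball y r \<subseteq> ball x t"
  and 1: "(\<integral>\<^sup>+z\<in>ball x t. ennreal \<bar>f z - a\<bar> \<partial>m) \<le> ennreal A * emeasure m (ball y r)"
  and 2: "(\<integral>\<^sup>+z\<in>ball y r. ennreal \<bar>f z - b\<bar> \<partial>m) \<le> ennreal B * emeasure m (ball y r)" and "0 \<le> B"
 shows "\<bar>a - b\<bar> \<le> A + B"
proof -
 have "ennreal \<bar>a - b\<bar> * emeasure m (ball y r) = (\<integral>\<^sup>+z\<in>ball y r. ennreal \<bar>a - b\<bar> \<partial>m)"
  by (simp add: nn_integral_cmult)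
 also have "... \<le> (\<integral>\<^sup>+z. ennreal \<bar>f z - a\<bar> * indicator (ball x t) z + ennreal \<bar>f z - b\<bar> * indicator (ball y r) z \<partial>m)"
 proof (intro nn_integral_mono)
  fix z
  have "ennreal \<bar>a - b\<bar> \<le> ennreal \<bar>f z - a\<bar> + ennreal \<bar>f z - b\<bar>"
   by (simp flip: ennreal_plus add: ennreal_leI)
  then show "ennreal \<bar>a - b\<bar> * indicator (ball y r) z
   \<le> ennreal \<bar>f z - a\<bar> * indicator (ball x t) z + ennreal \<bar>f z - b\<bar> * indicator (ball y r) z"
   using sub by (cases "z \<in> ball y r") (auto simp: subset_eq)
 qed
 also have "... \<le> ennreal A * emeasure m (ball y r) + ennreal B * emeasure m (ball y r)"
  using 1 2 by (simp add: nn_integral_add add_mono)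
 also have "... = ennreal (A + B) * emeasure m (ball y r)"
  using \<open>0 \<le> A\<close> \<open>0 \<le> B\<close> by (simp add: distrib_right)
 finally have "ennreal \<bar>a - b\<bar> \<le> ennreal (A + B)"
  by (rule ennreal_mult_le_cancel_right) (use ball_pos[OF x r] ball_finite in auto)
 then show ?thesis using \<open>0 \<le> A\<close> \<open>0 \<le> B\<close> by (subst (asm) ennreal_le_iff) auto
qed

text \<open>g x is the limit value of \<open>osc_limit\<close> at x. It does not depend on the
  starting radius, since two limit values are compared on arbitrarily small balls. For two points at
  distance d the balls B(y, d) and B(x, 2 d) are nested, which is why 2 d has to be an admissible
  radius; the constant is 20 D^3 + 10 D <= 30 D^3. That f = g almost everywhere on F replaces the
  Lebesgue differentiation theorem.\<close>

proposition lipschitz_approximation: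
 fixes f :: "'a \<Rightarrow> real"
 assumes f [measurable]: "f \<in> borel_measurable m" and F [measurable]: "F \<in> sets m" and sub: "F \<subseteq> Om" and "0 \<le> \<tau>"
  and osc: "\<And>x t. x \<in> F \<Longrightarrow> t \<in> T \<Longrightarrow> dosc m f x t \<le> ennreal (\<tau> * t) * (emeasure m (ball x t))\<^sup>2"
 obtains g where
  "\<And>x t. x \<in> F \<Longrightarrow> t \<in> T \<Longrightarrow>
   (\<integral>\<^sup>+y\<in>ball x t. ennreal \<bar>f y - g x\<bar> \<partial>m) \<le> ennreal (10 * D * \<tau> * t) * emeasure m (ball x t)"
  "\<And>x y. x \<in> F \<Longrightarrow> y \<in> F \<Longrightarrow> 2 * dist x y \<in> T \<Longrightarrow> \<bar>g x - g y\<bar> \<le> 30 * D ^ 3 * \<tau> * dist x y"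
  "AE x in m. x \<in> F \<longrightarrow> f x = g x"
proof -
 obtain t0 where t0: "t0 \<in> T" using T_ne by auto
 have t0p: "0 < t0" using T_pos t0 by auto
 let ?ok = "\<lambda>x t c. (\<integral>\<^sup>+y\<in>ball x t. ennreal \<bar>f y - c\<bar> \<partial>m) \<le> ennreal (10 * D * \<tau> * t) * emeasure m (ball x t)"
 define K where "K = 30 * D ^ 3 * \<tau>"
 have K: "0 \<le> K" using D_ge_1 \<open>0 \<le> \<tau>\<close> by (simp add: K_def)
 have ex: "\<exists>c. \<forall>t. 0 < t \<and> t \<le> t1 \<longrightarrow> ?ok x t c" if "x \<in> F" "t1 \<in> T" for x t1
  by (rule osc_limit) (use that sub osc \<open>0 \<le> \<tau>\<close> in auto)
 define c where "c x t1 = (SOME c. \<forall>t. 0 < t \<and> t \<le> t1 \<longrightarrow> ?ok x t c)" for x t1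
 have c: "?ok x t (c x t1)" if "x \<in> F" "t1 \<in> T" "0 < t" "t \<le> t1" for x t1 t
  using someI_ex[OF ex[OF that(1,2)]] that(3,4) unfolding c_def by blast
 have uniq: "c x t1 = c x t2" if x: "x \<in> F" and t: "t1 \<in> T" "t2 \<in> T" for x t1 t2
 proof (rule ccontr)
  assume ne: "c x t1 \<noteq> c x t2"
  define d where "d = \<bar>c x t1 - c x t2\<bar>"
  have d: "0 < d" using ne by (simp add: d_def)
  define C where "C = 10 * D * \<tau>"
  have C: "0 \<le> C" using D_ge_1 \<open>0 \<le> \<tau>\<close> by (simp add: C_def)
  define t where "t = min (min t1 t2) (d / (4 * (C + 1)))"
  have tp: "0 < t" "t \<le> t1" "t \<le> t2" using t T_pos d C by (auto simp: t_def)
  have "d \<le> C * t + C * t"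
   unfolding d_def
  proof (rule ball_average_dist_le[of f x t _ x t])
   show "(\<integral>\<^sup>+y\<in>ball x t. ennreal \<bar>f y - c x t1\<bar> \<partial>m) \<le> ennreal (C * t) * emeasure m (ball x t)"
    "(\<integral>\<^sup>+y\<in>ball x t. ennreal \<bar>f y - c x t2\<bar> \<partial>m) \<le> ennreal (C * t) * emeasure m (ball x t)"
    using c x t tp by (auto simp: C_def)
  qed (use x sub tp C in \<open>auto simp: C_def\<close>)
  also have "... \<le> 2 * (C + 1) * t" using tp by (simp add: algebra_simps)
  also have "... \<le> 2 * (C + 1) * (d / (4 * (C + 1)))"
   using C by (intro mult_left_mono) (auto simp: t_def)
  also have "... = d / 2" using C by (simp add: divide_simps)
  finally show False using d by simp
 qed
 define g where "g x = c x t0" for x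
 have g1: "?ok x t (g x)" if "x \<in> F" "t \<in> T" for x t
  using c[OF that T_pos[OF that(2)] order_refl] uniq[OF that(1) t0 that(2)] by (simp add: g_def)
 have g2: "\<bar>g x - g y\<bar> \<le> K * dist x y" if xy: "x \<in> F" "y \<in> F" "2 * dist x y \<in> T" for x y
 proof -
  define d where "d = dist x y"
  have d: "0 < d" "2 * d \<in> T" "d \<in> T"
   using T_pos[OF xy(3)] xy(3) T_down[OF xy(3), of d] by (auto simp: d_def)
  have "\<bar>g x - g y\<bar> \<le> 20 * D ^ 3 * \<tau> * d + 10 * D * \<tau> * d"
  proof (rule ball_average_dist_le[of f y d _ x "2 * d"])
   show "ball y d \<subseteq> ball x (2 * d)"
    by (intro ball_subset_ball) (simp add: d_def)
   have "emeasure m (ball x (2 * d)) \<le> emeasure m (ball y (4 * d))"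
    using d by (intro emeasure_mono ball_subset_ball) (auto simp: d_def dist_commute)
   also have "... \<le> ennreal (D ^ 2) * emeasure m (ball y d)"
    using doubling2[of y d] xy sub d by auto
   finally have "(\<integral>\<^sup>+z\<in>ball x (2 * d). ennreal \<bar>f z - g x\<bar> \<partial>m)
    \<le> ennreal (10 * D * \<tau> * (2 * d)) * (ennreal (D ^ 2) * emeasure m (ball y d))"
    using g1[OF xy(1) d(2)] by (meson mult_left_mono order_trans zero_le)
   also have "... = ennreal (20 * D ^ 3 * \<tau> * d) * emeasure m (ball y d)"
    using D_ge_1 \<open>0 \<le> \<tau>\<close> d
    by (subst ennreal_mult_collect) (auto simp: power2_eq_square power3_eq_cube mult_ac)
   finally show "(\<integral>\<^sup>+z\<in>ball x (2 * d). ennreal \<bar>f z - g x\<bar> \<partial>m) \<le> ..." .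
   show "?ok y d (g y)" using g1 xy d by auto
  qed (use xy sub d D_ge_1 \<open>0 \<le> \<tau>\<close> in auto)
  also have "10 * D * \<tau> * d \<le> 10 * D ^ 3 * \<tau> * d"
  proof -
   have "D * 1 \<le> D * D ^ 2" using D_ge_1 by (intro mult_left_mono) auto
   then have "D \<le> D ^ 3" by (simp add: power2_eq_square power3_eq_cube)
   then show ?thesis using \<open>0 \<le> \<tau>\<close> d by (intro mult_right_mono mult_left_mono) auto
  qed
  finally show ?thesis by (simp add: K_def d_def mult_ac)
 qed
 have cont: "continuous_on F g"
 proof (rule continuous_onI)
  fix x e assume x: "x \<in> F" and e: "0 < (e::real)"
  show "\<exists>d>0. \<forall>x'\<in>F. dist x' x < d \<longrightarrow> dist (g x') (g x) \<le> e"
  proof (intro exI[of _ "min (t0 / 2) (e / (K + 1))"] conjI ballI impI)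
   show "0 < min (t0 / 2) (e / (K + 1))" using t0p e K by auto
   fix x' assume x': "x' \<in> F" "dist x' x < min (t0 / 2) (e / (K + 1))"
   show "dist (g x') (g x) \<le> e"
   proof (cases "x' = x")
    case False
    then have "2 * dist x' x \<in> T" using x' by (intro T_down[OF t0]) auto
    then have "\<bar>g x' - g x\<bar> \<le> K * dist x' x" using g2 x x' by auto
    also have "... \<le> (K + 1) * (e / (K + 1))" using x' K by (intro mult_mono) auto
    also have "... = e" using K by simp
    finally show ?thesis by (simp add: dist_real_def)
   qed (use e in simp)
  qed
 qed
 define w where "w x = ennreal \<bar>f x - g x\<bar> * indicator F x" for x
 have wm [measurable]: "w \<in> borel_measurable m"
 proof -
  have "(\<lambda>x. x) \<in> measurable (restrict_space m F) (restrict_space borel F)"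
   by (intro measurable_restrict_space2 measurable_restrict_space1) (auto simp: space_restrict_space)
  from measurable_compose[OF this borel_measurable_continuous_on_restrict[OF cont]]
  have [measurable]: "g \<in> borel_measurable (restrict_space m F)" by simp
  have [measurable]: "f \<in> borel_measurable (restrict_space m F)"
   by (intro measurable_restrict_space1) simp
  have "(\<lambda>x. ennreal \<bar>f x - g x\<bar>) \<in> borel_measurable (restrict_space m F)" by measurable
  then show ?thesis unfolding w_def[abs_def]
   by (subst (asm) borel_measurable_restrict_space_iff_ennreal) auto
 qed
 define C where "C = 4 * K * D ^ 2"
 have C: "0 \<le> C" using K by (simp add: C_def)
 obtain x0 :: 'a where True by simp
 have null: "(\<integral>\<^sup>+x\<in>ball x0 n. w x \<partial>m) = 0" for n :: nat
 proof -
  \<comment> \<open>At a centre a in F and scale 3 t, f is close to g a in the mean and g varies on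
    F by a multiple of t. Vitali adds these estimates over F, so the integral of |f - g| is bounded
    by a multiple of t; afterwards t tends to 0.\<close>
  have small: "(\<integral>\<^sup>+x\<in>ball x0 n. w x \<partial>m) \<le> ennreal (C * 3 * t) * emeasure m (ball x0 (real n + 1))"
   if t: "0 < t" "6 * t \<le> t0" "t \<le> 1" for t
  proof -
   have tT: "t \<in> T" "2 * t \<in> T" "3 * t \<in> T" "6 * t \<in> T" using t by (auto intro!: T_down[OF t0])
   define P where "P = {(x, t') | x t'. x \<in> F \<inter> ball x0 n \<and> t' = t}"
   define \<alpha> where "\<alpha> = density m w"
   define \<nu> where "\<nu> = density m (\<lambda>_. ennreal (C * 3 * t))"
   have Um: "(\<Union>q\<in>P. ball (fst q) (snd q)) \<in> sets m" by (intro open_sets_m open_UN) auto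
   have "(\<integral>\<^sup>+x\<in>ball x0 n. w x \<partial>m) \<le> (\<integral>\<^sup>+x\<in>(\<Union>q\<in>P. ball (fst q) (snd q)). w x \<partial>m)"
    using t by (intro nn_integral_mono) (auto simp: w_def P_def indicator_def)
   also have "... = emeasure \<alpha> (\<Union>q\<in>P. ball (fst q) (snd q))"
    unfolding \<alpha>_def using Um by (subst emeasure_density) auto
   also have "... \<le> emeasure \<nu> (\<Union>q\<in>P. ball (fst q) (snd q))"
   proof (rule vitali_emeasure_le)
    fix a r assume "(a, r) \<in> P"
    then have a: "a \<in> F" "a \<in> Om" "r = t" using sub by (auto simp: P_def)
    have "emeasure \<alpha> (ball a (3 * t)) = (\<integral>\<^sup>+x\<in>ball a (3 * t). w x \<partial>m)"
     unfolding \<alpha>_def by (subst emeasure_density) auto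
    also have "... \<le> (\<integral>\<^sup>+x. ennreal \<bar>f x - g a\<bar> * indicator (ball a (3 * t)) x + ennreal (K * (3 * t)) * indicator (ball a (3 * t)) x \<partial>m)"
    proof (intro nn_integral_mono)
     fix x
     show "w x * indicator (ball a (3 * t)) x \<le> ennreal \<bar>f x - g a\<bar> * indicator (ball a (3 * t)) x + ennreal (K * (3 * t)) * indicator (ball a (3 * t)) x"
     proof (cases "x \<in> F \<and> x \<in> ball a (3 * t)")
      case True
      have "\<bar>g a - g x\<bar> \<le> K * (3 * t)"
      proof (cases "x = a")
       case False
       have "2 * dist a x \<in> T" using True False by (intro T_down[OF tT(4)]) auto
       then have "\<bar>g a - g x\<bar> \<le> K * dist a x" using g2 a True by auto
       also have "... \<le> K * (3 * t)" using True K by (intro mult_left_mono) auto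
       finally show ?thesis .
      qed (use K t in auto)
      then have "\<bar>f x - g x\<bar> \<le> \<bar>f x - g a\<bar> + K * (3 * t)" by linarith
      then have "ennreal \<bar>f x - g x\<bar> \<le> ennreal \<bar>f x - g a\<bar> + ennreal (K * (3 * t))"
       using K t by (simp flip: ennreal_plus add: ennreal_leI)
      then show ?thesis using True by (simp add: w_def)
     qed (auto simp: w_def)
    qed
    also have "... \<le> ennreal (10 * D * \<tau> * (3 * t)) * emeasure m (ball a (3 * t)) + ennreal (K * (3 * t)) * emeasure m (ball a (3 * t))"
     using g1[OF a(1) tT(3)] by (simp add: nn_integral_add nn_integral_cmult add_mono)
    also have "... \<le> ennreal (K * (3 * t)) * emeasure m (ball a (3 * t)) + ennreal (K * (3 * t)) * emeasure m (ball a (3 * t))"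
    proof (intro add_mono mult_right_mono ennreal_leI)
     have "D * 1 \<le> D * D ^ 2" using D_ge_1 by (intro mult_left_mono) auto
     then have "10 * D \<le> 30 * D ^ 3" using D_ge_1 by (simp add: power2_eq_square power3_eq_cube)
     then show "10 * D * \<tau> \<le> K" unfolding K_def using \<open>0 \<le> \<tau>\<close> by (intro mult_right_mono)
    qed (use t in auto)
    also have "... = ennreal (2 * K * (3 * t)) * emeasure m (ball a (3 * t))"
     using K t by (subst ennreal_add_collect) auto
    also have "... \<le> ennreal (2 * K * (3 * t)) * (ennreal (D ^ 2) * emeasure m (ball a t))"
    proof (intro mult_left_mono)
     have "emeasure m (ball a (3 * t)) \<le> emeasure m (ball a (4 * t))"
      using t by (intro emeasure_mono) auto
     then show "emeasure m (ball a (3 * t)) \<le> ennreal (D ^ 2) * emeasure m (ball a t)"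
      using doubling2[OF a(2) tT(2)] by simp
    qed auto
    also have "... = ennreal (2 * K * (3 * t) * D ^ 2) * emeasure m (ball a t)"
     using K t D_ge_1 by (simp add: ennreal_mult mult.assoc)
    also have "... \<le> ennreal (C * 3 * t) * emeasure m (ball a t)"
     using K t by (intro mult_right_mono ennreal_leI) (auto simp: C_def)
    also have "... = emeasure \<nu> (ball a t)"
     unfolding \<nu>_def by (subst emeasure_density) (auto simp: nn_integral_cmult)
    finally show "0 < r \<and> emeasure \<alpha> (ball a (3 * r)) \<le> emeasure \<nu> (ball a r)"
     using a t by simp
   qed (use sets_m in \<open>auto simp: \<alpha>_def \<nu>_def\<close>)
   also have "... = ennreal (C * 3 * t) * emeasure m (\<Union>q\<in>P. ball (fst q) (snd q))"
    unfolding \<nu>_def using Um by (subst emeasure_density) (auto simp: nn_integral_cmult)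
   also have "... \<le> ennreal (C * 3 * t) * emeasure m (ball x0 (real n + 1))"
   proof (intro mult_left_mono emeasure_mono)
    show "(\<Union>q\<in>P. ball (fst q) (snd q)) \<subseteq> ball x0 (real n + 1)"
     using t by (intro UN_least ball_subset_ball) (auto simp: P_def)
   qed auto
   finally show ?thesis .
  qed
  define V where "V = enn2real (emeasure m (ball x0 (real n + 1)))"
  have V: "emeasure m (ball x0 (real n + 1)) = ennreal V" "0 \<le> V"
   using ball_finite[of x0 "real n + 1"] by (auto simp: V_def less_top)
  have lim: "((\<lambda>t. ennreal (C * 3 * t * V)) \<longlongrightarrow> ennreal (C * 3 * 0 * V)) (at_right 0)"
   by (intro tendsto_intros)
  have ev: "eventually (\<lambda>t. (\<integral>\<^sup>+x\<in>ball x0 n. w x \<partial>m) \<le> ennreal (C * 3 * t * V)) (at_right 0)"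
   unfolding eventually_at_right_field
  proof (intro exI[of _ "min (t0 / 6) 1"] conjI allI impI)
   show "0 < min (t0 / 6) 1" using t0p by simp
   fix t :: real assume "0 < t" "t < min (t0 / 6) 1"
   then show "(\<integral>\<^sup>+x\<in>ball x0 n. w x \<partial>m) \<le> ennreal (C * 3 * t * V)"
    using small[of t] V C by (simp add: ennreal_mult[symmetric])
  qed
  have "(\<integral>\<^sup>+x\<in>ball x0 n. w x \<partial>m) \<le> ennreal (C * 3 * 0 * V)"
   by (rule tendsto_lowerbound[OF lim ev]) simp
  then show ?thesis by simp
 qed
 have "AE x in m. \<forall>n::nat. w x * indicator (ball x0 n) x = 0"
  unfolding AE_all_countable using null
  by (subst (asm) nn_integral_0_iff_AE) auto
 then have g3: "AE x in m. x \<in> F \<longrightarrow> f x = g x"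
 proof eventually_elim
  case (elim x)
  obtain n :: nat where "dist x0 x < n" using reals_Archimedean2 by blast
  with elim[rule_format, of n] show ?case by (auto simp: w_def indicator_def)
 qed
 show ?thesis using that[OF g1 _ g3] g2 unfolding K_def by blast
qed

text \<open>\<open>lipschitz_approximation\<close> is applied on {S <= q} for every rational q >= 0.
  Off the countable union of the null sets, a pair of points is compared at rational levels slightly
  above max (S x) (S y).\<close>

lemma lipschitz_off_null:
 fixes f :: "'a \<Rightarrow> real"
 assumes f [measurable]: "f \<in> borel_measurable m" and S [measurable]: "S \<in> borel_measurable m"
  and osc: "\<And>x t. x \<in> Om \<Longrightarrow> t \<in> T \<Longrightarrow> dosc m f x t \<le> ennreal t * S x * (emeasure m (ball x t))\<^sup>2"
 obtains N where "N \<in> null_sets m"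
  "\<And>x y. x \<in> Om - N \<Longrightarrow> y \<in> Om - N \<Longrightarrow> 2 * dist x y \<in> T \<Longrightarrow>
   ennreal \<bar>f x - f y\<bar> \<le> ennreal (30 * D ^ 3 * dist x y) * (S x + S y)"
proof -
 define F where "F q = {x \<in> Om. S x \<le> ennreal q}" for q :: real
 have Fm [measurable]: "F q \<in> sets m" for q
 proof -
  have "F q = Om \<inter> {x \<in> space m. S x \<le> ennreal q}" by (auto simp: F_def)
  also have "... \<in> sets m" by measurable
  finally show ?thesis .
 qed
 have "\<exists>N. N \<in> null_sets m \<and> (\<forall>x\<in>F q - N. \<forall>y\<in>F q - N. 2 * dist x y \<in> T \<longrightarrow> \<bar>f x - f y\<bar> \<le> 30 * D ^ 3 * q * dist x y)"
  if q: "0 \<le> q" for q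
 proof -
  obtain g where g: "\<And>x y. x \<in> F q \<Longrightarrow> y \<in> F q \<Longrightarrow> 2 * dist x y \<in> T \<Longrightarrow> \<bar>g x - g y\<bar> \<le> 30 * D ^ 3 * q * dist x y"
   "AE x in m. x \<in> F q \<longrightarrow> f x = g x"
  proof (rule lipschitz_approximation[OF f Fm, of q q])
   show "F q \<subseteq> Om" by (auto simp: F_def)
   fix x t assume xt: "x \<in> F q" "t \<in> T"
   then have "dosc m f x t \<le> ennreal t * S x * (emeasure m (ball x t))\<^sup>2"
    by (intro osc) (auto simp: F_def)
   also have "... \<le> ennreal t * ennreal q * (emeasure m (ball x t))\<^sup>2"
    using xt by (intro mult_right_mono mult_left_mono) (auto simp: F_def)
   finally show "dosc m f x t \<le> ennreal (q * t) * (emeasure m (ball x t))\<^sup>2"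
    using q T_pos[OF xt(2)] by (simp add: ennreal_mult mult.commute)
  qed (use q in auto)
  from g(2) obtain N where N: "N \<in> null_sets m" "{x \<in> space m. \<not> (x \<in> F q \<longrightarrow> f x = g x)} \<subseteq> N"
   by (auto elim!: AE_E simp: null_sets_def)
  show ?thesis
  proof (intro exI[of _ N] conjI ballI impI)
   fix x y assume "x \<in> F q - N" "y \<in> F q - N" "2 * dist x y \<in> T"
   moreover from this have "f x = g x" "f y = g y" using N by auto
   ultimately show "\<bar>f x - f y\<bar> \<le> 30 * D ^ 3 * q * dist x y" using g(1) by auto
  qed fact
 qed
 then obtain N where N: "\<And>q. 0 \<le> q \<Longrightarrow> N q \<in> null_sets m"
  "\<And>q x y. 0 \<le> q \<Longrightarrow> x \<in> F q - N q \<Longrightarrow> y \<in> F q - N q \<Longrightarrow> 2 * dist x y \<in> T \<Longrightarrow> \<bar>f x - f y\<bar> \<le> 30 * D ^ 3 * q * dist x y"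
  by metis
 let ?N = "\<Union>q\<in>{q\<in>\<rat>. 0 \<le> q}. N q"
 have cnt: "countable {q\<in>\<rat>. (0::real) \<le> q}" by (rule countable_subset[OF _ countable_rat]) auto
 show ?thesis
 proof (rule that[of ?N])
  show "?N \<in> null_sets m" using N cnt by (intro null_sets_UN') auto
  fix x y assume xy: "x \<in> Om - ?N" "y \<in> Om - ?N" "2 * dist x y \<in> T"
  have d: "0 < dist x y" using T_pos[OF xy(3)] by simp
  define C where "C = 30 * D ^ 3 * dist x y"
  have C: "0 < C" using D_ge_1 d by (simp add: C_def)
  have "ennreal \<bar>f x - f y\<bar> \<le> ennreal C * max (S x) (S y)"
  proof (cases "max (S x) (S y)")
   case top
   then show ?thesis using C by (simp add: ennreal_mult_top)
  next
   case (real s)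
   have "\<bar>f x - f y\<bar> \<le> C * s"
   proof (rule ccontr)
    assume "\<not> ?thesis"
    then have "s < \<bar>f x - f y\<bar> / C" using C by (simp add: field_simps)
    then obtain q where q: "q \<in> \<rat>" "s < q" "q < \<bar>f x - f y\<bar> / C"
     using Rats_dense_in_real by blast
    have "S x \<le> ennreal s" "S y \<le> ennreal s" using real by (metis max.cobounded1, metis max.cobounded2)
    then have "x \<in> F q - N q" "y \<in> F q - N q"
     using xy q real by (auto simp: F_def intro: order_trans[OF _ ennreal_leI])
    then have "\<bar>f x - f y\<bar> \<le> 30 * D ^ 3 * q * dist x y" using N(2)[of q] xy q real by auto
    then have "\<bar>f x - f y\<bar> \<le> C * q" by (simp add: C_def ac_simps)
    then show False using q C by (simp add: field_simps)
   qed
   then show ?thesis using real C by (simp add: ennreal_mult[symmetric] ennreal_leI)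
  qed
  also have "... \<le> ennreal C * (S x + S y)" by (intro mult_left_mono) auto
  finally show "ennreal \<bar>f x - f y\<bar> \<le> ennreal (30 * D ^ 3 * dist x y) * (S x + S y)" by (simp add: C_def)
 qed
qed

end

section \<open>Curve length and length measure\<close>

lemma SUP_add_le_ennreal:
 fixes f :: "'i \<Rightarrow> ennreal"
 assumes "I \<noteq> {}" "\<And>i. i \<in> I \<Longrightarrow> f i + c \<le> X"
 shows "(SUP i\<in>I. f i) + c \<le> X"
 using assms by (simp add: ennreal_SUP_add_left[symmetric] SUP_le_iff)

lemma chain_sum_le_curve_length:
 assumes "t 0 = a" "t n = b" "\<And>i. i < n \<Longrightarrow> t i \<le> t (Suc i)"
 shows "(\<Sum>i<n. ennreal (dist (ga (t i)) (ga (t (Suc i))))) \<le> curve_length ga a b"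
 unfolding curve_length_def by (rule SUP_upper2[of "(n, t)"]) (use assms in auto)

lemma curve_length_leI:
 assumes "\<And>n t. t 0 = a \<Longrightarrow> t n = b \<Longrightarrow> (\<And>i. i < n \<Longrightarrow> t i \<le> t (Suc i)) \<Longrightarrow>
  (\<Sum>i<n. ennreal (dist (ga (t i)) (ga (t (Suc i))))) \<le> X"
 shows "curve_length ga a b \<le> X"
 unfolding curve_length_def by (rule SUP_least) (use assms in auto)

lemma chain_mono:
 fixes t :: "nat \<Rightarrow> real"
 assumes "\<And>i. i < n \<Longrightarrow> t i \<le> t (Suc i)" "i \<le> j" "j \<le> n"
 shows "t i \<le> t j"
 using assms(2,3)
proof (induction j rule: dec_induct)
 case (step j)
 then show ?case using assms(1)[of j] by simp
qed simp

lemma curve_length_append: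
 assumes "a \<le> x" "x \<le> y"
 shows "curve_length ga a x + ennreal (dist (ga x) (ga y)) \<le> curve_length ga a y"
 unfolding curve_length_def[of ga a x]
proof (rule SUP_add_le_ennreal)
 show "{(n::nat, t). t 0 = a \<and> t n = x \<and> (\<forall>i<n. t i \<le> t (Suc i))} \<noteq> {}"
 proof -
  have "(Suc 0, \<lambda>i. if i = 0 then a else x) \<in> {(n, t). t 0 = a \<and> t n = x \<and> (\<forall>i<n. t i \<le> t (Suc i))}"
   using assms by auto
  then show ?thesis by blast
 qed
 fix nt assume nt: "nt \<in> {(n::nat, t). t 0 = a \<and> t n = x \<and> (\<forall>i<n. t i \<le> t (Suc i))}"
 obtain n t where nt': "nt = (n, t)" by (cases nt)
 then have t: "t 0 = a" "t n = x" "\<forall>i<n. t i \<le> t (Suc i)" using nt by auto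
 define t' where "t' i = (if i \<le> n then t i else y)" for i
 have "(\<Sum>i<Suc n. ennreal (dist (ga (t' i)) (ga (t' (Suc i))))) \<le> curve_length ga a y"
  using t assms by (intro chain_sum_le_curve_length) (auto simp: t'_def less_Suc_eq)
 also have "(\<Sum>i<Suc n. ennreal (dist (ga (t' i)) (ga (t' (Suc i)))))
  = (\<Sum>i<n. ennreal (dist (ga (t i)) (ga (t (Suc i))))) + ennreal (dist (ga x) (ga y))"
  using t by (auto simp: t'_def intro!: sum.cong arg_cong2[where f="(+)"])
 finally show "(case nt of (n, t) \<Rightarrow> \<Sum>i<n. ennreal (dist (ga (t i)) (ga (t (Suc i)))))
  + ennreal (dist (ga x) (ga y)) \<le> curve_length ga a y" by (simp add: nt')
qed

lemma dist_le_curve_length: "a \<le> b \<Longrightarrow> ennreal (dist (ga a) (ga b)) \<le> curve_length ga a b"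
 using chain_sum_le_curve_length[of "\<lambda>i. if i = 0 then a else b" a 1 b ga] by simp

text \<open>A partition of [a, c] may miss b. The induction over partial sums therefore carries a
  bound that changes its form after b, and b is inserted in the one step that jumps over it.\<close>

lemma curve_length_add:
 assumes "a \<le> b" "b \<le> c"
 shows "curve_length ga a c = curve_length ga a b + curve_length ga b c"
proof (rule antisym)
 show "curve_length ga a c \<le> curve_length ga a b + curve_length ga b c"
 proof (rule curve_length_leI)
  fix n :: nat and t :: "nat \<Rightarrow> real"
  assume t: "t 0 = a" "t n = c" "\<And>i. i < n \<Longrightarrow> t i \<le> t (Suc i)"
  have "(\<Sum>i<k. ennreal (dist (ga (t i)) (ga (t (Suc i)))))
   \<le> (if t k \<le> b then curve_length ga a (t k) else curve_length ga a b + curve_length ga b (t k))"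
   if "k \<le> n" for k
   using that
  proof (induction k)
   case (Suc k)
   have le: "t k \<le> t (Suc k)" "a \<le> t k" "k \<le> n"
    using t(3)[of k] chain_mono[of n t 0 k] t Suc.prems by auto
   let ?s = "\<Sum>i<k. ennreal (dist (ga (t i)) (ga (t (Suc i))))"
   let ?d = "ennreal (dist (ga (t k)) (ga (t (Suc k))))"
   consider "t (Suc k) \<le> b" | "t k \<le> b" "b < t (Suc k)" | "b < t k" using le by linarith
   then show ?case
   proof cases
    case 1
    then have "?s + ?d \<le> curve_length ga a (t k) + ?d"
     using Suc.IH le by (intro add_right_mono) auto
    also have "... \<le> curve_length ga a (t (Suc k))" using le by (intro curve_length_append)
    finally show ?thesis using 1 by simp
   next
    case 2
    have "?s + ?d \<le> curve_length ga a (t k) + (ennreal (dist (ga (t k)) (ga b)) + ennreal (dist (ga b) (ga (t (Suc k)))))"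
     using Suc.IH le 2 by (intro add_mono) (auto simp flip: ennreal_plus intro: dist_triangle ennreal_leI)
    also have "... = (curve_length ga a (t k) + ennreal (dist (ga (t k)) (ga b))) + ennreal (dist (ga b) (ga (t (Suc k))))"
     by (simp add: add.assoc)
    also have "... \<le> curve_length ga a b + curve_length ga b (t (Suc k))"
     using le 2 by (intro add_mono curve_length_append dist_le_curve_length) auto
    finally show ?thesis using 2 by simp
   next
    case 3
    then have "?s + ?d \<le> (curve_length ga a b + curve_length ga b (t k)) + ?d"
     using Suc.IH le by (intro add_right_mono) auto
    also have "... \<le> curve_length ga a b + curve_length ga b (t (Suc k))"
     using le 3 by (simp add: add.assoc add_left_mono curve_length_append)
    finally show ?thesis using 3 le by simp
   qed
  qed (use assms t in auto)
  from this[of n] show "(\<Sum>i<n. ennreal (dist (ga (t i)) (ga (t (Suc i))))) \<le> curve_length ga a b + curve_length ga b c"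
   using t assms by (cases "c \<le> b") (auto intro: order_trans)
 qed
 have "curve_length ga b c + curve_length ga a b \<le> curve_length ga a c"
  unfolding curve_length_def[of ga b c]
 proof (rule SUP_add_le_ennreal)
  show "{(n::nat, t). t 0 = b \<and> t n = c \<and> (\<forall>i<n. t i \<le> t (Suc i))} \<noteq> {}"
  proof -
   have "(Suc 0, \<lambda>i. if i = 0 then b else c) \<in> {(n, t). t 0 = b \<and> t n = c \<and> (\<forall>i<n. t i \<le> t (Suc i))}"
    using assms by auto
   then show ?thesis by blast
  qed
  fix nt assume nt: "nt \<in> {(n::nat, t). t 0 = b \<and> t n = c \<and> (\<forall>i<n. t i \<le> t (Suc i))}"
  obtain n t where nt': "nt = (n, t)" by (cases nt)
  then have t: "t 0 = b" "t n = c" "\<And>i. i < n \<Longrightarrow> t i \<le> t (Suc i)" using nt by auto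
  have "(\<Sum>i<k. ennreal (dist (ga (t i)) (ga (t (Suc i))))) + curve_length ga a b \<le> curve_length ga a (t k)"
   if "k \<le> n" for k
   using that
  proof (induction k)
   case (Suc k)
   have le: "t k \<le> t (Suc k)" "b \<le> t k" "k \<le> n"
    using t(3)[of k] chain_mono[of n t 0 k] t Suc.prems by auto
   have "(\<Sum>i<Suc k. ennreal (dist (ga (t i)) (ga (t (Suc i))))) + curve_length ga a b
    = ((\<Sum>i<k. ennreal (dist (ga (t i)) (ga (t (Suc i))))) + curve_length ga a b) + ennreal (dist (ga (t k)) (ga (t (Suc k))))"
    by (simp add: ac_simps)
   also have "... \<le> curve_length ga a (t k) + ennreal (dist (ga (t k)) (ga (t (Suc k))))"
    using Suc.IH le by (intro add_right_mono) auto
   also have "... \<le> curve_length ga a (t (Suc k))"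
    using le assms by (intro curve_length_append) auto
   finally show ?case .
  qed (use t in simp)
  from this[of n] show "(case nt of (n, t) \<Rightarrow> \<Sum>i<n. ennreal (dist (ga (t i)) (ga (t (Suc i))))) + curve_length ga a b \<le> curve_length ga a c"
   using t by (simp add: nt')
 qed
 then show "curve_length ga a b + curve_length ga b c \<le> curve_length ga a c" by (simp add: add.commute)
qed

lemma curve_length_refl [simp]: "curve_length ga a a = 0"
proof -
 have "curve_length ga a a \<le> 0"
 proof (rule curve_length_leI)
  fix n and t :: "nat \<Rightarrow> real"
  assume t: "t 0 = a" "t n = a" "\<And>i. i < n \<Longrightarrow> t i \<le> t (Suc i)"
  have "t i = a" if "i \<le> n" for i
   using chain_mono[of n t 0 i] chain_mono[of n t i n] t that by auto
  then show "(\<Sum>i<n. ennreal (dist (ga (t i)) (ga (t (Suc i))))) \<le> 0" by simp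
 qed
 then show ?thesis by simp
qed

text \<open>Truncating a partition at \<open>t\<close> and letting \<open>t\<close> tend to the endpoint gives lower
 semicontinuity of the length, which for the additive length function is continuity.\<close>

lemma curve_length_lsc_left:
 assumes cont: "continuous_on {a..b} ga" and ab: "a < b"
  and le: "\<And>t. a \<le> t \<Longrightarrow> t < b \<Longrightarrow> curve_length ga a t \<le> X"
 shows "curve_length ga a b \<le> X"
proof (rule curve_length_leI)
 fix n :: nat and p :: "nat \<Rightarrow> real"
 assume p: "p 0 = a" "p n = b" "\<And>i. i < n \<Longrightarrow> p i \<le> p (Suc i)"
 have pab: "a \<le> p i" "p i \<le> b" if "i \<le> n" for i
  using chain_mono[of n p 0 i] chain_mono[of n p i n] p that by auto
 have lim: "((\<lambda>t. ga (min (p i) t)) \<longlongrightarrow> ga (p i)) (at b within {a..<b})" if "i \<le> n" for i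
 proof -
  have "((\<lambda>t. min (p i) t) \<longlongrightarrow> min (p i) b) (at b within {a..<b})"
   by (intro tendsto_min tendsto_const tendsto_ident_at)
  then have "((\<lambda>t. min (p i) t) \<longlongrightarrow> p i) (at b within {a..<b})" using pab[OF that] by simp
  moreover have "p i \<in> {a..b}" using pab[OF that] by simp
  moreover have "eventually (\<lambda>t. min (p i) t \<in> {a..b}) (at b within {a..<b})"
   unfolding eventually_at_filter
   by (intro always_eventually) (use pab[OF that] in \<open>auto simp: min_le_iff_disj le_max_iff_disj\<close>)
  ultimately show ?thesis
   by (rule continuous_on_tendsto_compose[OF cont])
 qed
 have "((\<lambda>t. \<Sum>i<n. ennreal (dist (ga (min (p i) t)) (ga (min (p (Suc i)) t))))
  \<longlongrightarrow> (\<Sum>i<n. ennreal (dist (ga (p i)) (ga (p (Suc i)))))) (at b within {a..<b})"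
  by (intro tendsto_sum tendsto_ennrealI tendsto_dist lim) auto
 moreover have "eventually (\<lambda>t. (\<Sum>i<n. ennreal (dist (ga (min (p i) t)) (ga (min (p (Suc i)) t)))) \<le> X) (at b within {a..<b})"
  unfolding eventually_at_filter
 proof (intro always_eventually allI impI)
  fix t assume "t \<noteq> b" "t \<in> {a..<b}"
  then have t: "a \<le> t" "t < b" by auto
  have "(\<Sum>i<n. ennreal (dist (ga (min (p i) t)) (ga (min (p (Suc i)) t)))) \<le> curve_length ga a t"
   using p t by (intro chain_sum_le_curve_length) (auto simp: min_le_iff_disj min.coboundedI1)
  also have "... \<le> X" using le t by simp
  finally show "(\<Sum>i<n. ennreal (dist (ga (min (p i) t)) (ga (min (p (Suc i)) t)))) \<le> X" .
 qed
 moreover have "at b within {a..<b} \<noteq> bot"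
  using ab by (simp add: trivial_limit_within )
 ultimately show "(\<Sum>i<n. ennreal (dist (ga (p i)) (ga (p (Suc i))))) \<le> X"
  by (rule tendsto_upperbound)
qed

lemma curve_length_lsc_right:
 assumes cont: "continuous_on {a..b} ga" and ab: "a < b"
  and le: "\<And>t. a < t \<Longrightarrow> t \<le> b \<Longrightarrow> curve_length ga t b \<le> X"
 shows "curve_length ga a b \<le> X"
proof (rule curve_length_leI)
 fix n :: nat and p :: "nat \<Rightarrow> real"
 assume p: "p 0 = a" "p n = b" "\<And>i. i < n \<Longrightarrow> p i \<le> p (Suc i)"
 have pab: "a \<le> p i" "p i \<le> b" if "i \<le> n" for i
  using chain_mono[of n p 0 i] chain_mono[of n p i n] p that by auto
 have lim: "((\<lambda>t. ga (max (p i) t)) \<longlongrightarrow> ga (p i)) (at a within {a<..b})" if "i \<le> n" for i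
 proof -
  have "((\<lambda>t. max (p i) t) \<longlongrightarrow> max (p i) a) (at a within {a<..b})"
   by (intro tendsto_max tendsto_const tendsto_ident_at)
  then have "((\<lambda>t. max (p i) t) \<longlongrightarrow> p i) (at a within {a<..b})" using pab[OF that] by simp
  moreover have "p i \<in> {a..b}" using pab[OF that] by simp
  moreover have "eventually (\<lambda>t. max (p i) t \<in> {a..b}) (at a within {a<..b})"
   unfolding eventually_at_filter
   by (intro always_eventually) (use pab[OF that] in \<open>auto simp: min_le_iff_disj le_max_iff_disj\<close>)
  ultimately show ?thesis
   by (rule continuous_on_tendsto_compose[OF cont])
 qed
 have "((\<lambda>t. \<Sum>i<n. ennreal (dist (ga (max (p i) t)) (ga (max (p (Suc i)) t))))
  \<longlongrightarrow> (\<Sum>i<n. ennreal (dist (ga (p i)) (ga (p (Suc i)))))) (at a within {a<..b})"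
  by (intro tendsto_sum tendsto_ennrealI tendsto_dist lim) auto
 moreover have "eventually (\<lambda>t. (\<Sum>i<n. ennreal (dist (ga (max (p i) t)) (ga (max (p (Suc i)) t)))) \<le> X) (at a within {a<..b})"
  unfolding eventually_at_filter
 proof (intro always_eventually allI impI)
  fix t assume "t \<noteq> a" "t \<in> {a<..b}"
  then have t: "a < t" "t \<le> b" by auto
  have "(\<Sum>i<n. ennreal (dist (ga (max (p i) t)) (ga (max (p (Suc i)) t)))) \<le> curve_length ga t b"
  proof (rule chain_sum_le_curve_length)
   show "max (p 0) t = t" "max (p n) t = b" using p t by auto
  qed (intro max.mono p order_refl)
  also have "... \<le> X" using le t by simp
  finally show "(\<Sum>i<n. ennreal (dist (ga (max (p i) t)) (ga (max (p (Suc i)) t)))) \<le> X" .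
 qed
 moreover have "at a within {a<..b} \<noteq> bot"
  using ab by (simp add: trivial_limit_within )
 ultimately show "(\<Sum>i<n. ennreal (dist (ga (p i)) (ga (p (Suc i))))) \<le> X"
  by (rule tendsto_upperbound)
qed

locale rectifiable_curve =
 fixes a b :: real and ga :: "real \<Rightarrow> 'a::metric_space"
 assumes a_le_b: "a \<le> b" and cont: "continuous_on {a..b} ga"
  and rect: "curve_length ga a b < \<infinity>"
begin

lemma curve_length_mono:
 assumes "a \<le> s" "s \<le> t" "t \<le> b"
 shows "curve_length ga s t < \<infinity>"
proof -
 have "curve_length ga s t \<le> curve_length ga a b"
  using curve_length_add[of a s b ga] curve_length_add[of s t b ga] assms
  by (simp add: add_increasing add_increasing2)
 then show ?thesis using rect by (rule le_less_trans)
qed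

definition len :: "real \<Rightarrow> real" where
 "len t = enn2real (curve_length ga a (max a (min t b)))"

lemma ennreal_len: "ennreal (len t) = curve_length ga a (max a (min t b))"
 using curve_length_mono[of a "max a (min t b)"] a_le_b by (simp add: len_def less_top)

lemma len_diff:
 assumes "a \<le> s" "s \<le> t" "t \<le> b"
 shows "len s \<le> len t" "curve_length ga s t = ennreal (len t - len s)"
proof -
 have fin: "curve_length ga s t < \<infinity>" using curve_length_mono assms by auto
 have "ennreal (len t) = ennreal (len s) + curve_length ga s t"
  using assms curve_length_add[of a s t ga] by (simp add: ennreal_len)
 then have "ennreal (len t) = ennreal (len s) + ennreal (enn2real (curve_length ga s t))"
  using fin by (simp add: less_top)
 also have "... = ennreal (len s + enn2real (curve_length ga s t))"
  by (simp add: len_def)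
 finally have "len t = len s + enn2real (curve_length ga s t)"
  by (subst (asm) ennreal_inj) (auto simp: len_def)
 then show "len s \<le> len t" "curve_length ga s t = ennreal (len t - len s)"
  using fin by (auto simp: less_top)
qed

lemma len_mono: "s \<le> t \<Longrightarrow> len s \<le> len t"
proof -
 assume "s \<le> t"
 then have "len (max a (min s b)) \<le> len (max a (min t b))"
  using a_le_b by (intro len_diff) auto
 then show ?thesis using a_le_b by (simp add: len_def)
qed

text \<open>A jump of height e at t would bound the lengths of all curves ending before t by len t -
  e, and lower semicontinuity would transfer this bound to t itself. Outside (a, b] the length
  function is constant to the left of t at small distance.\<close>

lemma len_left:
 assumes "0 < e" shows "\<exists>l<t. len t - len l < e"
proof (cases "a < t")
 case False
 then have "len t - len (t - 1) = 0" using a_le_b by (auto simp: len_def)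
 then show ?thesis using assms by (intro exI[of _ "t - 1"]) simp
next
 case True
 define t' where "t' = min t b"
 show ?thesis
 proof (cases "b < t \<or> a = b")
  case True
  have "len t - len b = 0" using True a_le_b \<open>a < t\<close> by (auto simp: len_def max_def min_def)
  then show ?thesis using assms True \<open>a < t\<close> by (intro exI[of _ b]) auto
 next
  case False
  then have t: "a < t" "t \<le> b" using \<open>a < t\<close> by auto
  show ?thesis
  proof (rule ccontr)
   assume contra: "\<not> (\<exists>l<t. len t - len l < e)"
   have "len a = 0" using a_le_b by (simp add: len_def)
   with contra t have le: "e \<le> len t" by force
   have "curve_length ga a t \<le> ennreal (len t - e)"
   proof (rule curve_length_lsc_left)
    show "continuous_on {a..t} ga" using cont t by (auto intro: continuous_on_subset)
    fix l assume l: "a \<le> l" "l < t"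
    then have "len l \<le> len t - e" using contra by force
    then show "curve_length ga a l \<le> ennreal (len t - e)"
     using len_diff(2)[of a l] l t \<open>len a = 0\<close> by (simp add: ennreal_leI)
   qed fact
   moreover have "curve_length ga a t = ennreal (len t)"
    using len_diff(2)[of a t] t \<open>len a = 0\<close> by simp
   ultimately show False using le assms by simp
  qed
 qed
qed

lemma len_right:
 assumes "0 < e" shows "\<exists>u>t. len u - len t < e"
proof (cases "a \<le> t \<and> t < b")
 case False
 show ?thesis
 proof (cases "t < a")
  case True
  have "len a - len t = 0" using True a_le_b by (auto simp: len_def)
  then show ?thesis using assms True by (intro exI[of _ a]) auto
 next
  case False
  with \<open>\<not> (a \<le> t \<and> t < b)\<close> have "b \<le> t" by simp
  then have "len (t + 1) - len t = 0" by (simp add: len_def)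
  then show ?thesis using assms by (intro exI[of _ "t + 1"]) simp
 qed
next
 case True
 then have t: "a \<le> t" "t < b" by auto
 show ?thesis
 proof (rule ccontr)
  assume contra: "\<not> (\<exists>u>t. len u - len t < e)"
  have le: "e \<le> len b - len t" using contra t by force
  have "curve_length ga t b \<le> ennreal (len b - len t - e)"
  proof (rule curve_length_lsc_right)
   show "continuous_on {t..b} ga" using cont t by (auto intro: continuous_on_subset)
   fix l assume l: "t < l" "l \<le> b"
   then have "len t + e \<le> len l" using contra by force
   then show "curve_length ga l b \<le> ennreal (len b - len t - e)"
    using len_diff(2)[of l b] l t by (simp add: ennreal_leI)
  qed fact
  moreover have "curve_length ga t b = ennreal (len b - len t)"
   using len_diff(2)[of t b] t by simp
  ultimately show False using le assms by simp
 qed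
qed

lemma len_cont: "isCont len t"
 unfolding continuous_at_eps_delta
proof (intro allI impI)
 fix e :: real assume e: "0 < e"
 obtain l where l: "l < t" "len t - len l < e" using len_left[OF e] by blast
 obtain u where u: "t < u" "len u - len t < e" using len_right[OF e] by blast
 show "\<exists>d>0. \<forall>x'. dist x' t < d \<longrightarrow> dist (len x') (len t) < e"
 proof (intro exI[of _ "min (t - l) (u - t)"] conjI allI impI)
  fix x assume "dist x t < min (t - l) (u - t)"
  then have "l \<le> x" "x \<le> u" by (auto simp: dist_real_def)
  then have "len l \<le> len x" "len x \<le> len u" by (auto intro: len_mono)
  moreover have "len l \<le> len t" "len t \<le> len u" using l u by (auto intro: len_mono)
  ultimately show "dist (len x) (len t) < e" using l u by (simp add: dist_real_def)
 qed (use l u in auto)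
qed

definition lm :: "real measure" where "lm = interval_measure len"

lemma length_measure_eq: "length_measure (a, b, ga) = lm"
 by (simp add: length_measure_def lm_def len_def[abs_def])

lemma sets_lm [simp, measurable_cong]: "sets lm = sets borel" by (simp add: lm_def)
lemma space_lm [simp]: "space lm = UNIV" by (simp add: lm_def)

lemma lm_Ioc: "s \<le> t \<Longrightarrow> emeasure lm {s<..t} = ennreal (len t - len s)"
 unfolding lm_def
 by (rule emeasure_interval_measure_Ioc[OF _ len_mono continuous_at_imp_continuous_at_within[OF len_cont]])

lemma lm_Icc: "s \<le> t \<Longrightarrow> emeasure lm {s..t} = ennreal (len t - len s)"
 unfolding lm_def
 by (rule emeasure_interval_measure_Icc[OF _ len_mono continuous_at_imp_continuous_on]) (simp_all add: len_cont)

lemma dist_le_len: "a \<le> s \<Longrightarrow> s \<le> t \<Longrightarrow> t \<le> b \<Longrightarrow> dist (ga s) (ga t) \<le> len t - len s"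
 using dist_le_curve_length[of s t ga] len_diff[of s t] by (simp add: ennreal_le_iff)

lemma line_integral_eq: "line_integral \<rho> (a, b, ga) = (\<integral>\<^sup>+t\<in>{a..b}. \<rho> (ga t) \<partial>lm)"
 using rect by (simp add: line_integral_def rectifiable_def length_measure_eq)

text \<open>The length measure of the subcurve is \<open>lm\<close> restricted to {s<..t}: both
  agree on half-open intervals, a generator of the Borel sets stable under intersection.\<close>

lemma line_integral_sub:
 assumes st: "a \<le> s" "s \<le> t" "t \<le> b"
 shows "line_integral \<rho> (s, t, ga) = (\<integral>\<^sup>+x\<in>{s..t}. \<rho> (ga x) \<partial>lm)"
proof -
 interpret st: rectifiable_curve s t ga
  using curve_length_mono[OF st] st cont by unfold_locales (auto intro: continuous_on_subset)
 have len_st: "st.len x = len (max s (min x t)) - len s" for x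
 proof -
  have "ennreal (st.len x) = curve_length ga s (max s (min x t))" by (simp add: st.ennreal_len)
  also have "... = ennreal (len (max s (min x t)) - len s)" using st by (intro len_diff) auto
  finally show ?thesis
   using len_mono[of s "max s (min x t)"] by (subst (asm) ennreal_inj) (auto simp: st.len_def)
 qed
 have eq: "st.lm = density lm (indicator {s<..t})"
 proof (rule measure_eqI_generator_eq[where E = "range (\<lambda>(c, d). {c<..d::real})" and \<Omega> = UNIV and A = "\<lambda>n. {- real n<..real n}"])
  show "Int_stable (range (\<lambda>(c, d). {c<..d::real}))"
  proof (rule Int_stableI)
   fix A B assume "A \<in> range (\<lambda>(c, d). {c<..d::real})" "B \<in> range (\<lambda>(c, d). {c<..d::real})"
   then obtain c d c' d' where "A = {c<..d}" "B = {c'<..d'}" by auto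
   then have "A \<inter> B = {max c c'<..min d d'}" by auto
   then show "A \<inter> B \<in> range (\<lambda>(c, d). {c<..d::real})" by auto
  qed
  show "sets st.lm = sigma_sets UNIV (range (\<lambda>(c, d). {c<..d::real}))"
   "sets (density lm (indicator {s<..t})) = sigma_sets UNIV (range (\<lambda>(c, d). {c<..d::real}))"
   by (simp_all add: borel_sigma_sets_Ioc)
  show "(\<Union>i::nat. {- real i<..real i}) = UNIV"
  proof (intro equalityI subsetI UNIV_I)
   fix x :: real
   obtain n :: nat where "\<bar>x\<bar> < real n" using reals_Archimedean2 by blast
   then show "x \<in> (\<Union>i::nat. {- real i<..real i})" by (intro UN_I[of n]) auto
  qed
  show "emeasure st.lm {- real i<..real i} \<noteq> \<infinity>" for i :: nat
   by (simp add: st.lm_Ioc)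
  fix X assume "X \<in> range (\<lambda>(c, d). {c<..d::real})"
  then obtain c d where X: "X = {c<..d}" by auto
  show "emeasure st.lm X = emeasure (density lm (indicator {s<..t})) X"
  proof (cases "c \<le> d")
   case False then show ?thesis by (simp add: X)
  next
   case True
   have "emeasure (density lm (indicator {s<..t})) X = emeasure lm ({s<..t} \<inter> X)"
    by (rule emeasure_restricted) (auto simp: X)
   also have "{s<..t} \<inter> X = {max s (min c t)<..max s (min d t)}" by (auto simp: X)
   also have "emeasure lm ... = ennreal (len (max s (min d t)) - len (max s (min c t)))"
    using True by (intro lm_Ioc) auto
   also have "... = emeasure st.lm X" using True by (simp add: X st.lm_Ioc len_st)
   finally show ?thesis by simp
  qed
 qed auto
 have "restrict_space st.lm {s..t} = restrict_space lm {s..t}"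
 proof (rule measure_eqI)
  show "sets (restrict_space st.lm {s..t}) = sets (restrict_space lm {s..t})"
   by (intro sets_restrict_space_cong) simp
  fix A assume "A \<in> sets (restrict_space st.lm {s..t})"
  then have A: "A \<in> sets borel" "A \<subseteq> {s..t}" by (auto simp: sets_restrict_space)
  \<comment> \<open>The restriction misses the left endpoint s, which is harmless because continuity
    of \<open>len\<close> excludes atoms.\<close>
  have s0: "{s} \<in> null_sets lm" using lm_Icc[of s s] by (intro null_setsI) auto
  have "emeasure st.lm A = emeasure lm ({s<..t} \<inter> A)"
   unfolding eq using A by (intro emeasure_restricted) auto
  also have "{s<..t} \<inter> A = A - {s}" using A by auto
  also have "emeasure lm (A - {s}) = emeasure lm A" using A s0 by (intro emeasure_Diff_null_set) auto
  finally show "emeasure (restrict_space st.lm {s..t}) A = emeasure (restrict_space lm {s..t}) A"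
   using A by (simp add: emeasure_restrict_space)
 qed
 then have "nn_integral (restrict_space st.lm {s..t}) (\<lambda>x. \<rho> (ga x)) = nn_integral (restrict_space lm {s..t}) (\<lambda>x. \<rho> (ga x))"
  by simp
 then show ?thesis
  by (simp add: st.line_integral_eq nn_integral_restrict_space)
qed

lemma comp_measurable:
 assumes "\<rho> \<in> borel_measurable borel"
 shows "(\<lambda>t. \<rho> (ga t) * indicator {a..b} t :: ennreal) \<in> borel_measurable lm"
proof -
 have "ga \<in> borel_measurable (restrict_space borel {a..b})"
  by (rule borel_measurable_continuous_on_restrict[OF cont])
 from measurable_compose[OF this assms]
 have "(\<lambda>t. \<rho> (ga t)) \<in> borel_measurable (restrict_space borel {a..b})" .
 then have "(\<lambda>t. \<rho> (ga t) * indicator {a..b} t) \<in> borel_measurable borel"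
  by (subst (asm) borel_measurable_restrict_space_iff_ennreal) auto
 then show ?thesis by (simp cong: measurable_cong_sets)
qed

end

lemma line_integral_cases:
 assumes "(a, b, ga) \<in> curves_in S" "line_integral \<rho> (a, b, ga) < \<infinity>"
 shows "rectifiable_curve a b ga"
 using assms by (auto simp: curves_in_def line_integral_def rectifiable_def rectifiable_curve_def split: if_splits)

section \<open>Pointwise gradients give Newton--Sobolev functions\<close>

text \<open>The value at \<open>x\<close> of the good representative of \<open>h\<close>: it is approached by values \<open>h y\<close> at
 points \<open>y\<close> within distance \<open>l\<close> of \<open>x\<close> at which \<open>G\<close> is \<open>o(1/l)\<close>, at all small scales \<open>l\<close>.
 Two such sequences at a common scale can be compared, hence the value is unique, and every
 endpoint of a curve with finite \<open>G\<close>-integral has one.\<close>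

definition approached ::
 "'a set \<Rightarrow> ('a \<Rightarrow> ennreal) \<Rightarrow> ('a::metric_space \<Rightarrow> 'b::real_normed_vector) \<Rightarrow> 'a \<Rightarrow> 'b \<Rightarrow> bool" where
 "approached N G h x w \<longleftrightarrow> (\<forall>\<epsilon>>0. \<exists>l0>0. \<forall>l. 0 < l \<and> l < l0 \<longrightarrow>
  (\<exists>y. y \<notin> N \<and> dist x y \<le> l \<and> ennreal l * G y \<le> ennreal \<epsilon> \<and> norm (h y - w) \<le> \<epsilon>))"

locale pointwise_gradient =
 fixes N :: "'a::metric_space set" and G :: "'a \<Rightarrow> ennreal" and h :: "'a \<Rightarrow> 'b::banach"
 assumes G_borel [measurable]: "G \<in> borel_measurable borel" and N_borel [measurable]: "N \<in> sets borel"
  and grad: "x \<notin> N \<Longrightarrow> y \<notin> N \<Longrightarrow> enorm (h x - h y) \<le> ennreal (dist x y) * (G x + G y)"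
begin

lemma approached_unique:
 assumes "approached N G h x v" "approached N G h x w"
 shows "v = w"
proof -
 have "norm (v - w) \<le> 6 * \<epsilon>" if e: "0 < \<epsilon>" for \<epsilon> :: real
 proof -
  from assms(1)[unfolded approached_def, rule_format, OF e]
  obtain l1 where l1: "0 < l1" "\<forall>l. 0 < l \<and> l < l1 \<longrightarrow>
   (\<exists>y. y \<notin> N \<and> dist x y \<le> l \<and> ennreal l * G y \<le> ennreal \<epsilon> \<and> norm (h y - v) \<le> \<epsilon>)"
   by (elim exE conjE)
  from assms(2)[unfolded approached_def, rule_format, OF e]
  obtain l2 where l2: "0 < l2" "\<forall>l. 0 < l \<and> l < l2 \<longrightarrow>
   (\<exists>y. y \<notin> N \<and> dist x y \<le> l \<and> ennreal l * G y \<le> ennreal \<epsilon> \<and> norm (h y - w) \<le> \<epsilon>)"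
   by (elim exE conjE)
  define l where "l = min l1 l2 / 2"
  have l: "0 < l" "l < l1" "l < l2" using l1 l2 by (auto simp: l_def)
  obtain y where y: "y \<notin> N" "dist x y \<le> l" "ennreal l * G y \<le> ennreal \<epsilon>" "norm (h y - v) \<le> \<epsilon>"
   using l1(2)[rule_format, OF conjI[OF l(1,2)]] by auto
  obtain z where z: "z \<notin> N" "dist x z \<le> l" "ennreal l * G z \<le> ennreal \<epsilon>" "norm (h z - w) \<le> \<epsilon>"
   using l2(2)[rule_format, OF conjI[OF l(1,3)]] by auto
  have "dist y z \<le> 2 * l" using y z dist_triangle[of y z x] by (simp add: dist_commute)
  have "enorm (h y - h z) \<le> ennreal (dist y z) * (G y + G z)" using grad y z by auto
  also have "... \<le> ennreal (2 * l) * (G y + G z)"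
   using \<open>dist y z \<le> 2 * l\<close> by (intro mult_right_mono ennreal_leI) auto
  also have "... = ennreal 2 * (ennreal l * G y + ennreal l * G z)"
   using l by (subst ennreal_mult) (auto simp: algebra_simps)
  also have "... \<le> ennreal 2 * (ennreal \<epsilon> + ennreal \<epsilon>)" using y z by (intro mult_left_mono add_mono) auto
  also have "... = ennreal (4 * \<epsilon>)"
  proof -
   have "ennreal \<epsilon> + ennreal \<epsilon> = ennreal (2 * \<epsilon>)" using e by (simp flip: ennreal_plus)
   then show ?thesis using e ennreal_mult[of 2 "2 * \<epsilon>"] by simp
  qed
  finally have "norm (h y - h z) \<le> 4 * \<epsilon>" using e by (subst (asm) ennreal_le_iff) auto
  moreover have "norm (v - w) \<le> norm (h y - v) + norm (h y - h z) + norm (h z - w)"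
   using norm_triangle_ineq[of "v - h y" "h y - h z"] norm_triangle_ineq[of "v - h z" "h z - w"]
   by (simp add: norm_minus_commute)
  ultimately show ?thesis using y z by linarith
 qed
 from this[of "norm (v - w) / 12"] show ?thesis by (cases "norm (v - w) > 0") auto
qed

lemma approached_self:
 assumes "x \<notin> N" "G x < \<infinity>"
 shows "approached N G h x (h x)"
 unfolding approached_def
proof (intro allI impI)
 fix \<epsilon> :: real assume e: "0 < \<epsilon>"
 define g where "g = enn2real (G x)"
 have g: "G x = ennreal g" "0 \<le> g" using assms by (auto simp: g_def less_top)
 show "\<exists>l0>0. \<forall>l. 0 < l \<and> l < l0 \<longrightarrow>
  (\<exists>y. y \<notin> N \<and> dist x y \<le> l \<and> ennreal l * G y \<le> ennreal \<epsilon> \<and> norm (h y - h x) \<le> \<epsilon>)"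
 proof (intro exI[of _ "\<epsilon> / (g + 1)"] conjI allI impI)
  show "0 < \<epsilon> / (g + 1)" using e g by simp
  fix l assume l: "0 < l \<and> l < \<epsilon> / (g + 1)"
  have "l * g \<le> \<epsilon> / (g + 1) * (g + 1)" using l g by (intro mult_mono) auto
  then have "l * g \<le> \<epsilon>" using g by simp
  then show "\<exists>y. y \<notin> N \<and> dist x y \<le> l \<and> ennreal l * G y \<le> ennreal \<epsilon> \<and> norm (h y - h x) \<le> \<epsilon>"
   using l g assms e by (intro exI[of _ x]) (auto simp: ennreal_mult[symmetric] ennreal_leI)
 qed
qed

text \<open>Where no value is approached, h x is kept. Along the curves of
  \<open>gradient_curve\<close> this never affects an endpoint, unless the curve has length zero and
  both endpoints coincide.\<close>

definition repr :: "'a \<Rightarrow> 'b" where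
 "repr x = (if \<exists>w. approached N G h x w then THE w. approached N G h x w else h x)"

lemma repr_eq: "approached N G h x w \<Longrightarrow> repr x = w"
 unfolding repr_def using approached_unique[of x] by (auto intro!: the_equality)

end

section \<open>Estimates along one curve with finite G-integral\<close>

locale gradient_curve = pointwise_gradient N G h + rectifiable_curve a b ga
 for N :: "'a::metric_space set" and G and h :: "'a \<Rightarrow> 'b::banach" and a b :: real and ga :: "real \<Rightarrow> 'a" +
 assumes off_N: "AE t in lm. t \<in> {a..b} \<longrightarrow> ga t \<notin> N"
  and G_finite: "(\<integral>\<^sup>+t\<in>{a..b}. G (ga t) \<partial>lm) < \<infinity>"
begin

definition mG :: "real measure" where "mG = density lm (\<lambda>t. G (ga t) * indicator {a..b} t)"

lemma G_comp_measurable [measurable]: "(\<lambda>t. G (ga t) * indicator {a..b} t) \<in> borel_measurable lm"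
 by (rule comp_measurable[OF G_borel])

lemma sets_mG [simp, measurable_cong]: "sets mG = sets borel" by (simp add: mG_def)

lemma mG_eq: "A \<in> sets borel \<Longrightarrow> emeasure mG A = (\<integral>\<^sup>+t\<in>A. G (ga t) * indicator {a..b} t \<partial>lm)"
 unfolding mG_def by (intro emeasure_density) auto

lemma mG_finite: "emeasure mG A < \<infinity>"
proof (cases "A \<in> sets borel")
 case True
 have "emeasure mG A \<le> (\<integral>\<^sup>+t\<in>{a..b}. G (ga t) \<partial>lm)"
  unfolding mG_eq[OF True] by (intro nn_integral_mono) (auto simp: indicator_def)
 then show ?thesis using G_finite by (rule le_less_trans)
qed (simp add: emeasure_notin_sets)

lemma pick_point:
 assumes A: "A \<in> sets borel" "A \<subseteq> {a..b}" and l: "0 < l" "emeasure lm A = ennreal l"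
 obtains t where "t \<in> A" "ga t \<notin> N" "ennreal l * G (ga t) \<le> emeasure mG A"
proof -
 have "\<exists>t\<in>A. (t \<in> {a..b} \<longrightarrow> ga t \<notin> N) \<and> G (ga t) * indicator {a..b} t \<le> emeasure mG A / ennreal l"
 proof (rule exists_le_average)
  show "(\<integral>\<^sup>+t\<in>A. G (ga t) * indicator {a..b} t \<partial>lm) \<le> emeasure mG A / ennreal l * emeasure lm A"
   using mG_eq[OF A(1)] l by (simp add: ennreal_divide_mult_self)
 qed (use A l off_N in auto)
 then obtain t where t: "t \<in> A" "ga t \<notin> N" "G (ga t) \<le> emeasure mG A / ennreal l"
  using A by auto
 have "ennreal l * G (ga t) \<le> ennreal l * (emeasure mG A / ennreal l)"
  using t by (intro mult_left_mono) auto
 also have "... = emeasure mG A" using l ennreal_divide_mult_self[of "ennreal l" "emeasure mG A"]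
  by (simp add: mult.commute)
 finally show ?thesis using t that by blast
qed

lemma ivt_len:
 assumes "a \<le> s" "s \<le> t" "t \<le> b" "len s \<le> y" "y \<le> len t"
 obtains u where "s \<le> u" "u \<le> t" "len u = y"
 using IVT'[of len s y t] assms len_cont continuous_at_imp_continuous_on[of "{s..t}" len] by blast

lemma curve_step:
 assumes "t' \<le> t''" "a \<le> t'" "t'' \<le> b" "ga t' \<notin> N" "ga t'' \<notin> N" "len t'' - len t' \<le> d"
 shows "enorm (h (ga t') - h (ga t'')) \<le> ennreal d * (G (ga t') + G (ga t''))"
proof -
 have "enorm (h (ga t') - h (ga t'')) \<le> ennreal (dist (ga t') (ga t'')) * (G (ga t') + G (ga t''))"
  using grad assms by auto
 also have "... \<le> ennreal d * (G (ga t') + G (ga t''))"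
  using dist_le_len[of t' t''] assms by (intro mult_right_mono ennreal_leI) auto
 finally show ?thesis .
qed

text \<open>The curve is cut into pieces of length l, and in each piece a point is picked where l G
  is at most the G-integral over that piece; neighbouring points are at most 2 l apart in length.
  The term 2 l G (ga t) on the left pays in advance for leaving the last point. Each point is thus
  charged 2 l G for arriving and 2 l G for leaving, which gives the factor 4.\<close>

lemma curve_chain:
 assumes l: "0 < l" and s: "a \<le> s" "ga s \<notin> N"
 shows "s \<le> u \<Longrightarrow> u \<le> b \<Longrightarrow> len u = len s + real n * l \<Longrightarrow>
  \<exists>t. s \<le> t \<and> t \<le> u \<and> ga t \<notin> N \<and> len u - len t \<le> l \<and>
   enorm (h (ga s) - h (ga t)) + ennreal (2 * l) * G (ga t)
    \<le> ennreal (2 * l) * G (ga s) + 4 * emeasure mG {s<..u}"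
proof (induction n arbitrary: u)
 case 0
 then show ?case using s l by (intro exI[of _ s]) auto
next
 case (Suc n)
 have "len s \<le> len s + real n * l" "len s + real n * l \<le> len u" using l Suc.prems by (auto simp: algebra_simps)
 then obtain u' where u': "s \<le> u'" "u' \<le> u" "len u' = len s + real n * l"
  using ivt_len[of s u "len s + real n * l"] s Suc.prems by auto
 obtain t where t: "s \<le> t" "t \<le> u'" "ga t \<notin> N" "len u' - len t \<le> l"
  "enorm (h (ga s) - h (ga t)) + ennreal (2 * l) * G (ga t)
    \<le> ennreal (2 * l) * G (ga s) + 4 * emeasure mG {s<..u'}"
  using Suc.IH[of u'] u' Suc.prems by auto
 have lmu: "emeasure lm {u'<..u} = ennreal l"
  using u' Suc.prems by (simp add: lm_Ioc algebra_simps)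
 obtain t' where t': "t' \<in> {u'<..u}" "ga t' \<notin> N" "ennreal l * G (ga t') \<le> emeasure mG {u'<..u}"
  by (rule pick_point[of "{u'<..u}" l]) (use u' Suc.prems s l lmu in auto)
 have lt': "len t' \<le> len u" "len u' \<le> len t'" using t' by (auto intro: len_mono)
 have lu: "len u = len u' + l" using u' Suc.prems by (simp add: algebra_simps)
 have step: "enorm (h (ga t) - h (ga t')) \<le> ennreal (2 * l) * (G (ga t) + G (ga t'))"
  using t t' u' s Suc.prems lt' lu by (intro curve_step) auto
 have "norm (h (ga s) - h (ga t')) \<le> norm (h (ga s) - h (ga t)) + norm (h (ga t) - h (ga t'))"
  using norm_triangle_ineq[of "h (ga s) - h (ga t)" "h (ga t) - h (ga t')"] by simp
 then have "enorm (h (ga s) - h (ga t')) \<le> enorm (h (ga s) - h (ga t)) + enorm (h (ga t) - h (ga t'))"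
  by (simp flip: ennreal_plus add: ennreal_leI)
 then have "enorm (h (ga s) - h (ga t')) + ennreal (2 * l) * G (ga t')
  \<le> enorm (h (ga s) - h (ga t)) + ennreal (2 * l) * (G (ga t) + G (ga t')) + ennreal (2 * l) * G (ga t')"
  using step by (meson add_left_mono add_right_mono order_trans)
 also have "... = (enorm (h (ga s) - h (ga t)) + ennreal (2 * l) * G (ga t)) + 2 * (ennreal (2 * l) * G (ga t'))"
  by (simp add: algebra_simps mult_2)
 also have "2 * (ennreal (2 * l) * G (ga t')) = 4 * (ennreal l * G (ga t'))"
  using l by (simp add: ennreal_mult mult.assoc[symmetric])
 also have "(enorm (h (ga s) - h (ga t)) + ennreal (2 * l) * G (ga t)) + 4 * (ennreal l * G (ga t'))
  \<le> (ennreal (2 * l) * G (ga s) + 4 * emeasure mG {s<..u'}) + 4 * emeasure mG {u'<..u}"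
  by (rule add_mono[OF t(5) mult_left_mono[OF t'(3)]]) simp
 also have "... = ennreal (2 * l) * G (ga s) + 4 * emeasure mG {s<..u}"
 proof -
  have "{s<..u} = {s<..u'} \<union> {u'<..u}" using u' by auto
  then have "emeasure mG {s<..u} = emeasure mG {s<..u'} + emeasure mG {u'<..u}"
   by (simp add: plus_emeasure)
  then show ?thesis by (simp add: algebra_simps)
 qed
 finally show ?case using t t' u' s Suc.prems lt' lu by (intro exI[of _ t']) auto
qed

text \<open>With n pieces of length l = L / n, only the endpoint terms 2 l G (ga s) + l G (ga t)
  remain besides the integral. They vanish in the limit because G is finite at both
  endpoints.\<close>

lemma curve_bound:
 assumes st: "a \<le> s" "s \<le> t" "t \<le> b" and N: "ga s \<notin> N" "ga t \<notin> N"
  and fin: "G (ga s) < \<infinity>" "G (ga t) < \<infinity>"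
 shows "enorm (h (ga s) - h (ga t)) \<le> 4 * emeasure mG {s<..t}"
proof (cases "len s = len t")
 case True
 then have "ga s = ga t" using dist_le_len[OF st] by simp
 then show ?thesis by simp
next
 case False
 define L where "L = len t - len s"
 have L: "0 < L" using False len_mono[OF st(2)] by (simp add: L_def)
 obtain gs gt where g: "G (ga s) = ennreal gs" "0 \<le> gs" "G (ga t) = ennreal gt" "0 \<le> gt"
  using fin by (cases "G (ga s)"; cases "G (ga t)") auto
 show ?thesis
 proof (rule ennreal_le_epsilon)
  fix e :: real assume e: "0 < e"
  obtain n :: nat where n: "(2 * L * gs + L * gt) / e < real n" using reals_Archimedean2 by blast
  have n0: "0 < n"
  proof (rule ccontr)
   assume "\<not> 0 < n"
   then have "(2 * L * gs + L * gt) / e < 0" using n by simp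
   moreover have "0 \<le> (2 * L * gs + L * gt) / e" using L g e by simp
   ultimately show False by simp
  qed
  define l where "l = L / real n"
  have l: "0 < l" "len t = len s + real n * l" using L n0 by (auto simp: l_def L_def)
  obtain u where u: "s \<le> u" "u \<le> t" "ga u \<notin> N" "len t - len u \<le> l"
   "enorm (h (ga s) - h (ga u)) + ennreal (2 * l) * G (ga u)
    \<le> ennreal (2 * l) * G (ga s) + 4 * emeasure mG {s<..t}"
   using curve_chain[OF l(1) st(1) N(1) st(2,3) l(2)] by auto
  have 1: "enorm (h (ga u) - h (ga t)) \<le> ennreal l * (G (ga u) + G (ga t))"
   using u st N by (intro curve_step) auto
  have "norm (h (ga s) - h (ga t)) \<le> norm (h (ga s) - h (ga u)) + norm (h (ga u) - h (ga t))"
   using norm_triangle_ineq[of "h (ga s) - h (ga u)" "h (ga u) - h (ga t)"] by simp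
  then have "enorm (h (ga s) - h (ga t)) \<le> enorm (h (ga s) - h (ga u)) + enorm (h (ga u) - h (ga t))"
   by (simp flip: ennreal_plus add: ennreal_leI)
  also have "... \<le> enorm (h (ga s) - h (ga u)) + ennreal l * (G (ga u) + G (ga t))"
   by (rule add_left_mono[OF 1])
  also have "... = enorm (h (ga s) - h (ga u)) + ennreal l * G (ga u) + ennreal l * G (ga t)"
   by (simp add: distrib_left add.assoc)
  also have "... \<le> enorm (h (ga s) - h (ga u)) + ennreal (2 * l) * G (ga u) + ennreal l * G (ga t)"
   using l by (intro add_right_mono add_left_mono mult_right_mono ennreal_leI) auto
  also have "... \<le> ennreal (2 * l) * G (ga s) + 4 * emeasure mG {s<..t} + ennreal l * G (ga t)"
   using u(5) by (rule add_right_mono)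
  also have "... = 4 * emeasure mG {s<..t} + ennreal (2 * l * gs + l * gt)"
   using g l by (simp add: ennreal_mult[symmetric] ac_simps)
  also have "... \<le> 4 * emeasure mG {s<..t} + ennreal e"
  proof (intro add_left_mono ennreal_leI)
   have "2 * l * gs + l * gt = (2 * L * gs + L * gt) / real n" by (simp add: l_def add_divide_distrib)
   also have "... \<le> e" using n n0 e by (simp add: field_simps)
   finally show "2 * l * gs + l * gt \<le> e" .
  qed
  finally show "enorm (h (ga s) - h (ga t)) \<le> 4 * emeasure mG {s<..t} + ennreal e" .
 qed
qed

text \<open>A l stands for the piece of length l at one end of the curve; the abstract form covers
  both ends. The points p l picked in A l satisfy l G <= mG (A l), and by \<open>curve_bound\<close>
  the values of h at them differ by at most 4 mG (A k) for indices up to k. Since mG (A l) tends to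
  0, these values converge and G at the points is o(1/l), as \<open>approached\<close>
  demands.\<close>

lemma approached_endpoint:
 assumes L: "0 < L"
  and A: "\<And>l. A l \<in> sets borel" "\<And>l. A l \<subseteq> {a..b}" "\<And>l l'. l \<le> l' \<Longrightarrow> A l \<subseteq> A l'"
   "\<And>l. 0 < l \<Longrightarrow> l < L \<Longrightarrow> emeasure lm (A l) = ennreal l"
  and d: "\<And>l t. t \<in> A l \<Longrightarrow> dist x (ga t) \<le> l"
  and conv: "\<And>l s t. s \<in> A l \<Longrightarrow> t \<in> A l \<Longrightarrow> {s<..t} \<subseteq> A l"
 obtains w where "approached N G h x w"
  "\<And>e l. 0 < e \<Longrightarrow> 0 < l \<Longrightarrow> \<exists>t\<in>A l. ga t \<notin> N \<and> G (ga t) < \<infinity> \<and> norm (h (ga t) - w) \<le> e"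
proof -
 have ql: "0 < L / real (n + 2)" "L / real (n + 2) < L" for n :: nat
  using L divide_strict_left_mono[of 1 "real (n + 2)" L] by auto
 \<comment> \<open>The intersection of the sets A l has length 0, hence \<open>mG\<close>-measure 0
   by absolute continuity; continuity from above gives the limit.\<close>
 have small: "\<exists>l>0. l < L \<and> emeasure mG (A l) \<le> ennreal e" if e: "0 < e" for e
 proof -
  define B where "B n = A (L / real (n + 2))" for n :: nat
  note Bl = ql
  have dec: "decseq B"
  proof (rule decseq_SucI)
   fix n show "B (Suc n) \<subseteq> B n" unfolding B_def using L by (intro A) (auto simp: field_simps)
  qed
  have lim: "(\<lambda>n. emeasure mG (B n)) \<longlonglongrightarrow> emeasure mG (\<Inter>n. B n)"
  proof (rule Lim_emeasure_decseq[OF _ dec])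
   show "range B \<subseteq> sets mG" by (auto simp: B_def A)
   show "emeasure mG (B i) \<noteq> \<infinity>" for i using mG_finite[of "B i"] by simp
  qed
  have "emeasure lm (\<Inter>n. B n) \<le> ennreal (L / real (n + 2))" for n
  proof -
   have "emeasure lm (\<Inter>n. B n) \<le> emeasure lm (B n)" by (intro emeasure_mono) (auto simp: B_def A)
   also have "... = ennreal (L / real (n + 2))" unfolding B_def by (rule A(4)[OF Bl])
   finally show ?thesis .
  qed
  then have "emeasure lm (\<Inter>n. B n) \<le> ennreal 0"
  proof (intro LIMSEQ_le_const)
   show "(\<lambda>n. ennreal (L / real (n + 2))) \<longlonglongrightarrow> ennreal 0"
    by (intro tendsto_ennrealI LIMSEQ_ignore_initial_segment[OF lim_const_over_n[of L]])
  qed auto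
  then have null: "(\<Inter>n. B n) \<in> null_sets lm"
   by (intro null_setsI) (auto simp: B_def A)
  then have "emeasure mG (\<Inter>n. B n) = 0"
   using absolutely_continuousI_density[OF G_comp_measurable]
   by (auto simp: mG_def absolutely_continuous_def null_sets_def)
  then have "eventually (\<lambda>n. emeasure mG (B n) < ennreal e) sequentially"
   using lim e by (intro order_tendstoD(2)[OF lim]) auto
  then obtain n where "emeasure mG (B n) < ennreal e" by (auto simp: eventually_sequentially)
  then show ?thesis using Bl[of n] by (intro exI[of _ "L / real (n + 2)"]) (auto simp: B_def)
 qed
 have "\<exists>t. t \<in> A l \<and> ga t \<notin> N \<and> ennreal l * G (ga t) \<le> emeasure mG (A l)" if "0 < l" "l < L" for l
  using pick_point[of "A l" l] A that by metis
 then obtain p where p: "\<And>l. 0 < l \<Longrightarrow> l < L \<Longrightarrow> p l \<in> A l"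
  "\<And>l. 0 < l \<Longrightarrow> l < L \<Longrightarrow> ga (p l) \<notin> N"
  "\<And>l. 0 < l \<Longrightarrow> l < L \<Longrightarrow> ennreal l * G (ga (p l)) \<le> emeasure mG (A l)" by metis
 have pfin: "G (ga (p l)) < \<infinity>" if "0 < l" "l < L" for l
 proof (rule ccontr)
  assume "\<not> G (ga (p l)) < \<infinity>"
  then have "ennreal l * G (ga (p l)) = \<infinity>" using that by (simp add: less_top[symmetric] ennreal_mult_top)
  then show False using p(3)[OF that] mG_finite[of "A l"] by (simp add: top_unique)
 qed
 have close: "enorm (h (ga (p l)) - h (ga (p l'))) \<le> 4 * emeasure mG (A k)"
  if l: "0 < l" "l \<le> k" "0 < l'" "l' \<le> k" "k < L" for l l' k
 proof -
  have in_A: "p l \<in> A k" "p l' \<in> A k" using p(1)[of l] p(1)[of l'] l A(3)[of l k] A(3)[of l' k] by auto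
  have *: "enorm (h (ga (p m)) - h (ga (p m'))) \<le> 4 * emeasure mG (A k)"
   if m: "p m \<le> p m'" "0 < m" "m < L" "0 < m'" "m' < L" "p m \<in> A k" "p m' \<in> A k" for m m'
  proof -
   have "enorm (h (ga (p m)) - h (ga (p m'))) \<le> 4 * emeasure mG {p m<..p m'}"
    using m A(2)[of k] p pfin by (intro curve_bound) auto
   also have "... \<le> 4 * emeasure mG (A k)"
    using conv[OF m(6,7)] A(1) by (intro mult_left_mono emeasure_mono) auto
   finally show ?thesis .
  qed
  show ?thesis
   using *[of l l'] *[of l' l] in_A l by (cases "p l \<le> p l'") (auto simp: norm_minus_commute)
 qed
 define q where "q n = h (ga (p (L / real (n + 2))))" for n :: nat
 have evl: "\<exists>n0. \<forall>n\<ge>n0. L / real (n + 2) < l" if "0 < l" for l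
 proof -
  have "eventually (\<lambda>n. L / real (n + 2) < l) sequentially"
   using that by (intro order_tendstoD(2)[OF LIMSEQ_ignore_initial_segment[OF lim_const_over_n[of L]]])
  then show ?thesis by (auto simp: eventually_sequentially)
 qed
 have "Cauchy q"
 proof (rule metric_CauchyI)
  fix e :: real assume e: "0 < e"
  obtain l where l: "0 < l" "l < L" "emeasure mG (A l) \<le> ennreal (e / 8)" using small[of "e / 8"] e by auto
  obtain n0 where n0: "\<And>n. n \<ge> n0 \<Longrightarrow> L / real (n + 2) < l" using evl[OF l(1)] by blast
  show "\<exists>M. \<forall>m\<ge>M. \<forall>n\<ge>M. dist (q m) (q n) < e"
  proof (intro exI[of _ n0] allI impI)
   fix m n assume mn: "n0 \<le> m" "n0 \<le> n"
   have "enorm (q m - q n) \<le> 4 * emeasure mG (A l)"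
    unfolding q_def using n0[OF mn(1)] n0[OF mn(2)] ql l by (intro close) auto
   also have "... \<le> 4 * ennreal (e / 8)" using l by (intro mult_left_mono) auto
   also have "... = ennreal (e / 2)" using e ennreal_mult[of 4 "e / 8"] by simp
   finally have "norm (q m - q n) \<le> e / 2" using e by (subst (asm) ennreal_le_iff) auto
   then show "dist (q m) (q n) < e" using e by (simp add: dist_norm)
  qed
 qed
 then obtain w where w: "q \<longlonglongrightarrow> w" by (auto simp: Cauchy_convergent_iff convergent_def)
 have near: "enorm (h (ga (p l)) - w) \<le> 4 * emeasure mG (A k)" if l: "0 < l" "l \<le> k" "k < L" for l k
 proof (rule tendsto_upperbound)
  show "(\<lambda>n. enorm (h (ga (p l)) - q n)) \<longlonglongrightarrow> enorm (h (ga (p l)) - w)"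
   using w by (intro tendsto_intros)
  obtain n0 where n0: "\<And>n. n \<ge> n0 \<Longrightarrow> L / real (n + 2) < k" using evl[of k] l by auto
  show "eventually (\<lambda>n. enorm (h (ga (p l)) - q n) \<le> 4 * emeasure mG (A k)) sequentially"
   unfolding eventually_sequentially q_def
   using n0 ql l by (intro exI[of _ n0] allI impI close) (auto intro: less_imp_le)
 qed simp
 have near': "norm (h (ga (p l)) - w) \<le> e" "emeasure mG (A l) \<le> ennreal e"
  if l: "0 < l" "l \<le> k" "k < L" "emeasure mG (A k) \<le> ennreal (e / 4)" "0 < e" for l k e
 proof -
  have "4 * emeasure mG (A k) \<le> 4 * ennreal (e / 4)" using l by (intro mult_left_mono) auto
  also have "... = ennreal e" using l ennreal_mult[of 4 "e / 4"] by simp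
  finally have *: "4 * emeasure mG (A k) \<le> ennreal e" .
  then show "norm (h (ga (p l)) - w) \<le> e"
   using near[OF l(1-3)] l(5) by (metis ennreal_le_iff less_imp_le order_trans)
  have "emeasure mG (A l) \<le> emeasure mG (A k)" using l A by (intro emeasure_mono) auto
  also have "... \<le> ennreal (e / 4)" by (rule l)
  also have "... \<le> ennreal e" using l by (intro ennreal_leI) auto
  finally show "emeasure mG (A l) \<le> ennreal e" .
 qed
 show ?thesis
 proof (rule that[of w])
  show "approached N G h x w"
   unfolding approached_def
  proof (intro allI impI)
   fix e :: real assume e: "0 < e"
   obtain k where k: "0 < k" "k < L" "emeasure mG (A k) \<le> ennreal (e / 4)" using small[of "e / 4"] e by auto
   show "\<exists>l0>0. \<forall>l. 0 < l \<and> l < l0 \<longrightarrow>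
     (\<exists>y. y \<notin> N \<and> dist x y \<le> l \<and> ennreal l * G y \<le> ennreal e \<and> norm (h y - w) \<le> e)"
   proof (intro exI[of _ k] conjI allI impI)
    fix l assume "0 < l \<and> l < k"
    then have l: "0 < l" "l \<le> k" "l < L" using k by auto
    show "\<exists>y. y \<notin> N \<and> dist x y \<le> l \<and> ennreal l * G y \<le> ennreal e \<and> norm (h y - w) \<le> e"
     using p[OF l(1,3)] d near'[OF l(1,2) k(2,3) e] by (intro exI[of _ "ga (p l)"]) (auto intro: order_trans)
   qed (use k in auto)
  qed
  fix e l :: real assume e: "0 < e" and l: "0 < l"
  obtain k where k: "0 < k" "k < L" "emeasure mG (A k) \<le> ennreal (e / 4)" using small[of "e / 4"] e by auto
  define m where "m = min l k"
  have m: "0 < m" "m \<le> k" "m < L" "m \<le> l" using k l by (auto simp: m_def)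
  show "\<exists>t\<in>A l. ga t \<notin> N \<and> G (ga t) < \<infinity> \<and> norm (h (ga t) - w) \<le> e"
   using p[OF m(1,3)] pfin[OF m(1,3)] near'(1)[OF m(1,2) k(2,3) e] A(3)[OF m(4)]
   by (intro bexI[of _ "p m"]) auto
 qed
qed

text \<open>The endpoints themselves may lie in N or have infinite G. They are approached by good
  points of the curve, and \<open>curve_bound\<close> is used between these.\<close>

lemma repr_curve_bound: "enorm (repr (ga a) - repr (ga b)) \<le> 4 * (\<integral>\<^sup>+t\<in>{a..b}. G (ga t) \<partial>lm)"
proof (cases "len b = 0")
 case True
 then have "ga a = ga b" using dist_le_len[of a b] a_le_b by (simp add: len_def)
 then show ?thesis by simp
next
 case False
 define L where "L = len b"
 have L: "0 < L" using False by (simp add: L_def len_def less_le)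
 have len_a: "len a = 0" using a_le_b by (simp add: len_def)
 have [measurable]: "len \<in> borel_measurable borel"
  using len_cont by (intro borel_measurable_continuous_onI continuous_at_imp_continuous_on) auto
 define A B where "A l = {t \<in> {a..b}. len t \<le> l}" and "B l = {t \<in> {a..b}. L - len t \<le> l}" for l
 have AB: "A l \<in> sets borel" "B l \<in> sets borel" for l unfolding A_def B_def by measurable
 have cont_len: "continuous_on S len" for S
  using len_cont by (intro continuous_at_imp_continuous_on) auto
 \<comment> \<open>The curve may rest, so a level set of \<open>len\<close> can be an interval. Its
   largest point ends the initial piece and its smallest point starts the final piece.\<close>
 have level: "\<exists>u v. u \<in> {a..b} \<and> v \<in> {a..b} \<and> len u = y \<and> len v = y \<and> (\<forall>t\<in>{a..b}. len t = y \<longrightarrow> v \<le> t \<and> t \<le> u)"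
  if y: "0 \<le> y" "y \<le> L" for y
 proof -
  let ?S = "{t \<in> {a..b}. len t = y}"
  have "?S = {a..b} \<inter> len -` {y}" by auto
  also have "compact ..."
   by (intro compact_Int_closed compact_Icc closed_vimage closed_singleton cont_len)
  finally have c: "compact ?S" .
  obtain u where "a \<le> u" "u \<le> b" "len u = y"
   by (rule ivt_len[of a b y]) (use y a_le_b in \<open>auto simp: len_a L_def\<close>)
  then have ne: "?S \<noteq> {}" by auto
  from compact_attains_sup[OF c ne] compact_attains_inf[OF c ne] show ?thesis by fast
 qed
 have mA: "emeasure lm (A l) = ennreal l" if l: "0 < l" "l < L" for l
 proof -
  obtain u where u: "u \<in> {a..b}" "len u = l" "\<And>t. t \<in> {a..b} \<Longrightarrow> len t = l \<Longrightarrow> t \<le> u"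
   using level[of l] l by auto
  have "A l = {a..u}"
  proof (intro equalityI subsetI)
   fix t assume t: "t \<in> A l"
   show "t \<in> {a..u}"
   proof (cases "t \<le> u")
    case False
    then have "len t = l" using t u len_mono[of u t] by (auto simp: A_def)
    then show ?thesis using t u by (auto simp: A_def)
   qed (use t in \<open>auto simp: A_def\<close>)
  qed (use u len_mono in \<open>auto simp: A_def\<close>)
  then show ?thesis using u lm_Icc[of a u] by (simp add: len_a)
 qed
 have mB: "emeasure lm (B l) = ennreal l" if l: "0 < l" "l < L" for l
 proof -
  obtain v where v: "v \<in> {a..b}" "len v = L - l" "\<And>t. t \<in> {a..b} \<Longrightarrow> len t = L - l \<Longrightarrow> v \<le> t"
   using level[of "L - l"] l by auto
  have "B l = {v..b}"
  proof (intro equalityI subsetI)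
   fix t assume t: "t \<in> B l"
   show "t \<in> {v..b}"
   proof (cases "v \<le> t")
    case False
    then have "len t = L - l" using t v len_mono[of t v] by (auto simp: B_def)
    then show ?thesis using t v by (auto simp: B_def)
   qed (use t in \<open>auto simp: B_def\<close>)
  next
   fix t assume "t \<in> {v..b}"
   then show "t \<in> B l" using v len_mono[of v t] by (auto simp: B_def)
  qed
  then show ?thesis using v lm_Icc[of v b] by (simp add: L_def)
 qed
 obtain w where w: "approached N G h (ga a) w"
  "\<And>e l. 0 < e \<Longrightarrow> 0 < l \<Longrightarrow> \<exists>t\<in>A l. ga t \<notin> N \<and> G (ga t) < \<infinity> \<and> norm (h (ga t) - w) \<le> e"
 proof (rule approached_endpoint[of L A "ga a"])
  fix l t assume "t \<in> A l"
  then show "dist (ga a) (ga t) \<le> l" using dist_le_len[of a t] by (auto simp: A_def len_a)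
 next
  fix l s t assume "s \<in> A l" "t \<in> A l"
  then show "{s<..t} \<subseteq> A l" by (auto simp: A_def intro: order_trans[OF len_mono])
 qed (use L AB mA in \<open>auto simp: A_def\<close>)
 obtain w' where w': "approached N G h (ga b) w'"
  "\<And>e l. 0 < e \<Longrightarrow> 0 < l \<Longrightarrow> \<exists>t\<in>B l. ga t \<notin> N \<and> G (ga t) < \<infinity> \<and> norm (h (ga t) - w') \<le> e"
 proof (rule approached_endpoint[of L B "ga b"])
  fix l t assume "t \<in> B l"
  then show "dist (ga b) (ga t) \<le> l" using dist_le_len[of t b] by (auto simp: B_def L_def dist_commute)
 next
  fix l s t assume st: "s \<in> B l" "t \<in> B l"
  show "{s<..t} \<subseteq> B l"
  proof
   fix u assume "u \<in> {s<..t}"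
   then show "u \<in> B l" using st len_mono[of s u] by (auto simp: B_def)
  qed
 qed (use L AB mB in \<open>auto simp: B_def\<close>)
 have "enorm (w - w') \<le> 4 * emeasure mG {a..b} + ennreal e" if e: "0 < e" for e
 proof -
  \<comment> \<open>The initial and the final piece of length L/4 are disjoint, so s precedes
    t.\<close>
  obtain s where s: "s \<in> A (L / 4)" "ga s \<notin> N" "G (ga s) < \<infinity>" "norm (h (ga s) - w) \<le> e / 2"
   using w(2)[of "e / 2" "L / 4"] e L by auto
  obtain t where t: "t \<in> B (L / 4)" "ga t \<notin> N" "G (ga t) < \<infinity>" "norm (h (ga t) - w') \<le> e / 2"
   using w'(2)[of "e / 2" "L / 4"] e L by auto
  have "s \<le> t"
  proof (rule ccontr)
   assume "\<not> s \<le> t"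
   then have "len t \<le> len s" by (intro len_mono) auto
   then show False using s t L by (auto simp: A_def B_def)
  qed
  then have "enorm (h (ga s) - h (ga t)) \<le> 4 * emeasure mG {s<..t}"
   using s t by (intro curve_bound) (auto simp: A_def B_def)
  also have "... \<le> 4 * emeasure mG {a..b}"
   using s t by (intro mult_left_mono emeasure_mono) (auto simp: A_def B_def)
  finally have 1: "enorm (h (ga s) - h (ga t)) \<le> 4 * emeasure mG {a..b}" .
  have "norm (w - w') \<le> norm (h (ga s) - w) + norm (h (ga s) - h (ga t)) + norm (h (ga t) - w')"
   using norm_triangle_ineq[of "w - h (ga s)" "h (ga s) - h (ga t)"] norm_triangle_ineq[of "w - h (ga t)" "h (ga t) - w'"]
   by (simp add: norm_minus_commute)
  also have "... \<le> norm (h (ga s) - h (ga t)) + e" using s t by simp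
  finally have "enorm (w - w') \<le> enorm (h (ga s) - h (ga t)) + ennreal e"
   using e by (simp flip: ennreal_plus add: ennreal_leI)
  also have "... \<le> 4 * emeasure mG {a..b} + ennreal e" using 1 by (rule add_right_mono)
  finally show ?thesis .
 qed
 then have "enorm (w - w') \<le> 4 * emeasure mG {a..b}" by (metis ennreal_le_epsilon)
 also have "emeasure mG {a..b} = (\<integral>\<^sup>+t\<in>{a..b}. G (ga t) \<partial>lm)"
  unfolding mG_eq[OF borel_closed[OF closed_atLeastAtMost]] by (intro nn_integral_cong) (auto simp: indicator_def)
 finally show ?thesis using repr_eq[OF w(1)] repr_eq[OF w'(1)] by simp
qed

end



text \<open>C may lie outside S, so it is moved into S: for every c in C and every n, a point of S
  is picked in the ball of radius 1/(n+1) about c whenever there is one. The criterion on the right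
  is visibly stable under subsets and countable unions.\<close>

lemma separable_space_iff:
 fixes S :: "'a::metric_space set"
 shows "separable_space (subtopology euclidean S) \<longleftrightarrow> (\<exists>C. countable C \<and> S \<subseteq> closure C)"
proof
 assume "separable_space (subtopology euclidean S)"
 then obtain C where "countable C" "C \<subseteq> S" "S \<inter> closure (S \<inter> C) = S"
  by (auto simp: separable_space_def closure_of_subtopology)
 then show "\<exists>C. countable C \<and> S \<subseteq> closure C"
  by (intro exI[of _ "S \<inter> C"]) auto
next
 assume "\<exists>C. countable C \<and> S \<subseteq> closure C"
 then obtain C where C: "countable C" "S \<subseteq> closure C" by auto
 define I where "I = {(c, n). c \<in> C \<and> ball c (1 / Suc n) \<inter> S \<noteq> {}}"
 define D where "D = (\<lambda>(c, n). SOME y. y \<in> ball c (1 / Suc n) \<inter> S) ` I"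
 have "I \<subseteq> C \<times> UNIV" by (auto simp: I_def)
 then have "countable I" using C by (meson countable_SIGMA countable_subset countableI_type)
 then have cD: "countable D" by (simp add: D_def)
 have pick: "(SOME y. y \<in> ball c (1 / Suc n) \<inter> S) \<in> ball c (1 / Suc n) \<inter> S" if "(c, n) \<in> I" for c n
  using that some_in_eq[of "ball c (1 / Suc n) \<inter> S"] by (auto simp: I_def)
 have DS: "D \<subseteq> S"
 proof
  fix y assume "y \<in> D"
  then obtain c n where "(c, n) \<in> I" "y = (SOME y. y \<in> ball c (1 / Suc n) \<inter> S)" by (auto simp: D_def)
  then show "y \<in> S" using pick[of c n] by simp
 qed
 have "S \<subseteq> closure D"
 proof
  fix x assume x: "x \<in> S"
  show "x \<in> closure D"
   unfolding closure_approachable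
  proof (intro allI impI)
   fix e :: real assume e: "0 < e"
   obtain n :: nat where n: "2 / e < real n" using reals_Archimedean2 by blast
   then have n': "2 / real (Suc n) < e" using e by (simp add: field_simps)
   obtain c where c: "c \<in> C" "dist c x < 1 / Suc n"
    using C x closure_approachable[of x C] by (meson of_nat_0_less_iff subsetD zero_less_Suc zero_less_divide_1_iff)
   then have I: "(c, n) \<in> I" using x by (auto simp: I_def)
   let ?y = "SOME y. y \<in> ball c (1 / Suc n) \<inter> S"
   have "?y \<in> D" using I by (force simp: D_def)
   moreover have "dist ?y x < e"
    using pick[OF I] c n' dist_triangle[of ?y x c] by (simp add: dist_commute)
   ultimately show "\<exists>y\<in>D. dist y x < e" by blast
  qed
 qed
 then show "separable_space (subtopology euclidean S)"
  using cD DS by (auto simp: separable_space_def closure_of_subtopology Int_absorb1 intro!: exI[of _ D])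
qed

lemma separable_range_off_null:
 fixes u :: "'a \<Rightarrow> 'b::metric_space"
 assumes "ess_separable_measurable M u"
 obtains N C where "N \<in> null_sets M" "countable C" "u ` (space M - N) \<subseteq> closure C"
proof -
 from assms obtain N where N: "N \<in> null_sets M" "separable_space (subtopology euclidean (u ` (space M - N)))"
  unfolding ess_separable_measurable_def by (elim conjE bexE)
 from N(2)[unfolded separable_space_iff] obtain C where "countable C" "u ` (space M - N) \<subseteq> closure C"
  by (elim exE conjE)
 then show ?thesis by (rule that[OF N(1)])
qed

text \<open>Completeness makes a modification on a null set measurable; \<open>repr\<close> is such
  a modification of h.\<close>

lemma Lp_cong_AE:
 fixes h v :: "'a \<Rightarrow> 'b::real_normed_vector"
 assumes M: "complete_measure M" and h: "Lp p M h" and eq: "AE x in M. v x = h x"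
 shows "Lp p M v"
proof -
 interpret complete_measure M by fact
 obtain N where N: "N \<in> null_sets M" "{x \<in> space M. v x \<noteq> h x} \<subseteq> N"
  using eq by (auto elim!: AE_E simp: null_sets_def)
 have hm [measurable]: "h \<in> borel_measurable M"
  using h by (auto simp: Lp_def ess_separable_measurable_def)
 have vm [measurable]: "v \<in> borel_measurable M"
 proof (rule borel_measurableI)
  fix S :: "'b set" assume S: "open S"
  have "v -` S \<inter> space M = (h -` S \<inter> space M - N) \<union> (v -` S \<inter> space M \<inter> N)" using N by auto
  moreover have "v -` S \<inter> space M \<inter> N \<in> sets M" by (rule complete[of _ N]) (use N in auto)
  moreover have "h -` S \<inter> space M - N \<in> sets M"
   using N S by (intro sets.Diff measurable_sets[OF hm]) (auto dest: null_setsD2)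
  ultimately show "v -` S \<inter> space M \<in> sets M" by (metis sets.Un)
 qed
 have hs: "ess_separable_measurable M h" using h by (simp add: Lp_def)
 obtain N' C where N': "N' \<in> null_sets M" "countable C" "h ` (space M - N') \<subseteq> closure C"
  by (rule separable_range_off_null[OF hs])
 have "v ` (space M - (N \<union> N')) \<subseteq> closure C"
 proof
  fix y assume "y \<in> v ` (space M - (N \<union> N'))"
  then obtain x where x: "x \<in> space M" "x \<notin> N" "x \<notin> N'" "y = v x" by auto
  then have "y = h x" using N by auto
  then show "y \<in> closure C" using x N' by auto
 qed
 then have "ess_separable_measurable M v"
  unfolding ess_separable_measurable_def separable_space_iff using N N' vm
  by (auto intro!: bexI[of _ "N \<union> N'"])
 moreover have "Lp_nonneg p M (\<lambda>x. enorm (v x))"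
 proof -
  have "(\<integral>\<^sup>+x. ennreal_powr (enorm (v x)) p \<partial>M) = (\<integral>\<^sup>+x. ennreal_powr (enorm (h x)) p \<partial>M)"
   using eq by (intro nn_integral_cong_AE) (auto elim: eventually_mono)
  moreover have "(\<lambda>x. enorm (v x)) \<in> borel_measurable M"
   using measurable_compose[OF vm borel_measurable_continuous_onI[OF continuous_on_norm_id]] by simp
  ultimately show ?thesis using h by (auto simp: Lp_def Lp_nonneg_def)
 qed
 ultimately show ?thesis by (simp add: Lp_def)
qed

text \<open>The representative \<open>repr\<close> satisfies the gradient inequality along every
  curve: if the \<rho>-integral is finite, \<open>repr_curve_bound\<close> applies, and otherwise
  the right-hand side is infinite.\<close>

theorem newton_sobolev_if_pointwise_gradient:
 fixes h :: "'a::{metric_space,second_countable_topology} \<Rightarrow> 'b::banach"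
 assumes M: "complete_measure M" "space M = UNIV" "sets borel \<subseteq> sets M" and p: "0 < p"
  and h: "Lp p M h" and G: "Lp_nonneg p M G" and Gb: "G \<in> borel_measurable borel"
  and N: "N \<in> null_sets M" "N \<in> sets borel"
  and grad: "\<And>x y. x \<notin> N \<Longrightarrow> y \<notin> N \<Longrightarrow> enorm (h x - h y) \<le> ennreal (dist x y) * (G x + G y)"
 shows "newton_sobolev p M h"
proof -
 interpret pointwise_gradient N G h using Gb N grad by unfold_locales auto
 note [measurable] = Gb N(2)
 \<comment> \<open>The factor 4 is that of \<open>repr_curve_bound\<close>. The infinite value on
   the null set N leaves the L^p norm unchanged and forces a curve with finite integral to spend no
   length in N.\<close>
 define \<rho> where "\<rho> x = 4 * G x + \<infinity> * indicator N x" for x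
 have rb [measurable]: "\<rho> \<in> borel_measurable borel" unfolding \<rho>_def[abs_def] by measurable
 have id: "(\<lambda>x. x) \<in> measurable M borel" using M by (intro measurableI) auto
 have rM [measurable]: "\<rho> \<in> borel_measurable M" using measurable_compose[OF id rb] by simp
 have AEN: "AE x in M. x \<notin> N" using N(1) by (rule AE_not_in)
 have "Lp_nonneg p M (\<lambda>x. ennreal 4 * G x)" using G p by (intro Lp_nonneg_cmult) auto
 then have rho: "Lp_nonneg p M \<rho>"
  by (rule Lp_nonneg_mono_AE) (use AEN p rM in \<open>auto simp: \<rho>_def elim!: eventually_mono\<close>)
 have "AE x in M. repr x = h x"
  using AEN Lp_nonneg_AE_finite[OF G]
  by eventually_elim (use approached_self repr_eq in blast)
 moreover have "enorm (repr (ga a) - repr (ga b)) \<le> line_integral \<rho> (a, b, ga)"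
  if c: "(a, b, ga) \<in> curves_in UNIV" for a b ga
 proof (cases "line_integral \<rho> (a, b, ga) < \<infinity>")
  case True
  interpret rectifiable_curve a b ga by (rule line_integral_cases[OF c True])
  have [measurable]: "(\<lambda>t. \<rho> (ga t) * indicator {a..b} t) \<in> borel_measurable lm"
   "(\<lambda>t. G (ga t) * indicator {a..b} t) \<in> borel_measurable lm"
   by (rule comp_measurable[OF rb], rule comp_measurable[OF Gb])
  have fin: "(\<integral>\<^sup>+t\<in>{a..b}. \<rho> (ga t) \<partial>lm) < \<infinity>" using True by (simp add: line_integral_eq)
  have le: "4 * (\<integral>\<^sup>+t\<in>{a..b}. G (ga t) \<partial>lm) \<le> (\<integral>\<^sup>+t\<in>{a..b}. \<rho> (ga t) \<partial>lm)"
  proof -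
   have "4 * (\<integral>\<^sup>+t\<in>{a..b}. G (ga t) \<partial>lm) = (\<integral>\<^sup>+t. 4 * (G (ga t) * indicator {a..b} t) \<partial>lm)"
    by (rule nn_integral_cmult[symmetric]) measurable
   also have "... \<le> (\<integral>\<^sup>+t\<in>{a..b}. \<rho> (ga t) \<partial>lm)"
    by (intro nn_integral_mono) (auto simp: \<rho>_def indicator_def)
   finally show ?thesis .
  qed
  interpret gradient_curve N G h a b ga
  proof
   have "AE t in lm. \<rho> (ga t) * indicator {a..b} t \<noteq> \<infinity>"
    using fin by (intro nn_integral_PInf_AE) auto
   then show "AE t in lm. t \<in> {a..b} \<longrightarrow> ga t \<notin> N"
    by eventually_elim (auto simp: \<rho>_def indicator_def split: if_splits)
   have "4 * (\<integral>\<^sup>+t\<in>{a..b}. G (ga t) \<partial>lm) < \<infinity>" using le fin by (rule le_less_trans)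
   then show "(\<integral>\<^sup>+t\<in>{a..b}. G (ga t) \<partial>lm) < \<infinity>"
    by (auto simp: ennreal_mult_less_top)
  qed
  show ?thesis using repr_curve_bound le by (simp add: line_integral_eq)
 qed (simp add: less_top[symmetric])
 \<comment> \<open>No exceptional curve is left, so the zero function witnesses
   negligibility.\<close>
 then have "weak_upper_gradient p M \<rho> repr"
  using M rb unfolding weak_upper_gradient_def p_negligible_def borel_on_def
  by (auto simp: Lp_nonneg_def intro!: exI[of _ "\<lambda>_. 0"])
 ultimately show ?thesis
  unfolding newton_sobolev_def using h rho Lp_cong_AE[OF M(1) h] by blast
qed

section \<open>Truncation along curves\<close>

lemma mcshane_extension:
 fixes g :: "'a::metric_space \<Rightarrow> real"
 assumes "F \<noteq> {}" "0 \<le> K" and lip: "\<And>x y. x \<in> F \<Longrightarrow> y \<in> F \<Longrightarrow> \<bar>g x - g y\<bar> \<le> K * dist x y"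
 obtains h where "\<And>x. x \<in> F \<Longrightarrow> h x = g x" "\<And>x y. \<bar>h x - h y\<bar> \<le> K * dist x y"
proof -
 define h where "h x = (INF z\<in>F. g z + K * dist x z)" for x
 obtain z0 where z0: "z0 \<in> F" using assms(1) by auto
 have low: "g z0 - K * dist z0 x \<le> g z + K * dist x z" if "z \<in> F" for x z
 proof -
  have "g z0 - g z \<le> K * dist z0 z" using lip[OF z0 that] by simp
  also have "... \<le> K * (dist z0 x + dist x z)" using assms(2) by (intro mult_left_mono dist_triangle)
  finally show ?thesis by (simp add: algebra_simps)
 qed
 have bdd: "bdd_below ((\<lambda>z. g z + K * dist x z) ` F)" for x
  using low by (auto intro!: bdd_belowI2)
 have le: "h x - h y \<le> K * dist x y" for x y
 proof -
  have "h x - K * dist x y \<le> h y"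
   unfolding h_def[of y]
  proof (rule cINF_greatest)
   fix z assume z: "z \<in> F"
   have "h x \<le> g z + K * dist x z" unfolding h_def by (rule cINF_lower[OF bdd z])
   also have "... \<le> g z + K * (dist x y + dist y z)"
    using assms(2) by (intro add_left_mono mult_left_mono dist_triangle)
   finally show "h x - K * dist x y \<le> g z + K * dist y z" by (simp add: algebra_simps)
  qed fact
  then show ?thesis by simp
 qed
 have "\<bar>h x - h y\<bar> \<le> K * dist x y" for x y
  using le[of x y] le[of y x] by (simp add: dist_commute abs_le_iff)
 moreover have "h x = g x" if x: "x \<in> F" for x
 proof (rule antisym)
  show "h x \<le> g x" using cINF_lower[OF bdd x, of x] by (simp add: h_def)
  show "g x \<le> h x" unfolding h_def
  proof (rule cINF_greatest)
   fix z assume "z \<in> F"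
   then show "g x \<le> g z + K * dist x z" using lip[OF x] by fastforce
  qed fact
 qed
 ultimately show ?thesis using that by blast
qed

lemma inner_regular_real:
 fixes m :: "real measure"
 assumes "sets m = sets borel" "emeasure m UNIV < \<infinity>" "B \<in> sets borel" "0 < e"
 obtains K where "compact K" "K \<subseteq> B" "emeasure m (B - K) \<le> ennreal e"
proof -
 have sp: "space m = UNIV" using assms(1) sets_eq_imp_space_eq by fastforce
 have fin: "emeasure m A < \<infinity>" for A
  using emeasure_space[of m A] assms(2) sp by (simp add: le_less_trans)
 have eq: "emeasure m B = (SUP K \<in> {K. K \<subseteq> B \<and> compact K}. emeasure m K)"
  using assms sp by (intro inner_regular) (auto simp: less_top)
 have "\<exists>K. K \<subseteq> B \<and> compact K \<and> emeasure m B \<le> emeasure m K + ennreal e"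
 proof (rule ccontr)
  assume contra: "\<not> ?thesis"
  have "emeasure m K + ennreal e \<le> emeasure m B" if "K \<subseteq> B" "compact K" for K
   using contra that by (meson linear)
  then have "(SUP K \<in> {K. K \<subseteq> B \<and> compact K}. emeasure m K) + ennreal e \<le> emeasure m B"
   by (intro SUP_add_le_ennreal) (auto intro: exI[of _ "{}"])
  then have "emeasure m B + ennreal e \<le> emeasure m B" using eq by simp
  moreover have "emeasure m B < emeasure m B + ennreal e"
   using fin[of B] assms(4) by (simp add: ennreal_add_left_cancel_less less_top)
  ultimately show False by simp
 qed
 then obtain K where K: "K \<subseteq> B" "compact K" "emeasure m B \<le> emeasure m K + ennreal e" by auto
 have "K \<in> sets m" using K assms(1) by (auto simp: compact_imp_closed)
 then have "emeasure m (B - K) = emeasure m B - emeasure m K"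
  using K assms fin[of K] by (intro emeasure_Diff) (auto simp: less_top)
 also have "... \<le> ennreal e"
  using K(3) fin[of B] by (auto simp: ennreal_minus_le_iff)
 finally show ?thesis using K that by auto
qed

context rectifiable_curve
begin

text \<open>The contact set is replaced by a compact \<open>K1\<close> and the excursions by a set whose
 \<open>\<rho>\<close>-integral is almost carried by a compact \<open>Q\<close>, so that every point has a neighbourhood
 that avoids \<open>K1\<close> or avoids \<open>Q\<close>; there the estimate is elementary, and it is additive.\<close>

lemma gluing:
 fixes f g :: "'a \<Rightarrow> real"
 assumes K: "0 \<le> K" and lip: "\<And>x y. \<bar>g x - g y\<bar> \<le> K * dist x y"
  and F: "closed F" and N: "N \<in> sets borel" and eq: "\<And>x. x \<in> F - N \<Longrightarrow> g x = f x"
  and \<rho> [measurable]: "\<rho> \<in> borel_measurable borel"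
  and ug: "\<And>s t. a \<le> s \<Longrightarrow> s \<le> t \<Longrightarrow> t \<le> b \<Longrightarrow> ennreal \<bar>f (ga s) - f (ga t)\<bar> \<le> line_integral \<rho> (s, t, ga)"
  and fin: "line_integral \<rho> (a, b, ga) < \<infinity>"
  and \<rho>': "\<And>x. \<rho>' x = ennreal K * indicator (- F) x + \<rho> x * indicator F x + \<infinity> * indicator N x"
 shows "ennreal \<bar>g (ga a) - g (ga b)\<bar> \<le> line_integral \<rho>' (a, b, ga)"
proof (cases "line_integral \<rho>' (a, b, ga) < \<infinity>")
 case False
 then show ?thesis by (simp add: less_top[symmetric])
next
 case fin': True
 have [measurable]: "F \<in> sets borel" "N \<in> sets borel" using F N by auto
 have r'b: "\<rho>' \<in> borel_measurable borel"
 proof -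
  have "\<rho>' = (\<lambda>x. ennreal K * indicator (- F) x + \<rho> x * indicator F x + \<infinity> * indicator N x)"
   using \<rho>' by auto
  then show ?thesis by simp
 qed
 note comp_measurable[OF \<rho>, measurable] comp_measurable[OF r'b, measurable]
 define cF where "cF = {t \<in> {a..b}. ga t \<in> F}"
 define cN where "cN = {t \<in> {a..b}. ga t \<in> N}"
 have pre: "{t \<in> {a..b}. ga t \<in> S} \<in> sets borel" if "S \<in> sets borel" for S
 proof -
  have "ga \<in> borel_measurable (restrict_space borel {a..b})"
   by (rule borel_measurable_continuous_on_restrict[OF cont])
  from measurable_sets[OF this that] have "ga -` S \<inter> {a..b} \<in> sets (restrict_space borel {a..b})"
   by (simp add: space_restrict_space)
  moreover have "ga -` S \<inter> {a..b} = {t \<in> {a..b}. ga t \<in> S}" by auto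
  ultimately show ?thesis by (auto simp: sets_restrict_space)
 qed
 have [measurable]: "cF \<in> sets borel" "cN \<in> sets borel" unfolding cF_def cN_def by (rule pre; simp)+
 \<comment> \<open>\<rho>' is infinite on N and has a finite integral along the curve.\<close>
 have AEN: "AE t in lm. t \<notin> cN"
 proof -
  have "AE t in lm. \<rho>' (ga t) * indicator {a..b} t \<noteq> \<infinity>"
   using fin' by (intro nn_integral_PInf_AE) (auto simp: line_integral_eq)
  then show ?thesis
   by eventually_elim (auto simp: \<rho>' cN_def indicator_def split: if_splits)
 qed
 define mK where "mK = density lm (\<lambda>t. ennreal K * indicator {a..b} t)"
 define m\<rho> where "m\<rho> = density lm (\<lambda>t. \<rho> (ga t) * indicator {a..b} t)"
 have mK: "emeasure mK A = ennreal K * emeasure lm (A \<inter> {a..b})" if "A \<in> sets borel" for A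
 proof -
  have "emeasure mK A = (\<integral>\<^sup>+t. ennreal K * indicator (A \<inter> {a..b}) t \<partial>lm)"
   unfolding mK_def using that by (subst emeasure_density) (auto intro!: nn_integral_cong simp: indicator_def)
  then show ?thesis using that by (simp add: nn_integral_cmult)
 qed
 have m\<rho>: "emeasure m\<rho> A = (\<integral>\<^sup>+t\<in>A \<inter> {a..b}. \<rho> (ga t) \<partial>lm)" if "A \<in> sets borel" for A
  unfolding m\<rho>_def using that
  by (subst emeasure_density[OF comp_measurable[OF \<rho>]]) (auto intro!: nn_integral_cong simp: indicator_def)
 have mKs [simp, measurable_cong]: "sets mK = sets borel" "sets m\<rho> = sets borel" by (simp_all add: mK_def m\<rho>_def)
 have finK: "emeasure mK UNIV < \<infinity>"
  using a_le_b by (simp add: mK lm_Icc ennreal_mult_less_top)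
 have fin\<rho>: "emeasure m\<rho> UNIV < \<infinity>" using fin by (simp add: m\<rho> line_integral_eq)
 have nullN: "emeasure mK cN = 0"
 proof -
  have "emeasure lm cN = 0" using AEN by (subst (asm) AE_iff_measurable[of cN]) auto
  moreover have "emeasure lm (cN \<inter> {a..b}) \<le> emeasure lm cN" by (intro emeasure_mono) auto
  ultimately show ?thesis by (simp add: mK)
 qed
 have null1: "emeasure lm {x} = 0" for x using lm_Icc[of x x] by simp
 have main: "ennreal \<bar>g (ga a) - g (ga b)\<bar> \<le> line_integral \<rho>' (a, b, ga) + ennreal (2 * e)" if e: "0 < e" for e
 proof -
  obtain K1 where K1: "compact K1" "K1 \<subseteq> cF - cN" "emeasure mK (cF - cN - K1) \<le> ennreal e"
   by (rule inner_regular_real[of mK "cF - cN" e]) (use e finK in auto)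
  have K1b [measurable]: "K1 \<in> sets borel" using K1 by (auto simp: compact_imp_closed)
  obtain Q where Q: "compact Q" "Q \<subseteq> {a..b} - K1" "emeasure m\<rho> ({a..b} - K1 - Q) \<le> ennreal e"
   by (rule inner_regular_real[of m\<rho> "{a..b} - K1" e]) (use e fin\<rho> in auto)
  have Qb [measurable]: "Q \<in> sets borel" using Q by (auto simp: compact_imp_closed)
  \<comment> \<open>\<open>H\<close> charges K off \<open>K1\<close> and \<rho> off
    \<open>Q\<close>. Intervals without interior points in \<open>K1\<close> are paid by the first
    summand through the Lipschitz bound, and intervals that avoid \<open>Q\<close> and have both
    endpoints in \<open>K1\<close>, where g = f, by the second through the gradient of f.\<close>
  define H where "H A = emeasure mK (A - K1) + emeasure m\<rho> (A - Q)" for A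
  have H_add: "H {s<..u} = H {s<..t} + H {t<..u}" if "s \<le> t" "t \<le> u" for s t u
  proof -
   have "{s<..u} - K1 = ({s<..t} - K1) \<union> ({t<..u} - K1)" "{s<..u} - Q = ({s<..t} - Q) \<union> ({t<..u} - Q)"
    using that by auto
   moreover have "emeasure mK (({s<..t} - K1) \<union> ({t<..u} - K1)) = emeasure mK ({s<..t} - K1) + emeasure mK ({t<..u} - K1)"
    by (rule plus_emeasure[symmetric]) auto
   moreover have "emeasure m\<rho> (({s<..t} - Q) \<union> ({t<..u} - Q)) = emeasure m\<rho> ({s<..t} - Q) + emeasure m\<rho> ({t<..u} - Q)"
    by (rule plus_emeasure[symmetric]) auto
   ultimately show ?thesis by (simp add: H_def ac_simps)
  qed
  have lipc: "ennreal \<bar>g (ga s) - g (ga t)\<bar> \<le> H {s<..t}"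
   if st: "a \<le> s" "s \<le> t" "t \<le> b" and K1: "{s<..<t} \<inter> K1 = {}" for s t
  proof -
   have "\<bar>g (ga s) - g (ga t)\<bar> \<le> K * (len t - len s)"
    using lip[of "ga s" "ga t"] mult_left_mono[OF dist_le_len[OF st] K] by linarith
   then have "ennreal \<bar>g (ga s) - g (ga t)\<bar> \<le> ennreal K * ennreal (len t - len s)"
    using K len_mono[OF st(2)] by (simp add: ennreal_mult[symmetric] ennreal_leI)
   also have "... = ennreal K * emeasure lm {s<..t}" by (simp add: lm_Ioc[OF st(2)])
   also have "emeasure lm {s<..t} \<le> emeasure lm ({s<..t} - {t})"
    using null1[of t] by (subst emeasure_Diff_null_set) (auto simp: null_sets_def)
   also have "... \<le> emeasure lm (({s<..t} - K1) \<inter> {a..b})"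
   proof (rule emeasure_mono)
    show "{s<..t} - {t} \<subseteq> ({s<..t} - K1) \<inter> {a..b}"
    proof
     fix x assume x: "x \<in> {s<..t} - {t}"
     then have "x \<in> {s<..<t}" by auto
     then show "x \<in> ({s<..t} - K1) \<inter> {a..b}" using K1 st by auto
    qed
   qed simp
   also have "ennreal K * ... = emeasure mK ({s<..t} - K1)" by (simp add: mK)
   also have "... \<le> H {s<..t}" by (simp add: H_def)
   finally show ?thesis by (simp add: mult_left_mono)
  qed
  have ugc: "ennreal \<bar>g (ga s) - g (ga t)\<bar> \<le> H {s<..t}"
   if st: "s \<in> K1" "t \<in> K1" "s \<le> t" and Q: "{s..t} \<inter> Q = {}" for s t
  proof -
   have s: "a \<le> s" "t \<le> b" "ga s \<in> F - N" "ga t \<in> F - N" using K1(2) st by (auto simp: cF_def cN_def)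
   have "ennreal \<bar>g (ga s) - g (ga t)\<bar> = ennreal \<bar>f (ga s) - f (ga t)\<bar>" using eq s by simp
   also have "... \<le> line_integral \<rho> (s, t, ga)" using ug s st by auto
   also have "... = (\<integral>\<^sup>+x\<in>{s..t}. \<rho> (ga x) \<partial>lm)" using s st by (intro line_integral_sub) auto
   also have "... = (\<integral>\<^sup>+x\<in>({s<..t} - Q) \<inter> {a..b}. \<rho> (ga x) \<partial>lm)"
   proof (rule nn_integral_cong_AE)
    have "AE x in lm. x \<noteq> s" using null1[of s] by (intro AE_not_in[of "{s}", simplified]) auto
    then show "AE x in lm. \<rho> (ga x) * indicator {s..t} x = \<rho> (ga x) * indicator (({s<..t} - Q) \<inter> {a..b}) x"
     by eventually_elim (use Q s in \<open>auto simp: indicator_def\<close>)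
   qed
   also have "... = emeasure m\<rho> ({s<..t} - Q)" by (rule m\<rho>[symmetric]) simp
   also have "... \<le> H {s<..t}" by (simp add: H_def)
   finally show ?thesis .
  qed
  have tri: "ennreal \<bar>g (ga s) - g (ga u)\<bar> \<le> H {s<..u}"
   if "s \<le> t" "t \<le> u" "ennreal \<bar>g (ga s) - g (ga t)\<bar> \<le> H {s<..t}" "ennreal \<bar>g (ga t) - g (ga u)\<bar> \<le> H {t<..u}" for s t u
  proof -
   have "ennreal \<bar>g (ga s) - g (ga u)\<bar> \<le> ennreal \<bar>g (ga s) - g (ga t)\<bar> + ennreal \<bar>g (ga t) - g (ga u)\<bar>"
    by (simp flip: ennreal_plus add: ennreal_leI)
   also have "... \<le> H {s<..t} + H {t<..u}" by (rule add_mono[OF that(3,4)])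
   finally show ?thesis using H_add[OF that(1,2)] by simp
  qed
  define P where "P s t \<longleftrightarrow> (a \<le> s \<and> t \<le> b \<longrightarrow> ennreal \<bar>g (ga s) - g (ga t)\<bar> \<le> H {s<..t})" for s t
  \<comment> \<open>By bisection it is enough that the estimate is additive over adjacent intervals
    and holds on all short intervals around each parameter.\<close>
  have "P a b"
  proof (rule Bolzano[OF a_le_b])
   fix s t u assume "P s t" "P t u" "s \<le> t" "t \<le> u"
   then show "P s u" unfolding P_def using tri[of s t u] by auto
  next
   fix x assume x: "a \<le> x" "x \<le> b"
   show "\<exists>d>0. \<forall>s t. s \<le> x \<and> x \<le> t \<and> t - s < d \<longrightarrow> P s t"
   proof (cases "x \<in> K1")
    case False
    then obtain d where d: "0 < d" "ball x d \<inter> K1 = {}"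
     using K1(1) compact_imp_closed[of K1] open_contains_ball[of "- K1"]
     by (metis Compl_iff closed_def disjoint_eq_subset_Compl)
    show ?thesis
    proof (intro exI[of _ d] conjI allI impI)
     fix s t assume st: "s \<le> x \<and> x \<le> t \<and> t - s < d"
     have "{s<..<t} \<subseteq> ball x d" using st by (auto simp: dist_real_def)
     then have "{s<..<t} \<inter> K1 = {}" using d by auto
     then show "P s t" unfolding P_def using lipc[of s t] st by auto
    qed fact
   next
    case True
    then have "x \<notin> Q" using Q(2) by auto
    then obtain d where d: "0 < d" "ball x d \<inter> Q = {}"
     using Q(1) compact_imp_closed[of Q] open_contains_ball[of "- Q"]
     by (metis Compl_iff closed_def disjoint_eq_subset_Compl)
    show ?thesis
    proof (intro exI[of _ d] conjI allI impI)
     fix s t assume st: "s \<le> x \<and> x \<le> t \<and> t - s < d"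
     have sub: "{s..t} \<subseteq> ball x d" using st by (auto simp: dist_real_def)
     let ?S = "{s..t} \<inter> K1"
     have S: "compact ?S" "?S \<noteq> {}" using K1(1) True st by (auto intro!: compact_Int)
     \<comment> \<open>The first and the last contact parameter in [s, t]. Before s1 and after s2
       the interval avoids \<open>K1\<close>; between them it avoids \<open>Q\<close>.\<close>
     obtain s1 where s1: "s1 \<in> ?S" "\<And>y. y \<in> ?S \<Longrightarrow> s1 \<le> y" using compact_attains_inf[OF S] by blast
     obtain s2 where s2: "s2 \<in> ?S" "\<And>y. y \<in> ?S \<Longrightarrow> y \<le> s2" using compact_attains_sup[OF S] by blast
     show "P s t"
      unfolding P_def
     proof (intro impI, elim conjE)
      assume ab: "a \<le> s" "t \<le> b"
      have "x \<notin> K1" if "s < x" "x < s1" for x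
       using s1(1) s1(2)[of x] that by auto
      then have 1: "ennreal \<bar>g (ga s) - g (ga s1)\<bar> \<le> H {s<..s1}"
       using s1(1) ab by (intro lipc) auto
      have 2: "ennreal \<bar>g (ga s1) - g (ga s2)\<bar> \<le> H {s1<..s2}"
      proof (rule ugc)
       have "{s1..s2} \<subseteq> {s..t}" using s1 s2 by auto
       then show "{s1..s2} \<inter> Q = {}" using sub d by blast
      qed (use s1 s2 in auto)
      have "x \<notin> K1" if "s2 < x" "x < t" for x
       using s2(1) s2(2)[of x] that by auto
      then have 3: "ennreal \<bar>g (ga s2) - g (ga t)\<bar> \<le> H {s2<..t}"
       using s2(1) ab by (intro lipc) auto
      show "ennreal \<bar>g (ga s) - g (ga t)\<bar> \<le> H {s<..t}"
       using tri[OF _ _ tri[OF _ _ 1 2] 3] s1 s2 by auto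
     qed
    qed fact
   qed
  qed
  then have "ennreal \<bar>g (ga a) - g (ga b)\<bar> \<le> H {a<..b}" by (simp add: P_def)
  \<comment> \<open>The main terms are K on the excursions and \<rho> on the contact set.
    \<open>cN\<close> has measure zero, and the two regularity remainders cost e each.\<close>
  also have "... \<le> (emeasure mK ({a..b} - cF) + emeasure mK cN + emeasure mK (cF - cN - K1)) + (emeasure m\<rho> cF + emeasure m\<rho> ({a..b} - K1 - Q))"
   unfolding H_def
  proof (rule add_mono)
   have "{a<..b} - K1 \<subseteq> (({a..b} - cF) \<union> cN) \<union> (cF - cN - K1)" by auto
   then have "emeasure mK ({a<..b} - K1) \<le> emeasure mK ((({a..b} - cF) \<union> cN) \<union> (cF - cN - K1))"
    by (intro emeasure_mono) auto
   also have "... \<le> emeasure mK (({a..b} - cF) \<union> cN) + emeasure mK (cF - cN - K1)"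
    by (intro emeasure_subadditive) auto
   also have "... \<le> (emeasure mK ({a..b} - cF) + emeasure mK cN) + emeasure mK (cF - cN - K1)"
    by (intro add_right_mono emeasure_subadditive) auto
   finally show "emeasure mK ({a<..b} - K1) \<le> (emeasure mK ({a..b} - cF) + emeasure mK cN) + emeasure mK (cF - cN - K1)" .
   have "{a<..b} - Q \<subseteq> cF \<union> ({a..b} - K1 - Q)" using K1(2) by auto
   then have "emeasure m\<rho> ({a<..b} - Q) \<le> emeasure m\<rho> (cF \<union> ({a..b} - K1 - Q))"
    by (intro emeasure_mono) auto
   also have "... \<le> emeasure m\<rho> cF + emeasure m\<rho> ({a..b} - K1 - Q)"
    by (intro emeasure_subadditive) auto
   finally show "emeasure m\<rho> ({a<..b} - Q) \<le> emeasure m\<rho> cF + emeasure m\<rho> ({a..b} - K1 - Q)" .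
  qed
  also have "... \<le> (emeasure mK ({a..b} - cF) + 0 + ennreal e) + (emeasure m\<rho> cF + ennreal e)"
   using K1(3) Q(3) nullN by (intro add_mono) auto
  also have "... = (emeasure mK ({a..b} - cF) + emeasure m\<rho> cF) + ennreal (2 * e)"
   using e by (simp add: ac_simps flip: ennreal_plus)
  also have "emeasure mK ({a..b} - cF) + emeasure m\<rho> cF \<le> line_integral \<rho>' (a, b, ga)"
  proof -
   have "({a..b} - cF) \<inter> {a..b} = {a..b} - cF" "cF \<inter> {a..b} = cF" by (auto simp: cF_def)
   then have "emeasure mK ({a..b} - cF) + emeasure m\<rho> cF
    = (\<integral>\<^sup>+t. ennreal K * indicator ({a..b} - cF) t \<partial>lm) + (\<integral>\<^sup>+t\<in>cF. \<rho> (ga t) \<partial>lm)"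
    by (simp add: mK m\<rho> nn_integral_cmult)
   also have "... = (\<integral>\<^sup>+t. ennreal K * indicator ({a..b} - cF) t + \<rho> (ga t) * indicator cF t \<partial>lm)"
   proof (rule nn_integral_add[symmetric])
    have "(\<lambda>t. \<rho> (ga t) * indicator cF t) = (\<lambda>t. (\<rho> (ga t) * indicator {a..b} t) * indicator cF t)"
     by (auto simp: fun_eq_iff cF_def indicator_def)
    then show "(\<lambda>t. \<rho> (ga t) * indicator cF t) \<in> borel_measurable lm" by simp
   qed simp
   also have "... \<le> (\<integral>\<^sup>+t\<in>{a..b}. \<rho>' (ga t) \<partial>lm)"
    by (intro nn_integral_mono) (auto simp: \<rho>' cF_def indicator_def)
   finally show ?thesis by (simp add: line_integral_eq)
  qed
  finally show ?thesis by (simp add: add_right_mono)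
 qed
 show ?thesis
 proof (rule ennreal_le_epsilon)
  fix e :: real assume "0 < e"
  then show "ennreal \<bar>g (ga a) - g (ga b)\<bar> \<le> line_integral \<rho>' (a, b, ga) + ennreal e"
   using main[of "e / 2"] by simp
 qed
qed

end

section \<open>Self-improvement of the Poincare inequality\<close>

lemma lipschitz_borel_measurable:
 fixes g :: "'a::metric_space \<Rightarrow> real"
 assumes lip: "\<And>x y. \<bar>g x - g y\<bar> \<le> K * dist x y" and K: "0 \<le> K"
 shows "g \<in> borel_measurable borel"
proof (rule borel_measurable_continuous_onI, rule continuous_onI)
 fix x e assume "0 < (e::real)"
 then show "\<exists>d>0. \<forall>x'\<in>UNIV. dist x' x < d \<longrightarrow> dist (g x') (g x) \<le> e"
 proof (intro exI[of _ "e / (K + 1)"] conjI ballI impI)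
  fix x' assume "dist x' x < e / (K + 1)"
  then have "K * dist x' x \<le> (K + 1) * (e / (K + 1))" using K by (intro mult_mono) auto
  then show "dist (g x') (g x) \<le> e" using lip[of x' x] K by (simp add: dist_real_def)
 qed (use K in auto)
qed

lemma nn_integral_ball_lipschitz_finite:
 fixes h :: "'a::{metric_space,second_countable_topology} \<Rightarrow> real"
 assumes "emeasure M (ball x R) < \<infinity>" "ball x R \<in> sets M" "\<And>x y. \<bar>h x - h y\<bar> \<le> K * dist x y" "0 \<le> K"
 shows "(\<integral>\<^sup>+y\<in>ball x R. ennreal \<bar>h y\<bar> \<partial>M) < \<infinity>"
proof -
 have "(\<integral>\<^sup>+y\<in>ball x R. ennreal \<bar>h y\<bar> \<partial>M) \<le> (\<integral>\<^sup>+y. ennreal (\<bar>h x\<bar> + K * R) * indicator (ball x R) y \<partial>M)"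
 proof (intro nn_integral_mono)
  fix y
  show "ennreal \<bar>h y\<bar> * indicator (ball x R) y \<le> ennreal (\<bar>h x\<bar> + K * R) * indicator (ball x R) y"
  proof (cases "y \<in> ball x R")
   case True
   then have "K * dist x y \<le> K * R" using assms(4) by (intro mult_left_mono) auto
   then have "\<bar>h y\<bar> \<le> \<bar>h x\<bar> + K * R" using assms(3)[of x y] by linarith
   then show ?thesis by (intro mult_right_mono ennreal_leI) auto
  qed simp
 qed
 also have "... < \<infinity>" using assms by (simp add: nn_integral_cmult_indicator ennreal_mult_less_top)
 finally show ?thesis .
qed

text \<open>A sum of distinct powers of 2 is at most twice its largest term. The p-th power of the
  sum is therefore controlled with a constant independent of the number of terms, so that averaging
  over many truncation levels loses nothing.\<close>

lemma sum_powers_powr_le: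
 fixes A :: "nat set"
 assumes "finite A" "0 < p"
 shows "(\<Sum>j\<in>A. 2 ^ j) powr p \<le> 2 powr p * (\<Sum>j\<in>A. (2 ^ j) powr p :: real)"
proof (cases "A = {}")
 case False
 let ?m = "Max A"
 have m: "?m \<in> A" using assms False by simp
 have "(\<Sum>j\<in>A. 2 ^ j) \<le> (\<Sum>j\<le>?m. 2 ^ j :: real)"
  using assms by (intro sum_mono2) auto
 also have "... = 2 ^ Suc ?m - 1"
  by (simp add: lessThan_Suc_atMost[symmetric] sum_gp_strict[of 2] field_simps)
 also have "... \<le> 2 * 2 ^ ?m" by simp
 finally have "(\<Sum>j\<in>A. 2 ^ j) powr p \<le> (2 * 2 ^ ?m :: real) powr p"
  using assms by (intro powr_mono2) (auto intro: sum_nonneg)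
 also have "... = 2 powr p * (2 ^ ?m) powr p" by (simp add: powr_mult)
 also have "(2 ^ ?m :: real) powr p \<le> (\<Sum>j\<in>A. (2 ^ j) powr p)"
  using assms m by (intro member_le_sum) auto
 finally show ?thesis by simp
qed simp

lemma (in doubling_measure) dosc_perturb:
 fixes f h :: "'a \<Rightarrow> real"
 assumes [measurable]: "f \<in> borel_measurable M" "h \<in> borel_measurable M"
 shows "dosc M f x r \<le> dosc M h x r + 2 * (vol x r * (\<integral>\<^sup>+y\<in>ball x r. ennreal \<bar>f y - h y\<bar> \<partial>M))"
proof -
 let ?B = "ball x r"
 let ?I = "\<integral>\<^sup>+y\<in>?B. ennreal \<bar>f y - h y\<bar> \<partial>M"
 have inner: "(\<integral>\<^sup>+z\<in>?B. ennreal \<bar>f y - f z\<bar> \<partial>M)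
   \<le> (\<integral>\<^sup>+z\<in>?B. ennreal \<bar>h y - h z\<bar> \<partial>M) + (ennreal \<bar>f y - h y\<bar> * emeasure M ?B + ?I)" for y
 proof -
  have "(\<integral>\<^sup>+z\<in>?B. ennreal \<bar>f y - f z\<bar> \<partial>M)
   \<le> (\<integral>\<^sup>+z. ennreal \<bar>h y - h z\<bar> * indicator ?B z + (ennreal \<bar>f y - h y\<bar> * indicator ?B z + ennreal \<bar>f z - h z\<bar> * indicator ?B z) \<partial>M)"
  proof (intro nn_integral_mono)
   fix z
   have "ennreal \<bar>f y - f z\<bar> \<le> ennreal \<bar>h y - h z\<bar> + (ennreal \<bar>f y - h y\<bar> + ennreal \<bar>f z - h z\<bar>)"
    by (simp flip: ennreal_plus add: ennreal_leI)
   then show "ennreal \<bar>f y - f z\<bar> * indicator ?B z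
    \<le> ennreal \<bar>h y - h z\<bar> * indicator ?B z + (ennreal \<bar>f y - h y\<bar> * indicator ?B z + ennreal \<bar>f z - h z\<bar> * indicator ?B z)"
    by (cases "z \<in> ?B") auto
  qed
  also have "... = (\<integral>\<^sup>+z\<in>?B. ennreal \<bar>h y - h z\<bar> \<partial>M) + (ennreal \<bar>f y - h y\<bar> * emeasure M ?B + ?I)"
   by (simp add: nn_integral_add nn_integral_cmult_indicator)
  finally show ?thesis .
 qed
 have "dosc M f x r \<le> (\<integral>\<^sup>+y. (\<integral>\<^sup>+z\<in>?B. ennreal \<bar>h y - h z\<bar> \<partial>M) * indicator ?B y
   + (emeasure M ?B * (ennreal \<bar>f y - h y\<bar> * indicator ?B y) + ?I * indicator ?B y) \<partial>M)"
  unfolding dosc_def real_norm_def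
 proof (intro nn_integral_mono)
  fix y
  show "(\<integral>\<^sup>+z\<in>?B. ennreal \<bar>f y - f z\<bar> \<partial>M) * indicator ?B y
   \<le> (\<integral>\<^sup>+z\<in>?B. ennreal \<bar>h y - h z\<bar> \<partial>M) * indicator ?B y
   + (emeasure M ?B * (ennreal \<bar>f y - h y\<bar> * indicator ?B y) + ?I * indicator ?B y)"
   using inner[of y] by (cases "y \<in> ?B") (auto simp: ac_simps)
 qed
 also have "... = dosc M h x r + (emeasure M ?B * ?I + ?I * emeasure M ?B)"
  unfolding dosc_def real_norm_def
  by (subst nn_integral_add, measurable, subst nn_integral_add, measurable)
   (simp add: nn_integral_cmult nn_integral_cmult_indicator)
 finally show ?thesis by (simp add: mult_2 ac_simps)
qed

text \<open>In this form of the inequality the mean oscillation over the ball is at least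
  \<open>A\<close> times the radius, which avoids averages of w. The gradient inequality for g is
  tested only on curves with finite \<rho>-integral, so \<rho> plays the witness of negligibility in
  the weak gradient. With L >= 2 the doubled ball lies in the enlarged one.\<close>

locale poincare_space = doubling_measure M D + complete_measure M
 for M :: "'a::{metric_space,second_countable_topology} measure" and D +
 fixes p C L :: real
 assumes p: "1 < p" and C_ge_1: "1 \<le> C" and L_ge_2: "2 \<le> L"
  and borel_hull: "A \<in> sets M \<Longrightarrow> \<exists>B\<in>sets borel. A \<subseteq> B \<and> emeasure M B = emeasure M A"
  and poincare: "\<And>w g \<rho> x r A. \<lbrakk>0 < r; w \<in> borel_measurable M; \<And>x R. (\<integral>\<^sup>+y\<in>ball x R. ennreal \<bar>w y\<bar> \<partial>M) < \<infinity>;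
   g \<in> borel_measurable borel; \<rho> \<in> borel_measurable borel; Lp_nonneg p M \<rho>;
   \<And>a b ga. (a, b, ga) \<in> curves_in UNIV \<Longrightarrow> line_integral \<rho> (a, b, ga) < \<infinity> \<Longrightarrow>
    ennreal \<bar>w (ga a) - w (ga b)\<bar> \<le> line_integral g (a, b, ga);
   0 \<le> A; ennreal (A * r) * (vol x r)\<^sup>2 \<le> dosc M w x r\<rbrakk> \<Longrightarrow>
   ennreal (A powr p) * vol x r \<le> ennreal C * (\<integral>\<^sup>+y\<in>ball x (L * r). ennreal_powr (g y) p \<partial>M)"
begin

sublocale ld: local_doubling M UNIV "{0<..}" D
 using D_ge_1 ball_pos ball_finite doubling sets_M
 by unfold_locales (auto intro: exI[of _ 1])

lemma null_hull:
 assumes "N \<in> null_sets M"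
 obtains N' where "N \<subseteq> N'" "N' \<in> null_sets M" "N' \<in> sets borel"
proof -
 obtain B where "B \<in> sets borel" "N \<subseteq> B" "emeasure M B = emeasure M N"
  using borel_hull[of N] assms by auto
 moreover from this have "B \<in> null_sets M" using assms sets_M by (auto simp: null_sets_def)
 ultimately show ?thesis using that by blast
qed

end

text \<open>All oscillation estimates are uniform over a family of functions sharing the upper gradient
 \<open>\<rho>\<close>; the family is applied to the distance functions of a Banach-valued map to a dense set.\<close>

locale gradient_family = poincare_space M D p C L
 for M :: "'a::{metric_space,second_countable_topology} measure" and D p C L +
 fixes \<F> :: "('a \<Rightarrow> real) set" and \<rho> :: "'a \<Rightarrow> ennreal"
 assumes family_measurable: "f \<in> \<F> \<Longrightarrow> f \<in> borel_measurable M"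
  and family_integrable: "f \<in> \<F> \<Longrightarrow> (\<integral>\<^sup>+y\<in>ball x R. ennreal \<bar>f y\<bar> \<partial>M) < \<infinity>"
  and \<rho>_borel [measurable]: "\<rho> \<in> borel_measurable borel" and \<rho>_Lp: "Lp_nonneg p M \<rho>"
  and family_gradient: "f \<in> \<F> \<Longrightarrow> (a, b, ga) \<in> curves_in UNIV \<Longrightarrow>
   ennreal \<bar>f (ga a) - f (ga b)\<bar> \<le> line_integral \<rho> (a, b, ga)"
begin

lemma \<rho>_M [measurable]: "\<rho> \<in> borel_measurable M" by (rule borel_measurable_M[OF \<rho>_borel])

section \<open>Bad balls and Lipschitz truncation\<close>

definition bad :: "real \<Rightarrow> ('a \<times> real) set" where
 "bad \<tau> = {(a, r). 0 < r \<and> (\<exists>f\<in>\<F>. ennreal (\<tau> * r) * (vol a r)\<^sup>2 < dosc M f a r)}"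

text \<open>A superlevel set of the uncentred maximal oscillation, taken over the whole family at
  once. Using the union of the bad balls, and not their centres, makes it open.\<close>

definition U :: "real \<Rightarrow> 'a set" where "U \<tau> = (\<Union>q\<in>bad \<tau>. ball (fst q) (snd q))"

lemma open_U [simp, intro]: "open (U \<tau>)" unfolding U_def by auto

lemma U_sets [measurable]: "U \<tau> \<in> sets M" by simp

lemma bad_mono: "\<tau> \<le> \<tau>' \<Longrightarrow> bad \<tau>' \<subseteq> bad \<tau>"
proof -
 assume le: "\<tau> \<le> \<tau>'"
 have "ennreal (\<tau> * r) * (vol a r)\<^sup>2 \<le> ennreal (\<tau>' * r) * (vol a r)\<^sup>2" if "0 < r" for a r
  using that le by (intro mult_right_mono ennreal_leI) auto
 then show ?thesis unfolding bad_def by (auto intro: le_less_trans)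
qed

lemma U_mono: "\<tau> \<le> \<tau>' \<Longrightarrow> U \<tau>' \<subseteq> U \<tau>"
 unfolding U_def using bad_mono by blast

lemma dosc_le_off_U:
 assumes "f \<in> \<F>" "x \<notin> U \<tau>" "x \<in> ball a r"
 shows "dosc M f a r \<le> ennreal (\<tau> * r) * (vol a r)\<^sup>2"
proof (rule ccontr)
 assume "\<not> ?thesis"
 moreover have "0 < r" using assms(3) by (auto intro: le_less_trans[OF zero_le_dist])
 ultimately have "(a, r) \<in> bad \<tau>" using assms(1) by (auto simp: bad_def not_le)
 then show False using assms(2,3) by (force simp: U_def)
qed

text \<open>Off the bad set f is Lipschitz by \<open>lipschitz_approximation\<close>, and g is the
  McShane extension from there. Inside, at distance d from the complement, f and g are compared on a
  ball of radius 5 d about a nearby good point, with an error of order \<tau> d times the measure.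
  As d <= r by assumption, Vitali adds this up to \<tau> r times the measure of the bad set. The
  constant is 50 D^4 + 150 D^5 <= 200 D^5.\<close>

lemma truncation:
 assumes f: "f \<in> \<F>" and \<tau>: "0 < \<tau>" and ne: "U \<tau> \<noteq> UNIV"
 obtains g N where
  "\<And>x y. \<bar>g x - g y\<bar> \<le> 30 * D ^ 3 * \<tau> * dist x y"
  "N \<in> null_sets M" "N \<in> sets borel" "\<And>x. x \<in> - U \<tau> - N \<Longrightarrow> g x = f x"
  "\<And>a r. 0 < r \<Longrightarrow> (\<And>x. x \<in> ball a r \<Longrightarrow> infdist x (- U \<tau>) \<le> r) \<Longrightarrow>
   (\<integral>\<^sup>+y\<in>ball a r. ennreal \<bar>f y - g y\<bar> \<partial>M) \<le> ennreal (200 * D ^ 5 * \<tau> * r) * emeasure M (U \<tau> \<inter> ball a (2 * r))"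
proof -
 note fm [measurable] = family_measurable[OF f]
 define F where "F = - U \<tau>"
 have F: "closed F" "F \<noteq> {}" using ne by (auto simp: F_def closed_def)
 define K where "K = 30 * D ^ 3 * \<tau>"
 have K: "0 \<le> K" using D_ge_1 \<tau> by (simp add: K_def)
 obtain g0 where g0: "\<And>x t. x \<in> F \<Longrightarrow> t \<in> {0<..} \<Longrightarrow>
   (\<integral>\<^sup>+y\<in>ball x t. ennreal \<bar>f y - g0 x\<bar> \<partial>M) \<le> ennreal (10 * D * \<tau> * t) * vol x t"
  "\<And>x y. x \<in> F \<Longrightarrow> y \<in> F \<Longrightarrow> 2 * dist x y \<in> {0<..} \<Longrightarrow> \<bar>g0 x - g0 y\<bar> \<le> 30 * D ^ 3 * \<tau> * dist x y"
  "AE x in M. x \<in> F \<longrightarrow> f x = g0 x"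
 proof (rule ld.lipschitz_approximation[OF fm, of F \<tau>])
  show "F \<in> sets M" using F by auto
  show "dosc M f x t \<le> ennreal (\<tau> * t) * (vol x t)\<^sup>2" if "x \<in> F" "t \<in> {0<..}" for x t
   using that f by (intro dosc_le_off_U[of f x]) (auto simp: F_def)
 qed (use \<tau> in auto)
 obtain g where g: "\<And>x. x \<in> F \<Longrightarrow> g x = g0 x" "\<And>x y. \<bar>g x - g y\<bar> \<le> K * dist x y"
 proof (rule mcshane_extension[of F K g0])
  show "\<bar>g0 x - g0 y\<bar> \<le> K * dist x y" if "x \<in> F" "y \<in> F" for x y
   using g0(2)[OF that] by (cases "x = y") (auto simp: K_def)
 qed (use F K in auto)
 have gm [measurable]: "g \<in> borel_measurable M"
  by (rule borel_measurable_M[OF lipschitz_borel_measurable[OF g(2) K]])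
 obtain N0 where N0: "N0 \<in> null_sets M" "{x \<in> space M. \<not> (x \<in> F \<longrightarrow> f x = g0 x)} \<subseteq> N0"
  using g0(3) by (auto elim!: AE_E simp: null_sets_def)
 obtain N where N: "N0 \<subseteq> N" "N \<in> null_sets M" "N \<in> sets borel" by (rule null_hull[OF N0(1)])
 have gf: "g x = f x" if "x \<in> F - N" for x using that N0 N g(1) by force
 have E: "(\<integral>\<^sup>+y\<in>ball a r. ennreal \<bar>f y - g y\<bar> \<partial>M) \<le> ennreal (200 * D ^ 5 * \<tau> * r) * emeasure M (U \<tau> \<inter> ball a (2 * r))"
  if r: "0 < r" and near: "\<And>x. x \<in> ball a r \<Longrightarrow> infdist x F \<le> r" for a r
 proof -
  define w where "w x = ennreal \<bar>f x - g x\<bar>" for x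
  have [measurable]: "w \<in> borel_measurable M" unfolding w_def[abs_def] by measurable
  define c where "c = 200 * D ^ 5 * \<tau> * r"
  have c: "0 \<le> c" using D_ge_1 \<tau> r by (simp add: c_def)
  \<comment> \<open>These balls stay inside U \<tau>; after the Vitali selection they take the place
    of a Whitney covering.\<close>
  define P where "P = (\<lambda>x. (x, infdist x F)) ` (ball a r \<inter> U \<tau>)"
  define \<alpha> where "\<alpha> = density M w"
  define \<nu> where "\<nu> = density M (\<lambda>_. ennreal c)"
  have Um: "(\<Union>q\<in>P. ball (fst q) (snd q)) \<in> sets M" by (intro open_sets_M open_UN) auto
  have pos: "0 < infdist x F" if "x \<in> U \<tau>" for x
   using that F by (subst infdist_pos_not_in_closed) (auto simp: F_def)
  have ballU: "ball x (infdist x F) \<subseteq> U \<tau>" for x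
  proof
   fix y assume "y \<in> ball x (infdist x F)"
   then have "y \<notin> F" using infdist_le[of y F x] by auto
   then show "y \<in> U \<tau>" by (simp add: F_def)
  qed
  have "(\<integral>\<^sup>+y\<in>ball a r. w y \<partial>M) \<le> (\<integral>\<^sup>+y\<in>(\<Union>q\<in>P. ball (fst q) (snd q)). w y \<partial>M)"
  proof (rule nn_integral_mono_AE)
   have "AE y in M. y \<notin> N" using N(2) by (rule AE_not_in)
   then show "AE y in M. w y * indicator (ball a r) y \<le> w y * indicator (\<Union>q\<in>P. ball (fst q) (snd q)) y"
   proof eventually_elim
    case (elim y)
    show ?case
    proof (cases "y \<in> ball a r")
     case True
     show ?thesis
     proof (cases "y \<in> U \<tau>")
      case U: True
      then have "y \<in> (\<Union>q\<in>P. ball (fst q) (snd q))"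
       using True pos[OF U] by (auto simp: P_def intro!: bexI[of _ y])
      then show ?thesis by (simp add: indicator_def)
     next
      case False
      then have "w y = 0" using gf[of y] elim by (simp add: w_def F_def)
      then show ?thesis by simp
     qed
    qed simp
   qed
  qed
  also have "... = emeasure \<alpha> (\<Union>q\<in>P. ball (fst q) (snd q))"
   unfolding \<alpha>_def using Um by (subst emeasure_density) auto
  also have "... \<le> emeasure \<nu> (\<Union>q\<in>P. ball (fst q) (snd q))"
  proof (rule vitali_emeasure_le)
   fix x d assume "(x, d) \<in> P"
   then have x: "x \<in> ball a r" "x \<in> U \<tau>" "d = infdist x F" by (auto simp: P_def)
   have d: "0 < d" "d \<le> r" using pos near x by auto
   obtain z where z: "z \<in> F" "dist x z < 2 * d"
   proof -
    have "infdist x F < 2 * d" using x d by simp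
    then show ?thesis using that F(2) by (auto simp: infdist_notempty cInf_less_iff)
   qed
   have "emeasure \<alpha> (ball x (3 * d)) = (\<integral>\<^sup>+y\<in>ball x (3 * d). w y \<partial>M)"
    unfolding \<alpha>_def by (subst emeasure_density) auto
   also have "... \<le> (\<integral>\<^sup>+y. ennreal \<bar>f y - g0 z\<bar> * indicator (ball z (5 * d)) y + ennreal (K * (5 * d)) * indicator (ball x (3 * d)) y \<partial>M)"
   proof (intro nn_integral_mono)
    fix y
    show "w y * indicator (ball x (3 * d)) y \<le> ennreal \<bar>f y - g0 z\<bar> * indicator (ball z (5 * d)) y + ennreal (K * (5 * d)) * indicator (ball x (3 * d)) y"
    proof (cases "y \<in> ball x (3 * d)")
     case True
     then have zy: "dist z y < 5 * d" using z dist_triangle[of z y x] by (simp add: dist_commute)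
     then have "\<bar>g z - g y\<bar> \<le> K * (5 * d)"
      using g(2)[of z y] K mult_left_mono[of "dist z y" "5 * d" K] by linarith
     then have "\<bar>f y - g y\<bar> \<le> \<bar>f y - g0 z\<bar> + K * (5 * d)" using g(1)[OF z(1)] by linarith
     then have "w y \<le> ennreal \<bar>f y - g0 z\<bar> + ennreal (K * (5 * d))"
      unfolding w_def using K d by (simp flip: ennreal_plus add: ennreal_leI)
     then show ?thesis using True zy by simp
    qed simp
   qed
   also have "... = (\<integral>\<^sup>+y\<in>ball z (5 * d). ennreal \<bar>f y - g0 z\<bar> \<partial>M) + ennreal (K * (5 * d)) * vol x (3 * d)"
    by (simp add: nn_integral_add nn_integral_cmult_indicator)
   also have "... \<le> ennreal (10 * D * \<tau> * (5 * d)) * (ennreal (D ^ 3) * vol x d) + ennreal (K * (5 * d)) * (ennreal (D ^ 2) * vol x d)"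
   proof (rule add_mono)
    \<comment> \<open>The centres are less than 2 d apart, and 2 d + 5 d <= 2^3 d.\<close>
    have "vol z (5 * d) \<le> ennreal (D ^ 3) * vol x d"
     using z d by (intro ball_le) auto
    then show "(\<integral>\<^sup>+y\<in>ball z (5 * d). ennreal \<bar>f y - g0 z\<bar> \<partial>M) \<le> ennreal (10 * D * \<tau> * (5 * d)) * (ennreal (D ^ 3) * vol x d)"
     using d by (intro order_trans[OF g0(1)[OF z(1)] mult_left_mono]) auto
    have "vol x (3 * d) \<le> ennreal (D ^ 2) * vol x d"
     using d by (intro ball_le) auto
    then show "ennreal (K * (5 * d)) * vol x (3 * d) \<le> ennreal (K * (5 * d)) * (ennreal (D ^ 2) * vol x d)"
     by (intro mult_left_mono) auto
   qed
   also have "... = ennreal (50 * D ^ 4 * \<tau> * d + 150 * D ^ 5 * \<tau> * d) * vol x d"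
   proof -
    have 1: "10 * D * \<tau> * (5 * d) * D ^ 3 = 50 * D ^ 4 * \<tau> * d" by (simp add: power3_eq_cube power4_eq_xxxx)
    have 2: "K * (5 * d) * D ^ 2 = 150 * D ^ 5 * \<tau> * d"
     unfolding K_def by (simp add: power_add[symmetric] mult_ac flip: power_add)
    have "0 \<le> D" using D_ge_1 by simp
    then have a: "ennreal (10 * D * \<tau> * (5 * d)) * (ennreal (D ^ 3) * vol x d) = ennreal (50 * D ^ 4 * \<tau> * d) * vol x d"
     and b: "ennreal (K * (5 * d)) * (ennreal (D ^ 2) * vol x d) = ennreal (150 * D ^ 5 * \<tau> * d) * vol x d"
     unfolding 1[symmetric] 2[symmetric] using K \<tau> d by (auto intro!: ennreal_mult_collect)
    show ?thesis unfolding a b using \<open>0 \<le> D\<close> \<tau> d by (intro ennreal_add_collect) auto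
   qed
   also have "... \<le> ennreal c * vol x d"
   proof (intro mult_right_mono ennreal_leI)
    have "D ^ 4 \<le> D ^ 5" using D_ge_1 by (intro power_increasing) auto
    then have "50 * D ^ 4 * (\<tau> * d) \<le> 50 * D ^ 5 * (\<tau> * d)" using \<tau> d by (intro mult_right_mono) auto
    then have "50 * D ^ 4 * \<tau> * d + 150 * D ^ 5 * \<tau> * d \<le> 200 * D ^ 5 * \<tau> * d" by (simp add: mult_ac)
    also have "... \<le> c" unfolding c_def using d D_ge_1 \<tau> by (intro mult_left_mono) auto
    finally show "50 * D ^ 4 * \<tau> * d + 150 * D ^ 5 * \<tau> * d \<le> c" .
   qed auto
   also have "... = emeasure \<nu> (ball x d)"
    unfolding \<nu>_def by (subst emeasure_density) (auto simp: nn_integral_cmult_indicator)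
   finally show "0 < d \<and> emeasure \<alpha> (ball x (3 * d)) \<le> emeasure \<nu> (ball x d)" using d by simp
  qed (use sets_M in \<open>auto simp: \<alpha>_def \<nu>_def\<close>)
  also have "... = ennreal c * emeasure M (\<Union>q\<in>P. ball (fst q) (snd q))"
   unfolding \<nu>_def using Um by (subst emeasure_density) (auto simp: nn_integral_cmult_indicator)
  also have "... \<le> ennreal c * emeasure M (U \<tau> \<inter> ball a (2 * r))"
  proof (intro mult_left_mono emeasure_mono UN_least)
   fix q assume "q \<in> P"
   then obtain x where x: "x \<in> ball a r" "q = (x, infdist x F)" by (auto simp: P_def)
   then have "ball x (infdist x F) \<subseteq> ball a (2 * r)" using near[OF x(1)] by (intro ball_subset_ball) auto
   then show "ball (fst q) (snd q) \<subseteq> U \<tau> \<inter> ball a (2 * r)" using ballU x by auto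
  qed auto
  finally show ?thesis by (simp add: w_def c_def)
 qed
 show ?thesis
  by (rule that[of g N]) (use g(2) N gf E in \<open>auto simp: K_def F_def\<close>)
qed

end

section \<open>Averaged truncations on one bad ball\<close>

context gradient_family
begin

text \<open>Up to a constant, this dominates the p-th power of the gradient of the averaged
  truncation: a truncation at level 2^j lam has Lipschitz constant of order 2^j lam on its bad set
  and enters the average with weight 1/k, while off the last bad set \<rho> itself appears.\<close>

definition W :: "real \<Rightarrow> nat \<Rightarrow> 'a \<Rightarrow> ennreal" where
 "W lam k x = (\<Sum>j\<in>{k..2 * k}. ennreal ((2 ^ j * lam / k) powr p) * indicator (U (2 ^ j * lam)) x)
  + ennreal_powr (\<rho> x) p * indicator (- U (2 ^ (2 * k) * lam)) x"

lemma W_measurable [measurable]: "W lam k \<in> borel_measurable M"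
 unfolding W_def[abs_def] by measurable

text \<open>The left-hand side is k^p 2^(j(1-p)), which decreases in j because p > 1. The truncation
  error therefore has to be made small only at level k.\<close>

lemma level_ratio_le:
 assumes "k \<le> (j::nat)"
 shows "2 ^ j * (real k / 2 ^ j) powr p \<le> 2 ^ k * (real k / 2 ^ k) powr p"
proof -
 have eq: "2 ^ i * (real k / 2 ^ i) powr p = real k powr p * (2 ^ i) powr (1 - p)" for i :: nat
  by (simp add: powr_divide powr_diff)
 have "(2 ^ j) powr (1 - p) \<le> (2 ^ k :: real) powr (1 - p)"
  using assms p by (intro powr_mono2') (auto intro: power_increasing)
 then show ?thesis unfolding eq by (intro mult_left_mono) auto
qed

text \<open>Averaging the truncations at the levels \<open>2\<^sup>j lam\<close>, \<open>k < j \<le> 2k\<close>, divides the gradient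
 on \<open>U (2\<^sup>j lam)\<close> by \<open>k\<close>; since \<open>p > 1\<close> this gain \<open>k\<^sup>-\<^sup>p\<close> beats the \<open>k + 1\<close> levels in \<^const>\<open>W\<close>.\<close>

lemma bad_ball_estimate:
 fixes k :: nat
 assumes k: "1 \<le> k" "D * (k / 2 ^ k) powr p < 1" "800 * D ^ 5 * (2 ^ k * (k / 2 ^ k) powr p) \<le> 1"
  and lam: "0 < lam" and bad: "(a, r) \<in> bad lam"
 shows "ennreal (lam powr p) * vol a r
  \<le> ennreal (C * (240 * D ^ 3) powr p) * (\<integral>\<^sup>+x\<in>ball a (L * r). W lam k x \<partial>M)"
proof -
 obtain f where f: "f \<in> \<F>" and r: "0 < r"
  and osc: "ennreal (lam * r) * (vol a r)\<^sup>2 < dosc M f a r"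
  using bad by (auto simp: bad_def)
 note fm [measurable] = family_measurable[OF f]
 define V where "V = vol a r"
 have V: "0 < V" "V < \<infinity>" using ball_pos[OF r] ball_finite by (auto simp: V_def)
 define \<tau> where "\<tau> j = 2 ^ j * lam" for j :: nat
 have \<tau>: "0 < \<tau> j" for j using lam by (simp add: \<tau>_def)
 define B where "B = ball a (L * r)"
 have B2: "ball a (2 * r) \<subseteq> B" unfolding B_def using L_ge_2 r by (intro subset_ball) auto
 have D0: "0 \<le> D" "1 \<le> D ^ 3" using D_ge_1 by auto
 have "1 \<le> (240 * D ^ 3) powr p" using D0 p by (intro ge_one_powr_ge_zero) auto
 then have C1: "1 \<le> C * (240 * D ^ 3) powr p" using C_ge_1 mult_mono[of 1 C 1 "(240 * D ^ 3) powr p"] by simp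
 show ?thesis
 \<comment> \<open>Either one bad set fills a definite part of the enlarged ball, and then its own
   term in \<open>W\<close> is already large enough; or all of them are so small that truncation
   hardly changes f on the ball.\<close>
 proof (cases "\<exists>j\<in>{k..2 * k}. ennreal ((k / 2 ^ j) powr p) * V < emeasure M (U (\<tau> j) \<inter> B)")
  case True
  then obtain j where j: "j \<in> {k..2 * k}" "ennreal ((k / 2 ^ j) powr p) * V < emeasure M (U (\<tau> j) \<inter> B)" by auto
  have "lam powr p = (\<tau> j / k) powr p * (k / 2 ^ j) powr p"
   using lam k by (simp add: \<tau>_def powr_mult[symmetric])
  then have "ennreal (lam powr p) * V = ennreal ((\<tau> j / k) powr p) * (ennreal ((k / 2 ^ j) powr p) * V)"
   by (simp add: ennreal_mult mult.assoc)
  also have "... \<le> ennreal ((\<tau> j / k) powr p) * emeasure M (U (\<tau> j) \<inter> B)"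
   using j by (intro mult_left_mono) auto
  also have "... = (\<integral>\<^sup>+x. ennreal ((\<tau> j / k) powr p) * indicator (U (\<tau> j) \<inter> B) x \<partial>M)"
   by (simp add: nn_integral_cmult_indicator B_def)
  also have "... \<le> (\<integral>\<^sup>+x\<in>B. W lam k x \<partial>M)"
  proof (intro nn_integral_mono)
   fix x
   have "ennreal ((\<tau> j / k) powr p) * indicator (U (\<tau> j)) x \<le> W lam k x"
    unfolding W_def \<tau>_def
    by (intro add_increasing2 member_le_sum[where f = "\<lambda>j. ennreal ((2 ^ j * lam / k) powr p) * indicator (U (2 ^ j * lam)) x"] j) auto
   then show "ennreal ((\<tau> j / k) powr p) * indicator (U (\<tau> j) \<inter> B) x \<le> W lam k x * indicator B x"
    by (auto simp: indicator_def)
  qed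
  also have "... = ennreal 1 * (\<integral>\<^sup>+x\<in>B. W lam k x \<partial>M)" by simp
  also have "... \<le> ennreal (C * (240 * D ^ 3) powr p) * (\<integral>\<^sup>+x\<in>B. W lam k x \<partial>M)"
   using C1 by (intro mult_right_mono ennreal_leI) auto
  finally show ?thesis by (simp add: V_def B_def)
 next
  case False
  then have small: "emeasure M (U (\<tau> j) \<inter> B) \<le> ennreal ((k / 2 ^ j) powr p) * V" if "j \<in> {k..2 * k}" for j
   using that by (auto simp: not_less)
  define J where "J = {k + 1..2 * k}"
  have J: "finite J" "card J = k" "J \<subseteq> {k..2 * k}" by (auto simp: J_def)
  \<comment> \<open>Otherwise a ball of radius r would lie in a bad set, which its small measure and
    D (k/2^k)^p < 1 forbid. \<open>truncation\<close> can then be used on the ball of radius r about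
    a.\<close>
  have near: "\<exists>y\<in>- U (\<tau> j). dist x y < r" if j: "j \<in> J" and x: "x \<in> ball a r" for j x
  proof (rule ccontr)
   assume "\<not> ?thesis"
   then have sub: "ball x r \<subseteq> U (\<tau> j)" by auto
   have "ball x r \<subseteq> ball a (2 * r)" using x by (intro ball_subset_ball) auto
   then have "vol x r \<le> emeasure M (U (\<tau> j) \<inter> B)"
    using sub B2 by (intro emeasure_mono) (auto simp: B_def)
   also have "... \<le> ennreal ((k / 2 ^ j) powr p) * V" using small j J by auto
   finally have "ennreal D * vol x r \<le> ennreal D * (ennreal ((k / 2 ^ j) powr p) * V)"
    by (intro mult_left_mono) auto
   moreover have "V \<le> ennreal (D ^ 1) * vol x r"
    unfolding V_def using x r by (intro ball_le) (auto simp: dist_commute)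
   ultimately have "V \<le> ennreal D * (ennreal ((k / 2 ^ j) powr p) * V)" by (auto intro: order_trans)
   also have "... = ennreal (D * (k / 2 ^ j) powr p) * V" using D0 by (simp add: ennreal_mult_collect)
   finally have "1 * V \<le> ennreal (D * (k / 2 ^ j) powr p) * V" by simp
   then have "1 \<le> ennreal (D * (k / 2 ^ j) powr p)"
    by (rule ennreal_mult_le_cancel_right) (use V in auto)
   then have "1 \<le> D * (k / 2 ^ j) powr p" by (simp flip: ennreal_1 add: ennreal_le_iff2)
   also have "(k / 2 ^ j) powr p \<le> (k / 2 ^ k) powr p"
   proof (rule powr_mono2)
    show "real k / 2 ^ j \<le> real k / 2 ^ k"
     using j J by (intro divide_left_mono power_increasing) auto
   qed (use p in auto)
   finally show False using k D0 by (simp add: mult_left_mono)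
  qed
  define Tr where "Tr j G \<longleftrightarrow>
    (\<forall>x y. \<bar>fst G x - fst G y\<bar> \<le> 30 * D ^ 3 * \<tau> j * dist x y) \<and>
    snd G \<in> null_sets M \<and> snd G \<in> sets borel \<and> (\<forall>x\<in>- U (\<tau> j) - snd G. fst G x = f x) \<and>
    (\<integral>\<^sup>+y\<in>ball a r. ennreal \<bar>f y - fst G y\<bar> \<partial>M) \<le> ennreal (200 * D ^ 5 * \<tau> j * r) * emeasure M (U (\<tau> j) \<inter> ball a (2 * r))"
   for j and G :: "('a \<Rightarrow> real) \<times> 'a set"
  have "\<forall>j\<in>J. \<exists>G. Tr j G"
  proof
   fix j assume j: "j \<in> J"
   have "U (\<tau> j) \<noteq> UNIV" using near[OF j, of a] r by auto
   then obtain g N where gN: "\<And>x y. \<bar>g x - g y\<bar> \<le> 30 * D ^ 3 * \<tau> j * dist x y"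
    "N \<in> null_sets M" "N \<in> sets borel" "\<And>x. x \<in> - U (\<tau> j) - N \<Longrightarrow> g x = f x"
    "\<And>a r. 0 < r \<Longrightarrow> (\<And>x. x \<in> ball a r \<Longrightarrow> infdist x (- U (\<tau> j)) \<le> r) \<Longrightarrow>
     (\<integral>\<^sup>+y\<in>ball a r. ennreal \<bar>f y - g y\<bar> \<partial>M) \<le> ennreal (200 * D ^ 5 * \<tau> j * r) * emeasure M (U (\<tau> j) \<inter> ball a (2 * r))"
    using truncation[OF f \<tau>[of j]] by blast
   have "infdist x (- U (\<tau> j)) \<le> r" if "x \<in> ball a r" for x
    using near[OF j that] infdist_le[of _ "- U (\<tau> j)" x] by (meson less_imp_le order_trans)
   then have "Tr j (g, N)" unfolding Tr_def using gN r by auto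
   then show "\<exists>G. Tr j G" ..
  qed
  from bchoice[OF this] obtain G where G: "\<And>j. j \<in> J \<Longrightarrow> Tr j (G j)" by blast
  define g where "g j = fst (G j)" for j
  define N where "N j = snd (G j)" for j
  have glip: "\<bar>g j x - g j y\<bar> \<le> 30 * D ^ 3 * \<tau> j * dist x y" if "j \<in> J" for j x y
   using G[OF that] by (simp add: Tr_def g_def)
  have N: "N j \<in> null_sets M" "N j \<in> sets borel" if "j \<in> J" for j
   using G[OF that] by (auto simp: Tr_def N_def)
  have gf: "g j x = f x" if "j \<in> J" "x \<in> - U (\<tau> j) - N j" for j x
   using G[OF that(1)] that(2) by (auto simp: Tr_def g_def N_def)
  \<comment> \<open>The error enters \<open>dosc_perturb\<close> twice, so lam/4 uses up half of the
    oscillation lam and leaves lam/2 for the average h.\<close>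
  have gE: "(\<integral>\<^sup>+y\<in>ball a r. ennreal \<bar>f y - g j y\<bar> \<partial>M) \<le> ennreal (lam / 4 * r) * V" if j: "j \<in> J" for j
  proof -
   have "(\<integral>\<^sup>+y\<in>ball a r. ennreal \<bar>f y - g j y\<bar> \<partial>M) \<le> ennreal (200 * D ^ 5 * \<tau> j * r) * emeasure M (U (\<tau> j) \<inter> ball a (2 * r))"
    using G[OF j] by (simp add: Tr_def g_def)
   also have "... \<le> ennreal (200 * D ^ 5 * \<tau> j * r) * emeasure M (U (\<tau> j) \<inter> B)"
    using B2 by (intro mult_left_mono emeasure_mono) (auto simp: B_def)
   also have "... \<le> ennreal (200 * D ^ 5 * \<tau> j * r) * (ennreal ((k / 2 ^ j) powr p) * V)"
    using small j J by (intro mult_left_mono) auto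
   also have "... = ennreal (200 * D ^ 5 * \<tau> j * r * (k / 2 ^ j) powr p) * V"
    using D0 \<tau>[of j] r by (simp add: ennreal_mult_collect)
   also have "... \<le> ennreal (lam / 4 * r) * V"
   proof (intro mult_right_mono ennreal_leI)
    have "2 ^ j * (real k / 2 ^ j) powr p \<le> 2 ^ k * (real k / 2 ^ k) powr p"
     using j by (intro level_ratio_le) (auto simp: J_def)
    then have "800 * D ^ 5 * (2 ^ j * (real k / 2 ^ j) powr p) \<le> 800 * D ^ 5 * (2 ^ k * (real k / 2 ^ k) powr p)"
     using D0 by (intro mult_left_mono) auto
    also have "... \<le> 1" by (rule k)
    finally have "(lam * r / 4) * (800 * D ^ 5 * (2 ^ j * (real k / 2 ^ j) powr p)) \<le> (lam * r / 4) * 1"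
     using lam r by (intro mult_left_mono) auto
    then show "200 * D ^ 5 * \<tau> j * r * (k / 2 ^ j) powr p \<le> lam / 4 * r" by (simp add: \<tau>_def mult_ac)
   qed auto
   finally show ?thesis .
  qed
  have gc: "g j \<in> borel_measurable borel" if "j \<in> J" for j
   using glip[OF that] by (rule lipschitz_borel_measurable) (use D0 \<tau>[of j] in simp)
  define h where "h x = (\<Sum>j\<in>J. g j x) / k" for x
  have k0: "0 < real k" using k by simp
  have hm: "h \<in> borel_measurable borel" unfolding h_def[abs_def] using gc by (intro borel_measurable_divide borel_measurable_sum) auto
  note hM [measurable] = borel_measurable_M[OF hm]
  have gM [measurable]: "g j \<in> borel_measurable M" if "j \<in> J" for j using borel_measurable_M[OF gc[OF that]] .
  have hdiff: "\<bar>h x - h y\<bar> \<le> (\<Sum>j\<in>J. \<bar>g j x - g j y\<bar> / k)" for x y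
  proof -
   have "h x - h y = (\<Sum>j\<in>J. (g j x - g j y) / k)"
    by (simp add: h_def sum_subtractf sum_divide_distrib diff_divide_distrib)
   also have "\<bar>...\<bar> \<le> (\<Sum>j\<in>J. \<bar>(g j x - g j y) / k\<bar>)" by (rule sum_abs)
   finally show ?thesis by simp
  qed
  have hf: "\<bar>f y - h y\<bar> \<le> (\<Sum>j\<in>J. \<bar>f y - g j y\<bar> / k)" for y
  proof -
   have "f y = (\<Sum>j\<in>J. f y / k)" using J k0 by simp
   then have "f y - h y = (\<Sum>j\<in>J. (f y - g j y) / k)"
    by (simp add: h_def sum_subtractf sum_divide_distrib diff_divide_distrib)
   also have "\<bar>...\<bar> \<le> (\<Sum>j\<in>J. \<bar>(f y - g j y) / k\<bar>)" by (rule sum_abs)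
   finally show ?thesis by simp
  qed
  have hlip: "\<bar>h x - h y\<bar> \<le> (\<Sum>j\<in>J. 30 * D ^ 3 * \<tau> j / k) * dist x y" for x y
  proof -
   have "\<bar>h x - h y\<bar> \<le> (\<Sum>j\<in>J. 30 * D ^ 3 * \<tau> j / k * dist x y)"
    using glip k0 by (intro order_trans[OF hdiff] sum_mono) (auto simp: field_simps)
   then show ?thesis by (simp add: sum_distrib_right)
  qed
  have I: "(\<integral>\<^sup>+y\<in>ball a r. ennreal \<bar>f y - h y\<bar> \<partial>M) \<le> ennreal (lam / 4 * r) * V"
  proof -
   have "(\<integral>\<^sup>+y\<in>ball a r. ennreal \<bar>f y - h y\<bar> \<partial>M)
    \<le> (\<integral>\<^sup>+y. (\<Sum>j\<in>J. ennreal (1 / k) * (ennreal \<bar>f y - g j y\<bar> * indicator (ball a r) y)) \<partial>M)"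
   proof (intro nn_integral_mono)
    fix y
    have "ennreal \<bar>f y - h y\<bar> \<le> ennreal (\<Sum>j\<in>J. \<bar>f y - g j y\<bar> / k)" by (intro ennreal_leI hf)
    also have "... = (\<Sum>j\<in>J. ennreal (1 / k) * ennreal \<bar>f y - g j y\<bar>)"
     using k0 by (subst sum_ennreal[symmetric]) (auto simp: ennreal_mult[symmetric])
    finally show "ennreal \<bar>f y - h y\<bar> * indicator (ball a r) y
     \<le> (\<Sum>j\<in>J. ennreal (1 / k) * (ennreal \<bar>f y - g j y\<bar> * indicator (ball a r) y))"
     by (cases "y \<in> ball a r") auto
   qed
   also have "... = (\<Sum>j\<in>J. ennreal (1 / k) * (\<integral>\<^sup>+y\<in>ball a r. ennreal \<bar>f y - g j y\<bar> \<partial>M))"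
    by (subst nn_integral_sum) (auto intro!: sum.cong nn_integral_cmult)
   also have "... \<le> (\<Sum>j\<in>J. ennreal (1 / k) * (ennreal (lam / 4 * r) * V))"
    using gE by (intro sum_mono mult_left_mono) auto
   also have "... = of_nat k * (ennreal (1 / k) * (ennreal (lam / 4 * r) * V))" by (simp add: J)
   also have "... = ennreal (lam / 4 * r) * V"
    using k0 by (simp add: mult.assoc[symmetric] ennreal_of_nat_eq_real_of_nat ennreal_mult[symmetric])
   finally show ?thesis .
  qed
  have low: "ennreal (lam / 2 * r) * V\<^sup>2 \<le> dosc M h a r"
  proof -
   let ?A = "ennreal (lam / 2 * r) * V\<^sup>2"
   have "?A + ?A = ennreal (lam * r) * V\<^sup>2"
    using lam r by (subst ennreal_add_collect) (auto simp: field_simps)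
   also have "... \<le> dosc M f a r" using osc by (simp add: V_def)
   also have "... \<le> dosc M h a r + 2 * (V * (\<integral>\<^sup>+y\<in>ball a r. ennreal \<bar>f y - h y\<bar> \<partial>M))"
    unfolding V_def by (rule dosc_perturb) measurable
   also have "... \<le> dosc M h a r + 2 * (V * (ennreal (lam / 4 * r) * V))"
    using I by (intro add_left_mono mult_left_mono) auto
   also have "2 * (V * (ennreal (lam / 4 * r) * V)) = ?A"
   proof -
    have "2 * ennreal (lam / 4 * r) = ennreal (lam / 2 * r)"
     using ennreal_mult[of 2 "lam / 4 * r"] lam r by simp
    moreover have "2 * (V * (ennreal (lam / 4 * r) * V)) = (2 * ennreal (lam / 4 * r)) * V\<^sup>2"
     by (simp add: power2_eq_square mult_ac)
    ultimately show ?thesis by simp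
   qed
   finally have "?A + ?A \<le> ?A + dosc M h a r" by (simp add: add.commute)
   moreover have "?A < \<infinity>" using V by (simp add: ennreal_mult_less_top power2_eq_square)
   ultimately show ?thesis by (auto simp: ennreal_add_left_cancel_le)
  qed
  define K where "K j = 30 * D ^ 3 * \<tau> j" for j
  have K: "0 \<le> K j" for j using D0 \<tau>[of j] by (simp add: K_def)
  define \<rho>' where "\<rho>' j x = ennreal (K j) * indicator (U (\<tau> j)) x + \<rho> x * indicator (- U (\<tau> j)) x + \<infinity> * indicator (N j) x" for j x
  define gh where "gh x = (\<Sum>j\<in>J. ennreal (1 / k) * \<rho>' j x)" for x
  have r'b [measurable]: "\<rho>' j \<in> borel_measurable borel" if "j \<in> J" for j
  proof -
   have [measurable]: "N j \<in> sets borel" "U (\<tau> j) \<in> sets borel" using N[OF that] by auto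
   show ?thesis unfolding \<rho>'_def[abs_def] by measurable
  qed
  have ghb [measurable]: "gh \<in> borel_measurable borel" unfolding gh_def[abs_def] using r'b by measurable
  note ghM [measurable] = borel_measurable_M[OF ghb]
  have "ennreal ((lam / 2) powr p) * V \<le> ennreal C * (\<integral>\<^sup>+y\<in>B. ennreal_powr (gh y) p \<partial>M)"
   unfolding V_def B_def
  proof (rule poincare[of r h gh \<rho> "lam / 2" a])
   show "(\<integral>\<^sup>+y\<in>ball x R. ennreal \<bar>h y\<bar> \<partial>M) < \<infinity>" for x R
    by (rule nn_integral_ball_lipschitz_finite[OF ball_finite _ hlip])
     (use D0 \<tau>[THEN less_imp_le] in \<open>auto intro!: sum_nonneg divide_nonneg_nonneg\<close>)
   show "ennreal (lam / 2 * r) * (vol a r)\<^sup>2 \<le> dosc M h a r" using low by (simp add: V_def)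
   fix c d ga assume c: "(c, d, ga) \<in> curves_in (UNIV :: 'a set)" and fin: "line_integral \<rho> (c, d, ga) < \<infinity>"
   interpret cv: rectifiable_curve c d ga by (rule line_integral_cases[OF c fin])
   \<comment> \<open>The contact set is the complement of the bad set, where the truncation equals f
     off a null set. \<open>gluing\<close> needs a finite \<rho>-integral along the curve, which is
     exactly the restriction on curves in \<open>poincare\<close>.\<close>
   have each: "ennreal \<bar>g j (ga c) - g j (ga d)\<bar> \<le> line_integral (\<rho>' j) (c, d, ga)" if j: "j \<in> J" for j
   proof (rule cv.gluing[of "K j" "g j" "- U (\<tau> j)" "N j" f \<rho> "\<rho>' j"])
    show "\<bar>g j x - g j y\<bar> \<le> K j * dist x y" for x y using glip[OF j] by (simp add: K_def)
    show "ennreal \<bar>f (ga s) - f (ga t)\<bar> \<le> line_integral \<rho> (s, t, ga)" if "c \<le> s" "s \<le> t" "t \<le> d" for s t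
     using that cv.cont by (intro family_gradient[OF f]) (auto simp: curves_in_def intro: continuous_on_subset)
   qed (use K N[OF j] gf[OF j] fin in \<open>auto simp: \<rho>'_def\<close>)
   have "ennreal \<bar>h (ga c) - h (ga d)\<bar> \<le> ennreal (\<Sum>j\<in>J. \<bar>g j (ga c) - g j (ga d)\<bar> / k)"
    by (intro ennreal_leI hdiff)
   also have "... = (\<Sum>j\<in>J. ennreal (1 / k) * ennreal \<bar>g j (ga c) - g j (ga d)\<bar>)"
    using k0 by (subst sum_ennreal[symmetric]) (auto simp: ennreal_mult[symmetric])
   also have "... \<le> (\<Sum>j\<in>J. ennreal (1 / k) * line_integral (\<rho>' j) (c, d, ga))"
    using each by (intro sum_mono mult_left_mono) auto
   also have "... = (\<Sum>j\<in>J. \<integral>\<^sup>+t. ennreal (1 / k) * (\<rho>' j (ga t) * indicator {c..d} t) \<partial>cv.lm)"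
    unfolding cv.line_integral_eq
    by (intro sum.cong refl nn_integral_cmult[symmetric] cv.comp_measurable r'b)
   also have "... = (\<integral>\<^sup>+t. (\<Sum>j\<in>J. ennreal (1 / k) * (\<rho>' j (ga t) * indicator {c..d} t)) \<partial>cv.lm)"
    by (intro nn_integral_sum[symmetric] borel_measurable_times_ennreal borel_measurable_const cv.comp_measurable r'b)
   also have "... = line_integral gh (c, d, ga)"
    unfolding cv.line_integral_eq
    by (intro nn_integral_cong) (auto simp: gh_def sum_distrib_right mult.assoc)
   finally show "ennreal \<bar>h (ga c) - h (ga d)\<bar> \<le> line_integral gh (c, d, ga)" .
  qed (use r lam \<rho>_Lp in auto)
  also have "(\<integral>\<^sup>+y\<in>B. ennreal_powr (gh y) p \<partial>M) \<le> (\<integral>\<^sup>+y. ennreal ((120 * D ^ 3) powr p) * (W lam k y * indicator B y) \<partial>M)"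
  proof (rule nn_integral_mono_AE)
   have "AE x in M. \<forall>j\<in>J. x \<notin> N j"
    using J(1) N by (intro AE_finite_allI) (auto intro: AE_not_in)
   then show "AE x in M. ennreal_powr (gh x) p * indicator B x \<le> ennreal ((120 * D ^ 3) powr p) * (W lam k x * indicator B x)"
   proof eventually_elim
    case (elim x)
    define A where "A = {j \<in> J. x \<in> U (\<tau> j)}"
    have A: "finite A" "A \<subseteq> J" using J by (auto simp: A_def)
    \<comment> \<open>The bad sets shrink as j grows, so \<rho> off any of them is at most \<rho>
      off the last one; averaging k such terms keeps this bound.\<close>
    let ?R = "\<rho> x * indicator (- U (\<tau> (2 * k))) x"
    have "gh x = (\<Sum>j\<in>J. ennreal (K j / k) * indicator (U (\<tau> j)) x + ennreal (1 / k) * (\<rho> x * indicator (- U (\<tau> j)) x))"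
     unfolding gh_def \<rho>'_def using elim K k0
     by (intro sum.cong) (auto simp: distrib_left ennreal_mult_collect)
    also have "... = (\<Sum>j\<in>J. ennreal (K j / k) * indicator (U (\<tau> j)) x) + (\<Sum>j\<in>J. ennreal (1 / k) * (\<rho> x * indicator (- U (\<tau> j)) x))"
     by (rule sum.distrib)
    also have "... \<le> ennreal (\<Sum>j\<in>A. K j / k) + ?R"
    proof (rule add_mono)
     have "(\<Sum>j\<in>J. ennreal (K j / k) * indicator (U (\<tau> j)) x) = (\<Sum>j\<in>A. ennreal (K j / k))"
      using J(1) by (intro sum.mono_neutral_cong_right) (auto simp: A_def)
     also have "... = ennreal (\<Sum>j\<in>A. K j / k)" using K by (intro sum_ennreal) auto
     finally show "(\<Sum>j\<in>J. ennreal (K j / k) * indicator (U (\<tau> j)) x) \<le> ennreal (\<Sum>j\<in>A. K j / k)" by simp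
     have "(\<Sum>j\<in>J. ennreal (1 / k) * (\<rho> x * indicator (- U (\<tau> j)) x)) \<le> (\<Sum>j\<in>J. ennreal (1 / k) * ?R)"
     proof (intro sum_mono mult_left_mono)
      fix j assume "j \<in> J"
      then have "\<tau> j \<le> \<tau> (2 * k)" using lam by (auto simp: \<tau>_def J_def intro!: power_increasing)
      then have "U (\<tau> (2 * k)) \<subseteq> U (\<tau> j)" by (rule U_mono)
      then show "indicator (- U (\<tau> j)) x \<le> (indicator (- U (\<tau> (2 * k))) x :: ennreal)" by auto
     qed auto
     also have "... = ?R"
      using k0 J(2) by (simp add: mult.assoc[symmetric] ennreal_of_nat_eq_real_of_nat ennreal_mult[symmetric])
     finally show "(\<Sum>j\<in>J. ennreal (1 / k) * (\<rho> x * indicator (- U (\<tau> j)) x)) \<le> ?R" .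
    qed
    finally have ghx: "gh x \<le> ennreal (\<Sum>j\<in>A. K j / k) + ?R" .
    have "ennreal_powr (gh x) p \<le> ennreal_powr (ennreal (\<Sum>j\<in>A. K j / k) + ?R) p"
     using p by (intro ennreal_powr_mono ghx) auto
    also have "... \<le> ennreal (2 powr p) * (ennreal_powr (ennreal (\<Sum>j\<in>A. K j / k)) p + ennreal_powr ?R p)"
     using p by (intro ennreal_powr_add_le) auto
    also have "... \<le> ennreal (2 powr p) * (ennreal ((60 * D ^ 3) powr p) * W lam k x)"
    proof (intro mult_left_mono)
     have "(\<Sum>j\<in>A. K j / k) = (30 * D ^ 3 * lam / k) * (\<Sum>j\<in>A. 2 ^ j)"
      unfolding sum_distrib_left by (intro sum.cong) (auto simp: K_def \<tau>_def)
     then have "(\<Sum>j\<in>A. K j / k) powr p = (30 * D ^ 3 * lam / k) powr p * (\<Sum>j\<in>A. 2 ^ j) powr p"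
      by (simp only: powr_mult)
     also have "... \<le> (30 * D ^ 3 * lam / k) powr p * (2 powr p * (\<Sum>j\<in>A. (2 ^ j) powr p))"
      using A p by (intro mult_left_mono sum_powers_powr_le) auto
     also have "... = (60 * D ^ 3) powr p * (\<Sum>j\<in>A. (2 ^ j * lam / k) powr p)"
     proof -
      have "(30 * D ^ 3 * lam / k) powr p * (2 powr p * (2 ^ j) powr p) = (60 * D ^ 3) powr p * (2 ^ j * lam / k) powr p" for j :: nat
      proof -
       have "(30 * D ^ 3 * lam / k) powr p * (2 powr p * (2 ^ j) powr p) = ((30 * D ^ 3 * lam / k) * (2 * 2 ^ j)) powr p"
        by (simp only: powr_mult)
       also have "(30 * D ^ 3 * lam / k) * (2 * 2 ^ j) = (60 * D ^ 3) * (2 ^ j * lam / k)" by simp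
       also have "... powr p = (60 * D ^ 3) powr p * (2 ^ j * lam / k) powr p"
        by (rule powr_mult)
       finally show ?thesis .
      qed
      then show ?thesis by (simp add: sum_distrib_left)
     qed
     finally have "ennreal_powr (ennreal (\<Sum>j\<in>A. K j / k)) p \<le> ennreal ((60 * D ^ 3) powr p * (\<Sum>j\<in>A. (2 ^ j * lam / k) powr p))"
      using K by (subst ennreal_powr_ennreal) (auto intro!: sum_nonneg ennreal_leI)
     also have "... = ennreal ((60 * D ^ 3) powr p) * (\<Sum>j\<in>A. ennreal ((2 ^ j * lam / k) powr p))"
      by (subst ennreal_mult) (auto intro!: sum_nonneg simp: sum_ennreal)
     also have "(\<Sum>j\<in>A. ennreal ((2 ^ j * lam / k) powr p)) = (\<Sum>j\<in>A. ennreal ((2 ^ j * lam / k) powr p) * indicator (U (2 ^ j * lam)) x)"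
      by (intro sum.cong) (auto simp: A_def \<tau>_def)
     also have "... \<le> (\<Sum>j\<in>{k..2 * k}. ennreal ((2 ^ j * lam / k) powr p) * indicator (U (2 ^ j * lam)) x)"
      using A J by (intro sum_mono2) auto
     finally have 1: "ennreal_powr (ennreal (\<Sum>j\<in>A. K j / k)) p \<le> ennreal ((60 * D ^ 3) powr p) *
      (\<Sum>j\<in>{k..2 * k}. ennreal ((2 ^ j * lam / k) powr p) * indicator (U (2 ^ j * lam)) x)"
      by (simp add: mult_left_mono)
     have "1 \<le> (60 * D ^ 3) powr p" using D0 p by (intro ge_one_powr_ge_zero) auto
     then have "1 * ennreal_powr ?R p \<le> ennreal ((60 * D ^ 3) powr p) * ennreal_powr ?R p"
      by (intro mult_right_mono) (auto simp flip: ennreal_1 intro: ennreal_leI)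
     moreover have "ennreal_powr ?R p = ennreal_powr (\<rho> x) p * indicator (- U (2 ^ (2 * k) * lam)) x"
      by (auto simp: indicator_def \<tau>_def)
     ultimately show "ennreal_powr (ennreal (\<Sum>j\<in>A. K j / k)) p + ennreal_powr ?R p \<le> ennreal ((60 * D ^ 3) powr p) * W lam k x"
      unfolding W_def distrib_left using 1 by (intro add_mono) auto
    qed auto
    also have "... = ennreal ((120 * D ^ 3) powr p) * W lam k x"
    proof -
     have "2 powr p * (60 * D ^ 3) powr p = (120 * D ^ 3) powr p" using D0 by (simp add: powr_mult[symmetric])
     then show ?thesis by (simp add: ennreal_mult_collect)
    qed
    finally show ?case by (cases "x \<in> B") auto
   qed
  qed
  also have "... = ennreal ((120 * D ^ 3) powr p) * (\<integral>\<^sup>+y\<in>B. W lam k y \<partial>M)"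
   by (rule nn_integral_cmult) (simp add: B_def)
  \<comment> \<open>The factor 240 D^3 consists of 30 D^3 from \<open>truncation\<close> and three
    factors 2: from the sum of powers of 2, from the p-th power of a sum, and from replacing lam by
    lam/2.\<close>
  finally have "ennreal ((lam / 2) powr p) * V \<le> ennreal C * (ennreal ((120 * D ^ 3) powr p) * (\<integral>\<^sup>+y\<in>B. W lam k y \<partial>M))"
   by (simp add: mult_left_mono)
  then have "ennreal (2 powr p) * (ennreal ((lam / 2) powr p) * V)
   \<le> ennreal (2 powr p) * (ennreal C * (ennreal ((120 * D ^ 3) powr p) * (\<integral>\<^sup>+y\<in>B. W lam k y \<partial>M)))"
   by (intro mult_left_mono) auto
  moreover have "2 powr p * (lam / 2) powr p = lam powr p" using lam by (simp add: powr_mult[symmetric])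
  moreover have "2 powr p * (C * (120 * D ^ 3) powr p) = C * (240 * D ^ 3) powr p"
  proof -
   have "2 powr p * (120 * D ^ 3) powr p = (240 * D ^ 3) powr p" using D0 by (simp add: powr_mult[symmetric])
   then show ?thesis by simp
  qed
  ultimately show ?thesis using C_ge_1 by (simp add: ennreal_mult_collect V_def B_def)
 qed
qed

end

text \<open>With x = 2^((1-p)/p) < 1 the first quantity is (k x^k)^p, and the second is at most 2
  k^(1-p). Both tend to 0 because p > 1. The first governs the truncation errors, the second the
  absorption.\<close>

lemma exists_good_level_number:
 fixes p e D :: real
 assumes p: "1 < p" and e: "0 < e"
 obtains k :: nat where "1 \<le> k" "2 ^ k * (k / 2 ^ k) powr p \<le> e" "real (k + 1) * (1 / k) powr p \<le> e"
proof -
 define x where "x = 2 powr ((1 - p) / p)"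
 have x: "0 < x" "x < 1" using p by (auto simp: x_def powr_less_one divide_neg_pos)
 have "(\<lambda>k. real k * x ^ k) \<longlonglongrightarrow> 0" using x by (intro powser_times_n_limit_0) auto
 then have "(\<lambda>k. (real k * x ^ k) powr p) \<longlonglongrightarrow> 0 powr p"
  using p x by (intro tendsto_powr') (auto intro!: always_eventually)
 then have 1: "(\<lambda>k. (real k * x ^ k) powr p) \<longlonglongrightarrow> 0" by simp
 have eq: "(real k * x ^ k) powr p = 2 ^ k * (k / 2 ^ k) powr p" for k :: nat
 proof -
  have "(x ^ k) powr p = 2 powr (real k * (1 - p))"
   using p by (simp add: x_def powr_realpow[symmetric] powr_powr mult.commute)
  also have "... = 2 ^ k / (2 ^ k) powr p"
   by (simp add: powr_realpow[symmetric] powr_powr powr_diff[symmetric] algebra_simps)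
  finally show ?thesis by (simp add: powr_mult powr_divide)
 qed
 have "(\<lambda>k. real k powr (1 - p)) \<longlonglongrightarrow> 0"
  using p by (intro tendsto_neg_powr filterlim_real_sequentially) auto
 then have 2: "(\<lambda>k. 2 * real k powr (1 - p)) \<longlonglongrightarrow> 0" using tendsto_mult_right_zero by blast
 have "eventually (\<lambda>k. (real k * x ^ k) powr p < e \<and> 2 * real k powr (1 - p) < e \<and> 1 \<le> k) sequentially"
  using order_tendstoD(2)[OF 1 e] order_tendstoD(2)[OF 2 e] eventually_ge_at_top[of 1]
  by eventually_elim auto
 then obtain k where k: "(real k * x ^ k) powr p < e" "2 * real k powr (1 - p) < e" "1 \<le> k"
  by (auto simp: eventually_sequentially)
 have "real (k + 1) * (1 / k) powr p \<le> (2 * real k) * (1 / k) powr p"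
  using k by (intro mult_right_mono) auto
 also have "... = 2 * real k powr (1 - p)" using k by (simp add: powr_diff powr_divide)
 finally show ?thesis using that[of k] k eq[of k] by simp
qed

section \<open>The good-lambda recursion and its summation\<close>

context gradient_family
begin

text \<open>Vitali is applied to the bad balls enlarged by L, and 3 L <= 2^n yields D^n. The
  integral on the right extends only over a bad set of a fixed lower level, not over the whole
  space; the bounded overlap in \<open>overlap_sum\<close> depends on this.\<close>

lemma covering:
 assumes lam: "0 < lam" and n: "3 * L \<le> 2 ^ n" and w [measurable]: "w \<in> borel_measurable M"
  and est: "\<And>a r. (a, r) \<in> bad lam \<Longrightarrow>
   ennreal (lam powr p) * vol a r \<le> (\<integral>\<^sup>+x\<in>ball a (L * r). w x \<partial>M)"
 shows "ennreal (lam powr p) * emeasure M (U lam)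
  \<le> ennreal (D ^ n) * (\<integral>\<^sup>+x\<in>U (lam / (L * D ^ (2 * n))). w x \<partial>M)"
proof -
 define c where "c = lam / (L * D ^ (2 * n))"
 have L0: "0 < L" using L_ge_2 by simp
 have D0: "0 < D" using D_ge_1 by simp
 define P where "P = (\<lambda>(a, r). (a, L * r)) ` bad lam"
 have Um: "(\<Union>q\<in>P. ball (fst q) (snd q)) \<in> sets M" by (intro open_sets_M open_UN) auto
 \<comment> \<open>Passing to the enlarged ball does not decrease the double integral, while the
   radius grows by L and the squared measure by at most D^(2n). The enlarged ball is therefore bad
   at the level divided by L D^(2n).\<close>
 have sub: "ball a (L * r) \<subseteq> U c" if ar: "(a, r) \<in> bad lam" for a r
 proof -
  obtain f where f: "f \<in> \<F>" and r: "0 < r"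
   and osc: "ennreal (lam * r) * (vol a r)\<^sup>2 < dosc M f a r"
   using ar by (auto simp: bad_def)
  have "L * r \<le> 2 ^ n * r" using n r L0 by (intro mult_right_mono) auto
  then have le: "vol a (L * r) \<le> ennreal (D ^ n) * vol a r"
   using r by (intro ball_le) auto
  have "ennreal (c * (L * r)) * (vol a (L * r))\<^sup>2
   \<le> ennreal (c * (L * r)) * (ennreal (D ^ n) * vol a r)\<^sup>2"
   using le by (intro mult_left_mono power_mono_ennreal) auto
  also have "... = ennreal (c * (L * r) * (D ^ n * D ^ n)) * (vol a r)\<^sup>2"
  proof -
   have "(ennreal (D ^ n) * vol a r)\<^sup>2 = ennreal (D ^ n * D ^ n) * (vol a r)\<^sup>2"
    using D0 by (simp add: power2_eq_square ennreal_mult mult_ac)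
   then show ?thesis using lam L0 D0 r by (simp only:) (intro ennreal_mult_collect, auto simp: c_def)
  qed
  also have "c * (L * r) * (D ^ n * D ^ n) = lam * r"
   using L0 D0 by (simp add: c_def power_add[symmetric] mult_2)
  also have "ennreal (lam * r) * (vol a r)\<^sup>2 < dosc M f a r" by (rule osc)
  also have "dosc M f a r \<le> dosc M f a (L * r)"
  proof -
   have "1 * r \<le> L * r" using L_ge_2 r by (intro mult_right_mono) auto
   then have *: "ball a r \<subseteq> ball a (L * r)" by (intro subset_ball) auto
   show ?thesis
    unfolding dosc_def using *
    by (intro nn_integral_mono mult_mono) (auto simp: indicator_def intro!: nn_integral_mono)
  qed
  finally have "(a, L * r) \<in> bad c" using f r L0 by (auto simp: bad_def)
  then show ?thesis by (force simp: U_def)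
 qed
 define \<alpha> where "\<alpha> = density M (\<lambda>_. ennreal (lam powr p))"
 define \<nu> where "\<nu> = density M (\<lambda>x. ennreal (D ^ n) * w x)"
 have "U lam \<subseteq> (\<Union>q\<in>P. ball (fst q) (snd q))"
 proof
  fix x assume "x \<in> U lam"
  then obtain a r where ar: "(a, r) \<in> bad lam" "x \<in> ball a r" by (auto simp: U_def)
  then have "0 < r" by (auto simp: bad_def)
  then have "1 * r \<le> L * r" using L_ge_2 by (intro mult_right_mono) auto
  then have "x \<in> ball a (L * r)" using ar by auto
  then show "x \<in> (\<Union>q\<in>P. ball (fst q) (snd q))" using ar by (force simp: P_def)
 qed
 then have "ennreal (lam powr p) * emeasure M (U lam) \<le> ennreal (lam powr p) * emeasure M (\<Union>q\<in>P. ball (fst q) (snd q))"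
  using Um by (intro mult_left_mono emeasure_mono) auto
 also have "... = emeasure \<alpha> (\<Union>q\<in>P. ball (fst q) (snd q))"
  unfolding \<alpha>_def using Um by (subst emeasure_density) (auto simp: nn_integral_cmult_indicator)
 also have "... \<le> emeasure \<nu> (\<Union>q\<in>P. ball (fst q) (snd q))"
 proof (rule vitali_emeasure_le)
  fix a R assume "(a, R) \<in> P"
  then obtain r where r: "(a, r) \<in> bad lam" "R = L * r" "0 < r" by (auto simp: P_def bad_def)
  have "3 * R \<le> 2 ^ n * r" using r n mult_right_mono[of "3 * L" "2 ^ n" r] by simp
  then have "vol a (3 * R) \<le> ennreal (D ^ n) * vol a r"
   using r by (intro ball_le) auto
  then have "emeasure \<alpha> (ball a (3 * R)) \<le> ennreal (lam powr p) * (ennreal (D ^ n) * vol a r)"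
   unfolding \<alpha>_def by (subst emeasure_density) (auto simp: nn_integral_cmult_indicator mult_left_mono)
  also have "... = ennreal (D ^ n) * (ennreal (lam powr p) * vol a r)" by (simp add: mult_ac)
  also have "... \<le> ennreal (D ^ n) * (\<integral>\<^sup>+x\<in>ball a R. w x \<partial>M)"
   using est[OF r(1)] r(2) by (intro mult_left_mono) auto
  also have "... = emeasure \<nu> (ball a R)"
   unfolding \<nu>_def by (subst emeasure_density) (auto simp: nn_integral_cmult[symmetric] mult.assoc)
  finally show "0 < R \<and> emeasure \<alpha> (ball a (3 * R)) \<le> emeasure \<nu> (ball a R)" using r L0 by simp
 qed (use sets_M in \<open>auto simp: \<alpha>_def \<nu>_def\<close>)
 also have "... \<le> emeasure \<nu> (U c)"
 proof (intro emeasure_mono UN_least)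
  fix q assume "q \<in> P"
  then obtain a r where "(a, r) \<in> bad lam" "q = (a, L * r)" by (auto simp: P_def)
  then show "ball (fst q) (snd q) \<subseteq> U c" using sub[of a r] by simp
 qed (simp add: \<nu>_def)
 also have "... = ennreal (D ^ n) * (\<integral>\<^sup>+x\<in>U c. w x \<partial>M)"
  unfolding \<nu>_def by (subst emeasure_density) (auto simp: nn_integral_cmult[symmetric] mult.assoc)
 finally show ?thesis by (simp add: c_def)
qed

definition level :: "int \<Rightarrow> ennreal" where
 "level m = ennreal ((2 powr m) powr p) * emeasure M (U (2 powr m))"

definition R where "R = (\<integral>\<^sup>+x. ennreal_powr (\<rho> x) p \<partial>M)"

lemma R_finite: "R < \<infinity>" using \<rho>_Lp by (simp add: R_def Lp_nonneg_def)

text \<open>The Poincare inequality is applied directly to the functions of the family. The uniform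
  bound is the a priori finiteness behind the absorption.\<close>

lemma level_weak_type:
 assumes n: "3 * L \<le> 2 ^ n"
 shows "level m \<le> ennreal (D ^ n * C) * R"
proof -
 let ?lam = "2 powr real_of_int m"
 have "level m \<le> ennreal (D ^ n) * (\<integral>\<^sup>+x\<in>U (?lam / (L * D ^ (2 * n))). ennreal C * ennreal_powr (\<rho> x) p \<partial>M)"
  unfolding level_def
 proof (rule covering[OF _ n])
  fix a r assume "(a, r) \<in> bad ?lam"
  then obtain f where f: "f \<in> \<F>" and r: "0 < r"
   and osc: "ennreal (?lam * r) * (vol a r)\<^sup>2 < dosc M f a r" by (auto simp: bad_def)
  have "ennreal (?lam powr p) * vol a r \<le> ennreal C * (\<integral>\<^sup>+y\<in>ball a (L * r). ennreal_powr (\<rho> y) p \<partial>M)"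
   by (rule poincare[of r f \<rho> \<rho> ?lam a])
    (use r f family_measurable family_integrable \<rho>_Lp family_gradient osc in \<open>auto intro: less_imp_le\<close>)
  also have "... = (\<integral>\<^sup>+x\<in>ball a (L * r). ennreal C * ennreal_powr (\<rho> x) p \<partial>M)"
   by (simp add: nn_integral_cmult[symmetric] mult.assoc)
  finally show "ennreal (?lam powr p) * vol a r \<le> ..." .
 qed auto
 also have "... \<le> ennreal (D ^ n) * (\<integral>\<^sup>+x. ennreal C * ennreal_powr (\<rho> x) p \<partial>M)"
  by (intro mult_left_mono nn_integral_mono) (auto simp: indicator_def)
 also have "... = ennreal (D ^ n * C) * R"
  using D_ge_1 C_ge_1 by (simp add: nn_integral_cmult R_def ennreal_mult_collect)
 finally show ?thesis .
qed

text \<open>\<open>bad_ball_estimate\<close> is integrated by \<open>covering\<close>. The terms of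
  \<open>W\<close> on the bad sets become k^(-p) times higher levels, and what remains of \<rho>
  lives on a shell between two bad sets.\<close>

lemma level_recursion:
 fixes k :: nat
 assumes n: "3 * L \<le> 2 ^ n" and k: "1 \<le> k" "D * (k / 2 ^ k) powr p < 1" "800 * D ^ 5 * (2 ^ k * (k / 2 ^ k) powr p) \<le> 1"
 shows "level m \<le> ennreal (D ^ n * (C * (240 * D ^ 3) powr p)) *
  (ennreal ((1 / k) powr p) * (\<Sum>j\<in>{k..2 * k}. level (m + int j)) +
  (\<integral>\<^sup>+x\<in>U (2 powr m / (L * D ^ (2 * n))) - U (2 powr (m + int (2 * k))). ennreal_powr (\<rho> x) p \<partial>M))"
proof -
 let ?lam = "2 powr real_of_int m"
 let ?C = "C * (240 * D ^ 3) powr p"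
 have pw: "2 ^ j * ?lam = 2 powr (m + int j)" for j :: nat
  by (simp add: powr_add powr_realpow)
 have "level m \<le> ennreal (D ^ n) * (\<integral>\<^sup>+x\<in>U (?lam / (L * D ^ (2 * n))). ennreal ?C * W ?lam k x \<partial>M)"
  unfolding level_def
 proof (rule covering[OF _ n])
  fix a r assume "(a, r) \<in> bad ?lam"
  from bad_ball_estimate[OF k _ this]
  show "ennreal (?lam powr p) * vol a r \<le> (\<integral>\<^sup>+x\<in>ball a (L * r). ennreal ?C * W ?lam k x \<partial>M)"
   by (simp add: nn_integral_cmult[symmetric] mult.assoc)
 qed auto
 also have "... = ennreal (D ^ n) * (ennreal ?C * (\<integral>\<^sup>+x\<in>U (?lam / (L * D ^ (2 * n))). W ?lam k x \<partial>M))"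
  by (simp add: nn_integral_cmult[symmetric] mult.assoc)
 also have "... = ennreal (D ^ n * ?C) * (\<integral>\<^sup>+x\<in>U (?lam / (L * D ^ (2 * n))). W ?lam k x \<partial>M)"
  using D_ge_1 C_ge_1 by (intro ennreal_mult_collect) auto
 also have "(\<integral>\<^sup>+x\<in>U (?lam / (L * D ^ (2 * n))). W ?lam k x \<partial>M)
  \<le> (\<integral>\<^sup>+x. (\<Sum>j\<in>{k..2 * k}. ennreal ((2 ^ j * ?lam / k) powr p) * indicator (U (2 ^ j * ?lam)) x)
   + ennreal_powr (\<rho> x) p * indicator (U (?lam / (L * D ^ (2 * n))) - U (2 ^ (2 * k) * ?lam)) x \<partial>M)"
  unfolding W_def by (intro nn_integral_mono) (auto simp: indicator_def)
 also have "... = (\<Sum>j\<in>{k..2 * k}. ennreal ((2 ^ j * ?lam / k) powr p) * emeasure M (U (2 ^ j * ?lam)))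
  + (\<integral>\<^sup>+x\<in>U (?lam / (L * D ^ (2 * n))) - U (2 ^ (2 * k) * ?lam). ennreal_powr (\<rho> x) p \<partial>M)"
 proof -
  have "(\<integral>\<^sup>+x. (\<Sum>j\<in>{k..2 * k}. ennreal ((2 ^ j * ?lam / k) powr p) * indicator (U (2 ^ j * ?lam)) x) \<partial>M)
   = (\<Sum>j\<in>{k..2 * k}. \<integral>\<^sup>+x. ennreal ((2 ^ j * ?lam / k) powr p) * indicator (U (2 ^ j * ?lam)) x \<partial>M)"
   by (rule nn_integral_sum) measurable
  also have "... = (\<Sum>j\<in>{k..2 * k}. ennreal ((2 ^ j * ?lam / k) powr p) * emeasure M (U (2 ^ j * ?lam)))"
   by (intro sum.cong refl nn_integral_cmult_indicator) simp
  finally have eq: "(\<integral>\<^sup>+x. (\<Sum>j\<in>{k..2 * k}. ennreal ((2 ^ j * ?lam / k) powr p) * indicator (U (2 ^ j * ?lam)) x) \<partial>M)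
   = (\<Sum>j\<in>{k..2 * k}. ennreal ((2 ^ j * ?lam / k) powr p) * emeasure M (U (2 ^ j * ?lam)))" .
  show ?thesis unfolding eq[symmetric] by (rule nn_integral_add) measurable
 qed
 also have "(\<Sum>j\<in>{k..2 * k}. ennreal ((2 ^ j * ?lam / k) powr p) * emeasure M (U (2 ^ j * ?lam)))
  = ennreal ((1 / k) powr p) * (\<Sum>j\<in>{k..2 * k}. level (m + int j))"
  unfolding sum_distrib_left
 proof (rule sum.cong[OF refl])
  fix j
  show "ennreal ((2 ^ j * ?lam / k) powr p) * emeasure M (U (2 ^ j * ?lam)) = ennreal ((1 / k) powr p) * level (m + int j)"
   unfolding level_def pw by (subst ennreal_mult_collect) (auto simp: powr_mult[symmetric])
 qed
 finally show ?thesis unfolding pw by (simp add: mult_left_mono)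
qed

text \<open>The bad sets decrease with the level. If m0 is the smallest index whose shell contains
  x, then x lies off the bad set of index m0 + k, so no index from m0 + k + q on can occur.\<close>

lemma overlap_sum:
 assumes c: "0 < c" and q: "2 powr - real q \<le> c" and A: "finite (A :: int set)"
 shows "(\<Sum>m\<in>A. \<integral>\<^sup>+x\<in>U (2 powr m * c) - U (2 powr (m + int k)). ennreal_powr (\<rho> x) p \<partial>M) \<le> of_nat (k + q) * R"
proof -
 have "(\<Sum>m\<in>A. \<integral>\<^sup>+x\<in>U (2 powr m * c) - U (2 powr (m + int k)). ennreal_powr (\<rho> x) p \<partial>M)
  = (\<integral>\<^sup>+x. (\<Sum>m\<in>A. ennreal_powr (\<rho> x) p * indicator (U (2 powr m * c) - U (2 powr (m + int k))) x) \<partial>M)"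
  by (rule nn_integral_sum[symmetric]) simp
 also have "... \<le> (\<integral>\<^sup>+x. of_nat (k + q) * ennreal_powr (\<rho> x) p \<partial>M)"
 proof (intro nn_integral_mono)
  fix x
  define B where "B = {m \<in> A. x \<in> U (2 powr m * c) - U (2 powr (m + int k))}"
  have B: "finite B" using A by (simp add: B_def)
  have "card B \<le> k + q"
  proof (cases "B = {}")
   case False
   define m0 where "m0 = Min B"
   have m0: "m0 \<in> B" "\<And>m. m \<in> B \<Longrightarrow> m0 \<le> m" using B False by (auto simp: m0_def)
   have "B \<subseteq> {m0..<m0 + int (k + q)}"
   proof
    fix m assume m: "m \<in> B"
    have "m < m0 + int (k + q)"
    proof (rule ccontr)
     assume "\<not> ?thesis"
     then have "2 powr (m0 + int k) * 1 \<le> 2 powr (m - int q)" by simp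
     also have "... = 2 powr m * 2 powr - real q" by (simp add: powr_add[symmetric])
     also have "... \<le> 2 powr m * c" using q by (intro mult_left_mono) auto
     finally have "U (2 powr m * c) \<subseteq> U (2 powr (m0 + int k))" by (intro U_mono) simp
     then show False using m m0(1) by (auto simp: B_def)
    qed
    then show "m \<in> {m0..<m0 + int (k + q)}" using m0 m by auto
   qed
   then have "card B \<le> card {m0..<m0 + int (k + q)}" by (intro card_mono) auto
   then show ?thesis by simp
  qed simp
  have "(\<Sum>m\<in>A. ennreal_powr (\<rho> x) p * indicator (U (2 powr m * c) - U (2 powr (m + int k))) x) = (\<Sum>m\<in>B. ennreal_powr (\<rho> x) p)"
   using A by (intro sum.mono_neutral_cong_right) (auto simp: B_def)
  also have "... = of_nat (card B) * ennreal_powr (\<rho> x) p" by simp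
  also have "... \<le> of_nat (k + q) * ennreal_powr (\<rho> x) p"
   using \<open>card B \<le> k + q\<close> by (intro mult_right_mono of_nat_mono) auto
  finally show "(\<Sum>m\<in>A. ennreal_powr (\<rho> x) p * indicator (U (2 powr m * c) - U (2 powr (m + int k))) x) \<le> of_nat (k + q) * ennreal_powr (\<rho> x) p" .
 qed
 also have "... = of_nat (k + q) * R" by (simp add: nn_integral_cmult R_def)
 finally show ?thesis .
qed

text \<open>The recursion is summed over the symmetric range from -N to N. Its k + 1 shifted sums
  each differ from the sum itself by at most 2 k levels, and the factor k^(-p) makes their total at
  most half of it plus a constant. The resulting bound does not depend on N.\<close>

lemma level_sum_bounded:
 obtains K where "K < \<infinity>" "\<And>A. finite A \<Longrightarrow> (\<Sum>m\<in>A. level m) \<le> K"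
proof -
 obtain n where n: "3 * L \<le> 2 ^ n" using real_arch_pow[of 2 "3 * L"] by (auto intro: less_imp_le)
 define E where "E = D ^ n * (C * (240 * D ^ 3) powr p)"
 have E: "0 < E" using D_ge_1 C_ge_1 by (auto simp: E_def intro!: mult_pos_pos)
 \<comment> \<open>The first entry makes the truncation errors admissible in
   \<open>bad_ball_estimate\<close>, the second makes the absorption factor at most 1/2.\<close>
 define e where "e = min (1 / (800 * D ^ 5)) (1 / (2 * E))"
 have e: "0 < e" using E D_ge_1 by (simp add: e_def)
 obtain k :: nat where k: "1 \<le> k" "2 ^ k * (k / 2 ^ k) powr p \<le> e" "real (k + 1) * (1 / k) powr p \<le> e"
  by (rule exists_good_level_number[OF p e])
 have k2: "800 * D ^ 5 * (2 ^ k * (k / 2 ^ k) powr p) \<le> 1"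
 proof -
  have "800 * D ^ 5 * (2 ^ k * (k / 2 ^ k) powr p) \<le> 800 * D ^ 5 * (1 / (800 * D ^ 5))"
   using k(2) D_ge_1 by (intro mult_left_mono) (auto simp: e_def)
  then show ?thesis using D_ge_1 by simp
 qed
 have k1: "D * (k / 2 ^ k) powr p < 1"
 proof -
  have "D * (k / 2 ^ k) powr p \<le> D ^ 5 * (2 ^ k * (k / 2 ^ k) powr p)"
  proof (intro mult_mono)
   show "D \<le> D ^ 5" using power_increasing[of 1 5 D] D_ge_1 by simp
   have "1 * (k / 2 ^ k) powr p \<le> 2 ^ k * (k / 2 ^ k) powr p" by (intro mult_right_mono) auto
   then show "(k / 2 ^ k) powr p \<le> 2 ^ k * (k / 2 ^ k) powr p" by simp
  qed (use D_ge_1 in auto)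
  then show ?thesis using k2 by linarith
 qed
 have k3: "E * (real (k + 1) * (1 / k) powr p) \<le> 1 / 2"
 proof -
  have "E * (real (k + 1) * (1 / k) powr p) \<le> E * (1 / (2 * E))"
   using k(3) E by (intro mult_left_mono) (auto simp: e_def)
  then show ?thesis using E by simp
 qed
 define c where "c = 1 / (L * D ^ (2 * n))"
 have c: "0 < c" using L_ge_2 D_ge_1 by (simp add: c_def)
 obtain q :: nat where q: "1 / c < 2 ^ q" using real_arch_pow[of 2 "1 / c"] by auto
 have q': "2 powr - real q \<le> c"
  using q c by (simp add: powr_minus powr_realpow field_simps)
 define A0 where "A0 = ennreal (D ^ n * C) * R"
 have A0: "A0 < \<infinity>" "level m \<le> A0" for m
  using R_finite level_weak_type[OF n] by (auto simp: A0_def ennreal_mult_less_top)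
 define Q where "Q = of_nat (2 * k) * A0 + 2 * (ennreal E * (of_nat (2 * k + q) * R))"
 have QF: "Q < \<infinity>" using A0(1) R_finite by (auto simp: Q_def ennreal_mult_less_top of_nat_less_top)
 have main: "(\<Sum>m\<in>{-N..N}. level m) \<le> Q" if N: "0 \<le> N" for N :: int
 proof -
  let ?S = "\<Sum>m\<in>{-N..N}. level m"
  have Sf: "?S < \<infinity>" using A0 by (simp add: le_less_trans less_top[symmetric]) (metis less_top top.not_eq_extremum infinity_ennreal_def order_less_irrefl order_le_less_trans)
  \<comment> \<open>A shifted range leaves the original one at its upper end in at most 2 k levels,
    each bounded by the weak-type constant.\<close>
  have shift: "(\<Sum>m\<in>{-N..N}. level (m + int j)) \<le> ?S + of_nat (2 * k) * A0" if j: "j \<in> {k..2 * k}" for j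
  proof -
   have "(\<Sum>m\<in>{-N..N}. level (m + int j)) = (\<Sum>m\<in>(\<lambda>m. m + int j) ` {-N..N}. level m)"
    by (subst sum.reindex) (auto simp: inj_on_def)
   also have "... \<le> (\<Sum>m\<in>{-N..N} \<union> {N + 1..N + int (2 * k)}. level m)"
    using j by (intro sum_mono2) auto
   also have "... = ?S + (\<Sum>m\<in>{N + 1..N + int (2 * k)}. level m)"
    by (rule sum.union_disjoint) auto
   also have "(\<Sum>m\<in>{N + 1..N + int (2 * k)}. level m) \<le> (\<Sum>m\<in>{N + 1..N + int (2 * k)}. A0)"
    by (intro sum_mono A0)
   also have "... = of_nat (2 * k) * A0"
   proof -
    have "card {N + 1..N + int (2 * k)} = 2 * k" by simp
    then show ?thesis by (simp only: sum_constant)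
   qed
   finally show ?thesis by (simp add: add_left_mono)
  qed
  define b where "b m = (\<integral>\<^sup>+x\<in>U (2 powr m * c) - U (2 powr (m + int (2 * k))). ennreal_powr (\<rho> x) p \<partial>M)" for m :: int
  have "?S \<le> (\<Sum>m\<in>{-N..N}. ennreal E * (ennreal ((1 / k) powr p) * (\<Sum>j\<in>{k..2 * k}. level (m + int j)) + b m))"
  proof (rule sum_mono)
   fix m
   show "level m \<le> ennreal E * (ennreal ((1 / k) powr p) * (\<Sum>j\<in>{k..2 * k}. level (m + int j)) + b m)"
    using level_recursion[OF n k(1) k1 k2, of m] by (simp add: E_def b_def c_def)
  qed
  also have "... = ennreal E * (ennreal ((1 / k) powr p) * (\<Sum>j\<in>{k..2 * k}. \<Sum>m\<in>{-N..N}. level (m + int j)) + (\<Sum>m\<in>{-N..N}. b m))"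
   by (simp add: sum_distrib_left[symmetric] sum.distrib sum.swap[of _ "{k..2 * k}"])
  also have "... \<le> ennreal E * (ennreal ((1 / k) powr p) * (\<Sum>j\<in>{k..2 * k}. ?S + of_nat (2 * k) * A0) + of_nat (2 * k + q) * R)"
   unfolding b_def using shift overlap_sum[OF c q', of "{-N..N}" "2 * k"]
   by (intro mult_left_mono add_mono sum_mono) auto
  also have "(\<Sum>j\<in>{k..2 * k}. ?S + of_nat (2 * k) * A0) = ennreal (real (k + 1)) * (?S + of_nat (2 * k) * A0)"
   by (simp add: ennreal_of_nat_eq_real_of_nat del: of_nat_Suc of_nat_add)
  finally have "?S \<le> ennreal E * (ennreal ((1 / k) powr p) * (ennreal (real (k + 1)) * (?S + of_nat (2 * k) * A0))) + ennreal E * (of_nat (2 * k + q) * R)"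
   by (simp add: distrib_left)
  also have "ennreal E * (ennreal ((1 / k) powr p) * (ennreal (real (k + 1)) * (?S + of_nat (2 * k) * A0)))
   = ennreal (E * (real (k + 1) * (1 / k) powr p)) * (?S + of_nat (2 * k) * A0)"
   using E by (simp add: ennreal_mult_collect mult_ac del: of_nat_add of_nat_Suc)
  also have "... \<le> ennreal (1 / 2) * (?S + of_nat (2 * k) * A0)"
   using k3 by (intro mult_right_mono ennreal_leI) auto
  \<comment> \<open>After doubling, the sum occurs once on the right, where it is finite and cancels
    against one of the two copies on the left.\<close>
  finally have "ennreal 2 * ?S \<le> ennreal 2 * (ennreal (1 / 2) * (?S + of_nat (2 * k) * A0) + ennreal E * (of_nat (2 * k + q) * R))"
   by (intro mult_left_mono) auto
  also have "... = ?S + Q"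
  proof -
   have "ennreal 2 * (ennreal (1 / 2) * X) = X" for X using ennreal_mult_collect[of 2 "1/2" X] by simp
   then show ?thesis by (simp add: distrib_left Q_def add.assoc)
  qed
  finally have "?S + ?S \<le> ?S + Q" by (simp add: mult_2)
  then show ?thesis using Sf by (auto simp: ennreal_add_left_cancel_le)
 qed
 show ?thesis
 proof (rule that[OF QF])
  fix A :: "int set" assume A: "finite A"
  obtain N where N: "0 \<le> N" "A \<subseteq> {-N..N}"
  proof
   define N where "N = (\<Sum>m\<in>A. \<bar>m\<bar>)"
   show "0 \<le> N" by (simp add: N_def sum_nonneg)
   show "A \<subseteq> {-N..N}"
   proof
    fix m assume "m \<in> A"
    then have "\<bar>m\<bar> \<le> N" unfolding N_def using A by (intro member_le_sum) auto
    then show "m \<in> {-N..N}" by auto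
   qed
  qed
  have "(\<Sum>m\<in>A. level m) \<le> (\<Sum>m\<in>{-N..N}. level m)" using N by (intro sum_mono2) auto
  also have "... \<le> Q" by (rule main[OF N(1)])
  finally show "(\<Sum>m\<in>A. level m) \<le> Q" .
 qed
qed

text \<open>The uncentred maximal oscillation, rebuilt from its superlevel sets. Rational levels
  suffice by monotonicity and make it Borel.\<close>

definition S :: "'a \<Rightarrow> ennreal" where
 "S x = (SUP \<tau>\<in>{\<tau>\<in>\<rat>. 0 < \<tau>}. ennreal \<tau> * indicator (U \<tau>) x)"

lemma S_borel [measurable]: "S \<in> borel_measurable borel"
proof -
 have "countable {\<tau>\<in>\<rat>. (0::real) < \<tau>}" by (rule countable_subset[OF _ countable_rat]) auto
 moreover have "U \<tau> \<in> sets borel" for \<tau> by simp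
 ultimately show ?thesis unfolding S_def[abs_def] by measurable
qed

text \<open>By the dyadic layer-cake bound the integral of S^p is at most a constant times the sum
  of all \<open>level m\<close>.\<close>

lemma Lp_nonneg_S: "Lp_nonneg p M S"
proof -
 have [measurable]: "S \<in> borel_measurable M" by (rule borel_measurable_M[OF S_borel])
 obtain K where K: "K < \<infinity>" "\<And>A. finite A \<Longrightarrow> (\<Sum>m\<in>A. level m) \<le> K"
  by (rule level_sum_bounded) blast
 have up: "x \<in> U t" if tS: "ennreal t < S x" and t: "0 < t" for x t
 proof -
  obtain \<tau> where \<tau>: "\<tau> \<in> \<rat>" "0 < \<tau>" "ennreal t < ennreal \<tau> * indicator (U \<tau>) x"
   using tS by (auto simp: S_def less_SUP_iff)
  then have "x \<in> U \<tau>" "t < \<tau>" using t by (cases "x \<in> U \<tau>"; auto simp: ennreal_less_iff)+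
  then show ?thesis using U_mono[of t \<tau>] by auto
 qed
 let ?g = "\<lambda>n x. ennreal ((2 powr real_of_int (int_decode n)) powr p) * indicator (U (2 powr real_of_int (int_decode n))) x"
 have "(\<integral>\<^sup>+x. ennreal_powr (S x) p \<partial>M) \<le> (\<integral>\<^sup>+x. ennreal (2 powr p) * (\<Sum>n. ?g n x) \<partial>M)"
 proof (rule nn_integral_mono)
  fix x
  have "ennreal_powr (S x) p \<le> ennreal (2 powr p) * dyadic_sum p (S x)"
   using p by (intro powr_le_dyadic_sum) auto
  also have "dyadic_sum p (S x) \<le> (\<Sum>n. ?g n x)"
   unfolding dyadic_sum_def using up[of _ x]
   by (intro suminf_le) (auto simp: indicator_def powr_powr mult.commute)
  finally show "ennreal_powr (S x) p \<le> ennreal (2 powr p) * (\<Sum>n. ?g n x)" by (simp add: mult_left_mono)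
 qed
 also have "... = ennreal (2 powr p) * (\<Sum>n. \<integral>\<^sup>+x. ?g n x \<partial>M)"
  by (simp add: nn_integral_cmult nn_integral_suminf)
 also have "(\<Sum>n. \<integral>\<^sup>+x. ?g n x \<partial>M) = (\<Sum>n. level (int_decode n))"
  by (simp add: level_def nn_integral_cmult_indicator)
 also have "... \<le> K"
 proof (rule suminf_le_const)
  fix N
  have "(\<Sum>n<N. level (int_decode n)) = (\<Sum>m\<in>int_decode ` {..<N}. level m)"
   by (subst sum.reindex) (auto simp: inj_on_def inj_int_decode[THEN injD])
  also have "... \<le> K" by (intro K) auto
  finally show "(\<Sum>n<N. level (int_decode n)) \<le> K" .
 qed auto
 finally have "(\<integral>\<^sup>+x. ennreal_powr (S x) p \<partial>M) \<le> ennreal (2 powr p) * K" by (simp add: mult_left_mono)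
 also have "... < \<infinity>" using K by (simp add: ennreal_mult_less_top)
 finally show ?thesis by (simp add: Lp_nonneg_def)
qed

lemma dosc_le_S:
 assumes f: "f \<in> \<F>" and t: "0 < t"
 shows "dosc M f x t \<le> ennreal t * S x * (vol x t)\<^sup>2"
proof (cases "S x")
 case top
 have "0 < vol x t" using ball_pos[OF t] .
 then show ?thesis using top t by (simp add: ennreal_mult_top ennreal_top_mult zero_less_iff_neq_zero)
next
 case (real s)
 define v where "v = enn2real (vol x t)"
 have v: "vol x t = ennreal v" "0 < v"
  using ball_pos[OF t, of x] ball_finite[of x t] by (auto simp: v_def less_top enn2real_positive_iff)
 show ?thesis
 proof (rule ennreal_le_epsilon)
  fix e :: real assume e: "0 < e"
  define d where "d = e / (t * v\<^sup>2)"
  have d: "0 < d" using e t v by (simp add: d_def)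
  obtain \<tau> where \<tau>: "\<tau> \<in> \<rat>" "s < \<tau>" "\<tau> < s + d" using Rats_dense_in_real[of s "s + d"] d by auto
  have "x \<notin> U \<tau>"
  proof
   assume "x \<in> U \<tau>"
   then have "ennreal \<tau> \<le> S x"
    unfolding S_def using \<tau> real by (intro SUP_upper2[of \<tau>]) auto
   then show False using \<tau> real by (simp add: ennreal_le_iff)
  qed
  then have "dosc M f x t \<le> ennreal (\<tau> * t) * (ennreal v)\<^sup>2"
   using dosc_le_off_U[OF f, of x \<tau> x t] t v by simp
  also have "... \<le> ennreal ((s + d) * t) * (ennreal v)\<^sup>2"
   using \<tau> t by (intro mult_right_mono ennreal_leI) auto
  also have "... = ennreal ((s + d) * t * v\<^sup>2)"
   using v real d t by (simp add: ennreal_mult ennreal_power)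
  also have "(s + d) * t * v\<^sup>2 = t * s * v\<^sup>2 + e" using t v by (simp add: d_def field_simps)
  also have "ennreal ... = ennreal t * S x * (vol x t)\<^sup>2 + ennreal e"
   using v real t e by (simp add: ennreal_mult ennreal_power)
  finally show "dosc M f x t \<le> ennreal t * S x * (vol x t)\<^sup>2 + ennreal e" .
 qed
qed

text \<open>Only the null set depends on f, whereas S is common to the family. A countable family
  therefore has one pointwise gradient off one null set.\<close>

theorem family_pointwise_gradient:
 assumes f: "f \<in> \<F>"
 obtains N where "N \<in> null_sets M"
  "\<And>x y. x \<notin> N \<Longrightarrow> y \<notin> N \<Longrightarrow> ennreal \<bar>f x - f y\<bar> \<le> ennreal (30 * D ^ 3 * dist x y) * (S x + S y)"
proof -
 obtain N where N: "N \<in> null_sets M"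
  "\<And>x y. x \<in> UNIV - N \<Longrightarrow> y \<in> UNIV - N \<Longrightarrow> 2 * dist x y \<in> {0<..} \<Longrightarrow>
   ennreal \<bar>f x - f y\<bar> \<le> ennreal (30 * D ^ 3 * dist x y) * (S x + S y)"
  by (rule ld.lipschitz_off_null[OF family_measurable[OF f] borel_measurable_M[OF S_borel]])
   (use dosc_le_S[OF f] in auto)
 have "ennreal \<bar>f x - f y\<bar> \<le> ennreal (30 * D ^ 3 * dist x y) * (S x + S y)" if "x \<notin> N" "y \<notin> N" for x y
  using N(2)[of x y] that by (cases "x = y") auto
 then show ?thesis using N(1) that by blast
qed

end

section \<open>Weighted integrals of Banach-valued functions\<close>

text \<open>The Bochner integral of the library needs a second countable target type. For an
 essentially separably valued map it is rebuilt here from finite-range approximations.\<close>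

definition weighted_sum :: "'a measure \<Rightarrow> ('a \<Rightarrow> real) \<Rightarrow> ('a \<Rightarrow> 'b::real_vector) \<Rightarrow> 'b" where
 "weighted_sum M \<phi> s = (\<Sum>y\<in>range s. (LINT x|M. \<phi> x * indicator (s -` {y}) x) *\<^sub>R y)"

text \<open>The sum may be computed over any finite partition finer than the level sets. With P x =
  (s x, t x), two finite-range maps are brought to a common partition.\<close>

lemma weighted_sum_refine:
 fixes P :: "'a \<Rightarrow> 'i" and v :: "'i \<Rightarrow> 'b::real_vector"
 assumes M: "space M = UNIV" and fin: "finite (range P)" and meas: "\<And>i. P -` {i} \<in> sets M" and \<phi>: "integrable M \<phi>"
 shows "weighted_sum M \<phi> (\<lambda>x. v (P x)) = (\<Sum>i\<in>range P. (LINT x|M. \<phi> x * indicator (P -` {i}) x) *\<^sub>R v i)"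
proof -
 have int: "integrable M (\<lambda>x. \<phi> x * indicator (P -` {i}) x)" for i
  using integrable_mult_indicator[OF meas \<phi>] by (simp add: mult.commute)
 have r: "range (\<lambda>x. v (P x)) = v ` range P" by auto
 have "(\<Sum>i\<in>range P. (LINT x|M. \<phi> x * indicator (P -` {i}) x) *\<^sub>R v i)
  = (\<Sum>y\<in>v ` range P. \<Sum>i\<in>{i\<in>range P. v i = y}. (LINT x|M. \<phi> x * indicator (P -` {i}) x) *\<^sub>R v i)"
  by (rule sum.image_gen[OF fin])
 also have "... = (\<Sum>y\<in>v ` range P. (LINT x|M. \<phi> x * indicator ((\<lambda>x. v (P x)) -` {y}) x) *\<^sub>R y)"
 proof (rule sum.cong[OF refl])
  fix y
  have "(\<Sum>i\<in>{i\<in>range P. v i = y}. (LINT x|M. \<phi> x * indicator (P -` {i}) x) *\<^sub>R v i)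
   = (\<Sum>i\<in>{i\<in>range P. v i = y}. LINT x|M. \<phi> x * indicator (P -` {i}) x) *\<^sub>R y"
   by (simp add: scaleR_sum_left)
  also have "(\<Sum>i\<in>{i\<in>range P. v i = y}. LINT x|M. \<phi> x * indicator (P -` {i}) x)
   = (LINT x|M. (\<Sum>i\<in>{i\<in>range P. v i = y}. \<phi> x * indicator (P -` {i}) x))"
   using int by (intro Bochner_Integration.integral_sum[symmetric]) auto
  also have "... = (LINT x|M. \<phi> x * indicator ((\<lambda>x. v (P x)) -` {y}) x)"
  proof (rule Bochner_Integration.integral_cong[OF refl])
   fix x
   have "(\<Sum>i\<in>{i\<in>range P. v i = y}. indicator (P -` {i}) x :: real) = (\<Sum>i\<in>{i\<in>range P. v i = y}. if i = P x then 1 else 0)"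
    by (intro sum.cong) (auto simp: indicator_def)
   also have "... = indicator ((\<lambda>x. v (P x)) -` {y}) x"
    using fin by (simp add: indicator_def)
   finally show "(\<Sum>i\<in>{i\<in>range P. v i = y}. \<phi> x * indicator (P -` {i}) x) = \<phi> x * indicator ((\<lambda>x. v (P x)) -` {y}) x"
    by (simp add: sum_distrib_left[symmetric])
  qed
  finally show "(\<Sum>i\<in>{i\<in>range P. v i = y}. (LINT x|M. \<phi> x * indicator (P -` {i}) x) *\<^sub>R v i)
   = (LINT x|M. \<phi> x * indicator ((\<lambda>x. v (P x)) -` {y}) x) *\<^sub>R y" .
 qed
 finally show ?thesis by (simp add: weighted_sum_def r)
qed

lemma weighted_sum_const:
 assumes "space M = UNIV" "integrable M \<phi>"
 shows "weighted_sum M \<phi> (\<lambda>_. c) = (LINT x|M. \<phi> x) *\<^sub>R c"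
 by (simp add: weighted_sum_def)

lemma weighted_sum_diff_weight:
 assumes M: "space M = UNIV" and meas: "\<And>y. s -` {y} \<in> sets M" and \<phi>: "integrable M \<phi>" "integrable M \<psi>"
 shows "weighted_sum M \<phi> s - weighted_sum M \<psi> s = weighted_sum M (\<lambda>x. \<phi> x - \<psi> x) s"
proof -
 have int: "integrable M (\<lambda>x. \<phi> x * indicator (s -` {i}) x)" "integrable M (\<lambda>x. \<psi> x * indicator (s -` {i}) x)" for i
  using integrable_mult_indicator[OF meas \<phi>(1)] integrable_mult_indicator[OF meas \<phi>(2)] by (simp_all add: mult.commute)
 show ?thesis
  unfolding weighted_sum_def by (simp add: left_diff_distrib int sum_subtractf scaleR_left_diff_distrib)
qed

lemma weighted_sum_norm_diff:
 fixes s t :: "'a \<Rightarrow> 'b::real_normed_vector"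
 assumes M: "space M = UNIV" and fin: "finite (range s)" "finite (range t)"
  and meas: "\<And>y. s -` {y} \<in> sets M" "\<And>y. t -` {y} \<in> sets M" and \<phi>: "integrable M \<phi>"
 shows "enorm (weighted_sum M \<phi> s - weighted_sum M \<phi> t) \<le> (\<integral>\<^sup>+x. ennreal (\<bar>\<phi> x\<bar> * norm (s x - t x)) \<partial>M)"
proof -
 define P where "P x = (s x, t x)" for x
 have "range P \<subseteq> range s \<times> range t" by (auto simp: P_def)
 then have fP: "finite (range P)" using fin by (meson finite_SigmaI finite_subset)
 have mP: "P -` {i} \<in> sets M" for i
 proof -
  have "P -` {i} = s -` {fst i} \<inter> t -` {snd i}" by (auto simp: P_def)
  then show ?thesis using meas by auto
 qed
 note [measurable] = mP
 have [measurable]: "\<phi> \<in> borel_measurable M" using \<phi> by auto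
 let ?a = "\<lambda>i. LINT x|M. \<phi> x * indicator (P -` {i}) x"
 have int: "integrable M (\<lambda>x. \<phi> x * indicator (P -` {i}) x)" for i
  using integrable_mult_indicator[OF mP \<phi>] by (simp add: mult.commute)
 have "weighted_sum M \<phi> s = (\<Sum>i\<in>range P. ?a i *\<^sub>R fst i)" "weighted_sum M \<phi> t = (\<Sum>i\<in>range P. ?a i *\<^sub>R snd i)"
  using weighted_sum_refine[OF M fP mP \<phi>, of fst] weighted_sum_refine[OF M fP mP \<phi>, of snd] by (simp_all add: P_def)
 then have "weighted_sum M \<phi> s - weighted_sum M \<phi> t = (\<Sum>i\<in>range P. ?a i *\<^sub>R (fst i - snd i))"
  by (simp add: sum_subtractf scaleR_diff_right)
 also have "norm ... \<le> (\<Sum>i\<in>range P. \<bar>?a i\<bar> * norm (fst i - snd i))"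
  by (rule order_trans[OF norm_sum]) simp
 finally have "enorm (weighted_sum M \<phi> s - weighted_sum M \<phi> t) \<le> ennreal (\<Sum>i\<in>range P. \<bar>?a i\<bar> * norm (fst i - snd i))"
  by (rule ennreal_leI)
 also have "... = (\<Sum>i\<in>range P. ennreal \<bar>?a i\<bar> * enorm (fst i - snd i))"
  by (subst sum_ennreal[symmetric]) (auto simp: ennreal_mult)
 also have "... \<le> (\<Sum>i\<in>range P. (\<integral>\<^sup>+x. ennreal \<bar>\<phi> x\<bar> * indicator (P -` {i}) x \<partial>M) * enorm (fst i - snd i))"
 proof (intro sum_mono mult_right_mono)
  fix i
  have "ennreal \<bar>?a i\<bar> \<le> (\<integral>\<^sup>+x. enorm (\<phi> x * indicator (P -` {i}) x) \<partial>M)"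
   using integral_norm_bound_ennreal[OF int[of i]] by simp
  also have "... = (\<integral>\<^sup>+x. ennreal \<bar>\<phi> x\<bar> * indicator (P -` {i}) x \<partial>M)"
   by (intro nn_integral_cong) (auto simp: indicator_def)
  finally show "ennreal \<bar>?a i\<bar> \<le> (\<integral>\<^sup>+x. ennreal \<bar>\<phi> x\<bar> * indicator (P -` {i}) x \<partial>M)" .
 qed auto
 also have "... = (\<Sum>i\<in>range P. \<integral>\<^sup>+x. ennreal \<bar>\<phi> x\<bar> * indicator (P -` {i}) x * enorm (fst i - snd i) \<partial>M)"
  by (intro sum.cong refl nn_integral_multc[symmetric]) measurable
 also have "... = (\<integral>\<^sup>+x. (\<Sum>i\<in>range P. ennreal \<bar>\<phi> x\<bar> * indicator (P -` {i}) x * enorm (fst i - snd i)) \<partial>M)"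
  by (rule nn_integral_sum[symmetric]) measurable
 also have "... = (\<integral>\<^sup>+x. ennreal (\<bar>\<phi> x\<bar> * norm (s x - t x)) \<partial>M)"
 proof (rule nn_integral_cong)
  fix x
  have "(\<Sum>i\<in>range P. ennreal \<bar>\<phi> x\<bar> * indicator (P -` {i}) x * enorm (fst i - snd i))
   = (\<Sum>i\<in>range P. if i = P x then ennreal \<bar>\<phi> x\<bar> * enorm (fst i - snd i) else 0)"
   by (intro sum.cong) (auto simp: indicator_def)
  also have "... = ennreal (\<bar>\<phi> x\<bar> * norm (s x - t x))"
   using fP by (simp add: P_def ennreal_mult)
  finally show "(\<Sum>i\<in>range P. ennreal \<bar>\<phi> x\<bar> * indicator (P -` {i}) x * enorm (fst i - snd i)) = ennreal (\<bar>\<phi> x\<bar> * norm (s x - t x))" .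
 qed
 finally show ?thesis .
qed

text \<open>The nearest point to u x among 0 and the first n members of the sequence, ties going to
  the earlier one. Starting from 0 keeps the error below the norm of u, which then serves as
  dominating function.\<close>

fun nearest_approx :: "(nat \<Rightarrow> 'b::real_normed_vector) \<Rightarrow> ('a \<Rightarrow> 'b) \<Rightarrow> nat \<Rightarrow> 'a \<Rightarrow> 'b" where
 "nearest_approx e u 0 x = 0"
| "nearest_approx e u (Suc n) x =
  (if norm (u x - e n) < norm (u x - nearest_approx e u n x) then e n else nearest_approx e u n x)"

lemma nearest_approx_finite: "finite (range (nearest_approx e u n))"
proof (induction n)
 case (Suc n)
 have "range (nearest_approx e u (Suc n)) \<subseteq> insert (e n) (range (nearest_approx e u n))" by auto
 then show ?case using Suc by (meson finite_insert finite_subset)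
qed (simp add: image_def)

lemma norm_diff_measurable:
 fixes u :: "'a \<Rightarrow> 'b::real_normed_vector"
 assumes "u \<in> borel_measurable M"
 shows "(\<lambda>x. norm (u x - c)) \<in> borel_measurable M"
proof -
 have "continuous_on UNIV (\<lambda>v. norm (v - c))" by (intro continuous_intros)
 from measurable_compose[OF assms borel_measurable_continuous_onI[OF this]] show ?thesis .
qed

lemma nearest_approx_measurable:
 assumes M: "space M = UNIV" and u: "u \<in> borel_measurable M"
 shows "(\<lambda>x. norm (u x - nearest_approx e u n x)) \<in> borel_measurable M \<and> nearest_approx e u n -` {y} \<in> sets M"
proof (induction n arbitrary: y)
 case 0
 have "nearest_approx e u 0 -` {y} = (if y = 0 then UNIV else {})" by auto
 then show ?case using norm_diff_measurable[OF u, of 0] M sets.top[of M] by auto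
next
 case (Suc n)
 have [measurable]: "(\<lambda>x. norm (u x - nearest_approx e u n x)) \<in> borel_measurable M"
  "(\<lambda>x. norm (u x - e n)) \<in> borel_measurable M" using Suc norm_diff_measurable[OF u] by auto
 have "(\<lambda>x. norm (u x - nearest_approx e u (Suc n) x))
  = (\<lambda>x. if norm (u x - e n) < norm (u x - nearest_approx e u n x) then norm (u x - e n) else norm (u x - nearest_approx e u n x))"
  by auto
 then have 1: "(\<lambda>x. norm (u x - nearest_approx e u (Suc n) x)) \<in> borel_measurable M" by simp
 let ?c = "{x \<in> space M. norm (u x - e n) < norm (u x - nearest_approx e u n x)}"
 have c: "?c \<in> sets M" by measurable
 have "nearest_approx e u (Suc n) -` {y} = (?c \<inter> (if e n = y then space M else {})) \<union> (nearest_approx e u n -` {y} - ?c)"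
  using M by auto
 moreover have "(?c \<inter> (if e n = y then space M else {})) \<union> (nearest_approx e u n -` {y} - ?c) \<in> sets M"
  using c Suc[of y] by auto
 ultimately have 2: "nearest_approx e u (Suc n) -` {y} \<in> sets M" by (simp only:)
 show ?case by (intro conjI 1 2)
qed

lemma nearest_approx_le:
 "norm (u x - nearest_approx e u n x) \<le> norm (u x)" "i < n \<Longrightarrow> norm (u x - nearest_approx e u n x) \<le> norm (u x - e i)"
 by (induction n) (auto simp: less_Suc_eq)

lemma nearest_approx_tendsto:
 assumes "u x \<in> closure (range e)"
 shows "(\<lambda>n. norm (u x - nearest_approx e u n x)) \<longlonglongrightarrow> 0"
proof (rule LIMSEQ_I)
 fix r :: real assume "0 < r"
 then obtain i where i: "dist (e i) (u x) < r" using assms by (auto simp: closure_approachable)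
 show "\<exists>no. \<forall>n\<ge>no. norm (norm (u x - nearest_approx e u n x) - 0) < r"
 proof (intro exI[of _ "Suc i"] allI impI)
  fix n assume "Suc i \<le> n"
  then have "norm (u x - nearest_approx e u n x) \<le> norm (u x - e i)" by (intro nearest_approx_le) auto
  then show "norm (norm (u x - nearest_approx e u n x) - 0) < r" using i by (simp add: dist_norm norm_minus_commute)
 qed
qed

text \<open>The functional is the limit of \<open>weighted_sum\<close> along the nearest-point
  approximations. One inequality records all that is used: the dependence on the weight, and the
  fact that only the deviation of u from an arbitrary constant c matters.\<close>

proposition vector_integral_exists:
 fixes u :: "'a \<Rightarrow> 'b::banach"
 assumes M: "space M = UNIV" and u: "u \<in> borel_measurable M" and C: "countable C" "range u \<subseteq> closure C"
 obtains I :: "('a \<Rightarrow> real) \<Rightarrow> 'b" where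
  "\<And>\<phi> \<psi> c. integrable M \<phi> \<Longrightarrow> integrable M \<psi> \<Longrightarrow>
   (\<integral>\<^sup>+x. ennreal (\<bar>\<phi> x\<bar> * norm (u x)) \<partial>M) < \<infinity> \<Longrightarrow> (\<integral>\<^sup>+x. ennreal (\<bar>\<psi> x\<bar> * norm (u x)) \<partial>M) < \<infinity> \<Longrightarrow>
   enorm (I \<phi> - I \<psi> - ((LINT x|M. \<phi> x) - (LINT x|M. \<psi> x)) *\<^sub>R c)
    \<le> (\<integral>\<^sup>+x. ennreal (\<bar>\<phi> x - \<psi> x\<bar> * norm (u x - c)) \<partial>M)"
proof -
 have Cne: "C \<noteq> {}" using C(2) by auto
 define e where "e = from_nat_into C"
 have re: "range e = C" unfolding e_def by (rule range_from_nat_into[OF Cne C(1)])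
 define s where "s n = nearest_approx e u n" for n
 have fs: "finite (range (s n))" for n unfolding s_def by (rule nearest_approx_finite)
 have ms: "s n -` {y} \<in> sets M" and dm [measurable]: "(\<lambda>x. norm (u x - s n x)) \<in> borel_measurable M" for n y
  unfolding s_def using nearest_approx_measurable[OF M u] by auto
 note norm_diff_measurable[OF u, measurable]
 have [measurable]: "(\<lambda>x. norm (u x)) \<in> borel_measurable M" using norm_diff_measurable[OF u, of 0] by simp
 have tail: "(\<lambda>n. \<integral>\<^sup>+x. ennreal (\<bar>\<phi> x\<bar> * norm (u x - s n x)) \<partial>M) \<longlonglongrightarrow> 0"
  if \<phi>: "integrable M \<phi>" "(\<integral>\<^sup>+x. ennreal (\<bar>\<phi> x\<bar> * norm (u x)) \<partial>M) < \<infinity>" for \<phi>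
 proof -
  have [measurable]: "\<phi> \<in> borel_measurable M" using \<phi> by auto
  have "(\<lambda>n. \<integral>\<^sup>+x. ennreal (\<bar>\<phi> x\<bar> * norm (u x - s n x)) \<partial>M) \<longlonglongrightarrow> (\<integral>\<^sup>+x. ennreal 0 \<partial>M)"
  proof (rule nn_integral_dominated_convergence[where w = "\<lambda>x. ennreal (\<bar>\<phi> x\<bar> * norm (u x))"])
   show "AE x in M. ennreal (\<bar>\<phi> x\<bar> * norm (u x - s n x)) \<le> ennreal (\<bar>\<phi> x\<bar> * norm (u x))" for n
    unfolding s_def by (intro AE_I2 ennreal_leI mult_left_mono nearest_approx_le) auto
   show "AE x in M. (\<lambda>n. ennreal (\<bar>\<phi> x\<bar> * norm (u x - s n x))) \<longlonglongrightarrow> ennreal 0"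
   proof (intro AE_I2 tendsto_ennrealI)
    fix x
    have "(\<lambda>n. norm (u x - s n x)) \<longlonglongrightarrow> 0"
     unfolding s_def using C re by (intro nearest_approx_tendsto) auto
    then show "(\<lambda>n. \<bar>\<phi> x\<bar> * norm (u x - s n x)) \<longlonglongrightarrow> 0" by (rule tendsto_mult_right_zero)
   qed
  qed (use \<phi> in auto)
  then show ?thesis by simp
 qed
 have conv: "convergent (\<lambda>n. weighted_sum M \<phi> (s n))"
  if \<phi>: "integrable M \<phi>" "(\<integral>\<^sup>+x. ennreal (\<bar>\<phi> x\<bar> * norm (u x)) \<partial>M) < \<infinity>" for \<phi>
 proof -
  have [measurable]: "\<phi> \<in> borel_measurable M" using \<phi> by auto
  have "Cauchy (\<lambda>n. weighted_sum M \<phi> (s n))"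
  proof (rule metric_CauchyI)
   fix r :: real assume r: "0 < r"
   have "eventually (\<lambda>n. (\<integral>\<^sup>+x. ennreal (\<bar>\<phi> x\<bar> * norm (u x - s n x)) \<partial>M) < ennreal (r / 2)) sequentially"
    using r by (intro order_tendstoD(2)[OF tail[OF \<phi>]]) auto
   then obtain N where N: "\<And>n. n \<ge> N \<Longrightarrow> (\<integral>\<^sup>+x. ennreal (\<bar>\<phi> x\<bar> * norm (u x - s n x)) \<partial>M) < ennreal (r / 2)"
    by (auto simp: eventually_sequentially)
   show "\<exists>K. \<forall>m\<ge>K. \<forall>n\<ge>K. dist (weighted_sum M \<phi> (s m)) (weighted_sum M \<phi> (s n)) < r"
   proof (intro exI[of _ N] allI impI)
    fix m n assume mn: "N \<le> m" "N \<le> n"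
    have "enorm (weighted_sum M \<phi> (s m) - weighted_sum M \<phi> (s n))
     \<le> (\<integral>\<^sup>+x. ennreal (\<bar>\<phi> x\<bar> * norm (s m x - s n x)) \<partial>M)"
     by (rule weighted_sum_norm_diff[OF M fs fs ms ms \<phi>(1)])
    also have "... \<le> (\<integral>\<^sup>+x. ennreal (\<bar>\<phi> x\<bar> * norm (u x - s m x)) + ennreal (\<bar>\<phi> x\<bar> * norm (u x - s n x)) \<partial>M)"
    proof (rule nn_integral_mono)
     fix x
     have "norm (s m x - s n x) \<le> norm (u x - s m x) + norm (u x - s n x)"
      using norm_triangle_ineq4[of "u x - s n x" "u x - s m x"] by simp
     then have "\<bar>\<phi> x\<bar> * norm (s m x - s n x) \<le> \<bar>\<phi> x\<bar> * norm (u x - s m x) + \<bar>\<phi> x\<bar> * norm (u x - s n x)"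
      by (simp add: distrib_left[symmetric] mult_left_mono)
     then show "ennreal (\<bar>\<phi> x\<bar> * norm (s m x - s n x)) \<le> ennreal (\<bar>\<phi> x\<bar> * norm (u x - s m x)) + ennreal (\<bar>\<phi> x\<bar> * norm (u x - s n x))"
      by (simp flip: ennreal_plus add: ennreal_leI)
    qed
    also have "... = (\<integral>\<^sup>+x. ennreal (\<bar>\<phi> x\<bar> * norm (u x - s m x)) \<partial>M) + (\<integral>\<^sup>+x. ennreal (\<bar>\<phi> x\<bar> * norm (u x - s n x)) \<partial>M)"
     by (rule nn_integral_add) measurable
    also have "... < ennreal (r / 2) + ennreal (r / 2)" using N[OF mn(1)] N[OF mn(2)] by (rule add_strict_mono)
    also have "... = ennreal r" using r by (simp flip: ennreal_plus)
    finally show "dist (weighted_sum M \<phi> (s m)) (weighted_sum M \<phi> (s n)) < r" using r by (simp add: dist_norm ennreal_less_iff)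
   qed
  qed
  then show ?thesis by (simp add: Cauchy_convergent_iff)
 qed
 define I where "I \<phi> = lim (\<lambda>n. weighted_sum M \<phi> (s n))" for \<phi>
 show ?thesis
 proof (rule that[of I])
  fix \<phi> \<psi> :: "'a \<Rightarrow> real" and c :: 'b
  assume int: "integrable M \<phi>" "integrable M \<psi>"
   and fin: "(\<integral>\<^sup>+x. ennreal (\<bar>\<phi> x\<bar> * norm (u x)) \<partial>M) < \<infinity>" "(\<integral>\<^sup>+x. ennreal (\<bar>\<psi> x\<bar> * norm (u x)) \<partial>M) < \<infinity>"
  have [measurable]: "\<phi> \<in> borel_measurable M" "\<psi> \<in> borel_measurable M" using int by auto
  define \<theta> where "\<theta> x = \<phi> x - \<psi> x" for x
  have \<theta>: "integrable M \<theta>" unfolding \<theta>_def using int by auto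
  have [measurable]: "\<theta> \<in> borel_measurable M" using \<theta> by auto
  have fin\<theta>: "(\<integral>\<^sup>+x. ennreal (\<bar>\<theta> x\<bar> * norm (u x)) \<partial>M) < \<infinity>"
  proof -
   have "(\<integral>\<^sup>+x. ennreal (\<bar>\<theta> x\<bar> * norm (u x)) \<partial>M) \<le> (\<integral>\<^sup>+x. ennreal (\<bar>\<phi> x\<bar> * norm (u x)) + ennreal (\<bar>\<psi> x\<bar> * norm (u x)) \<partial>M)"
   proof (rule nn_integral_mono)
    fix x
    have "\<bar>\<theta> x\<bar> * norm (u x) \<le> (\<bar>\<phi> x\<bar> + \<bar>\<psi> x\<bar>) * norm (u x)" unfolding \<theta>_def by (intro mult_right_mono) auto
    then show "ennreal (\<bar>\<theta> x\<bar> * norm (u x)) \<le> ennreal (\<bar>\<phi> x\<bar> * norm (u x)) + ennreal (\<bar>\<psi> x\<bar> * norm (u x))"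
     by (simp flip: ennreal_plus add: ennreal_leI distrib_right)
   qed
   also have "... = (\<integral>\<^sup>+x. ennreal (\<bar>\<phi> x\<bar> * norm (u x)) \<partial>M) + (\<integral>\<^sup>+x. ennreal (\<bar>\<psi> x\<bar> * norm (u x)) \<partial>M)"
    by (rule nn_integral_add) measurable
   also have "... < \<infinity>" using fin by simp
   finally show ?thesis .
  qed
  have lim: "(\<lambda>n. weighted_sum M \<phi> (s n)) \<longlonglongrightarrow> I \<phi>" "(\<lambda>n. weighted_sum M \<psi> (s n)) \<longlonglongrightarrow> I \<psi>"
   unfolding I_def using conv[OF int(1) fin(1)] conv[OF int(2) fin(2)] by (simp_all add: convergent_LIMSEQ_iff)
  have ck: "(\<lambda>_. c) -` {y} \<in> sets M" for y :: 'b using sets.top[of M] M by (cases "c = y") (auto simp: vimage_def)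
  let ?d = "((LINT x|M. \<phi> x) - (LINT x|M. \<psi> x)) *\<^sub>R c"
  let ?Y = "\<integral>\<^sup>+x. ennreal (\<bar>\<theta> x\<bar> * norm (u x - c)) \<partial>M"
  have each: "enorm (weighted_sum M \<phi> (s n) - weighted_sum M \<psi> (s n) - ?d)
   \<le> ?Y + (\<integral>\<^sup>+x. ennreal (\<bar>\<theta> x\<bar> * norm (u x - s n x)) \<partial>M)" for n
  proof -
   have "weighted_sum M \<phi> (s n) - weighted_sum M \<psi> (s n) - ?d = weighted_sum M \<theta> (s n) - weighted_sum M \<theta> (\<lambda>_. c)"
    using weighted_sum_diff_weight[OF M ms int, of n] weighted_sum_const[OF M \<theta>, of c] int by (simp add: \<theta>_def[abs_def])
   then have "enorm (weighted_sum M \<phi> (s n) - weighted_sum M \<psi> (s n) - ?d) \<le> (\<integral>\<^sup>+x. ennreal (\<bar>\<theta> x\<bar> * norm (s n x - c)) \<partial>M)"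
    using weighted_sum_norm_diff[OF M fs[of n] _ ms ck \<theta>] by simp
   also have "... \<le> (\<integral>\<^sup>+x. ennreal (\<bar>\<theta> x\<bar> * norm (u x - c)) + ennreal (\<bar>\<theta> x\<bar> * norm (u x - s n x)) \<partial>M)"
   proof (rule nn_integral_mono)
    fix x
    have "norm (s n x - c) \<le> norm (u x - c) + norm (u x - s n x)"
     using norm_triangle_ineq4[of "u x - c" "u x - s n x"] by simp
    then have "\<bar>\<theta> x\<bar> * norm (s n x - c) \<le> \<bar>\<theta> x\<bar> * norm (u x - c) + \<bar>\<theta> x\<bar> * norm (u x - s n x)"
     by (simp add: distrib_left[symmetric] mult_left_mono)
    then show "ennreal (\<bar>\<theta> x\<bar> * norm (s n x - c)) \<le> ennreal (\<bar>\<theta> x\<bar> * norm (u x - c)) + ennreal (\<bar>\<theta> x\<bar> * norm (u x - s n x))"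
     by (simp flip: ennreal_plus add: ennreal_leI)
   qed
   also have "... = ?Y + (\<integral>\<^sup>+x. ennreal (\<bar>\<theta> x\<bar> * norm (u x - s n x)) \<partial>M)"
    by (rule nn_integral_add) measurable
   finally show ?thesis .
  qed
  have "(\<lambda>n. enorm (weighted_sum M \<phi> (s n) - weighted_sum M \<psi> (s n) - ?d)) \<longlonglongrightarrow> enorm (I \<phi> - I \<psi> - ?d)"
   by (intro tendsto_intros lim)
  moreover have "(\<lambda>n. ?Y + (\<integral>\<^sup>+x. ennreal (\<bar>\<theta> x\<bar> * norm (u x - s n x)) \<partial>M)) \<longlonglongrightarrow> ?Y + 0"
   by (intro tendsto_add tendsto_const tail[OF \<theta> fin\<theta>])
  ultimately have "enorm (I \<phi> - I \<psi> - ?d) \<le> ?Y + 0"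
   by (rule LIMSEQ_le) (use each in blast)
  then show "enorm (I \<phi> - I \<psi> - ?d) \<le> (\<integral>\<^sup>+x. ennreal (\<bar>\<phi> x - \<psi> x\<bar> * norm (u x - c)) \<partial>M)"
   by (simp add: \<theta>_def)
 qed
qed

section \<open>Regularity of finite Borel measures\<close>

text \<open>The sets with this property form a sigma-algebra. An open set is exhausted by the closed
  sets of points at distance at least 1/(n+1) from its complement. For a countable union only
  finitely many closed sets are kept, so that their union stays closed; finiteness of the measure
  makes the rest small.\<close>

lemma closed_open_regular:
 fixes m :: "'a::metric_space measure"
 assumes sets: "sets borel \<subseteq> sets m" and fin: "emeasure m (space m) < \<infinity>" and B: "B \<in> sets borel"
 shows "\<forall>e>0. \<exists>F H. closed F \<and> open H \<and> F \<subseteq> B \<and> B \<subseteq> H \<and> emeasure m (H - F) \<le> ennreal e"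
proof -
 have finA: "emeasure m A < \<infinity>" for A
  using emeasure_space[of m A] fin by (simp add: le_less_trans)
 have "B \<in> sigma_sets UNIV {S. open S}" using B by (simp add: borel_def)
 then show ?thesis
 proof induction
  case (Basic S)
  then have S: "open S" by simp
  show ?case
  proof (intro allI impI)
   fix e :: real assume e: "0 < e"
   show "\<exists>F H. closed F \<and> open H \<and> F \<subseteq> S \<and> S \<subseteq> H \<and> emeasure m (H - F) \<le> ennreal e"
   proof (cases "S = UNIV")
    case True
    then show ?thesis by (intro exI[of _ UNIV]) auto
   next
    case False
    then have ne: "- S \<noteq> {}" by auto
    define F where "F n = {x. 1 / real (Suc n) \<le> infdist x (- S)}" for n
    have cl: "closed (F n)" for n
     unfolding F_def by (intro closed_Collect_le continuous_intros)
    have sub: "F n \<subseteq> S" for n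
    proof
     fix x assume "x \<in> F n"
     then have "0 < infdist x (- S)" by (auto simp: F_def intro: less_le_trans[rotated])
     then show "x \<in> S" by (intro ccontr[of "x \<in> S"]) simp
    qed
    have empty: "(\<Inter>n. S - F n) = {}"
    proof (rule equals0I)
     fix x assume x: "x \<in> (\<Inter>n. S - F n)"
     then have "0 < infdist x (- S)"
      using S ne by (subst infdist_pos_not_in_closed) auto
     then obtain n where "1 / real (Suc n) < infdist x (- S)" using nat_approx_posE by blast
     then show False using x by (auto simp: F_def dest!: spec[of _ n])
    qed
    have "(\<lambda>n. emeasure m (S - F n)) \<longlonglongrightarrow> emeasure m (\<Inter>n. S - F n)"
    proof (rule Lim_emeasure_decseq)
     show "range (\<lambda>n. S - F n) \<subseteq> sets m" using S cl sets by (auto intro!: sets.Diff)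
     show "decseq (\<lambda>n. S - F n)"
     proof (rule decseq_SucI)
      fix n
      have "1 / real (Suc (Suc n)) \<le> 1 / real (Suc n)" by (intro divide_left_mono) auto
      then show "S - F (Suc n) \<subseteq> S - F n" by (auto simp: F_def)
     qed
     show "emeasure m (S - F i) \<noteq> \<infinity>" for i using finA[of "S - F i"] by simp
    qed
    then have "(\<lambda>n. emeasure m (S - F n)) \<longlonglongrightarrow> 0" unfolding empty by simp
    then have "eventually (\<lambda>n. emeasure m (S - F n) < ennreal e) sequentially"
     using e by (intro order_tendstoD(2)) auto
    then obtain n where "emeasure m (S - F n) < ennreal e" by (auto simp: eventually_sequentially)
    then show ?thesis using cl S sub by (intro exI[of _ "F n"] exI[of _ S]) auto
   qed
  qed
 next
  case Empty
  then show ?case by (intro allI impI exI[of _ "{}"]) auto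
 next
  case (Compl A)
  show ?case
  proof (intro allI impI)
   fix e :: real assume "0 < e"
   from Compl.IH[rule_format, OF this]
   obtain F H where FH: "closed F" "open H" "F \<subseteq> A" "A \<subseteq> H" "emeasure m (H - F) \<le> ennreal e"
    by (elim exE conjE)
   have "- F - - H = H - F" by auto
   then show "\<exists>F H. closed F \<and> open H \<and> F \<subseteq> UNIV - A \<and> UNIV - A \<subseteq> H \<and> emeasure m (H - F) \<le> ennreal e"
    using FH by (intro exI[of _ "- H"] exI[of _ "- F"]) auto
  qed
 next
  case (Union A)
  show ?case
  proof (intro allI impI)
   fix e :: real assume e: "0 < e"
   have ex: "\<forall>i. \<exists>FH. closed (fst FH) \<and> open (snd FH) \<and> fst FH \<subseteq> A i \<and> A i \<subseteq> snd FH \<and> emeasure m (snd FH - fst FH) \<le> ennreal (e / 2 * (1 / 2) ^ Suc i)"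
   proof
    fix i
    have "0 < e / 2 * (1 / 2) ^ Suc i" using e by simp
    from Union.IH[of i, rule_format, OF this]
    obtain F H where "closed F" "open H" "F \<subseteq> A i" "A i \<subseteq> H" "emeasure m (H - F) \<le> ennreal (e / 2 * (1 / 2) ^ Suc i)"
     by (elim exE conjE)
    then show "\<exists>FH. closed (fst FH) \<and> open (snd FH) \<and> fst FH \<subseteq> A i \<and> A i \<subseteq> snd FH \<and> emeasure m (snd FH - fst FH) \<le> ennreal (e / 2 * (1 / 2) ^ Suc i)"
     by (intro exI[of _ "(F, H)"]) simp
   qed
   from choice[OF ex] obtain FH where FH0: "\<forall>i. closed (fst (FH i)) \<and> open (snd (FH i)) \<and> fst (FH i) \<subseteq> A i \<and> A i \<subseteq> snd (FH i) \<and> emeasure m (snd (FH i) - fst (FH i)) \<le> ennreal (e / 2 * (1 / 2) ^ Suc i)"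
    by (elim exE)
   note FH = FH0[rule_format]
   define F where "F i = fst (FH i)" for i
   define H where "H i = snd (FH i)" for i
   have F: "closed (F i)" "F i \<subseteq> A i" and H: "open (H i)" "A i \<subseteq> H i"
    and small: "emeasure m (H i - F i) \<le> ennreal (e / 2 * (1 / 2) ^ Suc i)" for i
    using FH by (auto simp: F_def H_def)
   define G where "G n = (\<Union>i. H i) - (\<Union>i\<le>n. F i)" for n
   have Fs: "F i \<in> sets m" "H i \<in> sets m" for i using F H sets by auto
   have "(\<lambda>n. emeasure m (G n)) \<longlonglongrightarrow> emeasure m (\<Inter>n. G n)"
   proof (rule Lim_emeasure_decseq)
    show "range G \<subseteq> sets m" unfolding G_def using Fs by auto
    show "decseq G" unfolding G_def decseq_def by auto
    show "emeasure m (G i) \<noteq> \<infinity>" for i using finA[of "G i"] by simp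
   qed
   have "emeasure m (\<Inter>n. G n) \<le> emeasure m (\<Union>i. H i - F i)"
   proof (rule emeasure_mono)
    show "(\<Inter>n. G n) \<subseteq> (\<Union>i. H i - F i)"
    proof
     fix x assume x: "x \<in> (\<Inter>n. G n)"
     then obtain i where "x \<in> H i" by (auto simp: G_def)
     moreover have "x \<in> G i" using x by blast
     ultimately show "x \<in> (\<Union>i. H i - F i)" by (auto simp: G_def)
    qed
   qed (use Fs in auto)
   also have "... \<le> (\<Sum>i. emeasure m (H i - F i))"
    using Fs by (intro emeasure_subadditive_countably) auto
   also have "... \<le> (\<Sum>i. ennreal (e / 2 * (1 / 2) ^ Suc i))" by (intro suminf_le small) auto
   also have "... = ennreal (e / 2)"
   proof (rule suminf_ennreal_eq)
    show "(\<lambda>i. e / 2 * (1 / 2) ^ Suc i) sums (e / 2)"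
     using sums_mult[OF power_half_series, of "e / 2"] by simp
   qed (use e in auto)
   also have "... < ennreal e" using e by (simp add: ennreal_less_iff)
   finally have "eventually (\<lambda>n. emeasure m (G n) < ennreal e) sequentially"
    by (intro order_tendstoD(2)[OF \<open>(\<lambda>n. emeasure m (G n)) \<longlonglongrightarrow> emeasure m (\<Inter>n. G n)\<close>])
   then obtain n where n: "emeasure m (G n) < ennreal e" by (auto simp: eventually_sequentially)
   have "(\<Union>i\<le>n. F i) \<subseteq> \<Union> (range A)" "\<Union> (range A) \<subseteq> (\<Union>i. H i)"
    using F(2) H(2) by fast+
   moreover have "closed (\<Union>i\<le>n. F i)" "open (\<Union>i. H i)" using F(1) H(1) by auto
   moreover have "emeasure m ((\<Union>i. H i) - (\<Union>i\<le>n. F i)) \<le> ennreal e" using n by (simp add: G_def)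
   ultimately show "\<exists>F H. closed F \<and> open H \<and> F \<subseteq> \<Union> (range A) \<and> \<Union> (range A) \<subseteq> H \<and> emeasure m (H - F) \<le> ennreal e"
    by (intro exI conjI)
  qed
 qed
qed

section \<open>Extension from a set satisfying the measure-density condition\<close>

lemma continuous_image_separable:
 fixes f :: "'a::{metric_space,second_countable_topology} \<Rightarrow> 'b::metric_space"
 assumes "continuous_on W f"
 obtains C where "countable C" "f ` W \<subseteq> closure C"
proof -
 obtain T where T: "countable T" "T \<subseteq> W" "W \<subseteq> closure T" by (rule separable)
 have "f ` W \<subseteq> closure (f ` T)"
 proof
  fix y assume "y \<in> f ` W"
  then obtain x where x: "x \<in> W" "y = f x" by auto
  show "y \<in> closure (f ` T)"
   unfolding closure_approachable
  proof (intro allI impI)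
   fix e :: real assume "0 < e"
   then obtain d where d: "0 < d" "\<And>x'. x' \<in> W \<Longrightarrow> dist x' x < d \<Longrightarrow> dist (f x') (f x) < e"
    using assms x unfolding continuous_on_iff by metis
   obtain t where "t \<in> T" "dist t x < d" using T(3) x d closure_approachable by blast
   then show "\<exists>y'\<in>f ` T. dist y' y < e" using d(2)[of t] T(2) x by auto
  qed
 qed
 then show ?thesis using that[of "f ` T"] T by auto
qed

lemma (in doubling_measure) Lp_nonneg_ball_finite:
 assumes p: "1 < p" and g: "Lp_nonneg p M g"
 shows "(\<integral>\<^sup>+z\<in>ball x r. g z \<partial>M) < \<infinity>"
proof -
 have [measurable]: "g \<in> borel_measurable M" using g by (simp add: Lp_nonneg_def)
 have le: "y \<le> 1 + ennreal_powr y p" for y :: ennreal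
 proof (cases y)
  case (real t)
  show ?thesis
  proof (cases "t \<le> 1")
   case True
   then show ?thesis using real by (simp add: add_increasing2 ennreal_le_1)
  next
   case False
   then have "t powr 1 \<le> t powr p" using p by (intro powr_mono) auto
   then show ?thesis using real False by (simp add: ennreal_powr_ennreal add_increasing ennreal_leI)
  qed
 qed (simp add: ennreal_powr_def)
 have "(\<integral>\<^sup>+z\<in>ball x r. g z \<partial>M) \<le> (\<integral>\<^sup>+z. indicator (ball x r) z + ennreal_powr (g z) p \<partial>M)"
  using le by (intro nn_integral_mono) (auto simp: indicator_def)
 also have "... = vol x r + (\<integral>\<^sup>+z. ennreal_powr (g z) p \<partial>M)"
  by (subst nn_integral_add) auto
 also have "... < \<infinity>" using ball_finite[of x r] g by (simp add: Lp_nonneg_def)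
 finally show ?thesis .
qed

section \<open>Borel hulls and Borel majorants\<close>

context poincare_space
begin

text \<open>Equality of infinite measures would say nothing about the difference, so hulls are taken
  inside balls, where the measure is finite, and then united.\<close>

lemma borel_hull_null_diff:
 assumes A: "A \<in> sets M"
 obtains B where "B \<in> sets borel" "A \<subseteq> B" "emeasure M (B - A) = 0"
proof -
 obtain x0 :: 'a where True by simp
 have "\<exists>B. B \<in> sets borel \<and> A \<inter> ball x0 n \<subseteq> B \<and> emeasure M B = emeasure M (A \<inter> ball x0 n)" for n :: nat
  using borel_hull[of "A \<inter> ball x0 n"] A by auto
 then obtain B where B: "\<And>n::nat. B n \<in> sets borel" "\<And>n. A \<inter> ball x0 n \<subseteq> B n" "\<And>n. emeasure M (B n) = emeasure M (A \<inter> ball x0 n)"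
  by metis
 have Bm: "B n \<in> sets M" for n using B(1) sets_M by auto
 have null: "emeasure M (B n - A \<inter> ball x0 n) = 0" for n :: nat
 proof -
  have "emeasure M (A \<inter> ball x0 n) \<le> vol x0 n" by (intro emeasure_mono) auto
  then have "emeasure M (A \<inter> ball x0 n) < \<infinity>" using ball_finite[of x0 n] by (rule le_less_trans)
  then have "emeasure M (B n - A \<inter> ball x0 n) = emeasure M (B n) - emeasure M (A \<inter> ball x0 n)"
   using B(2)[of n] Bm A by (intro emeasure_Diff) auto
  then show ?thesis using B(3)[of n] \<open>emeasure M (A \<inter> ball x0 n) < \<infinity>\<close> by simp
 qed
 show ?thesis
 proof (rule that[of "\<Union>n. B n"])
  show "(\<Union>n. B n) \<in> sets borel" using B(1) by auto
  show "A \<subseteq> (\<Union>n. B n)"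
  proof
   fix x assume "x \<in> A"
   moreover obtain n :: nat where "dist x0 x < n" using reals_Archimedean2 by blast
   ultimately show "x \<in> (\<Union>n. B n)" using B(2)[of n] by auto
  qed
  have "emeasure M ((\<Union>n. B n) - A) \<le> emeasure M (\<Union>n. B n - A \<inter> ball x0 n)"
   using Bm A by (intro emeasure_mono) auto
  also have "... \<le> (\<Sum>n. emeasure M (B n - A \<inter> ball x0 n))"
   using Bm A by (intro emeasure_subadditive_countably) auto
  also have "... = 0" by (simp add: null)
  finally show "emeasure M ((\<Union>n. B n) - A) = 0" by simp
 qed
qed

text \<open>The superlevel sets at rational heights are replaced by Borel hulls, and the function is
  rebuilt as a supremum. Gradients must be Borel for line integrals, and a majorant keeps every
  pointwise inequality.\<close>

lemma borel_majorant:
 fixes f :: "'a \<Rightarrow> ennreal"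
 assumes [measurable]: "f \<in> borel_measurable M"
 obtains f' where "f' \<in> borel_measurable borel" "\<And>x. f x \<le> f' x" "AE x in M. f' x = f x"
proof -
 define A where "A q = {x. ennreal q < f x}" for q
 have A: "A q \<in> sets M" for q
 proof -
  have "{x \<in> space M. ennreal q < f x} \<in> sets M" by measurable
  then show ?thesis by (simp add: A_def)
 qed
 have "\<exists>B. B \<in> sets borel \<and> A q \<subseteq> B \<and> emeasure M (B - A q) = 0" for q
  using borel_hull_null_diff[OF A[of q]] by metis
 then obtain B where B: "\<And>q. B q \<in> sets borel" "\<And>q. A q \<subseteq> B q" "\<And>q. emeasure M (B q - A q) = 0" by metis
 let ?Q = "{q\<in>\<rat>. (0::real) < q}"
 have cQ: "countable ?Q" by (rule countable_subset[OF _ countable_rat]) auto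
 define f' where "f' x = (SUP q\<in>?Q. ennreal q * indicator (B q) x)" for x
 show ?thesis
 proof (rule that[of f'])
  note B(1)[measurable]
  show "f' \<in> borel_measurable borel" unfolding f'_def[abs_def] using cQ by measurable
  show "f x \<le> f' x" for x
  proof (rule ccontr)
   assume "\<not> ?thesis"
   then have lt: "f' x < f x" by simp
   then obtain s where s: "f' x = ennreal s" "0 \<le> s" by (cases "f' x") auto
   obtain q where q: "q \<in> \<rat>" "s < q" "ennreal q < f x"
   proof (cases "f x")
    case (real t)
    then have "s < t" using lt s by (simp add: ennreal_less_iff)
    then obtain q where "q \<in> \<rat>" "s < q" "q < t" using Rats_dense_in_real by blast
    then show ?thesis using that[of q] real s by (auto simp: ennreal_less_iff)
   next
    case top
    obtain q where "q \<in> \<rat>" "s < q" "q < s + 1" using Rats_dense_in_real[of s "s + 1"] by auto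
    then show ?thesis using that[of q] top by simp
   qed
   then have "x \<in> B q" using B(2)[of q] by (auto simp: A_def)
   then have "ennreal q \<le> f' x" unfolding f'_def using q s by (intro SUP_upper2[of q]) auto
   then show False using q s by (simp add: ennreal_le_iff)
  qed
  then have ge: "f x \<le> f' x" for x .
  have "AE x in M. \<forall>q\<in>?Q. x \<notin> B q - A q"
  proof (rule AE_ball_countable[THEN iffD2, OF cQ], intro ballI)
   fix q
   have "B q \<in> sets M" using B(1)[of q] sets_M by blast
   then have "B q - A q \<in> null_sets M" using B(3)[of q] A[of q] by (intro null_setsI sets.Diff)
   then show "AE x in M. x \<notin> B q - A q" by (rule AE_not_in)
  qed
  then show "AE x in M. f' x = f x"
  proof eventually_elim
   case (elim x)
   have "f' x \<le> f x"
    unfolding f'_def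
   proof (rule SUP_least)
    fix q assume q: "q \<in> ?Q"
    then have "x \<in> B q \<Longrightarrow> x \<in> A q" using elim by auto
    then show "ennreal q * indicator (B q) x \<le> f x" by (cases "x \<in> B q") (auto simp: A_def)
   qed
   then show ?case using ge[of x] by simp
  qed
 qed
qed

end

text \<open>A single g is both a pointwise gradient on \<open>Om\<close> and a majorant of the norm
  of u, so one maximal function controls the difference quotients as well as the terms produced by
  the cut-off.\<close>

locale extension_problem = poincare_space M D p C L
 for M :: "'a::{metric_space,second_countable_topology} measure" and D p C L +
 fixes Om :: "'a set" and ka0 :: real and u :: "'a \<Rightarrow> 'b::banach" and g :: "'a \<Rightarrow> ennreal"
  and N :: "'a set" and Cs :: "'b set"
 assumes Om_sets [measurable]: "Om \<in> sets M" and Om_ne: "Om \<noteq> {}" and ka0: "0 < ka0" "ka0 \<le> 1"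
  and density: "x \<in> Om \<Longrightarrow> 0 < r \<Longrightarrow> r \<le> 1 \<Longrightarrow> ennreal ka0 * vol x r \<le> emeasure M (Om \<inter> ball x r)"
  and u_measurable: "u \<in> borel_measurable M" and Cs: "countable Cs" "range u \<subseteq> closure Cs"
  and g_measurable [measurable]: "g \<in> borel_measurable M" and g_Lp: "Lp_nonneg p M g"
  and u_le_g: "enorm (u x) \<le> g x"
  and N_null: "N \<in> null_sets M"
  and u_gradient: "x \<in> Om - N \<Longrightarrow> y \<in> Om - N \<Longrightarrow> enorm (u x - u y) \<le> ennreal (dist x y) * (g x + g y)"
begin

definition de :: "'a \<Rightarrow> real" where "de x = infdist x Om"

text \<open>In \<open>density_near\<close> the ball of radius 8 r about x is compared with one of
  radius r/2 about a point of \<open>Om\<close> closer than 3 r/2; as 8 r + 3 r/2 <= 2^5 r/2, this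
  costs D^5.\<close>

definition ka :: real where "ka = ka0 / D ^ 5"

lemma ka: "0 < ka" "ka \<le> 1"
proof -
 have "1 \<le> D ^ 5" using D_ge_1 by simp
 moreover from this have "0 < D ^ 5" by linarith
 ultimately show "0 < ka" "ka \<le> 1" using ka0 by (auto simp: ka_def divide_le_eq)
qed

lemma de_near: "0 < e \<Longrightarrow> \<exists>w\<in>Om. dist x w < de x + e"
proof -
 assume "0 < e"
 then have "infdist x Om < de x + e" by (simp add: de_def)
 then show ?thesis using Om_ne by (auto simp: infdist_notempty cInf_less_iff)
qed

lemma de_lip: "de x \<le> de y + dist x y"
 unfolding de_def by (rule infdist_triangle)

lemma de_le: "w \<in> Om \<Longrightarrow> de x \<le> dist x w"
 unfolding de_def by (rule infdist_le)

lemma de_continuous: "continuous_on S de"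
 unfolding de_def by (intro continuous_intros)

text \<open>The density condition speaks only of centres in \<open>Om\<close>; it is transferred to
  points near \<open>Om\<close> through a close point w. The large ball on the left covers all balls
  that occur later.\<close>

lemma density_near:
 assumes "0 < r" "r \<le> 2" and near: "\<And>e. 0 < e \<Longrightarrow> \<exists>w\<in>Om. dist x w < r + e"
 shows "ennreal ka * vol x (8 * r) \<le> emeasure M (Om \<inter> ball x (2 * r))"
proof -
 obtain w where w: "w \<in> Om" "dist x w < r + r / 2" using near[of "r / 2"] assms by auto
 have "vol x (8 * r) \<le> ennreal (D ^ 5) * vol w (r / 2)"
  using w assms by (intro ball_le) (auto simp: dist_commute)
 then have "ennreal ka * vol x (8 * r) \<le> ennreal ka * (ennreal (D ^ 5) * vol w (r / 2))"
  by (intro mult_left_mono) auto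
 also have "... = ennreal ka0 * vol w (r / 2)"
  using ka D_ge_1 by (subst ennreal_mult_collect) (auto simp: ka_def)
 also have "... \<le> emeasure M (Om \<inter> ball w (r / 2))" using assms w by (intro density) auto
 also have "... \<le> emeasure M (Om \<inter> ball x (2 * r))"
  using w ball_subset_ball[of x w "r / 2" "2 * r"] by (intro emeasure_mono) auto
 finally show ?thesis .
qed

text \<open>Every small ball centred in the closure contains a fixed share of \<open>Om\<close>. A
  bounded part P of the difference set has a Borel hull B with closed F inside and open H outside, H
  - F being small. Vitali with balls inside H bounds the measure of P by that of \<open>Om\<close>
  within H; as P is disjoint from \<open>Om\<close>, this part lies in H - F or in the null set B -
  P.\<close>

lemma closure_null: "closure Om - Om \<in> null_sets M"
proof -
 obtain x0 :: 'a where True by simp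
 define P where "P n = (closure Om - Om) \<inter> ball x0 (real n)" for n :: nat
 have "closure Om \<in> sets M" using sets_M by (meson borel_closed closed_closure subsetD)
 then have Pm: "P n \<in> sets M" for n unfolding P_def by (intro sets.Int sets.Diff) auto
 have "emeasure M (P n) = 0" for n
 proof -
  define m where "m = density M (indicator (ball x0 n))"
  have em: "emeasure m A = emeasure M (ball x0 n \<inter> A)" if "A \<in> sets M" for A
   unfolding m_def using that by (intro emeasure_restricted) auto
  obtain B where B: "B \<in> sets borel" "P n \<subseteq> B" "emeasure M (B - P n) = 0"
   by (rule borel_hull_null_diff[OF Pm])
  have Bm: "B \<in> sets M" using B sets_M by auto
  define c where "c = D ^ 4 / ka"
  have c: "0 < c" using ka D_ge_1 by (simp add: c_def)
  have le: "emeasure M (P n) \<le> ennreal (c * e)" if e: "0 < e" for e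
  proof -
   have "\<exists>F H. closed F \<and> open H \<and> F \<subseteq> B \<and> B \<subseteq> H \<and> emeasure m (H - F) \<le> ennreal e"
    by (rule closed_open_regular[rule_format]) (use B e sets_M em[of UNIV] ball_finite[of x0 n] in \<open>auto simp: m_def\<close>)
   then obtain F H where FH: "closed F" "open H" "F \<subseteq> B" "B \<subseteq> H" "emeasure m (H - F) \<le> ennreal e"
    by (elim exE conjE)
   define Q where "Q = {(x, r). x \<in> P n \<and> 0 < r \<and> r \<le> 2 \<and> ball x r \<subseteq> H \<inter> ball x0 n}"
   define \<nu> where "\<nu> = density M (\<lambda>x. ennreal c * indicator Om x)"
   have Um: "(\<Union>q\<in>Q. ball (fst q) (snd q)) \<in> sets M" by (intro open_sets_M open_UN) auto
   have \<nu>: "emeasure \<nu> A = ennreal c * emeasure M (Om \<inter> A)" if "A \<in> sets M" for A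
   proof -
    have "emeasure \<nu> A = (\<integral>\<^sup>+x. ennreal c * indicator (Om \<inter> A) x \<partial>M)"
     unfolding \<nu>_def using that by (subst emeasure_density) (auto intro!: nn_integral_cong simp: indicator_def)
    then show ?thesis using that by (simp add: nn_integral_cmult_indicator)
   qed
   have "P n \<subseteq> (\<Union>q\<in>Q. ball (fst q) (snd q))"
   proof
    fix x assume x: "x \<in> P n"
    then have "x \<in> H \<inter> ball x0 n" using B FH by (auto simp: P_def)
    moreover have "open (H \<inter> ball x0 n)" using FH by auto
    ultimately obtain r where r: "0 < r" "ball x r \<subseteq> H \<inter> ball x0 n" using open_contains_ball by blast
    have "ball x (min r 2) \<subseteq> ball x r" by (intro subset_ball) auto
    then have "ball x (min r 2) \<subseteq> H \<inter> ball x0 n" using r by blast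
    then have "(x, min r 2) \<in> Q" using x r by (auto simp: Q_def)
    then show "x \<in> (\<Union>q\<in>Q. ball (fst q) (snd q))" using r by force
   qed
   then have "emeasure M (P n) \<le> emeasure M (\<Union>q\<in>Q. ball (fst q) (snd q))" using Um by (intro emeasure_mono) auto
   also have "... \<le> emeasure \<nu> (\<Union>q\<in>Q. ball (fst q) (snd q))"
   proof (rule vitali_emeasure_le)
    fix x r assume "(x, r) \<in> Q"
    then have x: "x \<in> closure Om" "0 < r" "r \<le> 2" by (auto simp: Q_def P_def)
    have *: "ennreal ka * vol x (8 * (r / 2)) \<le> emeasure M (Om \<inter> ball x (2 * (r / 2)))"
    proof (rule density_near)
     fix e :: real assume "0 < e"
     then have "0 < r / 2 + e" using x by simp
     then obtain w where "w \<in> Om" "dist w x < r / 2 + e" using x(1) unfolding closure_approachable by blast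
     then show "\<exists>w\<in>Om. dist x w < r / 2 + e" by (auto simp: dist_commute)
    qed (use x in auto)
    have "vol x (3 * r) \<le> ennreal (D ^ 2) * vol x r" using x by (intro ball_le) auto
    also have "... \<le> ennreal (D ^ 4) * vol x (8 * (r / 2))"
    proof (intro mult_mono ennreal_leI)
     show "D ^ 2 \<le> D ^ 4" using D_ge_1 by (intro power_increasing) auto
     show "vol x r \<le> vol x (8 * (r / 2))" using x by (intro emeasure_mono subset_ball) auto
    qed auto
    also have "... = ennreal c * (ennreal ka * vol x (8 * (r / 2)))"
     using c ka by (subst ennreal_mult_collect) (auto simp: c_def)
    also have "... \<le> ennreal c * emeasure M (Om \<inter> ball x r)" using * by (intro mult_left_mono) auto
    finally show "0 < r \<and> vol x (3 * r) \<le> emeasure \<nu> (ball x r)" using x \<nu> by simp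
   qed (use sets_M in \<open>auto simp: \<nu>_def\<close>)
   also have "... = ennreal c * emeasure M (Om \<inter> (\<Union>q\<in>Q. ball (fst q) (snd q)))" by (rule \<nu>[OF Um])
   also have "... \<le> ennreal c * emeasure M ((ball x0 n \<inter> (H - F)) \<union> (B - P n))"
   proof (intro mult_left_mono emeasure_mono)
    show "Om \<inter> (\<Union>q\<in>Q. ball (fst q) (snd q)) \<subseteq> (ball x0 n \<inter> (H - F)) \<union> (B - P n)"
     using FH(3) by (auto simp: Q_def P_def)
    show "ball x0 n \<inter> (H - F) \<union> (B - P n) \<in> sets M"
     using FH(1,2) by (intro sets.Un sets.Int sets.Diff Bm Pm) auto
   qed auto
   also have "... \<le> ennreal c * (emeasure M (ball x0 n \<inter> (H - F)) + emeasure M (B - P n))"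
    using FH Bm Pm by (intro mult_left_mono emeasure_subadditive) auto
   also have "... \<le> ennreal c * (ennreal e + 0)"
   proof (intro mult_left_mono add_mono)
    have "H - F \<in> sets M" using FH(1,2) by (intro sets.Diff) auto
    from em[OF this] show "emeasure M (ball x0 n \<inter> (H - F)) \<le> ennreal e" using FH(5) by simp
   qed (use B in auto)
   also have "... = ennreal (c * e)" using c e by (simp add: ennreal_mult)
   finally show ?thesis .
  qed
  have "emeasure M (P n) \<le> 0"
  proof (rule ennreal_le_epsilon)
   fix e :: real assume e: "0 < e"
   then show "emeasure M (P n) \<le> 0 + ennreal e" using le[of "e / c"] c by simp
  qed
  then show ?thesis by simp
 qed
 then have "P n \<in> null_sets M" for n using Pm by (intro null_setsI) auto
 then have "(\<Union>n. P n) \<in> null_sets M" by (intro null_sets_UN)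
 moreover have "(\<Union>n. P n) = closure Om - Om"
  unfolding P_def by (auto simp: reals_Archimedean2)
 ultimately show ?thesis by simp
qed

text \<open>Equal to 1 on \<open>Om\<close> up to distance 2 de x and to 0 beyond 3 de x. The linear
  transition makes the weight, and hence the average, Lipschitz in x at scale de x; averages with a
  sharp cut-off could jump.\<close>

definition wt :: "'a \<Rightarrow> 'a \<Rightarrow> real" where
 "wt x z = indicator Om z * max 0 (min 1 (3 - dist x z / de x))"

definition \<Phi> :: "'a \<Rightarrow> real" where "\<Phi> x = (LINT z|M. wt x z)"

lemma wt_bounds: "0 \<le> wt x z" "wt x z \<le> 1" by (auto simp: wt_def indicator_def)

lemma wt_support: "0 < de x \<Longrightarrow> wt x z \<noteq> 0 \<Longrightarrow> z \<in> Om \<inter> ball x (3 * de x)"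
 by (auto simp: wt_def indicator_def max_def min_def field_simps split: if_splits)

lemma wt_one: "0 < de x \<Longrightarrow> z \<in> Om \<inter> ball x (2 * de x) \<Longrightarrow> wt x z = 1"
 by (auto simp: wt_def max_def min_def field_simps)

lemma wt_measurable [measurable]: "wt x \<in> borel_measurable M"
proof -
 have "(\<lambda>z. dist x z) \<in> borel_measurable M" by measurable
 then show ?thesis unfolding wt_def[abs_def] by measurable
qed

lemma wt_le_indicator: "0 < de x \<Longrightarrow> ennreal (wt x z) \<le> indicator (Om \<inter> ball x (3 * de x)) z"
 using wt_support[of x z] wt_bounds[of x z] by (cases "wt x z = 0") (auto simp: ennreal_le_1)

lemma wt_integrable: "0 < de x \<Longrightarrow> integrable M (wt x)"
proof (rule integrableI_bounded)
 assume x: "0 < de x"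
 have "(\<integral>\<^sup>+z. enorm (wt x z) \<partial>M) \<le> (\<integral>\<^sup>+z. indicator (ball x (3 * de x)) z \<partial>M)"
 proof (rule nn_integral_mono)
  fix z
  have "ennreal (wt x z) \<le> indicator (Om \<inter> ball x (3 * de x)) z" by (rule wt_le_indicator[OF x])
  also have "... \<le> indicator (ball x (3 * de x)) z" by (auto simp: indicator_def)
  finally show "enorm (wt x z) \<le> indicator (ball x (3 * de x)) z" using wt_bounds[of x z] by simp
 qed
 then show "(\<integral>\<^sup>+z. enorm (wt x z) \<partial>M) < \<infinity>" using ball_finite[of x "3 * de x"] by (auto intro: le_less_trans)
qed simp

lemma \<Phi>_eq: "0 < de x \<Longrightarrow> ennreal (\<Phi> x) = (\<integral>\<^sup>+z. ennreal (wt x z) \<partial>M)"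
 unfolding \<Phi>_def using wt_integrable[of x] wt_bounds by (intro nn_integral_eq_integral[symmetric]) auto

lemma \<Phi>_lower:
 assumes "0 < de x" "de x \<le> 2"
 shows "ennreal ka * vol x (8 * de x) \<le> ennreal (\<Phi> x)" "0 < \<Phi> x"
proof -
 have "ennreal ka * vol x (8 * de x) \<le> emeasure M (Om \<inter> ball x (2 * de x))"
  using assms de_near by (intro density_near) auto
 also have "... = (\<integral>\<^sup>+z. indicator (Om \<inter> ball x (2 * de x)) z \<partial>M)" by simp
 also have "... \<le> ennreal (\<Phi> x)"
  unfolding \<Phi>_eq[OF assms(1)] using wt_one[OF assms(1)] by (intro nn_integral_mono) (auto simp: indicator_def)
 finally show le: "ennreal ka * vol x (8 * de x) \<le> ennreal (\<Phi> x)" .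
 have "0 < ennreal ka * vol x (8 * de x)"
  using ka ball_pos[of "8 * de x" x] assms by (simp add: ennreal_zero_less_mult_iff)
 then have "0 < ennreal (\<Phi> x)" using le by (rule less_le_trans)
 then show "0 < \<Phi> x" by simp
qed

lemma ball_le_\<Phi>:
 assumes "0 < de x" "de x \<le> 2" "r \<le> 8 * de x"
 shows "vol x r \<le> ennreal (1 / ka) * ennreal (\<Phi> x)"
proof -
 have "vol x r \<le> vol x (8 * de x)" using assms by (intro emeasure_mono subset_ball) auto
 also have "... = ennreal (1 / ka) * (ennreal ka * vol x (8 * de x))"
  using ka by (subst ennreal_mult_collect) auto
 also have "... \<le> ennreal (1 / ka) * ennreal (\<Phi> x)" using \<Phi>_lower[OF assms(1,2)] by (intro mult_left_mono) auto
 finally show ?thesis .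
qed

lemma g_ball_finite: "(\<integral>\<^sup>+z\<in>ball x r. g z \<partial>M) < \<infinity>"
 by (rule Lp_nonneg_ball_finite[OF p g_Lp])

lemma u_norm_measurable [measurable]: "(\<lambda>z. norm (u z - c)) \<in> borel_measurable M"
 by (rule norm_diff_measurable[OF u_measurable])

lemma wt_u_finite:
 assumes "0 < de x" shows "(\<integral>\<^sup>+z. ennreal (\<bar>wt x z\<bar> * norm (u z)) \<partial>M) < \<infinity>"
proof -
 have "(\<integral>\<^sup>+z. ennreal (\<bar>wt x z\<bar> * norm (u z)) \<partial>M) \<le> (\<integral>\<^sup>+z\<in>ball x (3 * de x). g z \<partial>M)"
 proof (rule nn_integral_mono)
  fix z
  show "ennreal (\<bar>wt x z\<bar> * norm (u z)) \<le> g z * indicator (ball x (3 * de x)) z"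
  proof (cases "wt x z = 0")
   case False
   have "\<bar>wt x z\<bar> * norm (u z) \<le> 1 * norm (u z)" using wt_bounds[of x z] by (intro mult_right_mono) auto
   then have "ennreal (\<bar>wt x z\<bar> * norm (u z)) \<le> enorm (u z)" by (intro ennreal_leI) simp
   also have "... \<le> g z" by (rule u_le_g)
   finally show ?thesis using wt_support[OF assms False] by simp
  qed simp
 qed
 then show ?thesis using g_ball_finite by (rule le_less_trans)
qed

definition vint :: "('a \<Rightarrow> real) \<Rightarrow> 'b" where
 "vint = (SOME I. \<forall>\<phi> \<psi> c. integrable M \<phi> \<longrightarrow> integrable M \<psi> \<longrightarrow>
   (\<integral>\<^sup>+x. ennreal (\<bar>\<phi> x\<bar> * norm (u x)) \<partial>M) < \<infinity> \<longrightarrow> (\<integral>\<^sup>+x. ennreal (\<bar>\<psi> x\<bar> * norm (u x)) \<partial>M) < \<infinity> \<longrightarrow>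
   enorm (I \<phi> - I \<psi> - ((LINT x|M. \<phi> x) - (LINT x|M. \<psi> x)) *\<^sub>R c)
    \<le> (\<integral>\<^sup>+x. ennreal (\<bar>\<phi> x - \<psi> x\<bar> * norm (u x - c)) \<partial>M))"

lemma vint:
 assumes "integrable M \<phi>" "integrable M \<psi>"
  "(\<integral>\<^sup>+x. ennreal (\<bar>\<phi> x\<bar> * norm (u x)) \<partial>M) < \<infinity>" "(\<integral>\<^sup>+x. ennreal (\<bar>\<psi> x\<bar> * norm (u x)) \<partial>M) < \<infinity>"
 shows "enorm (vint \<phi> - vint \<psi> - ((LINT x|M. \<phi> x) - (LINT x|M. \<psi> x)) *\<^sub>R c)
    \<le> (\<integral>\<^sup>+x. ennreal (\<bar>\<phi> x - \<psi> x\<bar> * norm (u x - c)) \<partial>M)"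
proof -
 let ?P = "\<lambda>I. \<forall>\<phi> \<psi> c. integrable M \<phi> \<longrightarrow> integrable M \<psi> \<longrightarrow>
   (\<integral>\<^sup>+x. ennreal (\<bar>\<phi> x\<bar> * norm (u x)) \<partial>M) < \<infinity> \<longrightarrow> (\<integral>\<^sup>+x. ennreal (\<bar>\<psi> x\<bar> * norm (u x)) \<partial>M) < \<infinity> \<longrightarrow>
   enorm (I \<phi> - I \<psi> - ((LINT x|M. \<phi> x) - (LINT x|M. \<psi> x)) *\<^sub>R c)
    \<le> (\<integral>\<^sup>+x. ennreal (\<bar>\<phi> x - \<psi> x\<bar> * norm (u x - c)) \<partial>M)"
 have "\<exists>I. ?P I"
  by (rule vector_integral_exists[OF space_M u_measurable Cs]) (intro exI allI impI, assumption)
 from someI_ex[OF this] have "?P vint" unfolding vint_def .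
 then show ?thesis using assms by simp
qed

text \<open>\<open>vint\<close> is controlled only through differences of weights, hence the
  subtraction of its value at weight 0.\<close>

definition av :: "'a \<Rightarrow> 'b" where "av x = (1 / \<Phi> x) *\<^sub>R (vint (wt x) - vint (\<lambda>_. 0))"

lemma weighted_dev:
 assumes "0 < de x"
 shows "enorm (vint (wt x) - vint (\<lambda>_. 0) - \<Phi> x *\<^sub>R c) \<le> (\<integral>\<^sup>+z\<in>Om \<inter> ball x (3 * de x). enorm (u z - c) \<partial>M)"
proof -
 have "enorm (vint (wt x) - vint (\<lambda>_. 0) - \<Phi> x *\<^sub>R c) \<le> (\<integral>\<^sup>+z. ennreal (\<bar>wt x z - 0\<bar> * norm (u z - c)) \<partial>M)"
  using vint[OF wt_integrable[OF assms] integrable_zero wt_u_finite[OF assms], of c] by (simp add: \<Phi>_def)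
 also have "... \<le> (\<integral>\<^sup>+z\<in>Om \<inter> ball x (3 * de x). enorm (u z - c) \<partial>M)"
 proof (rule nn_integral_mono)
  fix z
  have "ennreal (\<bar>wt x z - 0\<bar> * norm (u z - c)) = ennreal (wt x z) * enorm (u z - c)"
   using wt_bounds[of x z] by (simp add: ennreal_mult)
  also have "... \<le> indicator (Om \<inter> ball x (3 * de x)) z * enorm (u z - c)"
   by (intro mult_right_mono wt_le_indicator assms) auto
  finally show "ennreal (\<bar>wt x z - 0\<bar> * norm (u z - c)) \<le> enorm (u z - c) * indicator (Om \<inter> ball x (3 * de x)) z"
   by (simp add: mult.commute)
 qed
 finally show ?thesis .
qed

lemma av_dev:
 assumes x: "0 < de x" "de x \<le> 2"
 shows "enorm (av x - c) * ennreal (\<Phi> x) \<le> (\<integral>\<^sup>+z\<in>Om \<inter> ball x (3 * de x). enorm (u z - c) \<partial>M)"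
proof -
 have P: "0 < \<Phi> x" by (rule \<Phi>_lower[OF x])
 have "av x - c = (1 / \<Phi> x) *\<^sub>R (vint (wt x) - vint (\<lambda>_. 0) - \<Phi> x *\<^sub>R c)"
  using P by (simp add: av_def scaleR_diff_right)
 then have "norm (av x - c) * \<Phi> x = norm (vint (wt x) - vint (\<lambda>_. 0) - \<Phi> x *\<^sub>R c)"
  using P by simp
 then have "enorm (av x - c) * ennreal (\<Phi> x) = enorm (vint (wt x) - vint (\<lambda>_. 0) - \<Phi> x *\<^sub>R c)"
  using P by (simp flip: ennreal_mult)
 also have "... \<le> (\<integral>\<^sup>+z\<in>Om \<inter> ball x (3 * de x). enorm (u z - c) \<partial>M)" by (rule weighted_dev[OF x(1)])
 finally show ?thesis .
qed

lemma integral_dev_le: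
 assumes w: "w \<in> Om - N" and r: "0 < r"
 shows "(\<integral>\<^sup>+z\<in>Om \<inter> ball x r. enorm (u z - u w) \<partial>M)
  \<le> ennreal (r + dist x w) * ((ennreal D * mxf g x + g w) * vol x r)"
proof -
 have "AE z in M. z \<notin> N" using N_null by (rule AE_not_in)
 then have "(\<integral>\<^sup>+z\<in>Om \<inter> ball x r. enorm (u z - u w) \<partial>M)
  \<le> (\<integral>\<^sup>+z. ennreal (r + dist x w) * (g z * indicator (ball x r) z + g w * indicator (ball x r) z) \<partial>M)"
 proof (intro nn_integral_mono_AE, eventually_elim)
  fix z assume z: "z \<notin> N"
  show "enorm (u z - u w) * indicator (Om \<inter> ball x r) z
   \<le> ennreal (r + dist x w) * (g z * indicator (ball x r) z + g w * indicator (ball x r) z)"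
  proof (cases "z \<in> Om \<inter> ball x r")
   case True
   then have "enorm (u z - u w) \<le> ennreal (dist z w) * (g z + g w)" using u_gradient z w by auto
   also have "... \<le> ennreal (r + dist x w) * (g z + g w)"
    using True dist_triangle[of z w x] by (intro mult_right_mono ennreal_leI) (auto simp: dist_commute)
   finally show ?thesis using True by simp
  qed simp
 qed
 also have "... = ennreal (r + dist x w) * ((\<integral>\<^sup>+z\<in>ball x r. g z \<partial>M) + g w * vol x r)"
  by (simp add: nn_integral_cmult nn_integral_add nn_integral_cmult_indicator)
 also have "... \<le> ennreal (r + dist x w) * (ennreal D * mxf g x * vol x r + g w * vol x r)"
  by (intro mult_left_mono add_right_mono ball_integral_le_mxf r) auto
 finally show ?thesis by (simp add: distrib_right)
qed

text \<open>Since \<open>Om\<close> fills a fixed share of the ball, some point of it has g below a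
  multiple of the mean. It is the intermediate point through which the averages at two places are
  compared.\<close>

lemma good_point:
 assumes x: "0 < de x" "de x \<le> 2"
 obtains w where "w \<in> Om - N" "dist x w < 2 * de x" "g w \<le> ennreal (D / ka) * mxf g x"
proof -
 let ?B = "Om \<inter> ball x (2 * de x)"
 have dens: "ennreal ka * vol x (8 * de x) \<le> emeasure M ?B"
  using x de_near by (intro density_near) auto
 have "\<exists>w\<in>?B. w \<notin> N \<and> g w \<le> ennreal (D / ka) * mxf g x"
 proof (rule exists_le_average)
  have "0 < ennreal ka * vol x (8 * de x)"
   using ka ball_pos[of "8 * de x" x] x by (simp add: ennreal_zero_less_mult_iff)
  then show "0 < emeasure M ?B" using dens by (rule less_le_trans)
  have "emeasure M ?B \<le> vol x (2 * de x)" by (intro emeasure_mono) auto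
  then show "emeasure M ?B < \<infinity>" using ball_finite by (rule le_less_trans)
  have "(\<integral>\<^sup>+y\<in>?B. g y \<partial>M) \<le> (\<integral>\<^sup>+y\<in>ball x (2 * de x). g y \<partial>M)"
   by (intro nn_integral_mono) (auto simp: indicator_def)
  also have "... \<le> ennreal D * mxf g x * vol x (2 * de x)"
   using x by (intro ball_integral_le_mxf) auto
  also have "... \<le> ennreal D * mxf g x * vol x (8 * de x)"
   using x by (intro mult_left_mono emeasure_mono subset_ball) auto
  also have "... = ennreal (D / ka) * mxf g x * (ennreal ka * vol x (8 * de x))"
  proof -
   have "ennreal D = ennreal (D / ka) * ennreal ka" using ka D_ge_1 by (simp flip: ennreal_mult)
   then show ?thesis by (simp add: mult_ac)
  qed
  also have "... \<le> ennreal (D / ka) * mxf g x * emeasure M ?B" using dens by (intro mult_left_mono) auto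
  finally show "(\<integral>\<^sup>+y\<in>?B. g y \<partial>M) \<le> ennreal (D / ka) * mxf g x * emeasure M ?B" .
  show "AE y in M. y \<notin> N" using N_null by (rule AE_not_in)
 qed auto
 then show ?thesis using that by auto
qed

lemma av_bound:
 assumes x: "0 < de x" "de x \<le> 2"
 shows "enorm (av x) \<le> ennreal (D / ka) * mxf g x"
proof (rule ennreal_mult_le_cancel_right)
 show "0 < ennreal (\<Phi> x)" "ennreal (\<Phi> x) < \<infinity>" using \<Phi>_lower[OF x] by auto
 have "enorm (av x) * ennreal (\<Phi> x) \<le> (\<integral>\<^sup>+z\<in>Om \<inter> ball x (3 * de x). enorm (u z) \<partial>M)"
  using av_dev[OF x, of 0] by simp
 also have "... \<le> (\<integral>\<^sup>+z\<in>ball x (3 * de x). g z \<partial>M)"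
  using u_le_g by (intro nn_integral_mono) (auto simp: indicator_def)
 also have "... \<le> ennreal D * mxf g x * vol x (3 * de x)"
  using x by (intro ball_integral_le_mxf) auto
 also have "... \<le> ennreal D * mxf g x * (ennreal (1 / ka) * ennreal (\<Phi> x))"
  using x by (intro mult_left_mono ball_le_\<Phi>) auto
 also have "... = ennreal (D / ka) * mxf g x * ennreal (\<Phi> x)"
 proof -
  have "ennreal (D / ka) = ennreal D * ennreal (1 / ka)" using ka D_ge_1 by (simp flip: ennreal_mult)
  then show ?thesis by (simp add: mult_ac)
 qed
 finally show "enorm (av x) * ennreal (\<Phi> x) \<le> ennreal (D / ka) * mxf g x * ennreal (\<Phi> x)" .
qed

lemma av_minus_u:
 assumes x: "0 < de x" "de x \<le> 2" and w: "w \<in> Om - N"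
 shows "enorm (av x - u w) \<le> ennreal (4 * D / ka * dist x w) * (mxf g x + g w)"
proof (rule ennreal_mult_le_cancel_right)
 show "0 < ennreal (\<Phi> x)" "ennreal (\<Phi> x) < \<infinity>" using \<Phi>_lower[OF x] by auto
 have "enorm (av x - u w) * ennreal (\<Phi> x) \<le> (\<integral>\<^sup>+z\<in>Om \<inter> ball x (3 * de x). enorm (u z - u w) \<partial>M)"
  by (rule av_dev[OF x])
 also have "... \<le> ennreal (3 * de x + dist x w) * ((ennreal D * mxf g x + g w) * vol x (3 * de x))"
  using x w by (intro integral_dev_le) auto
 also have "... \<le> ennreal (4 * dist x w) * ((ennreal D * (mxf g x + g w)) * (ennreal (1 / ka) * ennreal (\<Phi> x)))"
 proof (intro mult_mono ennreal_leI)
  show "3 * de x + dist x w \<le> 4 * dist x w" using de_le[of w x] w by simp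
  have "1 * g w \<le> ennreal D * g w" using D_ge_1 by (intro mult_right_mono) auto
  then show "ennreal D * mxf g x + g w \<le> ennreal D * (mxf g x + g w)" by (simp add: distrib_left add_left_mono)
  show "vol x (3 * de x) \<le> ennreal (1 / ka) * ennreal (\<Phi> x)" using x by (intro ball_le_\<Phi>) auto
 qed auto
 also have "... = ennreal (4 * D / ka * dist x w) * (mxf g x + g w) * ennreal (\<Phi> x)"
 proof -
  have "ennreal (4 * D / ka * dist x w) = ennreal (4 * dist x w) * (ennreal D * ennreal (1 / ka))"
   using ka D_ge_1 by (simp add: mult_ac flip: ennreal_mult)
  then show ?thesis by (simp add: mult_ac)
 qed
 finally show "enorm (av x - u w) * ennreal (\<Phi> x) \<le> ennreal (4 * D / ka * dist x w) * (mxf g x + g w) * ennreal (\<Phi> x)" .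
qed

text \<open>Both weights vanish off the ball of radius 4 de x, and there dist y z <= 6 de y. The
  quotient dist x z / de x changes by at most dist x y / de x through its numerator and by 6 times
  as much through its denominator, which gives 7.\<close>

lemma wt_diff:
 assumes x: "0 < de x" and d: "4 * dist x y < de x"
 shows "\<bar>wt x z - wt y z\<bar> \<le> 7 * dist x y / de x * indicator (Om \<inter> ball x (4 * de x)) z"
proof -
 have y: "de y \<le> de x + dist x y" "de x \<le> de y + dist x y" using de_lip[of y x] de_lip[of x y] by (auto simp: dist_commute)
 have y0: "0 < de y" using y d x zero_le_dist[of x y] by linarith
 show ?thesis
 proof (cases "z \<in> Om \<inter> ball x (4 * de x)")
  case False
  have "wt x z = 0" using wt_support[OF x, of z] False x by fastforce
  moreover have "wt y z = 0"
  proof (rule ccontr)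
   assume "wt y z \<noteq> 0"
   then have "z \<in> Om" "dist y z < 3 * de y" using wt_support[OF y0, of z] by auto
   then have "z \<in> Om \<inter> ball x (4 * de x)" using dist_triangle[of x z y] y d by simp
   then show False using False by simp
  qed
  ultimately show ?thesis using False by simp
 next
  case True
  have dyz: "dist y z \<le> 6 * de y" using True dist_triangle[of y z x] y d by (simp add: dist_commute)
  have "\<bar>wt x z - wt y z\<bar> \<le> \<bar>dist x z / de x - dist y z / de y\<bar>" using True by (auto simp: wt_def)
  also have "dist x z / de x - dist y z / de y = (dist x z - dist y z) / de x + dist y z / de y * ((de y - de x) / de x)"
   using x y0 by (simp add: field_simps)
  also have "\<bar>...\<bar> \<le> \<bar>(dist x z - dist y z) / de x\<bar> + \<bar>dist y z / de y * ((de y - de x) / de x)\<bar>" by (rule abs_triangle_ineq)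
  also have "... \<le> dist x y / de x + 6 * (dist x y / de x)"
  proof (rule add_mono)
   have "\<bar>dist x z - dist y z\<bar> \<le> dist x y" using dist_triangle[of x z y] dist_triangle[of y z x] by (simp add: dist_commute abs_le_iff)
   then show "\<bar>(dist x z - dist y z) / de x\<bar> \<le> dist x y / de x" using x by (simp add: divide_right_mono)
   have "\<bar>dist y z / de y\<bar> \<le> 6" using dyz y0 by (simp add: divide_le_eq)
   moreover have "\<bar>(de y - de x) / de x\<bar> \<le> dist x y / de x" using y x by (simp add: divide_right_mono abs_le_iff)
   ultimately show "\<bar>dist y z / de y * ((de y - de x) / de x)\<bar> \<le> 6 * (dist x y / de x)"
    unfolding abs_mult by (intro mult_mono) auto
  qed
  finally show ?thesis using True by simp
 qed
qed

text \<open>A quotient rule for integral over total weight. Subtracting c first leaves only the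
  deviation of u from c; later c is a value of u, or 0 for continuity. The constant is 14 = 7 * 2,
  with 7 from \<open>wt_diff\<close> and 2 from 1/ka + 1/ka^2 <= 2/ka^2.\<close>

lemma av_near:
 assumes x: "0 < de x" "de x \<le> 2" and y: "de y \<le> 2" and d: "4 * dist x y < de x"
 shows "enorm (av x - av y) * vol x (4 * de x)
  \<le> ennreal (14 / ka\<^sup>2 * (dist x y / de x)) * (\<integral>\<^sup>+z\<in>Om \<inter> ball x (4 * de x). enorm (u z - c) \<partial>M)"
proof (cases "(\<integral>\<^sup>+z\<in>Om \<inter> ball x (4 * de x). enorm (u z - c) \<partial>M)")
 case top
 show ?thesis
 proof (cases "x = y")
  case False
  then have "0 < 14 / ka\<^sup>2 * (dist x y / de x)" using ka x by simp
  then have "ennreal (14 / ka\<^sup>2 * (dist x y / de x)) * top = top" by (subst ennreal_mult_top) (auto simp: ennreal_eq_0_iff not_le)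
  then show ?thesis unfolding top by simp
 qed simp
next
 case (real Y)
 have yx: "de y \<le> de x + dist x y" "de x \<le> de y + dist x y" using de_lip[of y x] de_lip[of x y] by (auto simp: dist_commute)
 have y0: "0 < de y" using yx d x zero_le_dist[of x y] by linarith
 define V where "V = enn2real (vol x (4 * de x))"
 have V: "vol x (4 * de x) = ennreal V" "0 < V"
  using ball_pos[of "4 * de x" x] ball_finite[of x "4 * de x"] x by (auto simp: V_def less_top enn2real_positive_iff)
 define q where "q = 7 * dist x y / de x"
 have q: "0 \<le> q" using x by (simp add: q_def)
 have Px: "ka * V \<le> \<Phi> x" "0 < \<Phi> x" and Py: "ka * V \<le> \<Phi> y" "0 < \<Phi> y"
 proof -
  have "ennreal ka * ennreal V \<le> ennreal ka * vol x (8 * de x)"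
   unfolding V(1)[symmetric] using x by (intro mult_left_mono emeasure_mono subset_ball) auto
  also have "... \<le> ennreal (\<Phi> x)" by (rule \<Phi>_lower[OF x])
  finally show "ka * V \<le> \<Phi> x" using ka V \<Phi>_lower(2)[OF x] by (simp add: ennreal_mult[symmetric] ennreal_le_iff)
  have "ball x (4 * de x) \<subseteq> ball y (8 * de y)" using yx d by (intro ball_subset_ball) (simp add: dist_commute)
  then have "ennreal ka * ennreal V \<le> ennreal ka * vol y (8 * de y)"
   unfolding V(1)[symmetric] by (intro mult_left_mono emeasure_mono) auto
  also have "... \<le> ennreal (\<Phi> y)" by (rule \<Phi>_lower[OF y0 y])
  finally show "ka * V \<le> \<Phi> y" using ka V \<Phi>_lower(2)[OF y0 y] by (simp add: ennreal_mult[symmetric] ennreal_le_iff)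
 qed (use \<Phi>_lower(2)[OF x] \<Phi>_lower(2)[OF y0 y] in auto)
 define a where "a = vint (wt x) - vint (\<lambda>_. 0) - \<Phi> x *\<^sub>R c"
 define b where "b = vint (wt y) - vint (\<lambda>_. 0) - \<Phi> y *\<^sub>R c"
 have ab: "norm (a - b) \<le> q * Y"
 proof -
  have "enorm (a - b) \<le> (\<integral>\<^sup>+z. ennreal (\<bar>wt x z - wt y z\<bar> * norm (u z - c)) \<partial>M)"
   using vint[OF wt_integrable[OF x(1)] wt_integrable[OF y0] wt_u_finite[OF x(1)] wt_u_finite[OF y0], of c]
   by (simp add: a_def b_def \<Phi>_def scaleR_left_diff_distrib algebra_simps)
  also have "... \<le> (\<integral>\<^sup>+z. ennreal q * (enorm (u z - c) * indicator (Om \<inter> ball x (4 * de x)) z) \<partial>M)"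
  proof (rule nn_integral_mono)
   fix z
   have "\<bar>wt x z - wt y z\<bar> * norm (u z - c) \<le> q * indicator (Om \<inter> ball x (4 * de x)) z * norm (u z - c)"
    using wt_diff[OF x(1) d, of z] by (intro mult_right_mono) (auto simp: q_def)
   then have "ennreal (\<bar>wt x z - wt y z\<bar> * norm (u z - c)) \<le> ennreal (q * indicator (Om \<inter> ball x (4 * de x)) z * norm (u z - c))"
    by (rule ennreal_leI)
   also have "... = ennreal q * (enorm (u z - c) * indicator (Om \<inter> ball x (4 * de x)) z)"
    using q by (cases "z \<in> Om \<inter> ball x (4 * de x)") (auto simp: ennreal_mult)
   finally show "ennreal (\<bar>wt x z - wt y z\<bar> * norm (u z - c)) \<le> ennreal q * (enorm (u z - c) * indicator (Om \<inter> ball x (4 * de x)) z)" .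
  qed
  also have "... = ennreal q * ennreal Y" unfolding real(2)[symmetric] by (rule nn_integral_cmult) measurable
  finally show ?thesis using q real by (simp add: ennreal_mult[symmetric] ennreal_le_iff)
 qed
 have b: "norm b \<le> Y"
 proof -
  have "enorm b \<le> (\<integral>\<^sup>+z\<in>Om \<inter> ball y (3 * de y). enorm (u z - c) \<partial>M)"
   unfolding b_def by (rule weighted_dev[OF y0])
  also have "... \<le> (\<integral>\<^sup>+z\<in>Om \<inter> ball x (4 * de x). enorm (u z - c) \<partial>M)"
  proof (intro nn_integral_mono mult_left_mono)
   have "ball y (3 * de y) \<subseteq> ball x (4 * de x)" using yx d by (intro ball_subset_ball) simp
   then show "indicator (Om \<inter> ball y (3 * de y)) z \<le> (indicator (Om \<inter> ball x (4 * de x)) z :: ennreal)" for z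
    by (auto simp: indicator_def)
  qed auto
  finally show ?thesis using real by (simp add: ennreal_le_iff)
 qed
 have PP: "\<bar>\<Phi> x - \<Phi> y\<bar> \<le> q * V"
 proof -
  have "\<Phi> x - \<Phi> y = (LINT z|M. wt x z - wt y z)"
   unfolding \<Phi>_def using wt_integrable[OF x(1)] wt_integrable[OF y0] by simp
  then have "ennreal \<bar>\<Phi> x - \<Phi> y\<bar> \<le> (\<integral>\<^sup>+z. enorm (wt x z - wt y z) \<partial>M)"
   using integral_norm_bound_ennreal[of M "\<lambda>z. wt x z - wt y z"] wt_integrable[OF x(1)] wt_integrable[OF y0] by simp
  also have "... \<le> (\<integral>\<^sup>+z. ennreal q * indicator (ball x (4 * de x)) z \<partial>M)"
  proof (rule nn_integral_mono)
   fix z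
   have "\<bar>wt x z - wt y z\<bar> \<le> q * indicator (Om \<inter> ball x (4 * de x)) z" using wt_diff[OF x(1) d, of z] by (simp add: q_def)
   also have "... \<le> q * indicator (ball x (4 * de x)) z" using q by (intro mult_left_mono) (auto simp: indicator_def)
   finally have "ennreal \<bar>wt x z - wt y z\<bar> \<le> ennreal (q * indicator (ball x (4 * de x)) z)" by (rule ennreal_leI)
   then show "enorm (wt x z - wt y z) \<le> ennreal q * indicator (ball x (4 * de x)) z"
    by (cases "z \<in> ball x (4 * de x)") auto
  qed
  also have "... = ennreal (q * V)" using q V by (simp add: nn_integral_cmult_indicator ennreal_mult)
  finally show ?thesis using q V by (simp add: ennreal_le_iff)
 qed
 have "av x - av y = (1 / \<Phi> x) *\<^sub>R (a - b) + ((\<Phi> y - \<Phi> x) / (\<Phi> x * \<Phi> y)) *\<^sub>R b"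
 proof -
  have 1: "av x = (1 / \<Phi> x) *\<^sub>R a + c" "av y = (1 / \<Phi> y) *\<^sub>R b + c"
   using Px Py by (simp_all add: av_def a_def b_def scaleR_diff_right)
  have 2: "(\<Phi> y - \<Phi> x) / (\<Phi> x * \<Phi> y) = 1 / \<Phi> x - 1 / \<Phi> y" using Px Py by (simp add: field_simps)
  show ?thesis unfolding 1 2 by (simp add: scaleR_diff_right scaleR_left_diff_distrib)
 qed
 then have "norm (av x - av y) \<le> norm (a - b) / \<Phi> x + \<bar>\<Phi> y - \<Phi> x\<bar> / (\<Phi> x * \<Phi> y) * norm b"
  using Px Py norm_triangle_ineq[of "(1 / \<Phi> x) *\<^sub>R (a - b)" "((\<Phi> y - \<Phi> x) / (\<Phi> x * \<Phi> y)) *\<^sub>R b"] by simp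
 also have "... \<le> q * Y / (ka * V) + q * V / ((ka * V) * (ka * V)) * Y"
 proof (rule add_mono)
  show "norm (a - b) / \<Phi> x \<le> q * Y / (ka * V)" using ab Px ka V q real by (intro frac_le) auto
  have "ka * V * (ka * V) \<le> \<Phi> x * \<Phi> y" using Px Py ka V by (intro mult_mono) auto
  then have "\<bar>\<Phi> y - \<Phi> x\<bar> / (\<Phi> x * \<Phi> y) \<le> q * V / ((ka * V) * (ka * V))"
   using PP ka V q by (intro frac_le) auto
  then show "\<bar>\<Phi> y - \<Phi> x\<bar> / (\<Phi> x * \<Phi> y) * norm b \<le> q * V / ((ka * V) * (ka * V)) * Y"
   using b q V ka by (intro mult_mono) auto
 qed
 also have "... = q * Y / V * (1 / ka + 1 / ka\<^sup>2)" using V ka by (simp add: field_simps power2_eq_square)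
 also have "... \<le> q * Y / V * (2 / ka\<^sup>2)"
 proof (intro mult_left_mono)
  have "ka\<^sup>2 \<le> ka" using ka by (simp add: power2_eq_square mult_left_le)
  then have "1 / ka \<le> 1 / ka\<^sup>2" using ka by (intro divide_left_mono) auto
  then show "1 / ka + 1 / ka\<^sup>2 \<le> 2 / ka\<^sup>2" by (simp add: field_simps)
 qed (use q real V in auto)
 finally have "norm (av x - av y) * V \<le> (q * Y / V * (2 / ka\<^sup>2)) * V" using V by (intro mult_right_mono) auto
 also have "... = 14 / ka\<^sup>2 * (dist x y / de x) * Y" using V by (simp add: q_def mult_ac)
 finally have "ennreal (norm (av x - av y) * V) \<le> ennreal (14 / ka\<^sup>2 * (dist x y / de x) * Y)" by (rule ennreal_leI)
 then show ?thesis unfolding V(1) real(2) using x real V by (subst (asm) (1 2) ennreal_mult) auto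
qed

end

lemma ennreal_add_le_mult:
 fixes a b P Q R :: ennreal
 assumes "a \<le> ennreal \<alpha> * P" "b \<le> ennreal \<beta> * Q" "P \<le> R" "Q \<le> R" "0 \<le> \<alpha>" "0 \<le> \<beta>" "\<alpha> + \<beta> \<le> ga"
 shows "a + b \<le> ennreal ga * R"
proof -
 have "a + b \<le> ennreal \<alpha> * R + ennreal \<beta> * R"
  using assms(1-4) by (intro add_mono order_trans[OF assms(1)] order_trans[OF assms(2)] mult_left_mono) auto
 also have "... = ennreal (\<alpha> + \<beta>) * R" using assms by (intro ennreal_add_collect)
 also have "... \<le> ennreal ga * R" using assms by (intro mult_right_mono ennreal_leI) auto
 finally show ?thesis .
qed

lemma ennreal_norm_triangle: "enorm (a + b) \<le> enorm a + enorm b"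
 by (simp add: ennreal_leI norm_triangle_ineq flip: ennreal_plus)

context extension_problem
begin

text \<open>A common bound for the two cases of \<open>av_pair\<close>: 168 = 14 * 6 * 2 for points
  close to each other and 136 = 4 * (8 + 9) * 2 for the others.\<close>

definition K :: real where "K = 168 * D\<^sup>2 / ka ^ 3"

lemma K_bounds: "D / ka \<le> K" "4 * D / ka + 1 \<le> K" "168 * D / ka ^ 3 \<le> K" "136 * D\<^sup>2 / ka\<^sup>2 \<le> K" "1 \<le> D / ka" "1 \<le> K"
proof -
 have D: "1 \<le> D" "0 < D" "D \<le> D\<^sup>2" using D_ge_1 by (auto simp: power2_eq_square)
 have k: "0 < ka" "ka\<^sup>2 \<le> ka" "ka ^ 3 \<le> ka\<^sup>2" "0 < ka ^ 3"
  using ka by (auto simp: power2_eq_square power3_eq_cube mult_left_le)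
 show one: "1 \<le> D / ka" using D k ka by (simp add: le_divide_eq)
 show "168 * D / ka ^ 3 \<le> K" unfolding K_def using D k by (intro divide_right_mono) auto
 have "136 * D\<^sup>2 / ka\<^sup>2 \<le> 168 * D\<^sup>2 / ka\<^sup>2" using k by (intro divide_right_mono) auto
 also have "... \<le> K" unfolding K_def using D k by (intro divide_left_mono) auto
 finally show "136 * D\<^sup>2 / ka\<^sup>2 \<le> K" .
 have "168 * (D / ka) \<le> 168 * D\<^sup>2 / ka ^ 3"
  using D k by (simp, intro frac_le) auto
 then show "D / ka \<le> K" "4 * D / ka + 1 \<le> K" "1 \<le> K" using one unfolding K_def by auto
qed

text \<open>If x and y are close compared with de x, \<open>av_near\<close> is used with the value
  of u at a good point w. Otherwise both averages are compared with u w directly, since the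
  distances from x and y to w are at most a multiple of dist x y.\<close>

lemma av_pair:
 assumes x: "0 < de x" "de x \<le> 2" and y: "0 < de y" "de y \<le> 2"
 shows "enorm (av x - av y) \<le> ennreal (K * dist x y) * (mxf g x + mxf g y)"
proof -
 obtain w where w: "w \<in> Om - N" "dist x w < 2 * de x" "g w \<le> ennreal (D / ka) * mxf g x"
  by (rule good_point[OF x])
 let ?m = "mxf g x + mxf g y"
 have k0: "0 < D" "0 < ka" using D_ge_1 ka by auto
 have Dk: "D \<le> D / ka" using ka D_ge_1 by (simp add: le_divide_eq mult_left_le)
 show ?thesis
 proof (cases "4 * dist x y < de x")
  case True
  let ?V = "vol x (4 * de x)"
  show ?thesis
  proof (rule ennreal_mult_le_cancel_right)
   show "0 < ?V" "?V < \<infinity>" using ball_pos ball_finite x by auto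
   have "enorm (av x - av y) * ?V
    \<le> ennreal (14 / ka\<^sup>2 * (dist x y / de x)) * (\<integral>\<^sup>+z\<in>Om \<inter> ball x (4 * de x). enorm (u z - u w) \<partial>M)"
    by (rule av_near[OF x y(2) True])
   also have "... \<le> ennreal (14 / ka\<^sup>2 * (dist x y / de x)) * (ennreal (6 * de x) * (ennreal (2 * D / ka) * mxf g x * ?V))"
   proof (rule mult_left_mono)
    have "(\<integral>\<^sup>+z\<in>Om \<inter> ball x (4 * de x). enorm (u z - u w) \<partial>M)
     \<le> ennreal (4 * de x + dist x w) * ((ennreal D * mxf g x + g w) * ?V)"
     using w x by (intro integral_dev_le) auto
    also have "... \<le> ennreal (6 * de x) * (ennreal (2 * D / ka) * mxf g x * ?V)"
    proof (intro mult_mono mult_right_mono ennreal_leI)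
     show "ennreal D * mxf g x + g w \<le> ennreal (2 * D / ka) * mxf g x"
      using w(3) Dk k0 by (intro ennreal_add_le_mult[of _ D "mxf g x" _ "D / ka" "mxf g x"]) auto
    qed (use w in auto)
    finally show "(\<integral>\<^sup>+z\<in>Om \<inter> ball x (4 * de x). enorm (u z - u w) \<partial>M)
     \<le> ennreal (6 * de x) * (ennreal (2 * D / ka) * mxf g x * ?V)" .
   qed auto
   also have "... = ennreal (168 * D / ka ^ 3 * dist x y) * mxf g x * ?V"
   proof -
    have "ennreal (168 * D / ka ^ 3 * dist x y)
     = ennreal (14 / ka\<^sup>2 * (dist x y / de x)) * (ennreal (6 * de x) * ennreal (2 * D / ka))"
     using k0 x by (simp add: power2_eq_square power3_eq_cube mult_ac flip: ennreal_mult)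
    then show ?thesis by (simp add: mult_ac)
   qed
   also have "... \<le> ennreal (K * dist x y) * ?m * ?V"
    using K_bounds(3) by (intro mult_mono mult_right_mono ennreal_leI) auto
   finally show "enorm (av x - av y) * ?V \<le> ennreal (K * dist x y) * ?m * ?V" .
  qed
 next
  case False
  have d: "dist x w \<le> 8 * dist x y" using False w by simp
  have d': "dist y w \<le> 9 * dist x y" using dist_triangle[of y w x] d by (simp add: dist_commute)
  have gw: "g w \<le> ennreal (D / ka) * ?m" using w(3) by (rule order_trans) (intro mult_left_mono, auto)
  have m: "mxf g v + g w \<le> ennreal (2 * D / ka) * ?m" if "mxf g v \<le> ?m" for v
  proof (rule ennreal_add_le_mult[of _ 1 "?m" _ "D / ka" "?m"])
   show "1 + D / ka \<le> 2 * D / ka" using K_bounds(5) by linarith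
  qed (use gw that k0 in auto)
  have "enorm (av x - u w) \<le> ennreal (4 * D / ka * dist x w) * (mxf g x + g w)" by (rule av_minus_u[OF x w(1)])
  also have "... \<le> ennreal (4 * D / ka * (8 * dist x y)) * (mxf g x + g w)"
   using d k0 by (intro mult_right_mono ennreal_leI mult_left_mono) auto
  finally have 1: "enorm (av x - u w) \<le> ennreal (4 * D / ka * (8 * dist x y)) * (mxf g x + g w)" .
  have "enorm (av y - u w) \<le> ennreal (4 * D / ka * dist y w) * (mxf g y + g w)" by (rule av_minus_u[OF y w(1)])
  also have "... \<le> ennreal (4 * D / ka * (9 * dist x y)) * (mxf g y + g w)"
   using d' k0 by (intro mult_right_mono ennreal_leI mult_left_mono) auto
  finally have 2: "enorm (av y - u w) \<le> ennreal (4 * D / ka * (9 * dist x y)) * (mxf g y + g w)" .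
  have "enorm (av x - av y) \<le> enorm (av x - u w) + enorm (av y - u w)"
   using ennreal_norm_triangle[of "av x - u w" "u w - av y"] by (simp add: norm_minus_commute)
  also have "... \<le> ennreal (68 * D / ka * dist x y) * (ennreal (2 * D / ka) * ?m)"
   using k0 by (intro ennreal_add_le_mult[OF 1 2 m m]) (auto simp: field_simps)
  also have "... = ennreal (136 * D\<^sup>2 / ka\<^sup>2 * dist x y) * ?m"
   using k0 by (subst ennreal_mult_collect) (auto simp: power2_eq_square mult_ac)
  also have "... \<le> ennreal (K * dist x y) * ?m"
   using K_bounds(4) by (intro mult_right_mono ennreal_leI) auto
  finally show ?thesis .
 qed
qed

section \<open>The extension, its measurability and its gradient\<close>

lemma de_zero_iff: "de x = 0 \<longleftrightarrow> x \<in> closure Om"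
 unfolding de_def using Om_ne by (simp add: in_closure_iff_infdist_zero)

lemma de_pos_iff: "0 < de x \<longleftrightarrow> x \<notin> closure Om"
 using de_zero_iff[of x] infdist_nonneg[of x Om] by (auto simp: de_def)

text \<open>\<open>av_near\<close> with c = 0 gives a local Lipschitz bound. Continuity provides
  both the measurability and the separable range of the extension off the closure of
  \<open>Om\<close>.\<close>

lemma av_continuous: "continuous_on {x. 0 < de x \<and> de x < 2} av"
proof (rule continuous_on_iff[THEN iffD2], intro ballI allI impI)
 fix x and e :: real assume "x \<in> {x. 0 < de x \<and> de x < 2}" and e: "0 < e"
 then have x: "0 < de x" "de x \<le> 2" by auto
 have "(\<integral>\<^sup>+z\<in>Om \<inter> ball x (4 * de x). enorm (u z - 0) \<partial>M) \<le> (\<integral>\<^sup>+z\<in>ball x (4 * de x). g z \<partial>M)"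
  using u_le_g by (intro nn_integral_mono) (auto simp: indicator_def)
 also have "... < \<infinity>" by (rule g_ball_finite)
 finally obtain Y where Y: "(\<integral>\<^sup>+z\<in>Om \<inter> ball x (4 * de x). enorm (u z - 0) \<partial>M) = ennreal Y" "0 \<le> Y"
  by (cases "\<integral>\<^sup>+z\<in>Om \<inter> ball x (4 * de x). enorm (u z - 0) \<partial>M") auto
 obtain V where V: "vol x (4 * de x) = ennreal V" "0 < V"
  using ball_pos[of "4 * de x" x] ball_finite[of x "4 * de x"] x
  by (cases "vol x (4 * de x)") auto
 define c where "c = 14 / ka\<^sup>2 / de x * Y / V"
 have c: "0 \<le> c" using x Y V by (simp add: c_def)
 show "\<exists>d>0. \<forall>y\<in>{x. 0 < de x \<and> de x < 2}. dist y x < d \<longrightarrow> dist (av y) (av x) < e"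
 proof (intro exI[of _ "min (de x / 4) (e / (c + 1))"] conjI ballI impI)
  show "0 < min (de x / 4) (e / (c + 1))" using x e c by simp
  fix y assume "y \<in> {x. 0 < de x \<and> de x < 2}" and d: "dist y x < min (de x / 4) (e / (c + 1))"
  then have y: "de y \<le> 2" "4 * dist x y < de x" "dist x y < e / (c + 1)" by (auto simp: dist_commute)
  have "enorm (av x - av y) * ennreal V \<le> ennreal (14 / ka\<^sup>2 * (dist x y / de x)) * ennreal Y"
   using av_near[OF x y(1,2), of 0] unfolding Y(1) V(1) .
  then have "norm (av x - av y) * V \<le> 14 / ka\<^sup>2 * (dist x y / de x) * Y"
   using V Y x by (simp add: ennreal_mult[symmetric] ennreal_le_iff)
  also have "... = c * dist x y * V" using V by (simp add: c_def)
  finally have "norm (av x - av y) \<le> c * dist x y" using V by simp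
  also have "... \<le> (c + 1) * dist x y" by (intro mult_right_mono) auto
  also have "... < e" using y(3) c by (simp add: field_simps)
  finally show "dist (av y) (av x) < e" by (simp add: dist_norm norm_minus_commute)
 qed
qed

text \<open>On the closure minus \<open>Om\<close>, a null set by \<open>closure_null\<close>, the
  value 0 is arbitrary. The cut-off ends at distance 1, within the range de x <= 2 of the estimates
  for \<open>av\<close>.\<close>

definition ext :: "'a \<Rightarrow> 'b" where
 "ext x = (if x \<in> Om then u x else if x \<in> closure Om then 0 else max 0 (1 - de x) *\<^sub>R av x)"

lemma ext_inside: "x \<in> Om \<Longrightarrow> ext x = u x" by (simp add: ext_def)

lemma ext_outside: "0 < de x \<Longrightarrow> ext x = max 0 (1 - de x) *\<^sub>R av x"
 using closure_subset[of Om] by (auto simp: ext_def de_pos_iff)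

lemma ext_far: "1 \<le> de x \<Longrightarrow> ext x = 0"
 using ext_outside[of x] by simp

lemma ext_continuous: "continuous_on (- closure Om) ext"
proof -
 have eq: "- closure Om = {x. 0 < de x \<and> de x < 2} \<union> {x. 1 < de x}"
 proof -
  have "- closure Om = {x. 0 < de x}" using de_pos_iff by blast
  then show ?thesis by auto
 qed
 have "continuous_on {x. 0 < de x \<and> de x < 2} (\<lambda>x. max 0 (1 - de x) *\<^sub>R av x)"
  by (intro continuous_intros de_continuous av_continuous)
 then have 1: "continuous_on {x. 0 < de x \<and> de x < 2} ext"
  by (rule continuous_on_eq) (simp add: ext_outside)
 have 2: "continuous_on {x. 1 < de x} ext"
  by (rule continuous_on_eq[of _ "\<lambda>_. 0"]) (auto simp: ext_far)
 have "open {x. 0 < de x \<and> de x < 2}" "open {x. 1 < de x}"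
  by (intro open_Collect_conj open_Collect_less de_continuous continuous_on_const)+
 then show ?thesis unfolding eq using 1 2 by (intro continuous_on_open_Un)
qed

lemma ext_measurable: "ext \<in> borel_measurable M"
proof -
 have "(\<lambda>x. if x \<in> closure Om then 0 else ext x) \<in> borel_measurable borel"
  using ext_continuous by (intro borel_measurable_continuous_on_if) auto
 from borel_measurable_M[OF this]
 have "(\<lambda>x. if x \<in> Om then u x else (if x \<in> closure Om then 0 else ext x)) \<in> borel_measurable M"
  by (rule measurable_If_set[OF u_measurable]) simp
 also have "(\<lambda>x. if x \<in> Om then u x else (if x \<in> closure Om then 0 else ext x)) = ext"
  by (auto simp: ext_def)
 finally show ?thesis .
qed

lemma ext_bound: "enorm (ext x) \<le> g x + ennreal (D / ka) * mxf g x"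
proof (cases "x \<in> Om")
 case True
 then show ?thesis using u_le_g[of x] by (simp add: ext_inside add_increasing2)
next
 case False
 show ?thesis
 proof (cases "0 < de x \<and> de x < 1")
  case True
  then have "norm (ext x) \<le> norm (av x)" by (simp add: ext_outside mult_left_le_one_le)
  then have "enorm (ext x) \<le> enorm (av x)" by (rule ennreal_leI)
  also have "... \<le> ennreal (D / ka) * mxf g x" using True by (intro av_bound) auto
  finally show ?thesis by (simp add: add_increasing)
 next
  case F: False
  then have "ext x = 0" using False ext_far[of x] de_pos_iff[of x] by (auto simp: ext_def)
  then show ?thesis by simp
 qed
qed

lemma mxf_g_Lp: "Lp_nonneg p M (mxf g)"
 by (rule Lp_nonneg_mxf[OF p g_Lp])

lemma ext_Lp: "Lp p M ext"
proof -
 have [measurable]: "(\<lambda>x. norm (ext x)) \<in> borel_measurable M"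
  using norm_diff_measurable[OF ext_measurable, of 0] by simp
 obtain C' where C': "countable C'" "ext ` (- closure Om) \<subseteq> closure C'"
  by (rule continuous_image_separable[OF ext_continuous])
 have "ext x \<in> closure (Cs \<union> C' \<union> {0})" for x
 proof -
  have "x \<in> Om \<or> x \<in> - closure Om \<or> ext x = 0" by (auto simp: ext_def)
  then consider "x \<in> Om" | "x \<in> - closure Om" | "ext x = 0" by blast
  then have "ext x \<in> closure Cs \<union> closure C' \<union> closure {0}"
  proof cases
   case 1
   then show ?thesis using Cs(2) by (auto simp: ext_inside)
  next
   case 2
   then show ?thesis using C'(2) by auto
  next
   case 3
   then show ?thesis by simp
  qed
  then show ?thesis by (simp only: closure_Un)
 qed
 then have "ext ` (space M - {}) \<subseteq> closure (Cs \<union> C' \<union> {0})" by auto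
 moreover have "countable (Cs \<union> C' \<union> {0})" using Cs(1) C'(1) by simp
 ultimately have "separable_space (subtopology euclidean (ext ` (space M - {})))"
  unfolding separable_space_iff by blast
 then have "ess_separable_measurable M ext"
  unfolding ess_separable_measurable_def using ext_measurable by (intro conjI bexI[of _ "{}"]) auto
 moreover have "Lp_nonneg p M (\<lambda>x. enorm (ext x))"
 proof (rule Lp_nonneg_mono_AE)
  show "Lp_nonneg p M (\<lambda>x. g x + ennreal (D / ka) * mxf g x)"
   using p K_bounds(5) by (intro Lp_nonneg_add Lp_nonneg_cmult g_Lp mxf_g_Lp) auto
 qed (use ext_bound p in auto)
 ultimately show ?thesis by (simp add: Lp_def)
qed

definition ext_gradient :: "'a \<Rightarrow> ennreal" where
 "ext_gradient x = ennreal (2 * K) * (g x + mxf g x)"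

lemma ext_pair_aux:
 assumes "enorm (ext x - ext y) \<le> ennreal (2 * K * dist x y) * ((g x + mxf g x) + (g y + mxf g y))"
 shows "enorm (ext x - ext y) \<le> ennreal (dist x y) * (ext_gradient x + ext_gradient y)"
  "enorm (ext y - ext x) \<le> ennreal (dist y x) * (ext_gradient y + ext_gradient x)"
proof -
 have "0 \<le> K" using K_bounds(1,5) by linarith
 then have "ennreal (2 * K * dist x y) = ennreal (2 * K) * ennreal (dist x y)" by (intro ennreal_mult) auto
 then have "ennreal (2 * K * dist x y) * ((g x + mxf g x) + (g y + mxf g y)) = ennreal (dist x y) * (ext_gradient x + ext_gradient y)"
  by (simp add: ext_gradient_def distrib_left mult_ac)
 then show "enorm (ext x - ext y) \<le> ennreal (dist x y) * (ext_gradient x + ext_gradient y)" using assms by simp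
 then show "enorm (ext y - ext x) \<le> ennreal (dist y x) * (ext_gradient y + ext_gradient x)"
  by (simp add: norm_minus_commute dist_commute add.commute)
qed

lemma ext_pair_in_out:
 assumes x: "x \<in> Om - N" and y: "0 < de y"
 shows "enorm (ext x - ext y) \<le> ennreal (2 * K * dist x y) * ((g x + mxf g x) + (g y + mxf g y))" (is "_ \<le> _ * ?G")
proof -
 have k0: "0 < D" "0 < ka" and K: "1 \<le> K" using D_ge_1 ka K_bounds(6) by auto
 have d: "de y \<le> dist x y" using de_le[of x y] x by (simp add: dist_commute)
 have gx: "g x \<le> ?G" "mxf g y + g x \<le> ?G"
  by (simp add: add_increasing2, simp add: ac_simps)
 have ux: "ennreal (\<alpha> * norm (u x)) \<le> ennreal (dist x y) * g x" if "0 \<le> \<alpha>" "\<alpha> \<le> dist x y" for \<alpha>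
  using that u_le_g[of x] by (simp add: ennreal_mult mult_mono ennreal_leI)
 show ?thesis
 proof (cases "1 \<le> de y")
  case True
  have "enorm (ext x - ext y) \<le> ennreal (dist x y) * g x"
   using ux[of 1] True d x by (simp add: ext_far ext_inside)
  also have "... \<le> ennreal (2 * K * dist x y) * ?G"
   using gx(1) K mult_right_mono[of 1 "2 * K" "dist x y"] by (intro mult_mono ennreal_leI) auto
  finally show ?thesis .
 next
  case False
  have e: "ext y = (1 - de y) *\<^sub>R av y" using False y by (simp add: ext_outside)
  \<comment> \<open>Split so that the cut-off multiplies the difference of u and its average; the
    remaining term is small because de y <= dist x y.\<close>
  have "ext x - ext y = de y *\<^sub>R u x + (1 - de y) *\<^sub>R (u x - av y)"
   using x by (simp add: e ext_inside algebra_simps)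
  then have "enorm (ext x - ext y) \<le> enorm (de y *\<^sub>R u x) + enorm ((1 - de y) *\<^sub>R (u x - av y))"
   by (simp only: ennreal_norm_triangle)
  also have "... \<le> ennreal (2 * K * dist x y) * ?G"
  proof (rule ennreal_add_le_mult[OF _ _ gx])
   show "enorm (de y *\<^sub>R u x) \<le> ennreal (dist x y) * g x" using ux[of "de y"] y d by simp
   have "norm ((1 - de y) *\<^sub>R (u x - av y)) \<le> norm (av y - u x)"
    using False y by (simp add: mult_left_le_one_le norm_minus_commute)
   then have "enorm ((1 - de y) *\<^sub>R (u x - av y)) \<le> enorm (av y - u x)" by (rule ennreal_leI)
   also have "... \<le> ennreal (4 * D / ka * dist y x) * (mxf g y + g x)" using False y by (intro av_minus_u x) auto
   finally show "enorm ((1 - de y) *\<^sub>R (u x - av y)) \<le> ennreal (4 * D / ka * dist x y) * (mxf g y + g x)"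
    by (simp add: dist_commute)
   have "(4 * D / ka + 1) * dist x y \<le> K * dist x y" by (intro mult_right_mono K_bounds) auto
   moreover have "0 \<le> K * dist x y" using K by simp
   ultimately show "dist x y + 4 * D / ka * dist x y \<le> 2 * K * dist x y" by (simp add: algebra_simps)
  qed (use k0 in auto)
  finally show ?thesis .
 qed
qed

lemma ext_pair_far:
 assumes x: "0 < de x" and y: "1 \<le> de y"
 shows "enorm (ext x - ext y) \<le> ennreal (2 * K * dist x y) * ((g x + mxf g x) + (g y + mxf g y))" (is "_ \<le> _ * ?G")
proof (cases "1 \<le> de x")
 case False
 have K: "1 \<le> K" by (rule K_bounds(6))
 have d: "1 - de x \<le> dist x y" using de_lip[of y x] y by (simp add: dist_commute)
 have "norm (ext x - ext y) = (1 - de x) * norm (av x)" using False y x by (simp add: ext_far ext_outside)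
 also have "... \<le> dist x y * norm (av x)" using d by (intro mult_right_mono) auto
 finally have "enorm (ext x - ext y) \<le> ennreal (dist x y) * enorm (av x)"
  by (simp add: ennreal_leI flip: ennreal_mult)
 also have "... \<le> ennreal (dist x y) * (ennreal (D / ka) * mxf g x)" using x False by (intro mult_left_mono av_bound) auto
 also have "... = ennreal (D / ka * dist x y) * mxf g x"
  using K_bounds(5) by (subst ennreal_mult_collect) (auto simp: mult.commute)
 also have "... \<le> ennreal (2 * K * dist x y) * ?G"
 proof (intro mult_mono ennreal_leI mult_right_mono)
  show "D / ka \<le> 2 * K" using K_bounds(1) K by simp
  show "mxf g x \<le> ?G" by (simp add: add_increasing add_increasing2)
 qed (use K in auto)
 finally show ?thesis .
qed (use y in \<open>simp add: ext_far\<close>)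

lemma ext_pair_near:
 assumes x: "0 < de x" "de x < 1" and y: "0 < de y" "de y < 1"
 shows "enorm (ext x - ext y) \<le> ennreal (2 * K * dist x y) * ((g x + mxf g x) + (g y + mxf g y))" (is "_ \<le> _ * ?G")
proof -
 have k0: "0 < D" "0 < ka" and K: "1 \<le> K" using D_ge_1 ka K_bounds(6) by auto
 have d: "\<bar>de y - de x\<bar> \<le> dist x y" using de_lip[of y x] de_lip[of x y] by (simp add: dist_commute abs_le_iff)
 \<comment> \<open>Product rule: \<open>av_pair\<close> controls the first summand, the Lipschitz
   bound of \<open>de\<close> together with \<open>av_bound\<close> the second.\<close>
 have "ext x - ext y = (1 - de x) *\<^sub>R (av x - av y) + (de y - de x) *\<^sub>R av y"
  using x y by (simp add: ext_outside algebra_simps)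
 then have "enorm (ext x - ext y) \<le> enorm ((1 - de x) *\<^sub>R (av x - av y)) + enorm ((de y - de x) *\<^sub>R av y)"
  by (simp only: ennreal_norm_triangle)
 also have "... \<le> ennreal (2 * K * dist x y) * ?G"
 proof (rule ennreal_add_le_mult)
  have "norm ((1 - de x) *\<^sub>R (av x - av y)) \<le> norm (av x - av y)" using x by (simp add: mult_left_le_one_le)
  then have "enorm ((1 - de x) *\<^sub>R (av x - av y)) \<le> enorm (av x - av y)" by (rule ennreal_leI)
  also have "... \<le> ennreal (K * dist x y) * (mxf g x + mxf g y)" using x y by (intro av_pair) auto
  finally show "enorm ((1 - de x) *\<^sub>R (av x - av y)) \<le> ennreal (K * dist x y) * (mxf g x + mxf g y)" .
  have "norm ((de y - de x) *\<^sub>R av y) \<le> dist x y * norm (av y)" using d by (simp add: mult_right_mono)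
  then have "enorm ((de y - de x) *\<^sub>R av y) \<le> ennreal (dist x y) * enorm (av y)"
   by (simp add: ennreal_leI flip: ennreal_mult)
  also have "... \<le> ennreal (dist x y) * (ennreal (D / ka) * mxf g y)" using y by (intro mult_left_mono av_bound) auto
  also have "... = ennreal (D / ka * dist x y) * mxf g y"
   using K_bounds(5) by (subst ennreal_mult_collect) (auto simp: mult.commute)
  finally show "enorm ((de y - de x) *\<^sub>R av y) \<le> ennreal (D / ka * dist x y) * mxf g y" .
  show "mxf g x + mxf g y \<le> ?G" by (intro add_mono) (auto simp: add_increasing)
  show "mxf g y \<le> ?G" by (simp add: add_increasing add_increasing2)
  have "D / ka * dist x y \<le> K * dist x y" by (intro mult_right_mono K_bounds) auto
  moreover have "2 * K * dist x y = K * dist x y + K * dist x y" by (simp only: mult_2 distrib_right)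
  ultimately show "K * dist x y + D / ka * dist x y \<le> 2 * K * dist x y"
   by (simp only: add_le_cancel_left)
 qed (use K k0 in auto)
 finally show ?thesis .
qed

lemma ext_pair:
 assumes x: "x \<notin> N \<union> (closure Om - Om)" and y: "y \<notin> N \<union> (closure Om - Om)"
 shows "enorm (ext x - ext y) \<le> ennreal (dist x y) * (ext_gradient x + ext_gradient y)"
proof -
 have cases: "z \<in> Om - N \<or> (0 < de z \<and> de z < 1) \<or> 1 \<le> de z" if "z \<notin> N \<union> (closure Om - Om)" for z
  using that de_pos_iff[of z] by auto
 have K: "1 \<le> K" by (rule K_bounds(6))
 have both: ?thesis if "x \<in> Om - N" "y \<in> Om - N"
 proof (rule ext_pair_aux)
  have "enorm (ext x - ext y) \<le> ennreal (dist x y) * (g x + g y)"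
   using u_gradient[OF that] that by (simp add: ext_inside)
  also have "... \<le> ennreal (2 * K * dist x y) * ((g x + mxf g x) + (g y + mxf g y))"
   using K mult_right_mono[of 1 "2 * K" "dist x y"] by (intro mult_mono add_mono ennreal_leI) (auto simp: add_increasing2)
  finally show "enorm (ext x - ext y) \<le> ennreal (2 * K * dist x y) * ((g x + mxf g x) + (g y + mxf g y))" .
 qed
 have pos: "0 < de z" if "1 \<le> de z" for z using that by simp
 from cases[OF x] cases[OF y] show ?thesis
  using both ext_pair_aux(1)[OF ext_pair_in_out[of x y]] ext_pair_aux(2)[OF ext_pair_in_out[of y x]]
   ext_pair_aux(1)[OF ext_pair_far[of x y]] ext_pair_aux(2)[OF ext_pair_far[of y x]]
   ext_pair_aux(1)[OF ext_pair_near[of x y]] pos[of x] pos[of y] by argo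
qed

lemma newton_sobolev_ext: "newton_sobolev p M ext"
proof -
 have [measurable]: "mxf g \<in> borel_measurable M" using mxf_g_Lp by (simp add: Lp_nonneg_def)
 have Gm [measurable]: "ext_gradient \<in> borel_measurable M" unfolding ext_gradient_def[abs_def] by measurable
 have K: "0 \<le> 2 * K" using K_bounds(6) by auto
 have GL: "Lp_nonneg p M ext_gradient"
  unfolding ext_gradient_def[abs_def] using p K by (intro Lp_nonneg_cmult Lp_nonneg_add g_Lp mxf_g_Lp) auto
 obtain G where G: "G \<in> borel_measurable borel" "\<And>x. ext_gradient x \<le> G x" "AE x in M. G x = ext_gradient x"
  by (rule borel_majorant[OF Gm]) blast
 have GLp: "Lp_nonneg p M G"
 proof (rule Lp_nonneg_mono_AE[OF GL])
  show "AE x in M. G x \<le> ext_gradient x" using G(3) by eventually_elim simp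
 qed (use p G borel_measurable_M in auto)
 have "N \<union> (closure Om - Om) \<in> null_sets M" by (intro null_sets.Un N_null closure_null)
 then obtain N' where N': "N \<union> (closure Om - Om) \<subseteq> N'" "N' \<in> null_sets M" "N' \<in> sets borel"
  by (rule null_hull)
 show ?thesis
 proof (rule newton_sobolev_if_pointwise_gradient)
  show "complete_measure M" by (rule complete_measure_axioms)
  fix x y assume "x \<notin> N'" "y \<notin> N'"
  then have "x \<notin> N \<union> (closure Om - Om)" "y \<notin> N \<union> (closure Om - Om)" using N'(1) by auto
  then have "enorm (ext x - ext y) \<le> ennreal (dist x y) * (ext_gradient x + ext_gradient y)" by (rule ext_pair)
  also have "... \<le> ennreal (dist x y) * (G x + G y)" by (intro mult_left_mono add_mono G) auto
  finally show "enorm (ext x - ext y) \<le> ennreal (dist x y) * (G x + G y)" .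
 qed (use p sets_M ext_Lp GLp G N' in auto)
qed

end

section \<open>Caratheodory measures of PI spaces\<close>

lemma metric_measure_spaceD:
 assumes "metric_measure_space \<mu>"
 shows "outer_measure_space (Pow UNIV) \<mu>" "sets borel \<subseteq> sets (carath \<mu>)"
  "A \<in> sets (carath \<mu>) \<Longrightarrow> emeasure (carath \<mu>) A = \<mu> A"
  "A \<in> sets (carath \<mu>) \<Longrightarrow> \<exists>B\<in>sets borel. A \<subseteq> B \<and> emeasure (carath \<mu>) B = emeasure (carath \<mu>) A"
  "0 < r \<Longrightarrow> 0 < \<mu> (ball x r)" "0 < r \<Longrightarrow> \<mu> (ball x r) < \<infinity>"
proof -
 have reg: "borel_regular_outer_measure \<mu>" using assms by (simp add: metric_measure_space_def)
 show o: "outer_measure_space (Pow UNIV) \<mu>" using reg by (simp add: borel_regular_outer_measure_def)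
 show b: "sets borel \<subseteq> sets (carath \<mu>)" using reg by (simp add: borel_regular_outer_measure_def sets_carath[OF o])
 show e: "emeasure (carath \<mu>) A = \<mu> A" if "A \<in> sets (carath \<mu>)" for A
  using that by (simp add: sets_carath[OF o] emeasure_carath[OF o])
 have h: "\<exists>B\<in>sets borel. A \<subseteq> B \<and> \<mu> B = \<mu> A" for A using reg by (simp add: borel_regular_outer_measure_def)
 show "\<exists>B\<in>sets borel. A \<subseteq> B \<and> emeasure (carath \<mu>) B = emeasure (carath \<mu>) A" if "A \<in> sets (carath \<mu>)"
 proof -
  obtain B where "B \<in> sets borel" "A \<subseteq> B" "\<mu> B = \<mu> A" using h[of A] by (elim bexE conjE)
  then show ?thesis using e[of A] e[of B] b that by (intro bexI[of _ B]) auto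
 qed
 show "0 < r \<Longrightarrow> 0 < \<mu> (ball x r)" "0 < r \<Longrightarrow> \<mu> (ball x r) < \<infinity>"
  using assms by (simp_all add: metric_measure_space_def)
qed

lemma complete_measure_carath:
 assumes "metric_measure_space \<mu>"
 shows "complete_measure (carath \<mu>)"
proof
 note o = metric_measure_spaceD(1)[OF assms]
 fix A B assume "B \<subseteq> A" and A: "A \<in> null_sets (carath \<mu>)"
 have mono: "\<mu> X \<le> \<mu> Y" if "X \<subseteq> Y" for X Y
  using o that by (auto simp: outer_measure_space_def increasing_def)
 have "\<mu> A = 0" using A metric_measure_spaceD(3)[OF assms, of A] by (auto simp: null_sets_def)
 then have B0: "\<mu> (B \<inter> X) = 0" for X using mono[of "B \<inter> X" A] \<open>B \<subseteq> A\<close> by auto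
 have "subadditive (Pow UNIV) \<mu>"
  using o unfolding outer_measure_space_def
  by (elim conjE) (rule ring_of_sets.countably_subadditive_subadditive[OF ring_of_sets_Pow])
 then have sub: "X \<inter> Y = {} \<Longrightarrow> \<mu> (X \<union> Y) \<le> \<mu> X + \<mu> Y" for X Y
  by (rule subadditiveD) auto
 show "B \<in> sets (carath \<mu>)"
  unfolding sets_carath[OF o] lambda_system_def
 proof (intro CollectI conjI ballI)
  fix X
  have "\<mu> ((UNIV - B) \<inter> X) \<le> \<mu> X" by (rule mono) auto
  moreover have "\<mu> X \<le> \<mu> (B \<inter> X) + \<mu> ((UNIV - B) \<inter> X)"
  proof -
   have "B \<inter> X \<union> (UNIV - B) \<inter> X = X" by auto
   moreover have "\<mu> (B \<inter> X \<union> (UNIV - B) \<inter> X) \<le> \<mu> (B \<inter> X) + \<mu> ((UNIV - B) \<inter> X)" by (rule sub) auto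
   ultimately show ?thesis by simp
  qed
  ultimately show "\<mu> (B \<inter> X) + \<mu> ((UNIV - B) \<inter> X) = \<mu> X" using B0[of X] by simp
 qed simp
qed

text \<open>Comparing w with its mean turns the double integral into twice the deviation integral,
  to which the Poincare inequality applies. If the g-integral on the right is infinite there is
  nothing to prove; otherwise g is an admissible weak gradient on the enlarged ball, with \<rho> as
  witness for the exceptional curves.\<close>

lemma PI_poincare_space:
 fixes \<mu> :: "'a::{metric_space,second_countable_topology} set \<Rightarrow> ennreal"
 assumes p: "1 < p" and PI: "PI_space p \<mu>"
 obtains D C L where "poincare_space (carath \<mu>) D p C L"
proof -
 define M where "M = carath \<mu>"
 have mm: "metric_measure_space \<mu>" using PI by (simp add: PI_space_def)
 have bM: "sets borel \<subseteq> sets M" unfolding M_def by (rule metric_measure_spaceD(2)[OF mm])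
 have ballM: "ball x r \<in> sets M" for x r using bM by auto
 have eb: "emeasure M (ball x r) = \<mu> (ball x r)" for x r
  using ballM unfolding M_def by (rule metric_measure_spaceD(3)[OF mm])
 obtain c where c: "0 < c" "\<And>x r. 0 < r \<Longrightarrow> \<mu> (ball x (2 * r)) \<le> ennreal c * \<mu> (ball x r)"
  using PI by (auto simp: PI_space_def doubling_def)
 define D where "D = max 1 c"
 interpret doubling_measure M D
 proof
  show "space M = UNIV" by (simp add: M_def)
  show "sets borel \<subseteq> sets M" by (rule bM)
  show "1 \<le> D" by (simp add: D_def)
  show "0 < r \<Longrightarrow> 0 < emeasure M (ball x r)" for x r unfolding eb by (rule metric_measure_spaceD(5)[OF mm])
  show "emeasure M (ball x r) < \<infinity>" for x r
  proof (cases "0 < r")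
   case True
   then show ?thesis unfolding eb by (rule metric_measure_spaceD(6)[OF mm])
  next
   case False
   then have "ball x r = {}" by auto
   then show ?thesis by (simp only: emeasure_empty) simp
  qed
  show "emeasure M (ball x (2 * r)) \<le> ennreal D * emeasure M (ball x r)" if "0 < r" for x r
  proof -
   have "\<mu> (ball x (2 * r)) \<le> ennreal c * \<mu> (ball x r)" using c that by simp
   also have "... \<le> ennreal D * \<mu> (ball x r)" by (intro mult_right_mono ennreal_leI) (auto simp: D_def)
   finally show ?thesis unfolding eb .
  qed
 qed
 have "\<exists>C L::real. 0 < C \<and> 1 \<le> L \<and>
   (\<forall>x r. 0 < r \<longrightarrow>
    (\<forall>(u :: 'a \<Rightarrow> real) \<rho>.
      integrable (restrict_space M (ball x (L * r))) u \<and>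
      Lp_nonneg p (restrict_space M (ball x (L * r))) \<rho> \<and>
      weak_upper_gradient p (restrict_space M (ball x (L * r))) \<rho> u \<longrightarrow>
      (LINT y:ball x r|M. \<bar>u y - (LINT y:ball x r|M. u y) / measure M (ball x r)\<bar>) / measure M (ball x r)
      \<le> C * diameter (ball x r) *
        (enn2real (\<integral>\<^sup>+y\<in>ball x (L * r). ennreal_powr (\<rho> y) p \<partial>M) / measure M (ball x (L * r))) powr (1 / p)))"
  using PI unfolding PI_space_def weak_poincare_def Let_def M_def by (elim conjE)
 then obtain C L where C: "0 < C" and L: "1 \<le> L" and poinc: "\<forall>x r. 0 < r \<longrightarrow>
    (\<forall>(u :: 'a \<Rightarrow> real) \<rho>.
      integrable (restrict_space M (ball x (L * r))) u \<and>
      Lp_nonneg p (restrict_space M (ball x (L * r))) \<rho> \<and>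
      weak_upper_gradient p (restrict_space M (ball x (L * r))) \<rho> u \<longrightarrow>
      (LINT y:ball x r|M. \<bar>u y - (LINT y:ball x r|M. u y) / measure M (ball x r)\<bar>) / measure M (ball x r)
      \<le> C * diameter (ball x r) *
        (enn2real (\<integral>\<^sup>+y\<in>ball x (L * r). ennreal_powr (\<rho> y) p \<partial>M) / measure M (ball x (L * r))) powr (1 / p))"
  by (elim exE conjE) (rule that)
 \<comment> \<open>The factor 4 is 2 from \<open>dosc_perturb\<close> times 2 from the diameter
   bound 2 r; the maximum with 1, like that with 2 for L', meets the normalisation of the
   locale.\<close>
 define C' where "C' = max 1 ((4 * C) powr p)"
 define L' where "L' = max 2 L"
 have "poincare_space M D p C' L'"
 proof -
  interpret complete_measure M unfolding M_def by (rule complete_measure_carath[OF mm])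
  show ?thesis
  proof
   show "1 < p" by fact
   show "1 \<le> C'" "2 \<le> L'" by (auto simp: C'_def L'_def)
   show "\<exists>B\<in>sets borel. A \<subseteq> B \<and> emeasure M B = emeasure M A" if "A \<in> sets M" for A
    using that unfolding M_def by (rule metric_measure_spaceD(4)[OF mm])
   fix w :: "'a \<Rightarrow> real" and g \<rho> :: "'a \<Rightarrow> ennreal" and x :: 'a and r A :: real
   assume r: "0 < r" and w [measurable]: "w \<in> borel_measurable M"
    and w_fin: "\<And>x R. (\<integral>\<^sup>+y\<in>ball x R. ennreal \<bar>w y\<bar> \<partial>M) < \<infinity>"
    and g: "g \<in> borel_measurable borel" and \<rho>: "\<rho> \<in> borel_measurable borel" "Lp_nonneg p M \<rho>"
    and grad: "\<And>a b ga. (a, b, ga) \<in> curves_in UNIV \<Longrightarrow> line_integral \<rho> (a, b, ga) < \<infinity> \<Longrightarrow>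
     ennreal \<bar>w (ga a) - w (ga b)\<bar> \<le> line_integral g (a, b, ga)"
    and A: "0 \<le> A" and osc: "ennreal (A * r) * (emeasure M (ball x r))\<^sup>2 \<le> dosc M w x r"
   have gM [measurable]: "g \<in> borel_measurable M" by (rule borel_measurable_M[OF g])
   let ?B = "ball x r" and ?B' = "ball x (L * r)"
   let ?I = "\<integral>\<^sup>+y\<in>?B'. ennreal_powr (g y) p \<partial>M"
   have I_le: "ennreal ((4 * C) powr p) * ?I \<le> ennreal C' * (\<integral>\<^sup>+y\<in>ball x (L' * r). ennreal_powr (g y) p \<partial>M)"
   proof (intro mult_mono nn_integral_mono mult_left_mono ennreal_leI)
    have "L * r \<le> L' * r" using r by (intro mult_right_mono) (auto simp: L'_def)
    then show "indicator ?B' y \<le> (indicator (ball x (L' * r)) y :: ennreal)" for y by (auto simp: indicator_def)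
   qed (auto simp: C'_def)
   show "ennreal (A powr p) * emeasure M ?B \<le> ennreal C' * (\<integral>\<^sup>+y\<in>ball x (L' * r). ennreal_powr (g y) p \<partial>M)"
   proof (cases "?I < \<infinity>")
    case False
    then have "?I = top" by (simp add: less_top[symmetric])
    moreover have "ennreal ((4 * C) powr p) \<noteq> 0" using C by (simp add: ennreal_eq_0_iff)
    ultimately have "ennreal ((4 * C) powr p) * ?I = top" by (simp add: ennreal_mult_top)
    then show ?thesis using I_le by (simp add: top_unique)
   next
    case True
    define G where "G = enn2real ?I"
    have G: "?I = ennreal G" "0 \<le> G" using True by (auto simp: G_def)
    define v v' where "v = measure M ?B" and "v' = measure M ?B'"
    have Lr: "r \<le> L * r" using L r by simp
    have v: "emeasure M ?B = ennreal v" "0 < v"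
    proof -
     show e: "emeasure M ?B = ennreal v"
      unfolding v_def using ball_finite[of x r] by (intro emeasure_eq_ennreal_measure) (simp add: less_top)
     show "0 < v" using ball_pos[OF r, of x] unfolding e by simp
    qed
    have v': "emeasure M ?B' = ennreal v'" "0 \<le> v'"
     unfolding v'_def using ball_finite[of x "L * r"] by (intro emeasure_eq_ennreal_measure) (simp_all add: less_top)
    have "emeasure M ?B \<le> emeasure M ?B'" using Lr by (intro emeasure_mono subset_ball) auto
    then have vv': "v \<le> v'" unfolding v v' using v' by (simp add: ennreal_le_iff)
    have sp: "space (restrict_space M ?B') = ?B'" by (simp add: space_restrict_space)
    have B'M: "?B' \<inter> space M \<in> sets M" by auto
    define c where "c = (LINT y:?B|M. w y) / measure M ?B"
    have int: "integrable M (\<lambda>y. indicator (ball x R) y *\<^sub>R (w y - d))" for R d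
    proof (rule integrableI_bounded)
     have "(\<integral>\<^sup>+y. enorm (indicator (ball x R) y *\<^sub>R (w y - d)) \<partial>M)
      \<le> (\<integral>\<^sup>+y. ennreal \<bar>w y\<bar> * indicator (ball x R) y + ennreal \<bar>d\<bar> * indicator (ball x R) y \<partial>M)"
      by (intro nn_integral_mono) (auto simp: indicator_def ennreal_leI simp flip: ennreal_plus)
     also have "... = (\<integral>\<^sup>+y\<in>ball x R. ennreal \<bar>w y\<bar> \<partial>M) + ennreal \<bar>d\<bar> * emeasure M (ball x R)"
      by (simp add: nn_integral_add nn_integral_cmult_indicator)
     also have "... < \<infinity>" using w_fin[of x R] ball_finite[of x R] by (simp add: ennreal_mult_less_top)
     finally show "(\<integral>\<^sup>+y. enorm (indicator (ball x R) y *\<^sub>R (w y - d)) \<partial>M) < \<infinity>" .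
    qed (intro borel_measurable_scaleR borel_measurable_indicator borel_measurable_diff w borel_measurable_const ballM)
    have ineq: "(LINT y:?B|M. \<bar>w y - c\<bar>) / v \<le> C * diameter ?B * (G / v') powr (1 / p)"
     unfolding c_def v_def v'_def G_def
    proof (rule poinc[rule_format, OF r], intro conjI)
     show "integrable (restrict_space M ?B') w"
      using int[of "L * r" 0] by (simp add: integrable_restrict_space[OF B'M])
     show "Lp_nonneg p (restrict_space M ?B') g"
      using True unfolding Lp_nonneg_def
      by (auto simp: nn_integral_restrict_space[OF B'M] intro!: measurable_restrict_space1)
     show "weak_upper_gradient p (restrict_space M ?B') g w"
      unfolding weak_upper_gradient_def p_negligible_def sp
     proof (intro conjI exI[of _ \<rho>] ballI)
      show "borel_on ?B' g" "borel_on ?B' \<rho>" using g \<rho>(1) by (auto simp: borel_on_def intro: measurable_restrict_space1)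
      have "(\<integral>\<^sup>+y\<in>?B'. ennreal_powr (\<rho> y) p \<partial>M) \<le> (\<integral>\<^sup>+y. ennreal_powr (\<rho> y) p \<partial>M)"
       by (intro nn_integral_mono) (auto simp: indicator_def)
      also have "... < \<infinity>" using \<rho>(2) by (simp add: Lp_nonneg_def)
      finally show "Lp_nonneg p (restrict_space M ?B') \<rho>"
       using \<rho>(2) unfolding Lp_nonneg_def
       by (auto simp: nn_integral_restrict_space[OF B'M] intro!: measurable_restrict_space1)
      fix q assume q: "q \<in> {(a, b, ga) \<in> curves_in ?B'. \<not> enorm (w (ga a) - w (ga b)) \<le> line_integral g (a, b, ga)}"
      obtain a b ga where qq: "q = (a, b, ga)" by (cases q) auto
      have "(a, b, ga) \<in> curves_in UNIV" using q by (auto simp: qq curves_in_def)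
      then have "\<not> line_integral \<rho> (a, b, ga) < \<infinity>" using grad[of a b ga] q by (auto simp: qq)
      then show "line_integral \<rho> q = \<infinity>" by (simp add: qq less_top[symmetric])
     qed
    qed
    define J where "J = (LINT y:?B|M. \<bar>w y - c\<bar>)"
    have J0: "0 \<le> J" unfolding J_def set_lebesgue_integral_def by (intro integral_nonneg_AE) auto
    have J: "(\<integral>\<^sup>+y\<in>?B. ennreal \<bar>w y - c\<bar> \<partial>M) = ennreal J"
    proof -
     have "integrable M (\<lambda>y. indicator ?B y *\<^sub>R \<bar>w y - c\<bar>)"
      using integrable_norm[OF int[of r c]] by (simp add: abs_mult)
     then have "ennreal J = (\<integral>\<^sup>+y. ennreal (indicator ?B y *\<^sub>R \<bar>w y - c\<bar>) \<partial>M)"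
      unfolding J_def set_lebesgue_integral_def by (intro nn_integral_eq_integral[symmetric]) auto
     then show ?thesis by (auto intro!: nn_integral_cong simp: indicator_def)
    qed
    have "ennreal (A * r) * (ennreal v)\<^sup>2 \<le> dosc M (\<lambda>_. c) x r + 2 * (ennreal v * ennreal J)"
     using osc dosc_perturb[OF w, of "\<lambda>_. c" x r] unfolding v(1) J by (auto intro: order_trans)
    then have "ennreal (A * r * v\<^sup>2) \<le> ennreal (2 * (v * J))"
     using A r v J0 ennreal_mult[of 2 "v * J"] by (simp add: dosc_def ennreal_mult ennreal_power)
    then have "A * r * v\<^sup>2 \<le> 2 * (v * J)" using v J0 by (simp add: ennreal_le_iff)
    also have "... = 2 * v\<^sup>2 * (J / v)" using v by (simp add: power2_eq_square)
    also have "... \<le> 2 * v\<^sup>2 * (C * (2 * r) * (G / v') powr (1 / p))"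
    proof (rule mult_left_mono)
     have "diameter ?B \<le> 2 * r"
     proof -
      have "diameter ?B = (SUP q\<in>?B \<times> ?B. case q of (y, z) \<Rightarrow> dist y z)" using r by (simp add: diameter_def)
      also have "... \<le> 2 * r"
      proof (rule cSUP_least)
       fix q assume "q \<in> ?B \<times> ?B"
       then obtain y z where "q = (y, z)" "y \<in> ?B" "z \<in> ?B" by auto
       then show "(case q of (y, z) \<Rightarrow> dist y z) \<le> 2 * r" using dist_triangle[of y z x] by (simp add: dist_commute)
      qed (use r in auto)
      finally show ?thesis .
     qed
     then have "C * diameter ?B * (G / v') powr (1 / p) \<le> C * (2 * r) * (G / v') powr (1 / p)"
      using C by (intro mult_right_mono mult_left_mono) auto
     then show "J / v \<le> C * (2 * r) * (G / v') powr (1 / p)" using ineq unfolding J_def by simp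
    qed simp
    finally have "A * (r * v\<^sup>2) \<le> (4 * C * (G / v') powr (1 / p)) * (r * v\<^sup>2)" by (simp add: mult_ac)
    then have "A \<le> 4 * C * (G / v') powr (1 / p)" using r v by (simp add: mult_le_cancel_right)
    then have "A powr p \<le> (4 * C * (G / v') powr (1 / p)) powr p" using A p by (intro powr_mono2) auto
    also have "... = (4 * C) powr p * (G / v')" using p G v' by (simp add: powr_mult powr_powr)
    finally have "A powr p * v \<le> (4 * C) powr p * (G / v') * v'"
     using vv' v G v' by (intro mult_mono) auto
    also have "... = (4 * C) powr p * G" using v vv' by simp
    finally have "ennreal (A powr p * v) \<le> ennreal ((4 * C) powr p * G)" by (rule ennreal_leI)
    then have "ennreal (A powr p) * emeasure M ?B \<le> ennreal ((4 * C) powr p) * ?I"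
     using v G by (simp add: ennreal_mult)
    then show ?thesis using I_le by (rule order_trans)
   qed
  qed
 qed
 then show ?thesis using that unfolding M_def by blast
qed

section \<open>The sharp function\<close>

lemma ennreal_inverse_antimono:
 fixes a b :: ennreal
 assumes "a \<le> b" shows "inverse b \<le> inverse a"
proof (cases "a = 0 \<or> b = top")
 case False
 then have "a < top" using assms by (auto simp: less_top[symmetric] top_unique)
 then obtain r t where "a = ennreal r" "0 \<le> r" "b = ennreal t" "0 \<le> t"
  using False by (cases a; cases b) auto
 moreover from this have "0 < r" "r \<le> t" using False assms by (auto simp: ennreal_le_iff)
 ultimately show ?thesis by (simp add: inverse_ennreal ennreal_leI le_imp_inverse_le)
qed auto

text \<open>The distance functions to the points of C recover the norm of a difference, by choosing
  w close to a. This is the bridge from real functions to Banach-valued maps.\<close>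

lemma norm_diff_eq_SUP:
 fixes a b :: "'b::real_normed_vector"
 assumes "a \<in> closure C"
 shows "enorm (a - b) = (SUP w\<in>C. ennreal \<bar>norm (a - w) - norm (b - w)\<bar>)"
proof (rule antisym)
 show "(SUP w\<in>C. ennreal \<bar>norm (a - w) - norm (b - w)\<bar>) \<le> enorm (a - b)"
 proof (intro SUP_least ennreal_leI)
  show "\<bar>norm (a - w) - norm (b - w)\<bar> \<le> norm (a - b)" for w
   using norm_triangle_ineq3[of "a - w" "b - w"] by simp
 qed
 show "enorm (a - b) \<le> (SUP w\<in>C. ennreal \<bar>norm (a - w) - norm (b - w)\<bar>)"
 proof (rule ennreal_le_epsilon)
  fix e :: real assume "0 < e"
  then have "0 < e / 2" by simp
  then obtain w where w: "w \<in> C" "dist w a < e / 2" using assms unfolding closure_approachable by blast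
  have "norm (a - b) \<le> norm (b - w) + norm (a - w)"
   using norm_triangle_ineq[of "a - w" "w - b"] by (simp add: norm_minus_commute add.commute)
  moreover have "norm (a - w) < e / 2" using w(2) by (simp add: dist_norm norm_minus_commute)
  ultimately have "norm (a - b) \<le> \<bar>norm (a - w) - norm (b - w)\<bar> + e" by linarith
  then have "enorm (a - b) \<le> ennreal \<bar>norm (a - w) - norm (b - w)\<bar> + ennreal e"
   using \<open>0 < e\<close> by (simp add: ennreal_leI flip: ennreal_plus)
  also have "... \<le> (SUP w\<in>C. ennreal \<bar>norm (a - w) - norm (b - w)\<bar>) + ennreal e"
   using w(1) by (intro add_right_mono SUP_upper)
  finally show "enorm (a - b) \<le> (SUP w\<in>C. ennreal \<bar>norm (a - w) - norm (b - w)\<bar>) + ennreal e" .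
 qed
qed

text \<open>In a nonseparable space subtraction may fail to be measurable for the product
  sigma-algebra; the countable supremum of real kernels avoids this.\<close>

lemma norm_diff_kernel_measurable:
 fixes u :: "'a \<Rightarrow> 'b::real_normed_vector"
 assumes u: "u \<in> borel_measurable M" and C: "countable C" "range u \<subseteq> closure C"
 shows "(\<lambda>q. enorm (u (fst q) - u (snd q))) \<in> borel_measurable (M \<Otimes>\<^sub>M M)"
proof -
 have [measurable]: "(\<lambda>x. norm (u x - w)) \<in> borel_measurable M" for w by (rule norm_diff_measurable[OF u])
 have "(\<lambda>q. SUP w\<in>C. ennreal \<bar>norm (u (fst q) - w) - norm (u (snd q) - w)\<bar>) \<in> borel_measurable (M \<Otimes>\<^sub>M M)"
  using C(1) by measurable
 then show ?thesis using C(2) by (subst norm_diff_eq_SUP[of _ C]) auto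
qed

lemma increasing_rational_approximation:
 fixes t :: real
 obtains q :: "nat \<Rightarrow> real" where "\<And>n. q n \<in> \<rat>" "\<And>n. q n < t" "incseq q" "q \<longlonglongrightarrow> t"
proof -
 have "\<forall>n. \<exists>r. r \<in> \<rat> \<and> t - inverse (real (Suc n)) < r \<and> r < t"
 proof
  fix n
  show "\<exists>r. r \<in> \<rat> \<and> t - inverse (real (Suc n)) < r \<and> r < t"
   using Rats_dense_in_real[of "t - inverse (real (Suc n))" t] by auto
 qed
 from choice[OF this] obtain r where "\<forall>n. r n \<in> \<rat> \<and> t - inverse (real (Suc n)) < r n \<and> r n < t" ..
 then have r: "\<And>n. r n \<in> \<rat>" "\<And>n. t - inverse (real (Suc n)) < r n" "\<And>n. r n < t" by auto
 define q where "q n = Max (r ` {..n})" for n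
 have mem: "q n \<in> r ` {..n}" for n unfolding q_def by (intro Max_in) auto
 have ge: "r n \<le> q n" for n unfolding q_def by (intro Max_ge) auto
 show ?thesis
 proof
  show "q n \<in> \<rat>" "q n < t" for n using mem[of n] r by auto
  show "incseq q" unfolding q_def by (intro monoI Max_mono) auto
  have "(\<lambda>n. t - inverse (real (Suc n))) \<longlonglongrightarrow> t - 0"
   by (intro tendsto_diff tendsto_const LIMSEQ_inverse_real_of_nat)
  then have lim: "(\<lambda>n. t - inverse (real (Suc n))) \<longlonglongrightarrow> t" by simp
  show "q \<longlonglongrightarrow> t"
  proof (rule tendsto_sandwich[OF _ _ lim tendsto_const])
   show "\<forall>\<^sub>F n in sequentially. t - inverse (real (Suc n)) \<le> q n"
    using r(2) ge by (intro always_eventually allI) (meson less_imp_le order_trans)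
   show "\<forall>\<^sub>F n in sequentially. q n \<le> t"
    using mem r(3) by (intro always_eventually allI) (metis imageE less_imp_le)
  qed
 qed
qed

section \<open>Measurability of the sharp function\<close>

context doubling_measure
begin

lemma inter_ball_sets: "Om \<in> sets M \<Longrightarrow> Om \<inter> ball x t \<in> sets M"
 by (intro sets.Int) auto

definition osc_on :: "'a set \<Rightarrow> ('a \<Rightarrow> 'b::real_normed_vector) \<Rightarrow> 'a \<Rightarrow> real \<Rightarrow> ennreal" where
 "osc_on Om u x t = (\<integral>\<^sup>+y\<in>Om \<inter> ball x t. (\<integral>\<^sup>+z\<in>Om \<inter> ball x t. enorm (u y - u z) \<partial>M) \<partial>M)"

lemma osc_on_cong:
 assumes "AE x in M. x \<in> Om \<longrightarrow> u x = v x"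
 shows "osc_on Om u x t = osc_on Om v x t"
 unfolding osc_on_def
proof (rule nn_integral_cong_AE, use assms in eventually_elim)
 fix y assume y: "y \<in> Om \<longrightarrow> u y = v y"
 show "(\<integral>\<^sup>+z\<in>Om \<inter> ball x t. enorm (u y - u z) \<partial>M) * indicator (Om \<inter> ball x t) y
  = (\<integral>\<^sup>+z\<in>Om \<inter> ball x t. enorm (v y - v z) \<partial>M) * indicator (Om \<inter> ball x t) y"
 proof (cases "y \<in> Om")
  case True
  have "(\<integral>\<^sup>+z\<in>Om \<inter> ball x t. enorm (u y - u z) \<partial>M) = (\<integral>\<^sup>+z\<in>Om \<inter> ball x t. enorm (v y - v z) \<partial>M)"
   by (rule nn_integral_cong_AE, use assms in eventually_elim) (use y True in \<open>auto simp: indicator_def\<close>)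
  then show ?thesis by simp
 qed simp
qed

lemma inner_osc_measurable:
 fixes u :: "'a \<Rightarrow> 'b::real_normed_vector"
 assumes Om [measurable]: "Om \<in> sets M" and u: "u \<in> borel_measurable M" and C: "countable C" "range u \<subseteq> closure C"
 shows "(\<lambda>y. \<integral>\<^sup>+z\<in>Om \<inter> ball x t. enorm (u y - u z) \<partial>M) \<in> borel_measurable M"
proof -
 have "(\<lambda>q. enorm (u (fst q) - u (snd q)) * indicator (Om \<inter> ball x t) (snd q)) \<in> borel_measurable (M \<Otimes>\<^sub>M M)"
  by (intro borel_measurable_times_ennreal norm_diff_kernel_measurable[OF u C]
    measurable_compose[OF measurable_snd borel_measurable_indicator[OF inter_ball_sets[OF Om]]])
 then show ?thesis by (intro borel_measurable_nn_integral) (simp add: split_beta')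
qed

lemma osc_on_measurable:
 fixes u :: "'a \<Rightarrow> 'b::real_normed_vector"
 assumes Om [measurable]: "Om \<in> sets M" and u: "u \<in> borel_measurable M" and C: "countable C" "range u \<subseteq> closure C"
 shows "(\<lambda>x. osc_on Om u x t) \<in> borel_measurable M"
proof -
 have ib: "(\<lambda>q. indicator (Om \<inter> ball (fst q) t) (snd q) :: ennreal) \<in> borel_measurable (M \<Otimes>\<^sub>M M)"
 proof -
  have "(\<lambda>q. dist (fst q) (snd q)) \<in> borel_measurable (M \<Otimes>\<^sub>M M)"
   by (intro borel_measurable_dist measurable_compose[OF measurable_fst id_measurable_M] measurable_compose[OF measurable_snd id_measurable_M])
  then have "{q \<in> space (M \<Otimes>\<^sub>M M). dist (fst q) (snd q) < t \<and> snd q \<in> Om} \<in> sets (M \<Otimes>\<^sub>M M)" by measurable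
  then have "(indicator {q \<in> space (M \<Otimes>\<^sub>M M). dist (fst q) (snd q) < t \<and> snd q \<in> Om} :: _ \<Rightarrow> ennreal) \<in> borel_measurable (M \<Otimes>\<^sub>M M)"
   by (rule borel_measurable_indicator)
  also have "?this \<longleftrightarrow> ?thesis"
   by (intro measurable_cong) (auto simp: indicator_def space_pair_measure)
  finally show ?thesis .
 qed
 let ?K = "\<lambda>q. enorm (u (fst q) - u (snd q))"
 have K: "?K \<in> borel_measurable (M \<Otimes>\<^sub>M M)" by (rule norm_diff_kernel_measurable[OF u C])
 have "(\<lambda>q. ?K (snd (fst q), snd q)) \<in> borel_measurable ((M \<Otimes>\<^sub>M M) \<Otimes>\<^sub>M M)"
  by (rule measurable_compose[OF _ K]) measurable
 moreover have "(\<lambda>q. indicator (Om \<inter> ball (fst (fst (fst q), snd q)) t) (snd (fst (fst q), snd q)) :: ennreal) \<in> borel_measurable ((M \<Otimes>\<^sub>M M) \<Otimes>\<^sub>M M)"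
  by (rule measurable_compose[OF _ ib]) measurable
 ultimately have "(\<lambda>q. enorm (u (snd (fst q)) - u (snd q)) * indicator (Om \<inter> ball (fst (fst q)) t) (snd q)) \<in> borel_measurable ((M \<Otimes>\<^sub>M M) \<Otimes>\<^sub>M M)"
  by simp
 then have "(\<lambda>q. \<integral>\<^sup>+z. enorm (u (snd q) - u z) * indicator (Om \<inter> ball (fst q) t) z \<partial>M) \<in> borel_measurable (M \<Otimes>\<^sub>M M)"
  by (intro borel_measurable_nn_integral) (simp add: split_beta')
 then have "(\<lambda>q. (\<integral>\<^sup>+z. enorm (u (snd q) - u z) * indicator (Om \<inter> ball (fst q) t) z \<partial>M) * indicator (Om \<inter> ball (fst q) t) (snd q)) \<in> borel_measurable (M \<Otimes>\<^sub>M M)"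
  using ib by (rule borel_measurable_times_ennreal)
 then show ?thesis unfolding osc_on_def by (intro borel_measurable_nn_integral) (simp add: split_beta')
qed

text \<open>Open balls of radii increasing to t exhaust the ball of radius t. Monotone convergence
  is applied in each variable, and the double supremum collapses to the diagonal because everything
  increases.\<close>

lemma osc_on_SUP:
 fixes u :: "'a \<Rightarrow> 'b::real_normed_vector"
 assumes Om [measurable]: "Om \<in> sets M" and u: "u \<in> borel_measurable M" and C: "countable C" "range u \<subseteq> closure C"
  and q: "incseq q" "q \<longlonglongrightarrow> t" "\<And>n. q n < t"
 shows "osc_on Om u x t = (SUP n. osc_on Om u x (q n))"
proof -
 have mono: "indicator (Om \<inter> ball x (q m)) z \<le> (indicator (Om \<inter> ball x (q n)) z :: ennreal)" if "m \<le> n" for m n z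
  using incseqD[OF q(1) that] by (auto simp: indicator_def)
 have SUP: "(SUP n. a * indicator (Om \<inter> ball x (q n)) z) = a * indicator (Om \<inter> ball x t) z" for a :: ennreal and z
 proof (cases "z \<in> Om \<inter> ball x t")
  case True
  then have "\<forall>\<^sub>F n in sequentially. dist x z < q n" using q(2) by (intro order_tendstoD) auto
  then obtain n where "dist x z < q n" by (auto simp: eventually_sequentially)
  then have "a \<le> (SUP n. a * indicator (Om \<inter> ball x (q n)) z)" using True by (intro SUP_upper2[of n]) auto
  moreover have "(SUP n. a * indicator (Om \<inter> ball x (q n)) z) \<le> a" by (intro SUP_least) (auto simp: indicator_def)
  ultimately show ?thesis using True by simp
 next
  case False
  then have "z \<notin> Om \<inter> ball x (q n)" for n using q(3)[of n] by auto
  then show ?thesis using False by simp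
 qed
 have inner: "(\<integral>\<^sup>+z\<in>Om \<inter> ball x t. enorm (u y - u z) \<partial>M) = (SUP n. \<integral>\<^sup>+z\<in>Om \<inter> ball x (q n). enorm (u y - u z) \<partial>M)" for y
 proof -
  note inter_ball_sets[OF Om, measurable]
  have [measurable]: "(\<lambda>z. norm (u y - u z)) \<in> borel_measurable M"
   using norm_diff_measurable[OF u, of "u y"] by (simp add: norm_minus_commute)
  show ?thesis
   unfolding SUP[symmetric] using mono
   by (intro nn_integral_monotone_convergence_SUP) (auto simp: incseq_def le_fun_def mult_left_mono)
 qed
 let ?I = "\<lambda>n y. \<integral>\<^sup>+z\<in>Om \<inter> ball x (q n). enorm (u y - u z) \<partial>M"
 have imono: "?I m y \<le> ?I n y" if "m \<le> n" for m n y
  using mono[OF that] by (intro nn_integral_mono mult_left_mono) auto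
 note inter_ball_sets[OF Om, measurable]
 have [measurable]: "?I n \<in> borel_measurable M" for n by (rule inner_osc_measurable[OF Om u C])
 have outer: "(SUP n. ?I n y) * indicator (Om \<inter> ball x t) y = (SUP n. ?I n y * indicator (Om \<inter> ball x (q n)) y)" for y
 proof (rule antisym)
  have "(SUP n. ?I n y) * indicator (Om \<inter> ball x t) y = (SUP m. SUP n. ?I m y * indicator (Om \<inter> ball x (q n)) y)"
   unfolding SUP by (simp add: SUP_mult_right_ennreal)
  also have "... \<le> (SUP n. ?I n y * indicator (Om \<inter> ball x (q n)) y)"
  proof (intro SUP_least)
   fix m n
   have "?I m y * indicator (Om \<inter> ball x (q n)) y \<le> ?I (max m n) y * indicator (Om \<inter> ball x (q (max m n))) y"
    by (intro mult_mono imono mono) auto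
   then show "?I m y * indicator (Om \<inter> ball x (q n)) y \<le> (SUP n. ?I n y * indicator (Om \<inter> ball x (q n)) y)"
    by (rule SUP_upper2[OF UNIV_I])
  qed
  finally show "(SUP n. ?I n y) * indicator (Om \<inter> ball x t) y \<le> (SUP n. ?I n y * indicator (Om \<inter> ball x (q n)) y)" .
  show "(SUP n. ?I n y * indicator (Om \<inter> ball x (q n)) y) \<le> (SUP n. ?I n y) * indicator (Om \<inter> ball x t) y"
  proof (intro SUP_least mult_mono SUP_upper)
   show "indicator (Om \<inter> ball x (q n)) y \<le> (indicator (Om \<inter> ball x t) y :: ennreal)" for n
    using q(3)[of n] by (auto simp: indicator_def)
  qed auto
 qed
 show ?thesis
  unfolding osc_on_def inner outer using imono mono
  by (intro nn_integral_monotone_convergence_SUP) (auto simp: incseq_def le_fun_def intro!: mult_mono)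
qed

definition sharp_on :: "'a set \<Rightarrow> ('a \<Rightarrow> 'b::real_normed_vector) \<Rightarrow> real \<Rightarrow> 'a \<Rightarrow> ennreal" where
 "sharp_on Om u s x = (SUP t\<in>{0<..<s}. ennreal (1 / t) * (1 / emeasure M (Om \<inter> ball x t) ^ 2) * osc_on Om u x t)"

lemma sharp_on_cong:
 "AE x in M. x \<in> Om \<longrightarrow> u x = v x \<Longrightarrow> sharp_on Om u s x = sharp_on Om v s x"
 unfolding sharp_on_def by (simp only: osc_on_cong)

text \<open>Since the other factors decrease in the radius and the oscillation is left-continuous in it,
 rational radii suffice.\<close>

lemma sharp_on_rational:
 fixes u :: "'a \<Rightarrow> 'b::real_normed_vector"
 assumes Om [measurable]: "Om \<in> sets M" and u: "u \<in> borel_measurable M" and C: "countable C" "range u \<subseteq> closure C"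
 shows "sharp_on Om u s x = (SUP t\<in>{0<..<s} \<inter> \<rat>. ennreal (1 / t) * (1 / emeasure M (Om \<inter> ball x t) ^ 2) * osc_on Om u x t)"
  (is "_ = (SUP t\<in>_. ?\<phi> t)")
proof (rule antisym)
 show "(SUP t\<in>{0<..<s} \<inter> \<rat>. ?\<phi> t) \<le> sharp_on Om u s x"
  unfolding sharp_on_def by (intro SUP_subset_mono) auto
 show "sharp_on Om u s x \<le> (SUP t\<in>{0<..<s} \<inter> \<rat>. ?\<phi> t)"
  unfolding sharp_on_def
 proof (rule SUP_least)
  fix t assume t: "t \<in> {0<..<s}"
  obtain q where q: "\<And>n. q n \<in> \<rat>" "\<And>n. q n < t" "incseq q" "q \<longlonglongrightarrow> t" by (rule increasing_rational_approximation[of t]) (rule that)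
  have "?\<phi> t = (SUP n. ennreal (1 / t) * (1 / emeasure M (Om \<inter> ball x t) ^ 2) * osc_on Om u x (q n))"
   by (subst osc_on_SUP[OF Om u C q(3,4,2)]) (simp only: SUP_mult_left_ennreal)
  also have "... \<le> (SUP t\<in>{0<..<s} \<inter> \<rat>. ?\<phi> t)"
  proof (rule SUP_least)
   fix n
   show "ennreal (1 / t) * (1 / emeasure M (Om \<inter> ball x t) ^ 2) * osc_on Om u x (q n) \<le> (SUP t\<in>{0<..<s} \<inter> \<rat>. ?\<phi> t)"
   proof (cases "0 < q n")
    case True
    have "emeasure M (Om \<inter> ball x (q n)) \<le> emeasure M (Om \<inter> ball x t)"
     using q(2)[of n] by (intro emeasure_mono) auto
    then have "1 / emeasure M (Om \<inter> ball x t) ^ 2 \<le> 1 / emeasure M (Om \<inter> ball x (q n)) ^ 2"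
     unfolding divide_ennreal_def by (intro mult_left_mono ennreal_inverse_antimono power_mono) auto
    moreover have "1 / t \<le> 1 / q n" using True q(2)[of n] by (intro divide_left_mono) auto
    ultimately have "ennreal (1 / t) * (1 / emeasure M (Om \<inter> ball x t) ^ 2) * osc_on Om u x (q n) \<le> ?\<phi> (q n)"
     by (intro mult_mono ennreal_leI) auto
    moreover have "q n \<in> {0<..<s} \<inter> \<rat>" using True q(1,2)[of n] t by auto
    ultimately show ?thesis by (intro SUP_upper2)
   next
    case False
    then have e: "ball x (q n) = {}" by simp
    have "osc_on Om u x (q n) = 0" unfolding osc_on_def e by simp
    then show ?thesis by simp
   qed
  qed
  finally show "?\<phi> t \<le> (SUP t\<in>{0<..<s} \<inter> \<rat>. ?\<phi> t)" .
 qed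
qed

lemma sharp_on_measurable:
 fixes u :: "'a \<Rightarrow> 'b::real_normed_vector"
 assumes Om [measurable]: "Om \<in> sets M" and u: "u \<in> borel_measurable M" and C: "countable C" "range u \<subseteq> closure C"
 shows "sharp_on Om u s \<in> borel_measurable M"
proof -
 have [measurable]: "(\<lambda>x. osc_on Om u x t) \<in> borel_measurable M" for t by (rule osc_on_measurable[OF assms])
 have "(\<lambda>x. \<integral>\<^sup>+y\<in>ball x t. indicator Om y \<partial>M) \<in> borel_measurable M" for t
  by (rule borel_measurable_M[OF ball_integral_measurable]) measurable
 moreover have "(\<integral>\<^sup>+y\<in>ball x t. indicator Om y \<partial>M) = emeasure M (Om \<inter> ball x t)" for x t
 proof -
  have "(\<integral>\<^sup>+y\<in>ball x t. indicator Om y \<partial>M) = (\<integral>\<^sup>+y. indicator (Om \<inter> ball x t) y \<partial>M)"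
   by (intro nn_integral_cong) (auto simp: indicator_def)
  then show ?thesis using inter_ball_sets[OF Om] by simp
 qed
 ultimately have [measurable]: "(\<lambda>x. emeasure M (Om \<inter> ball x t)) \<in> borel_measurable M" for t by simp
 have "countable ({0<..<s} \<inter> \<rat>)" by (intro countable_Int2 countable_rat)
 then have "(\<lambda>x. SUP t\<in>{0<..<s} \<inter> \<rat>. ennreal (1 / t) * (1 / emeasure M (Om \<inter> ball x t) ^ 2) * osc_on Om u x t) \<in> borel_measurable M"
  by measurable
 then show ?thesis by (subst measurable_cong[OF sharp_on_rational[OF assms]])
qed

end

lemma ennreal_scaled_le_iff:
 fixes a c v :: ennreal
 assumes t: "0 < t" and v: "0 < v" "v < \<infinity>"
 shows "ennreal (1 / t) * (1 / v ^ 2) * a \<le> c \<longleftrightarrow> a \<le> ennreal t * c * v ^ 2"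
proof -
 obtain w where w: "v = ennreal w" "0 < w" using v by (cases v) auto
 have 1: "ennreal (1 / t) * (1 / v ^ 2) * a = ennreal (1 / (t * w\<^sup>2)) * a"
  using t w by (simp add: ennreal_power divide_ennreal flip: ennreal_mult ennreal_1)
 have 2: "ennreal t * c * v ^ 2 = ennreal (t * w\<^sup>2) * c"
  using t w by (simp add: ennreal_power ennreal_mult mult_ac)
 have pos: "0 < t * w\<^sup>2" using t w by simp
 show ?thesis unfolding 1 2
 proof
  assume "ennreal (1 / (t * w\<^sup>2)) * a \<le> c"
  then have "ennreal (t * w\<^sup>2) * (ennreal (1 / (t * w\<^sup>2)) * a) \<le> ennreal (t * w\<^sup>2) * c" by (intro mult_left_mono) auto
  then show "a \<le> ennreal (t * w\<^sup>2) * c" using pos t w by (subst (asm) ennreal_mult_collect) auto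
 next
  assume "a \<le> ennreal (t * w\<^sup>2) * c"
  then have "ennreal (1 / (t * w\<^sup>2)) * a \<le> ennreal (1 / (t * w\<^sup>2)) * (ennreal (t * w\<^sup>2) * c)" by (intro mult_left_mono) auto
  also have "... = c" using pos t w by (subst ennreal_mult_collect) auto
  finally show "ennreal (1 / (t * w\<^sup>2)) * a \<le> c" .
 qed
qed

lemma line_integral_mono: "(\<And>x. f x \<le> g x) \<Longrightarrow> line_integral f q \<le> line_integral g q"
 unfolding line_integral_def by (cases q) (auto intro!: nn_integral_mono mult_right_mono)

lemma (in doubling_measure) Lp_extend_by_zero:
 fixes u :: "'a \<Rightarrow> 'b::real_normed_vector"
 assumes Om: "Om \<in> sets M" and u: "Lp p (restrict_space M Om) u" and p: "0 < p"
 obtains v W where "v \<in> borel_measurable M" "countable W" "range v \<subseteq> closure W"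
  "AE x in M. x \<in> Om \<longrightarrow> u x = v x" "Lp_nonneg p M (\<lambda>x. enorm (v x))"
proof -
 have Om': "Om \<inter> space M \<in> sets M" using Om by simp
 have sp: "space (restrict_space M Om) = Om" by (simp add: space_restrict_space)
 have ess: "ess_separable_measurable (restrict_space M Om) u" using u by (simp add: Lp_def)
 obtain N W where N: "N \<in> null_sets (restrict_space M Om)" and W: "countable W" "u ` (space (restrict_space M Om) - N) \<subseteq> closure W"
  by (rule separable_range_off_null[OF ess])
 have N': "N \<in> null_sets M" using N by (simp add: null_sets_restrict_space[OF Om])
 define v where "v x = (if x \<in> Om - N then u x else 0)" for x
 show ?thesis
 proof (rule that[of v "W \<union> {0}"])
  have um: "u \<in> borel_measurable (restrict_space M Om)" using ess by (simp add: ess_separable_measurable_def)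
  have "(\<lambda>x. if x \<in> Om then u x else 0) \<in> borel_measurable M"
   using um by (subst (asm) measurable_restrict_space_iff[OF Om', of 0]) auto
  then have "(\<lambda>x. if x \<in> N then 0 else (if x \<in> Om then u x else 0)) \<in> borel_measurable M"
   using N' by (intro measurable_If_set[OF measurable_const]) auto
  also have "(\<lambda>x. if x \<in> N then 0 else (if x \<in> Om then u x else 0)) = v" by (auto simp: v_def)
  finally show vm: "v \<in> borel_measurable M" .
  show "countable (W \<union> {0})" using W(1) by simp
  have "v x \<in> closure W \<union> closure {0}" for x using W(2) sp by (auto simp: v_def)
  then show "range v \<subseteq> closure (W \<union> {0})" by (auto simp only: closure_Un)
  show "AE x in M. x \<in> Om \<longrightarrow> u x = v x"
   using AE_not_in[OF N'] by eventually_elim (simp add: v_def)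
  have nm: "(\<lambda>x. enorm (v x)) \<in> borel_measurable M"
   using norm_diff_measurable[OF vm, of 0] by simp
  have "(\<integral>\<^sup>+x. ennreal_powr (enorm (v x)) p \<partial>M) \<le> (\<integral>\<^sup>+x\<in>Om. ennreal_powr (enorm (u x)) p \<partial>M)"
   using p by (intro nn_integral_mono) (auto simp: v_def ennreal_powr_def)
  also have "... < \<infinity>" using u by (simp add: Lp_def Lp_nonneg_def nn_integral_restrict_space[OF Om'])
  finally show "Lp_nonneg p M (\<lambda>x. enorm (v x))" using nm by (simp add: Lp_nonneg_def)
 qed
qed

section \<open>The two implications\<close>

context poincare_space
begin

text \<open>Adding to \<rho> the function \<rho>0 that witnesses negligibility makes the gradient
  inequality true on every curve. The family consists of the distance functions to a countable set W
  whose closure contains the essential range of v. They share the function S, and countably many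
  null sets are united.\<close>

lemma pointwise_gradient_if_newton_sobolev:
 fixes h :: "'a \<Rightarrow> 'b::real_normed_vector"
 assumes h: "newton_sobolev p M h"
 obtains S N where "Lp_nonneg p M S" "N \<in> null_sets M"
  "\<And>x y. x \<notin> N \<Longrightarrow> y \<notin> N \<Longrightarrow> enorm (h x - h y) \<le> ennreal (dist x y) * (S x + S y)"
proof -
 from h[unfolded newton_sobolev_def] obtain v \<rho> where v: "Lp p M v" "AE x in M. v x = h x"
  and \<rho>: "Lp_nonneg p M \<rho>" "weak_upper_gradient p M \<rho> v"
  by (elim conjE exE) (rule that)
 from \<rho>(2)[unfolded weak_upper_gradient_def p_negligible_def]
 obtain \<rho>0 where \<rho>b: "borel_on (space M) \<rho>" and \<rho>0: "borel_on (space M) \<rho>0" "Lp_nonneg p M \<rho>0"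
  "\<forall>q\<in>{(a, b, ga) \<in> curves_in (space M). \<not> enorm (v (ga a) - v (ga b)) \<le> line_integral \<rho> (a, b, ga)}. line_integral \<rho>0 q = \<infinity>"
  by (elim conjE exE) (rule that)
 have ess: "ess_separable_measurable M v" using v by (simp add: Lp_def)
 then have vm: "v \<in> borel_measurable M" by (simp add: ess_separable_measurable_def)
 obtain N0 W where N0: "N0 \<in> null_sets M" and W: "countable W" "v ` (space M - N0) \<subseteq> closure W"
  by (rule separable_range_off_null[OF ess])
 define F where "F = (\<lambda>w x. norm (v x - w)) ` W"
 interpret gf: gradient_family M D p C L F "\<lambda>x. \<rho> x + \<rho>0 x"
 proof
  fix f assume "f \<in> F"
  then obtain w where f: "f = (\<lambda>x. norm (v x - w))" by (auto simp: F_def)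
  show "f \<in> borel_measurable M" unfolding f by (rule norm_diff_measurable[OF vm])
  show "(\<integral>\<^sup>+y\<in>ball x R. ennreal \<bar>f y\<bar> \<partial>M) < \<infinity>" for x R
  proof -
   have [measurable]: "(\<lambda>x. norm (v x)) \<in> borel_measurable M" using norm_diff_measurable[OF vm, of 0] by simp
   have "(\<integral>\<^sup>+y\<in>ball x R. ennreal \<bar>f y\<bar> \<partial>M)
    \<le> (\<integral>\<^sup>+y. enorm (v y) * indicator (ball x R) y + enorm w * indicator (ball x R) y \<partial>M)"
    unfolding f by (intro nn_integral_mono) (auto simp: indicator_def ennreal_leI norm_triangle_ineq4 simp flip: ennreal_plus)
   also have "... = (\<integral>\<^sup>+y\<in>ball x R. enorm (v y) \<partial>M) + enorm w * vol x R"
    by (simp add: nn_integral_add nn_integral_cmult_indicator)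
   also have "... < \<infinity>"
    using Lp_nonneg_ball_finite[OF p, of "\<lambda>y. enorm (v y)" x R] v(1) ball_finite[of x R]
    by (simp add: Lp_def ennreal_mult_less_top)
   finally show ?thesis .
  qed
  fix a b and ga :: "real \<Rightarrow> 'a" assume q: "(a, b, ga) \<in> curves_in UNIV"
  have le: "ennreal \<bar>f (ga a) - f (ga b)\<bar> \<le> enorm (v (ga a) - v (ga b))"
   using norm_triangle_ineq3[of "v (ga a) - w" "v (ga b) - w"] by (simp add: f ennreal_leI)
  show "ennreal \<bar>f (ga a) - f (ga b)\<bar> \<le> line_integral (\<lambda>x. \<rho> x + \<rho>0 x) (a, b, ga)"
  proof (cases "enorm (v (ga a) - v (ga b)) \<le> line_integral \<rho> (a, b, ga)")
   case True
   moreover have "line_integral \<rho> (a, b, ga) \<le> line_integral (\<lambda>x. \<rho> x + \<rho>0 x) (a, b, ga)"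
    by (rule line_integral_mono) simp
   ultimately show ?thesis using le by (meson order_trans)
  next
   case False
   then have "line_integral \<rho>0 (a, b, ga) = \<infinity>" using \<rho>0(3) q by auto
   moreover have "line_integral \<rho>0 (a, b, ga) \<le> line_integral (\<lambda>x. \<rho> x + \<rho>0 x) (a, b, ga)"
    by (rule line_integral_mono) simp
   ultimately show ?thesis by (simp add: top_unique)
  qed
 next
  have "\<rho> \<in> borel_measurable borel" "\<rho>0 \<in> borel_measurable borel" using \<rho>b \<rho>0(1) by (auto simp: borel_on_def)
  then show "(\<lambda>x. \<rho> x + \<rho>0 x) \<in> borel_measurable borel" by measurable
  show "Lp_nonneg p M (\<lambda>x. \<rho> x + \<rho>0 x)" using \<rho>(1) \<rho>0(2) p by (intro Lp_nonneg_add) auto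
 qed
 have "\<forall>w\<in>W. \<exists>N. N \<in> null_sets M \<and> (\<forall>x y. x \<notin> N \<longrightarrow> y \<notin> N \<longrightarrow>
  ennreal \<bar>norm (v x - w) - norm (v y - w)\<bar> \<le> ennreal (30 * D ^ 3 * dist x y) * (gf.S x + gf.S y))"
 proof
  fix w assume "w \<in> W"
  then have "(\<lambda>x. norm (v x - w)) \<in> F" by (auto simp: F_def)
  from gf.family_pointwise_gradient[OF this] obtain N where "N \<in> null_sets M"
   "\<And>x y. x \<notin> N \<Longrightarrow> y \<notin> N \<Longrightarrow> ennreal \<bar>norm (v x - w) - norm (v y - w)\<bar> \<le> ennreal (30 * D ^ 3 * dist x y) * (gf.S x + gf.S y)" by blast
  then show "\<exists>N. N \<in> null_sets M \<and> (\<forall>x y. x \<notin> N \<longrightarrow> y \<notin> N \<longrightarrow>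
   ennreal \<bar>norm (v x - w) - norm (v y - w)\<bar> \<le> ennreal (30 * D ^ 3 * dist x y) * (gf.S x + gf.S y))" by (intro exI[of _ N]) auto
 qed
 from bchoice[OF this] obtain Nf where Nf: "\<forall>w\<in>W. Nf w \<in> null_sets M \<and> (\<forall>x y. x \<notin> Nf w \<longrightarrow> y \<notin> Nf w \<longrightarrow>
  ennreal \<bar>norm (v x - w) - norm (v y - w)\<bar> \<le> ennreal (30 * D ^ 3 * dist x y) * (gf.S x + gf.S y))" ..
 obtain N2 where N2: "{x \<in> space M. \<not> v x = h x} \<subseteq> N2" "emeasure M N2 = 0" "N2 \<in> sets M" by (rule AE_E[OF v(2)])
 define N where "N = N0 \<union> (\<Union>w\<in>W. Nf w) \<union> N2"
 show ?thesis
 proof (rule that[of "\<lambda>x. ennreal (30 * D ^ 3) * gf.S x" N])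
  show "Lp_nonneg p M (\<lambda>x. ennreal (30 * D ^ 3) * gf.S x)" using p D_ge_1 by (intro Lp_nonneg_cmult gf.Lp_nonneg_S) auto
  show "N \<in> null_sets M" unfolding N_def using N0 W(1) Nf N2 by (intro null_sets.Un null_sets_UN' null_setsI) auto
  fix x y assume xy: "x \<notin> N" "y \<notin> N"
  have "v z = h z" if "z \<notin> N2" for z using that N2(1) by auto
  from this[symmetric] have "h x = v x" "h y = v y" using xy by (simp_all add: N_def)
  then have "enorm (h x - h y) = (SUP w\<in>W. ennreal \<bar>norm (v x - w) - norm (v y - w)\<bar>)"
   using xy W(2) by (simp only:) (intro norm_diff_eq_SUP, auto simp: N_def)
  also have "... \<le> ennreal (30 * D ^ 3 * dist x y) * (gf.S x + gf.S y)"
   using Nf xy by (intro SUP_least) (auto simp: N_def)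
  also have "... = ennreal (dist x y) * (ennreal (30 * D ^ 3) * gf.S x + ennreal (30 * D ^ 3) * gf.S y)"
   using D_ge_1 by (simp add: ennreal_mult distrib_left mult_ac)
  finally show "enorm (h x - h y) \<le> ennreal (dist x y) * (ennreal (30 * D ^ 3) * gf.S x + ennreal (30 * D ^ 3) * gf.S y)" .
 qed
qed

lemma density_pos_finite:
 assumes "0 < ka0" "0 < r" and Om: "Om \<in> sets M"
  and dens: "ennreal ka0 * vol x (min r 1) \<le> emeasure M (Om \<inter> ball x (min r 1))"
 shows "0 < emeasure M (Om \<inter> ball x r)" "emeasure M (Om \<inter> ball x r) < \<infinity>"
proof -
 have "0 < ennreal ka0 * vol x (min r 1)"
  using assms(1,2) ball_pos[of "min r 1" x] by (simp add: ennreal_zero_less_mult_iff)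
 also have "... \<le> emeasure M (Om \<inter> ball x (min r 1))" by (rule dens)
 also have "... \<le> emeasure M (Om \<inter> ball x r)" by (intro emeasure_mono inter_ball_sets Om) auto
 finally show "0 < emeasure M (Om \<inter> ball x r)" .
 have "emeasure M (Om \<inter> ball x r) \<le> vol x r" by (intro emeasure_mono) auto
 then show "emeasure M (Om \<inter> ball x r) < \<infinity>" using ball_finite by (rule le_less_trans)
qed

text \<open>Integrating the pointwise gradient twice over \<open>Om\<close> in the ball gives 4 t
  times the measure times the integral of S: 2 t bounds the distances, and the two variables
  contribute equally. The density condition turns this into the maximal function of S, for all radii
  up to 1.\<close>

lemma sharp_Lp_if_newton_sobolev:
 fixes u h :: "'a \<Rightarrow> 'b::real_normed_vector"
 assumes Om [measurable]: "Om \<in> sets M" and ka0: "0 < ka0"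
  and dens: "\<And>x r. x \<in> Om \<Longrightarrow> 0 < r \<Longrightarrow> r \<le> 1 \<Longrightarrow> ennreal ka0 * vol x r \<le> emeasure M (Om \<inter> ball x r)"
  and u: "u \<in> borel_measurable M" and W: "countable W" "range u \<subseteq> closure W"
  and h: "newton_sobolev p M h" and eq: "AE x in M. x \<in> Om \<longrightarrow> u x = h x"
 shows "Lp_nonneg p (restrict_space M Om) (sharp_on Om u 1)"
proof -
 obtain S N where S: "Lp_nonneg p M S" and N: "N \<in> null_sets M"
  and grad: "\<And>x y. x \<notin> N \<Longrightarrow> y \<notin> N \<Longrightarrow> enorm (h x - h y) \<le> ennreal (dist x y) * (S x + S y)"
  by (rule pointwise_gradient_if_newton_sobolev[OF h]) (rule that)
 have [measurable]: "S \<in> borel_measurable M" using S by (simp add: Lp_nonneg_def)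
 note inter_ball_sets[OF Om, measurable]
 have good: "AE x in M. x \<in> Om \<longrightarrow> u x = h x \<and> x \<notin> N" using eq AE_not_in[OF N] by eventually_elim auto
 have osc: "osc_on Om u x t \<le> ennreal t * (ennreal (4 * D / ka0) * mxf S x) * (emeasure M (Om \<inter> ball x t))\<^sup>2"
  if x: "x \<in> Om" and t: "0 < t" "t \<le> 1" for x t
 proof -
  let ?B = "Om \<inter> ball x t"
  let ?I = "\<integral>\<^sup>+z\<in>?B. S z \<partial>M"
  let ?v = "emeasure M ?B"
  have "osc_on Om u x t \<le> (\<integral>\<^sup>+y. ennreal (2 * t) * (S y * indicator ?B y * ?v + ?I * indicator ?B y) \<partial>M)"
   unfolding osc_on_def
  proof (intro nn_integral_mono_AE, use good in eventually_elim)
   fix y assume y: "y \<in> Om \<longrightarrow> u y = h y \<and> y \<notin> N"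
   show "(\<integral>\<^sup>+z\<in>?B. enorm (u y - u z) \<partial>M) * indicator ?B y \<le> ennreal (2 * t) * (S y * indicator ?B y * ?v + ?I * indicator ?B y)"
   proof (cases "y \<in> ?B")
    case True
    have "(\<integral>\<^sup>+z\<in>?B. enorm (u y - u z) \<partial>M) \<le> (\<integral>\<^sup>+z. ennreal (2 * t) * (S y * indicator ?B z + S z * indicator ?B z) \<partial>M)"
    proof (intro nn_integral_mono_AE, use good in eventually_elim)
     fix z assume z: "z \<in> Om \<longrightarrow> u z = h z \<and> z \<notin> N"
     show "enorm (u y - u z) * indicator ?B z \<le> ennreal (2 * t) * (S y * indicator ?B z + S z * indicator ?B z)"
     proof (cases "z \<in> ?B")
      case zB: True
      have "enorm (u y - u z) \<le> ennreal (dist y z) * (S y + S z)" using y z True zB grad[of y z] by auto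
      also have "... \<le> ennreal (2 * t) * (S y + S z)"
       using True zB dist_triangle[of y z x] by (intro mult_right_mono ennreal_leI) (auto simp: dist_commute)
      finally show ?thesis using zB by simp
     qed simp
    qed
    also have "... = ennreal (2 * t) * (S y * ?v + ?I)"
     by (simp add: nn_integral_cmult nn_integral_add nn_integral_cmult_indicator)
    finally show ?thesis using True by simp
   qed simp
  qed
  also have "... = ennreal (2 * t) * (?I * ?v + ?I * ?v)"
   by (simp add: nn_integral_cmult nn_integral_add nn_integral_cmult_indicator nn_integral_multc)
  also have "... = ennreal (4 * t) * (?I * ?v)"
  proof -
   have "?I * ?v + ?I * ?v = ennreal 2 * (?I * ?v)" by (simp add: mult_2)
   then show ?thesis using t by (simp only: ennreal_mult_collect) simp
  qed
  also have "... \<le> ennreal (4 * t) * (ennreal (D / ka0) * mxf S x * ?v * ?v)"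
  proof (intro mult_left_mono mult_right_mono)
   have "?I \<le> (\<integral>\<^sup>+z\<in>ball x t. S z \<partial>M)" by (intro nn_integral_mono mult_left_mono) (auto simp: indicator_def)
   also have "... \<le> ennreal D * mxf S x * vol x t" by (rule ball_integral_le_mxf[OF t(1)])
   also have "... = ennreal (D / ka0) * mxf S x * (ennreal ka0 * vol x t)"
   proof -
    have "ennreal D = ennreal (D / ka0) * ennreal ka0" using ka0 D_ge_1 by (simp flip: ennreal_mult)
    then show ?thesis by (simp add: mult_ac)
   qed
   also have "... \<le> ennreal (D / ka0) * mxf S x * ?v" using dens[OF x t] by (intro mult_left_mono) auto
   finally show "?I \<le> ennreal (D / ka0) * mxf S x * ?v" .
  qed auto
  also have "... = ennreal t * (ennreal (4 * D / ka0) * mxf S x) * ?v\<^sup>2"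
  proof -
   have "ennreal (4 * t) * ennreal (D / ka0) = ennreal t * ennreal (4 * D / ka0)"
    using t ka0 D_ge_1 by (simp add: mult_ac flip: ennreal_mult)
   then show ?thesis by (simp add: power2_eq_square mult.assoc[symmetric])
  qed
  finally show ?thesis .
 qed
 have pf: "0 < emeasure M (Om \<inter> ball x r)" "emeasure M (Om \<inter> ball x r) < \<infinity>" if "x \<in> Om" "0 < r" for x r
  using density_pos_finite[OF ka0 that(2) Om] dens[OF that(1), of "min r 1"] that(2) by simp_all
 have bound: "sharp_on Om u 1 x \<le> ennreal (4 * D / ka0) * mxf S x" if x: "x \<in> Om" for x
  unfolding sharp_on_def
 proof (rule SUP_least)
  fix t :: real assume t: "t \<in> {0<..<1}"
  then show "ennreal (1 / t) * (1 / (emeasure M (Om \<inter> ball x t))\<^sup>2) * osc_on Om u x t \<le> ennreal (4 * D / ka0) * mxf S x"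
   using pf[OF x, of t] osc[OF x, of t] by (subst ennreal_scaled_le_iff) auto
 qed
 have [measurable]: "sharp_on Om u 1 \<in> borel_measurable M" by (rule sharp_on_measurable[OF Om u W])
 have Lb: "Lp_nonneg p M (\<lambda>x. ennreal (4 * D / ka0) * mxf S x)"
  using p D_ge_1 ka0 by (intro Lp_nonneg_cmult Lp_nonneg_mxf S) auto
 have "Om \<inter> space M \<in> sets M" by simp
 note re = nn_integral_restrict_space[OF this]
 have "(\<integral>\<^sup>+x\<in>Om. ennreal_powr (sharp_on Om u 1 x) p \<partial>M) \<le> (\<integral>\<^sup>+x. ennreal_powr (ennreal (4 * D / ka0) * mxf S x) p \<partial>M)"
  using bound p by (intro nn_integral_mono) (auto simp: indicator_def intro!: ennreal_powr_mono)
 also have "... < \<infinity>" using Lb by (simp add: Lp_nonneg_def)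
 finally show ?thesis by (simp add: Lp_nonneg_def re measurable_restrict_space1)
qed

text \<open>Restricted to \<open>Om\<close> the measure is doubling at small radii about points of
  \<open>Om\<close>, with constant D/ka0. The sharp function dominates the oscillation of every
  distance function of u, so \<open>lipschitz_off_null\<close> gives a pointwise gradient for nearby
  pairs, and \<open>extension_problem\<close> does the rest.\<close>

lemma newton_sobolev_if_sharp_Lp:
 fixes u :: "'a \<Rightarrow> 'b::banach"
 assumes Om [measurable]: "Om \<in> sets M" and ne: "Om \<noteq> {}" and ka0: "0 < ka0" "ka0 \<le> 1"
  and dens: "\<And>x r. x \<in> Om \<Longrightarrow> 0 < r \<Longrightarrow> r \<le> 1 \<Longrightarrow> ennreal ka0 * vol x r \<le> emeasure M (Om \<inter> ball x r)"
  and u: "u \<in> borel_measurable M" and W: "countable W" "range u \<subseteq> closure W"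
  and uLp: "Lp_nonneg p M (\<lambda>x. enorm (u x))"
  and s: "0 < s" and sh: "Lp_nonneg p (restrict_space M Om) (sharp_on Om u s)"
 obtains h where "newton_sobolev p M h" "\<And>x. x \<in> Om \<Longrightarrow> h x = u x"
proof -
 define m where "m = density M (indicator Om)"
 \<comment> \<open>Radii below 1 for the density condition and below s for the sharp
   function.\<close>
 define T where "T = {0<..<min s 1}"
 define D' where "D' = D / ka0"
 have D': "1 \<le> D'" using ka0 D_ge_1 by (simp add: D'_def le_divide_eq)
 have em: "emeasure m A = emeasure M (Om \<inter> A)" if "A \<in> sets M" for A
  unfolding m_def using that by (intro emeasure_restricted) auto
 have eb: "emeasure m (ball x r) = emeasure M (Om \<inter> ball x r)" for x r by (rule em) auto
 have pf: "0 < emeasure M (Om \<inter> ball x r)" "emeasure M (Om \<inter> ball x r) < \<infinity>" if "x \<in> Om" "0 < r" for x r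
  using density_pos_finite[OF ka0(1) that(2) Om] dens[OF that(1), of "min r 1"] that(2) by simp_all
 interpret loc: local_doubling m Om T D'
 proof
  show "space m = UNIV" "sets borel \<subseteq> sets m" "Om \<in> sets m" using sets_M by (auto simp: m_def)
  show "r \<in> T \<Longrightarrow> 0 < r" "r \<in> T \<Longrightarrow> 0 < r' \<Longrightarrow> r' \<le> r \<Longrightarrow> r' \<in> T" for r r' by (auto simp: T_def)
  show "T \<noteq> {}" using s by (auto simp: T_def)
  show "1 \<le> D'" by (rule D')
  show "x \<in> Om \<Longrightarrow> 0 < r \<Longrightarrow> 0 < emeasure m (ball x r)" for x r unfolding eb by (rule pf(1))
  have "emeasure M (Om \<inter> ball x r) \<le> vol x r" for x r by (intro emeasure_mono) auto
  then show "emeasure m (ball x r) < \<infinity>" for x r unfolding eb using ball_finite by (rule le_less_trans)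
  show "emeasure m (ball x (2 * r)) \<le> ennreal D' * emeasure m (ball x r)" if x: "x \<in> Om" and r: "r \<in> T" for x r
  proof -
   have r': "0 < r" "r \<le> 1" using r by (auto simp: T_def)
   have "emeasure m (ball x (2 * r)) \<le> vol x (2 * r)" unfolding eb by (intro emeasure_mono) auto
   also have "... \<le> ennreal D * vol x r" by (rule doubling[OF r'(1)])
   also have "... = ennreal D' * (ennreal ka0 * vol x r)"
    using ka0 D_ge_1 by (subst ennreal_mult_collect) (auto simp: D'_def)
   also have "... \<le> ennreal D' * emeasure m (ball x r)" unfolding eb by (intro mult_left_mono dens x r') auto
   finally show ?thesis .
  qed
 qed
 have shm [measurable]: "sharp_on Om u s \<in> borel_measurable M" by (rule sharp_on_measurable[OF Om u W])
 have osc_le: "osc_on Om u x t \<le> ennreal t * sharp_on Om u s x * (emeasure M (Om \<inter> ball x t))\<^sup>2" if x: "x \<in> Om" and t: "t \<in> T" for x t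
 proof -
  have t': "0 < t" "t \<in> {0<..<s}" using t by (auto simp: T_def)
  have "ennreal (1 / t) * (1 / (emeasure M (Om \<inter> ball x t))\<^sup>2) * osc_on Om u x t \<le> sharp_on Om u s x"
   unfolding sharp_on_def by (rule SUP_upper[OF t'(2)])
  then show ?thesis using pf[OF x t'(1)] t'(1) by (subst (asm) ennreal_scaled_le_iff) auto
 qed
 have dosc: "dosc m (\<lambda>x. norm (u x - w)) x t \<le> osc_on Om u x t" for w x t
 proof -
  let ?f = "\<lambda>x. norm (u x - w)"
  have [measurable]: "?f \<in> borel_measurable M" by (rule norm_diff_measurable[OF u])
  have [measurable]: "ball x t \<in> sets M" by simp
  have [measurable]: "(\<lambda>y. \<integral>\<^sup>+z\<in>Om \<inter> ball x t. enorm (?f y - ?f z) \<partial>M) \<in> borel_measurable M"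
   by (rule inner_osc_measurable[OF Om _ countable_rat]) (simp_all add: Rats_closure_real)
  have "(\<integral>\<^sup>+z\<in>ball x t. enorm (?f y - ?f z) \<partial>m) = (\<integral>\<^sup>+z\<in>Om \<inter> ball x t. enorm (?f y - ?f z) \<partial>M)" for y
   unfolding m_def by (subst nn_integral_density) (auto intro!: nn_integral_cong simp: indicator_def)
  then have "dosc m ?f x t = (\<integral>\<^sup>+y\<in>ball x t. (\<integral>\<^sup>+z\<in>Om \<inter> ball x t. enorm (?f y - ?f z) \<partial>M) \<partial>m)" by (simp add: dosc_def)
  also have "... = osc_on Om ?f x t"
   unfolding m_def osc_on_def by (subst nn_integral_density) (auto intro!: nn_integral_cong simp: indicator_def)
  also have "... \<le> osc_on Om u x t"
   unfolding osc_on_def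
  proof (intro nn_integral_mono mult_right_mono ennreal_leI)
   show "norm (norm (u y - w) - norm (u z - w)) \<le> norm (u y - u z)" for y z
    using norm_triangle_ineq3[of "u y - w" "u z - w"] by simp
  qed auto
  finally show ?thesis .
 qed
 define S where "S x = sharp_on Om u s x * indicator Om x" for x
 have Sm [measurable]: "S \<in> borel_measurable M" unfolding S_def[abs_def] by measurable
 have "\<forall>w\<in>W. \<exists>N. N \<in> null_sets m \<and> (\<forall>x y. x \<in> Om - N \<longrightarrow> y \<in> Om - N \<longrightarrow> 2 * dist x y \<in> T \<longrightarrow>
  ennreal \<bar>norm (u x - w) - norm (u y - w)\<bar> \<le> ennreal (30 * D' ^ 3 * dist x y) * (S x + S y))"
 proof
  fix w assume "w \<in> W"
  obtain N where "N \<in> null_sets m" "\<And>x y. x \<in> Om - N \<Longrightarrow> y \<in> Om - N \<Longrightarrow> 2 * dist x y \<in> T \<Longrightarrow>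
   ennreal \<bar>norm (u x - w) - norm (u y - w)\<bar> \<le> ennreal (30 * D' ^ 3 * dist x y) * (S x + S y)"
  proof (rule loc.lipschitz_off_null)
   show "(\<lambda>x. norm (u x - w)) \<in> borel_measurable m" using norm_diff_measurable[OF u, of w] by (simp add: m_def)
   show "S \<in> borel_measurable m" using Sm by (simp add: m_def)
   fix x t assume x: "x \<in> Om" and t: "t \<in> T"
   have "dosc m (\<lambda>x. norm (u x - w)) x t \<le> osc_on Om u x t" by (rule dosc)
   also have "... \<le> ennreal t * S x * (emeasure m (ball x t))\<^sup>2" using osc_le[OF x t] x unfolding eb by (simp add: S_def)
   finally show "dosc m (\<lambda>x. norm (u x - w)) x t \<le> ennreal t * S x * (emeasure m (ball x t))\<^sup>2" .
  qed (rule that)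
  then show "\<exists>N. N \<in> null_sets m \<and> (\<forall>x y. x \<in> Om - N \<longrightarrow> y \<in> Om - N \<longrightarrow> 2 * dist x y \<in> T \<longrightarrow>
   ennreal \<bar>norm (u x - w) - norm (u y - w)\<bar> \<le> ennreal (30 * D' ^ 3 * dist x y) * (S x + S y))" by (intro exI[of _ N]) auto
 qed
 from bchoice[OF this] obtain Nf where Nf: "\<forall>w\<in>W. Nf w \<in> null_sets m \<and> (\<forall>x y. x \<in> Om - Nf w \<longrightarrow> y \<in> Om - Nf w \<longrightarrow> 2 * dist x y \<in> T \<longrightarrow>
  ennreal \<bar>norm (u x - w) - norm (u y - w)\<bar> \<le> ennreal (30 * D' ^ 3 * dist x y) * (S x + S y))" ..
 define N where "N = Om \<inter> (\<Union>w\<in>W. Nf w)"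
 have N: "N \<in> null_sets M"
 proof -
  have "(\<Union>w\<in>W. Nf w) \<in> null_sets m" using Nf W(1) by (intro null_sets_UN') auto
  then have "(\<Union>w\<in>W. Nf w) \<in> sets M" "emeasure m (\<Union>w\<in>W. Nf w) = 0" by (auto simp: m_def null_sets_def)
  then show ?thesis unfolding N_def using em[of "\<Union>w\<in>W. Nf w"] by (intro null_setsI sets.Int Om) simp_all
 qed
 \<comment> \<open>Pairs outside the range of \<open>lipschitz_off_null\<close> have 2 dist x y >=
   min s 1, so the bound |u x| + |u y| times 2 / min s 1 takes care of them. The summand 1 makes g a
   majorant of the norm of u.\<close>
 define c where "c = 1 + 2 / min s 1"
 have c: "1 \<le> c" using s by (simp add: c_def)
 define g where "g x = ennreal (30 * D' ^ 3) * S x + ennreal c * enorm (u x)" for x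
 have SLp: "Lp_nonneg p M S"
 proof -
  have "(\<integral>\<^sup>+x. ennreal_powr (S x) p \<partial>M) \<le> (\<integral>\<^sup>+x\<in>Om. ennreal_powr (sharp_on Om u s x) p \<partial>M)"
   using p by (intro nn_integral_mono) (auto simp: S_def indicator_def ennreal_powr_def)
  also have "... < \<infinity>" using sh by (simp add: Lp_nonneg_def nn_integral_restrict_space)
  finally show ?thesis by (simp add: Lp_nonneg_def)
 qed
 have gLp: "Lp_nonneg p M g"
  unfolding g_def[abs_def] using p D' c SLp uLp by (intro Lp_nonneg_add Lp_nonneg_cmult) auto
 have cu: "enorm (u x) \<le> ennreal c * enorm (u x)" for x
  using c by (simp add: mult_left_mono[of 1 c] ennreal_leI mult_le_cancel_right1 flip: ennreal_mult)
 interpret ex: extension_problem M D p C L Om ka0 u g N W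
 proof
  show "g \<in> borel_measurable M" using gLp by (simp add: Lp_nonneg_def)
  show "enorm (u x) \<le> g x" for x
   unfolding g_def using cu[of x] by (simp add: add_increasing)
  fix x y assume x: "x \<in> Om - N" and y: "y \<in> Om - N"
  show "enorm (u x - u y) \<le> ennreal (dist x y) * (g x + g y)"
  proof (cases "2 * dist x y \<in> T")
   case True
   have "enorm (u x - u y) = (SUP w\<in>W. ennreal \<bar>norm (u x - w) - norm (u y - w)\<bar>)"
    using W(2) by (intro norm_diff_eq_SUP) auto
   also have "... \<le> ennreal (30 * D' ^ 3 * dist x y) * (S x + S y)"
    using Nf x y True by (intro SUP_least) (auto simp: N_def)
   also have "... = ennreal (dist x y) * (ennreal (30 * D' ^ 3) * S x + ennreal (30 * D' ^ 3) * S y)"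
   proof -
    have "ennreal (30 * D' ^ 3 * dist x y) = ennreal (dist x y) * ennreal (30 * D' ^ 3)"
     using D' by (simp add: mult.commute flip: ennreal_mult)
    then show ?thesis by (simp only: distrib_left mult.assoc)
   qed
   also have "... \<le> ennreal (dist x y) * (g x + g y)"
    unfolding g_def by (intro mult_left_mono add_mono) auto
   finally show ?thesis .
  next
   case False
   show ?thesis
   proof (cases "x = y")
    case ne: False
    then have "min s 1 \<le> 2 * dist x y" using False by (auto simp: T_def)
    then have "1 \<le> 2 * dist x y / min s 1" using s by (simp add: le_divide_eq)
    then have d: "1 \<le> dist x y * c" by (simp add: c_def distrib_left add_increasing mult.commute)
    have "norm (u x - u y) \<le> norm (u x) + norm (u y)" by (rule norm_triangle_ineq4)
    also have "... \<le> dist x y * c * (norm (u x) + norm (u y))" using mult_right_mono[OF d, of "norm (u x) + norm (u y)"] by simp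
    finally have "enorm (u x - u y) \<le> ennreal (dist x y * c * (norm (u x) + norm (u y)))" by (rule ennreal_leI)
    also have "... = ennreal (dist x y) * (ennreal c * enorm (u x) + ennreal c * enorm (u y))"
     using c by (simp add: ennreal_mult distrib_left mult.assoc)
    also have "... \<le> ennreal (dist x y) * (g x + g y)"
     unfolding g_def by (intro mult_left_mono add_mono) auto
    finally show ?thesis .
   qed simp
  qed
 qed (use ne ka0 dens u W gLp N in auto)
 show ?thesis using that[of ex.ext] ex.newton_sobolev_ext ex.ext_inside by blast
qed

text \<open>Supplies the extension from an empty set, which \<open>extension_problem\<close>
  excludes.\<close>

lemma newton_sobolev_zero: "newton_sobolev p M (\<lambda>_. 0 :: 'b::banach)"
proof (rule newton_sobolev_if_pointwise_gradient)
 show "complete_measure M" by (rule complete_measure_axioms)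
 have "separable_space (subtopology euclidean ((\<lambda>_. 0 :: 'b) ` (space M - {})))"
  unfolding separable_space_iff by (intro exI[of _ "{0}"]) auto
 then have "ess_separable_measurable M (\<lambda>_. 0 :: 'b)"
  unfolding ess_separable_measurable_def by (intro conjI bexI[of _ "{}"]) auto
 then show "Lp p M (\<lambda>_. 0 :: 'b)" by (simp add: Lp_def Lp_nonneg_def ennreal_powr_def)
 show "Lp_nonneg p M (\<lambda>_. 0)" by (simp add: Lp_nonneg_def ennreal_powr_def)
 show "{} \<in> null_sets M" "{} \<in> sets (borel :: 'a measure)" by simp_all
qed (use p sets_M in auto)

end

lemma (in poincare_space) newton_sobolev_extension_iff_sharp:
 fixes u :: "'a \<Rightarrow> 'b::banach"
 assumes Om: "Om \<in> sets M" and ka0: "0 < ka0"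
  and dens: "\<And>x r. x \<in> Om \<Longrightarrow> 0 < r \<Longrightarrow> r \<le> 1 \<Longrightarrow> ennreal ka0 * vol x r \<le> emeasure M (Om \<inter> ball x r)"
  and u: "Lp p (restrict_space M Om) u"
 shows "(\<exists>h :: 'a \<Rightarrow> 'b. newton_sobolev p M h \<and> (AE x in restrict_space M Om. u x = h x))
  \<longleftrightarrow> (\<exists>s>0. Lp_nonneg p (restrict_space M Om) (sharp_on Om u s))"
proof -
 have AE_iff: "(AE x in restrict_space M Om. u x = h x) \<longleftrightarrow> (AE x in M. x \<in> Om \<longrightarrow> u x = h x)" for h :: "'a \<Rightarrow> 'b"
  using Om by (simp add: AE_restrict_space_iff)
 have p0: "0 < p" using p by simp
 obtain v W where v: "v \<in> borel_measurable M" and W: "countable W" "range v \<subseteq> closure W"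
  and uv: "AE x in M. x \<in> Om \<longrightarrow> u x = v x" and vLp: "Lp_nonneg p M (\<lambda>x. enorm (v x))"
  by (rule Lp_extend_by_zero[OF Om u p0])
 have sharp_eq: "sharp_on Om u s = sharp_on Om v s" for s using sharp_on_cong[OF uv] by blast
 show ?thesis unfolding AE_iff sharp_eq
 proof (intro iffI; elim exE conjE)
  fix h :: "'a \<Rightarrow> 'b" assume h: "newton_sobolev p M h" "AE x in M. x \<in> Om \<longrightarrow> u x = h x"
  have "AE x in M. x \<in> Om \<longrightarrow> v x = h x" using uv h(2) by eventually_elim auto
  from sharp_Lp_if_newton_sobolev[OF Om ka0 dens v W h(1) this]
  have "Lp_nonneg p (restrict_space M Om) (sharp_on Om v 1)" by simp
  then show "\<exists>s>0. Lp_nonneg p (restrict_space M Om) (sharp_on Om v s)" by (intro exI[of _ 1]) simp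
 next
  fix s :: real assume s: "0 < s" "Lp_nonneg p (restrict_space M Om) (sharp_on Om v s)"
  show "\<exists>h. newton_sobolev p M h \<and> (AE x in M. x \<in> Om \<longrightarrow> u x = h x)"
  proof (cases "Om = {}")
   case True
   then show ?thesis using newton_sobolev_zero by (intro exI[of _ "\<lambda>_. 0"]) simp
  next
   case False
   have dens': "ennreal (min ka0 1) * vol x r \<le> emeasure M (Om \<inter> ball x r)"
    if "x \<in> Om" "0 < r" "r \<le> 1" for x r
   proof -
    have "ennreal (min ka0 1) * vol x r \<le> ennreal ka0 * vol x r"
     by (intro mult_right_mono ennreal_leI) auto
    also have "... \<le> emeasure M (Om \<inter> ball x r)" by (rule dens[OF that])
    finally show ?thesis .
   qed
   have k: "0 < min ka0 1" "min ka0 1 \<le> 1" using ka0 by auto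
   obtain h where h: "newton_sobolev p M h" "\<And>x. x \<in> Om \<Longrightarrow> h x = v x"
    by (rule newton_sobolev_if_sharp_Lp[OF Om False k dens' v W vLp s]) (assumption | rule that)+
   then have "AE x in M. x \<in> Om \<longrightarrow> u x = h x" using uv by (auto elim!: eventually_mono)
   then show ?thesis using h(1) by blast
  qed
 qed
qed

theorem theorem1p2:
  fixes p :: real
    and \<mu> :: "'a::{metric_space,second_countable_topology} set \<Rightarrow> ennreal"
    and \<Omega> :: "'a set"
    and u :: "'a \<Rightarrow> 'b::banach"
  assumes "1 < p"
    and "PI_space p \<mu>"
    and "\<Omega> \<in> sets (carath \<mu>)"
    and "measure_density \<mu> \<Omega>"
    and "Lp p (restrict_space (carath \<mu>) \<Omega>) u"
  shows "(\<exists>h :: 'a \<Rightarrow> 'b. newton_sobolev p (carath \<mu>) h \<and>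
            (AE x in restrict_space (carath \<mu>) \<Omega>. u x = h x))
         \<longleftrightarrow> (\<exists>s::real. 0 < s \<and> Lp_nonneg p (restrict_space (carath \<mu>) \<Omega>) (sharp \<mu> \<Omega> u s))"
proof -
 obtain D C L where "poincare_space (carath \<mu>) D p C L"
  by (rule PI_poincare_space[OF assms(1,2)])
 then interpret poincare_space "carath \<mu>" D p C L .
 have mm: "metric_measure_space \<mu>" using assms(2) by (simp add: PI_space_def)
 have \<mu>_eq: "\<mu> A = emeasure (carath \<mu>) A" if "A \<in> sets (carath \<mu>)" for A
  using metric_measure_spaceD(3)[OF mm that] by simp
 have \<mu>_ball: "\<mu> (\<Omega> \<inter> ball x t) = emeasure (carath \<mu>) (\<Omega> \<inter> ball x t)" for x t
  by (rule \<mu>_eq[OF inter_ball_sets[OF assms(3)]])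
 have sharp_eq: "sharp \<mu> \<Omega> u s = sharp_on \<Omega> u s" for s
  unfolding sharp_def[abs_def] sharp_on_def[abs_def] osc_on_def \<mu>_ball ..
 obtain c where c: "0 < c" "\<forall>x\<in>\<Omega>. \<forall>r. 0 < r \<and> r \<le> 1 \<longrightarrow> \<mu> (ball x r \<inter> \<Omega>) \<ge> ennreal c * \<mu> (ball x r)"
  using assms(4) by (auto simp: measure_density_def)
 have "ennreal c * emeasure (carath \<mu>) (ball x r) \<le> emeasure (carath \<mu>) (\<Omega> \<inter> ball x r)"
  if "x \<in> \<Omega>" "0 < r" "r \<le> 1" for x r
  using c(2)[rule_format, OF that(1), of r] that \<mu>_ball[of x r] \<mu>_eq[of "ball x r"] by (simp add: Int_commute)
 then show ?thesis
  unfolding sharp_eq by (intro newton_sobolev_extension_iff_sharp[OF assms(3) c(1) _ assms(5)])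
qed

end
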